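(* Let $N\ge1$, $0<s<1$, assume (V$_1$) and ($f_1$)–($f_5$), and assume that $f$ does not depend on $x$ (i.e. $f(x,u)=f(u)$). Assume moreover (V$_3$) $\liminf_{|x|\to+\infty}V(x)=V_\infty$ and (V$_4$) $V\le V_\infty$ on $\mathbb{R}^N$ but $V$ is not identically equal to $V_\infty$, for some constant $V_\infty>0$. Then $c$ is a critical value of $J$.
   Context: $\hat u$ denotes the Fourier transform. (V$_1$) $V\in C^1(\mathbb{R}^N)$, $\inf V=V_0>0$. ($f_1$) $f\in C^1$. ($f_2$) $f(0)=0=f'(0)$. ($f_3$) $|f'(s)|\le a_1+a_2|s|^{p-1}$ for constants $a_1,a_2>0$ and some $1<p<\frac{N+2s}{N-2s}$ (in particular $N>2s$). ($f_4$) $0<\mu F(s)\le sf(s)$ for $s\ne0$ with some $\mu>2$, $F(s)=\int_0^sf(t)dt$. ($f_5$) $t\mapsto t^{-1}sf(ts)$ is increasing on $(0,\infty)$ for every $s$. $E^s=\{u\in L^2:\|u\|<\infty\}$, $\|u\|^2=\int|\xi|^{2s}|\hat u|^2d\xi+\int V|u|^2dx$; $J(u)=\frac12\|u\|^2-\int F(u)dx$; $\Gamma=\{g\in C([0,1],E^s):g(0)=0,J(g(1))<0\}$, $c=\inf_{g\in\Gamma}\max_{t\in[0,1]}J(g(t))$. *)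

theory Defs
  imports "HOL-Analysis.Analysis"
begin

text \<open>Fourier transform of a real function on the Euclidean space (coordinates indexed by 'n),
  with the unitary convention exp(-2 pi i x.xi).  For u in L2 it is defined, as usual (Plancherel),
  as the L2-limit of the Fourier integrals of the truncations of u to the balls of radius R.\<close>

definition fourier_trunc :: "(real^'n \<Rightarrow> real) \<Rightarrow> real \<Rightarrow> real^'n \<Rightarrow> complex" where
  "fourier_trunc u R \<xi> =
     set_lebesgue_integral lborel (ball 0 R)
       (\<lambda>x. exp (- (2 * pi * \<i>) * complex_of_real (x \<bullet> \<xi>)) * complex_of_real (u x))"

definition is_fourier_L2 :: "(real^'n \<Rightarrow> real) \<Rightarrow> (real^'n \<Rightarrow> complex) \<Rightarrow> bool" where
  "is_fourier_L2 u v \<longleftrightarrow>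
     v \<in> borel_measurable lborel \<and> integrable lborel (\<lambda>\<xi>. (cmod (v \<xi>))\<^sup>2) \<and>
     ((\<lambda>R. \<integral>\<^sup>+ \<xi>. ennreal ((cmod (fourier_trunc u R \<xi> - v \<xi>))\<^sup>2) \<partial>lborel) \<longlongrightarrow> 0) at_top"

definition fourier :: "(real^'n \<Rightarrow> real) \<Rightarrow> real^'n \<Rightarrow> complex" where
  "fourier u = (SOME v. is_fourier_L2 u v)"

definition L2 :: "(real^'n \<Rightarrow> real) set" where
  "L2 = {u. u \<in> borel_measurable lborel \<and> integrable lborel (\<lambda>x. (u x)\<^sup>2)}"

definition Es_norm2 :: "(real^'n \<Rightarrow> real) \<Rightarrow> real \<Rightarrow> (real^'n \<Rightarrow> real) \<Rightarrow> ennreal" where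
  "Es_norm2 V s u =
     (\<integral>\<^sup>+ \<xi>. ennreal (norm \<xi> powr (2 * s) * (cmod (fourier u \<xi>))\<^sup>2) \<partial>lborel)
     + (\<integral>\<^sup>+ x. ennreal (V x * (u x)\<^sup>2) \<partial>lborel)"

definition Es :: "(real^'n \<Rightarrow> real) \<Rightarrow> real \<Rightarrow> (real^'n \<Rightarrow> real) set" where
  "Es V s = {u \<in> L2. Es_norm2 V s u < \<infinity>}"

definition Es_norm :: "(real^'n \<Rightarrow> real) \<Rightarrow> real \<Rightarrow> (real^'n \<Rightarrow> real) \<Rightarrow> real" where
  "Es_norm V s u = sqrt (enn2real (Es_norm2 V s u))"

definition prim :: "(real \<Rightarrow> real) \<Rightarrow> real \<Rightarrow> real" where
  "prim f t = (LBINT \<tau>=0..t. f \<tau>)"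

definition Jfun :: "(real^'n \<Rightarrow> real) \<Rightarrow> (real \<Rightarrow> real) \<Rightarrow> real \<Rightarrow> (real^'n \<Rightarrow> real) \<Rightarrow> real" where
  "Jfun V f s u = 1/2 * (Es_norm V s u)\<^sup>2 - (\<integral>x. prim f (u x) \<partial>lborel)"

definition Gamma_paths :: "(real^'n \<Rightarrow> real) \<Rightarrow> (real \<Rightarrow> real) \<Rightarrow> real \<Rightarrow> (real \<Rightarrow> real^'n \<Rightarrow> real) set" where
  "Gamma_paths V f s = {g.
     (\<forall>t\<in>{0..1}. g t \<in> Es V s) \<and>
     (\<forall>t0\<in>{0..1}. ((\<lambda>t. Es_norm V s (\<lambda>x. g t x - g t0 x)) \<longlongrightarrow> 0) (at t0 within {0..1})) \<and>
     Es_norm V s (g 0) = 0 \<and> Jfun V f s (g 1) < 0}"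

definition mp_level :: "(real^'n \<Rightarrow> real) \<Rightarrow> (real \<Rightarrow> real) \<Rightarrow> real \<Rightarrow> real" where
  "mp_level V f s = (INF g\<in>Gamma_paths V f s. SUP t\<in>{0..1}. Jfun V f s (g t))"

definition critical_point :: "(real^'n \<Rightarrow> real) \<Rightarrow> (real \<Rightarrow> real) \<Rightarrow> real \<Rightarrow> (real^'n \<Rightarrow> real) \<Rightarrow> bool" where
  "critical_point V f s u \<longleftrightarrow> u \<in> Es V s \<and>
     (\<forall>\<phi>\<in>Es V s. ((\<lambda>t. Jfun V f s (\<lambda>x. u x + t * \<phi> x)) has_real_derivative 0) (at 0))"

definition critical_value :: "(real^'n \<Rightarrow> real) \<Rightarrow> (real \<Rightarrow> real) \<Rightarrow> real \<Rightarrow> real \<Rightarrow> bool" where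
  "critical_value V f s c \<longleftrightarrow> (\<exists>u. critical_point V f s u \<and> Jfun V f s u = c)"

end

theory Submission
  imports Defs "HOL-Probability.Probability" "HOL-Complex_Analysis.Great_Picard"
begin

text \<open>Subordination to the heat kernel turns the Fourier seminorm into a weighted square integral
  of the differences \<open>u x - u y\<close>, so that Fatou's lemma, translations and Brezis-Lieb splittings
  apply to it directly. By (f5) the map \<open>\<tau> \<mapsto> J (sqrt \<tau> * u)\<close> is concave, and \<open>c\<close> is
  the infimum over \<open>u \<noteq> 0\<close> of the maximum of \<open>J\<close> on the ray through \<open>u\<close>, because every mountain
  pass path crosses the set where \<open>J\<close> is maximal on its ray. A minimizing sequence on this set does not vanish,
  hence after translations it has a limit \<open>w \<noteq> 0\<close> almost everywhere. If \<open>J\<close> with the limiting potential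
  exceeded \<open>c\<close> on the ray of \<open>w\<close>, then the remainder \<open>w\<^sub>n - w\<close> would have negative energy there,
  its maximal energy, which is at least \<open>c\<close>, would be attained earlier on its ray,
  and adding the two would exceed \<open>c\<close>. Since \<open>V\<close> is bounded by its limit at infinity, a translate of \<open>w\<close> has
  ray maximum exactly \<open>c\<close>, and the point where it is attained is critical, because
  otherwise a perturbation would lower the ray maximum.\<close>

section \<open>Gaussian integrals and \<open>L\<^sup>2\<close> limits\<close>

text \<open>Two obstacles shape the argument. By (f5) the quotient is only nondecreasing, so
  \<open>J\<close> may attain its maximum along a ray on a whole interval, and the set of ray maxima
  need not be a manifold. Hence everything is phrased by comparing values of \<open>J\<close> on
  rays: the minimizing sequence is not assumed to be almost critical, and criticality of the final
  point comes from perturbing rays, together with the fact that \<open>dJ\<close> at two maximum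
  points of one ray is proportional. The second obstacle is the loss of compactness by translations.
  Shifting the functions shifts \<open>V\<close>, and a limit of shifted potentials is either a
  translate of \<open>V\<close> or its constant limit at infinity; both lie above some translate of
  \<open>V\<close>, so one argument covers both cases. The time variable of the heat kernel stays in
  the domain of integration: the seminorm is then the norm of a linear image of \<open>u\<close> on
  a product space, and its link with the Fourier transform rests on Gaussian integrals at a fixed
  time, whose limit at time zero is Plancherel's identity.\<close>

lemma nn_integral_lborel_translate:
  fixes g :: "'a::euclidean_space \<Rightarrow> ennreal"
  assumes [measurable]: "g \<in> borel_measurable borel"
  shows "(\<integral>\<^sup>+x. g (h + x) \<partial>lborel) = (\<integral>\<^sup>+x. g x \<partial>lborel)"
proof -
  have "(\<integral>\<^sup>+x. g x \<partial>lborel) = (\<integral>\<^sup>+x. g x \<partial>distr lborel borel ((+) h))"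
    by (simp add: lborel_distr_plus)
  also have "\<dots> = (\<integral>\<^sup>+x. g (h + x) \<partial>lborel)"
    by (subst nn_integral_distr) auto
  finally show ?thesis by simp
qed

lemma integrable_lborel_translate:
  fixes g :: "'a::euclidean_space \<Rightarrow> 'b::{banach,second_countable_topology}"
  assumes "integrable lborel g"
  shows "integrable lborel (\<lambda>x. g (h + x))"
proof -
  have "integrable (distr lborel borel ((+) h)) g"
    using assms by (simp add: lborel_distr_plus)
  then show ?thesis
    by (subst (asm) integrable_distr_eq) (use assms in auto)
qed

lemma integral_lborel_translate:
  fixes g :: "'a::euclidean_space \<Rightarrow> 'b::{banach,second_countable_topology}"
  assumes [measurable]: "g \<in> borel_measurable borel"
  shows "(\<integral>x. g (h + x) \<partial>lborel) = (\<integral>x. g x \<partial>lborel)"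
proof -
  have "(\<integral>x. g x \<partial>lborel) = (\<integral>x. g x \<partial>distr lborel borel ((+) h))"
    by (simp add: lborel_distr_plus)
  also have "\<dots> = (\<integral>x. g (h + x) \<partial>lborel)"
    by (subst integral_distr) auto
  finally show ?thesis by simp
qed

lemma nn_integral_lborel_scaleR:
  fixes g :: "'a::euclidean_space \<Rightarrow> ennreal"
  assumes [measurable]: "g \<in> borel_measurable borel" and c: "0 < c"
  shows "(\<integral>\<^sup>+x. g x \<partial>lborel) = ennreal (c ^ DIM('a)) * (\<integral>\<^sup>+x. g (c *\<^sub>R x) \<partial>lborel)"
proof -
  have "(\<integral>\<^sup>+x. g x \<partial>lborel)
      = (\<integral>\<^sup>+x. g x \<partial>density (distr lborel borel (\<lambda>x. 0 + c *\<^sub>R x)) (\<lambda>_. ennreal (\<bar>c\<bar> ^ DIM('a))))"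
    using c by (subst lborel_affine[of c 0]) auto
  also have "\<dots> = (\<integral>\<^sup>+x. ennreal (c ^ DIM('a)) * g (c *\<^sub>R x) \<partial>lborel)"
    using c by (subst nn_integral_density) (auto simp: nn_integral_distr)
  finally show ?thesis by (simp add: nn_integral_cmult)
qed

text \<open>The substitution by \<open>sqrt (2 * a)\<close> turns the integral into the
  characteristic function of the standard normal law, whose value is known.\<close>

lemma integral_1d_gaussian_fourier:
  fixes a z :: real
  assumes a: "0 < a"
  shows "integrable lborel (\<lambda>x. complex_of_real (exp (- a * x\<^sup>2)) * exp (- (2 * pi * \<i>) * complex_of_real (z * x)))"
    and "(\<integral>x. complex_of_real (exp (- a * x\<^sup>2)) * exp (- (2 * pi * \<i>) * complex_of_real (z * x)) \<partial>lborel)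
      = complex_of_real (sqrt (pi / a) * exp (- (pi\<^sup>2 * z\<^sup>2 / a)))"
proof -
  let ?\<sigma> = "sqrt (2 * a)"
  let ?t = "- (2 * pi * z) / ?\<sigma>"
  have s: "?\<sigma> > 0" using a by simp
  have 1: "integrable lborel (\<lambda>x. complex_of_real (std_normal_density x) * iexp (?t * x))"
  proof -
    have "integrable lborel (\<lambda>x. complex_of_real (std_normal_density x))"
      by (intro integrable_of_real) (simp add: integrable_normal_density)
    then show ?thesis
      by (rule Bochner_Integration.integrable_bound) (auto simp: norm_mult)
  qed
  have 2: "(\<integral>x. complex_of_real (std_normal_density x) * iexp (?t * x) \<partial>lborel) = complex_of_real (exp (- (?t\<^sup>2) / 2))"
  proof -
    have "complex_of_real (exp (- (?t\<^sup>2) / 2)) = (\<integral>x. iexp (?t * x) \<partial>std_normal_distribution)"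
      unfolding fun_cong[OF char_std_normal_distribution, of ?t, symmetric] char_def ..
    also have "\<dots> = (\<integral>x. std_normal_density x *\<^sub>R iexp (?t * x) \<partial>lborel)"
      by (subst integral_density) (auto simp: normal_density_nonneg)
    finally show ?thesis by (simp add: scaleR_conv_of_real)
  qed
  let ?g = "\<lambda>x. complex_of_real (exp (- a * x\<^sup>2)) * exp (- (2 * pi * \<i>) * complex_of_real (z * x))"
  have eq: "complex_of_real (std_normal_density (0 + ?\<sigma> * x)) * iexp (?t * (0 + ?\<sigma> * x)) = complex_of_real (1 / sqrt (2 * pi)) * ?g x" for x
  proof -
    have "std_normal_density (0 + ?\<sigma> * x) = 1 / sqrt (2 * pi) * exp (- a * x\<^sup>2)"
      using a by (simp add: normal_density_def power_mult_distrib)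
    moreover have "?t * (0 + ?\<sigma> * x) = - (2 * pi * z * x)" using s by simp
    moreover have "iexp (- (2 * pi * z * x)) = exp (- (2 * pi * \<i>) * complex_of_real (z * x))"
      by (simp add: algebra_simps)
    ultimately show ?thesis by (simp only: of_real_mult mult.assoc)
  qed
  have 3: "integrable lborel (\<lambda>x. complex_of_real (1 / sqrt (2 * pi)) * ?g x)"
    using lborel_integrable_real_affine[OF 1, of ?\<sigma> 0] s unfolding eq by simp
  then have "integrable lborel (\<lambda>x. complex_of_real (sqrt (2 * pi)) * (complex_of_real (1 / sqrt (2 * pi)) * ?g x))"
    by (rule integrable_mult_right)
  moreover have e2: "complex_of_real (sqrt (2 * pi)) * (complex_of_real (1 / sqrt (2 * pi)) * w) = w" for w
    by (simp add: mult.assoc[symmetric] of_real_mult[symmetric] del: of_real_mult)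
  ultimately show "integrable lborel ?g" by simp
  have "complex_of_real (exp (- (?t\<^sup>2) / 2)) = ?\<sigma> *\<^sub>R (\<integral>x. complex_of_real (1 / sqrt (2 * pi)) * ?g x \<partial>lborel)"
    using lborel_integral_real_affine[of ?\<sigma> "\<lambda>x. complex_of_real (std_normal_density x) * iexp (?t * x)" 0] s 2
    unfolding eq by simp
  then have "complex_of_real (exp (- (?t\<^sup>2) / 2)) = complex_of_real ?\<sigma> * (complex_of_real (1 / sqrt (2 * pi)) * integral\<^sup>L lborel ?g)"
    by (simp add: scaleR_conv_of_real)
  then have "integral\<^sup>L lborel ?g = complex_of_real (sqrt (2 * pi)/ ?\<sigma>) * complex_of_real (exp (- (?t\<^sup>2) / 2))"
    using s by (simp add: field_simps)
  moreover have "- (?t\<^sup>2) / 2 = - (pi\<^sup>2 * z\<^sup>2 / a)" using a by (simp add: power_divide power_mult_distrib)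
  moreover have "sqrt (2 * pi) / ?\<sigma> = sqrt (pi / a)" using a by (simp add: real_sqrt_divide real_sqrt_mult)
  ultimately show "integral\<^sup>L lborel ?g = complex_of_real (sqrt (pi / a) * exp (- (pi\<^sup>2 * z\<^sup>2 / a)))"
    by simp
qed

text \<open>The kernel of the heat equation at time a / (4 pi^2). With the phase -2 pi i its Fourier
  counterpart is the Gaussian exp (- a |xi|^2).\<close>

definition heat :: "real \<Rightarrow> 'a::euclidean_space \<Rightarrow> real" where
  "heat a z = sqrt (pi / a) ^ DIM('a) * exp (- (pi\<^sup>2 * (norm z)\<^sup>2 / a))"

lemma heat_nonneg [simp]: "0 < a \<Longrightarrow> 0 \<le> heat a z"
  by (simp add: heat_def)

lemma borel_measurable_heat [measurable (raw)]:
  assumes [measurable]: "f \<in> borel_measurable M" "g \<in> borel_measurable M"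
  shows "(\<lambda>x. heat (f x) (g x)) \<in> borel_measurable M"
  unfolding heat_def by measurable

lemma norm_sq_eq_sum_Basis:
  fixes x :: "'a::euclidean_space"
  shows "(norm x)\<^sup>2 = (\<Sum>b\<in>Basis. (x \<bullet> b)\<^sup>2)"
  unfolding power2_norm_eq_inner by (subst euclidean_inner) (simp add: power2_eq_square)

lemma exp_norm_sq_eq_prod:
  fixes x z :: "'a::euclidean_space"
  shows "complex_of_real (exp (- a * (norm x)\<^sup>2)) * exp (- (2 * pi * \<i>) * complex_of_real (z \<bullet> x))
   = (\<Prod>b\<in>Basis. complex_of_real (exp (- a * (x \<bullet> b)\<^sup>2)) * exp (- (2 * pi * \<i>) * complex_of_real ((z \<bullet> b) * (x \<bullet> b))))"
proof -
  have "(norm x)\<^sup>2 = (\<Sum>b\<in>Basis. (x \<bullet> b)\<^sup>2)"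
    by (rule norm_sq_eq_sum_Basis)
  then have "- a * (norm x)\<^sup>2 = (\<Sum>b\<in>Basis. - a * (x \<bullet> b)\<^sup>2)"
    by (simp only: sum_distrib_left)
  then have 1: "exp (- a * (norm x)\<^sup>2) = (\<Prod>b\<in>Basis. exp (- a * (x \<bullet> b)\<^sup>2))"
    by (simp only: exp_sum[OF finite_Basis])
  have 2: "exp (- (2 * pi * \<i>) * complex_of_real (z \<bullet> x)) = (\<Prod>b\<in>Basis. exp (- (2 * pi * \<i>) * complex_of_real ((z \<bullet> b) * (x \<bullet> b))))"
    by (subst euclidean_inner) (simp add: exp_sum[symmetric] sum_distrib_left)
  show ?thesis unfolding 1 2 by (simp add: prod.distrib)
qed

text \<open>The integrand factors over the coordinates and \<open>lborel\<close> is the image of a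
  finite product measure (\<open>lborel_eq\<close>), so the integral is a product of one-dimensional
  ones.\<close>

lemma gaussian_fourier:
  fixes z :: "'a::euclidean_space"
  assumes a: "0 < a"
  shows "integrable lborel (\<lambda>x. complex_of_real (exp (- a * (norm x)\<^sup>2)) * exp (- (2 * pi * \<i>) * complex_of_real (z \<bullet> x)))" (is ?th1)
    and "(\<integral>x. complex_of_real (exp (- a * (norm x)\<^sup>2)) * exp (- (2 * pi * \<i>) * complex_of_real (z \<bullet> x)) \<partial>lborel)
      = complex_of_real (heat a z)" (is ?th2)
proof -
  let ?f = "\<lambda>b x. complex_of_real (exp (- a * x\<^sup>2)) * exp (- (2 * pi * \<i>) * complex_of_real ((z \<bullet> b) * x))"
  let ?P = "\<Pi>\<^sub>M b\<in>(Basis::'a set). (lborel::real measure)"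
  let ?T = "\<lambda>f. \<Sum>b\<in>Basis. f b *\<^sub>R (b::'a)"
  interpret product_sigma_finite "\<lambda>_::'a. lborel::real measure" ..
  have m: "?T \<in> measurable ?P borel" by measurable
  have i1: "integrable lborel (?f b)" for b using integral_1d_gaussian_fourier(1)[OF a] .
  have eq: "(\<lambda>x. complex_of_real (exp (- a * (norm x)\<^sup>2)) * exp (- (2 * pi * \<i>) * complex_of_real (z \<bullet> x)))
     = (\<lambda>x. \<Prod>b\<in>Basis. ?f b (x \<bullet> b))"
    by (rule ext) (rule exp_norm_sq_eq_prod)
  have T: "?T f \<bullet> b = f b" if "b \<in> Basis" for f b using that by simp
  have pe: "(\<lambda>f. \<Prod>b\<in>Basis. ?f b (?T f \<bullet> b)) = (\<lambda>f. \<Prod>b\<in>Basis. ?f b (f b))"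
    by (intro ext prod.cong) (simp_all only: T)
  have ip: "integrable ?P (\<lambda>f. \<Prod>b\<in>Basis. ?f b (f b))"
    by (intro product_integrable_prod i1) auto
  show ?th1
    unfolding eq by (subst lborel_eq, subst integrable_distr_eq[OF m]) (use pe ip in \<open>auto simp del: of_real_mult of_real_exp\<close>)
  have "(\<integral>x. (\<Prod>b\<in>Basis. ?f b (x \<bullet> b)) \<partial>(lborel::'a measure)) = (\<integral>f. (\<Prod>b\<in>Basis. ?f b (f b)) \<partial>?P)"
    by (subst lborel_eq, subst integral_distr[OF m]) (use pe in \<open>auto simp del: of_real_mult of_real_exp\<close>)
  also have "\<dots> = (\<Prod>b\<in>Basis. integral\<^sup>L lborel (?f b))"
    by (intro product_integral_prod i1) auto
  also have "\<dots> = (\<Prod>b\<in>(Basis::'a set). complex_of_real (sqrt (pi / a) * exp (- (pi\<^sup>2 * (z \<bullet> b)\<^sup>2 / a))))"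
    by (intro prod.cong refl integral_1d_gaussian_fourier(2)[OF a])
  also have "\<dots> = complex_of_real (heat a z)"
  proof -
    have "(norm z)\<^sup>2 = (\<Sum>b\<in>Basis. (z \<bullet> b)\<^sup>2)"
      by (rule norm_sq_eq_sum_Basis)
    then have "- (pi\<^sup>2 * (norm z)\<^sup>2 / a) = (\<Sum>b\<in>Basis. - (pi\<^sup>2 * (z \<bullet> b)\<^sup>2 / a))"
      by (simp only: sum_distrib_left sum_divide_distrib sum_negf)
    then have "exp (- (pi\<^sup>2 * (norm z)\<^sup>2 / a)) = (\<Prod>b\<in>Basis. exp (- (pi\<^sup>2 * (z \<bullet> b)\<^sup>2 / a)))"
      by (simp only: exp_sum[OF finite_Basis])
    then show ?thesis by (simp add: heat_def prod.distrib of_real_prod[symmetric] del: of_real_prod)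
  qed
  finally show ?th2 unfolding eq .
qed

lemma integrable_exp_norm_sq:
  assumes "0 < a"
  shows "integrable lborel (\<lambda>x::'a::euclidean_space. exp (- a * (norm x)\<^sup>2))"
    and "(\<integral>x. exp (- a * (norm x)\<^sup>2) \<partial>(lborel::'a measure)) = sqrt (pi / a) ^ DIM('a)"
proof -
  have 1: "integrable lborel (\<lambda>x::'a. complex_of_real (exp (- a * (norm x)\<^sup>2)))"
    using gaussian_fourier(1)[OF assms, of "0::'a"] by (simp del: of_real_exp)
  then show "integrable lborel (\<lambda>x::'a. exp (- a * (norm x)\<^sup>2))"
    unfolding complex_of_real_integrable_eq .
  have "complex_of_real (\<integral>x. exp (- a * (norm x)\<^sup>2) \<partial>(lborel::'a measure)) = complex_of_real (heat a (0::'a))"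
    using gaussian_fourier(2)[OF assms, of "0::'a"] by (simp del: of_real_exp)
  then show "(\<integral>x. exp (- a * (norm x)\<^sup>2) \<partial>(lborel::'a measure)) = sqrt (pi / a) ^ DIM('a)"
    unfolding of_real_eq_iff by (simp add: heat_def)
qed

lemma integrable_heat:
  assumes "0 < a"
  shows "integrable lborel (heat a :: 'a::euclidean_space \<Rightarrow> real)"
    and "(\<integral>z. heat a z \<partial>(lborel::'a measure)) = 1"
proof -
  have b: "0 < pi\<^sup>2 / a" using assms by simp
  have eq: "(heat a :: 'a \<Rightarrow> real) = (\<lambda>z. sqrt (pi / a) ^ DIM('a) * exp (- (pi\<^sup>2 / a) * (norm z)\<^sup>2))"
    by (auto simp: heat_def fun_eq_iff)
  show "integrable lborel (heat a :: 'a \<Rightarrow> real)"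
    unfolding eq by (intro integrable_mult_right integrable_exp_norm_sq b)
  have "sqrt (pi / a) * sqrt (pi / (pi\<^sup>2 / a)) = 1"
    using assms by (simp add: real_sqrt_mult[symmetric] power2_eq_square)
  then show "(\<integral>z. heat a z \<partial>(lborel::'a measure)) = 1"
    unfolding eq using integrable_exp_norm_sq(2)[OF b, where 'a='a]
    by (simp add: power_mult_distrib[symmetric])
qed

lemma nn_integral_heat:
  assumes "0 < a"
  shows "(\<integral>\<^sup>+z. ennreal (heat a z) \<partial>(lborel::'a::euclidean_space measure)) = 1"
  using integrable_heat[OF assms, where 'a='a] nn_integral_eq_integral[of lborel "heat a :: 'a \<Rightarrow> real"] assms
  by simp

lemma heat_minus: "heat a (- z) = heat a z"
  by (simp add: heat_def)

lemma heat_scaleR: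
  fixes z :: "'a::euclidean_space"
  assumes "0 < a"
  shows "sqrt a ^ DIM('a) * heat a (sqrt a *\<^sub>R z) = heat 1 z"
  using assms by (simp add: heat_def power_mult_distrib power_divide real_sqrt_divide)

section \<open>Completeness of the space of square integrable functions\<close>

lemma tendsto_0_if_ennreal_le:
  fixes F :: "'a \<Rightarrow> ennreal"
  assumes "\<And>e::real. e > 0 \<Longrightarrow> \<forall>\<^sub>F n in G. F n \<le> ennreal e"
  shows "(F \<longlongrightarrow> 0) G"
proof (rule order_tendstoI)
  fix y :: ennreal assume "0 < y"
  then obtain z where z: "0 < z" "z < y" using dense by blast
  then have "z < \<infinity>" by (metis infinity_ennreal_def order_less_le_trans top_greatest)
  then obtain e where e: "z = ennreal e" "e > 0" using z by (cases z) auto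
  show "\<forall>\<^sub>F n in G. F n < y"
    using assms[OF e(2)] by eventually_elim (use z e in auto)
qed simp

lemma ennreal_le_suminf:
  fixes f :: "nat \<Rightarrow> ennreal"
  shows "f k \<le> suminf f"
  using sum_le_suminf[OF summableI, of "{k}" f] by simp

text \<open>Passing to a subsequence whose successive differences have summable \<open>L\<^sup>2\<close> norms yields
  almost everywhere convergence; Fatou's lemma then identifies the \<open>L\<^sup>2\<close> limit.\<close>

lemma L2_complete:
  fixes f :: "nat \<Rightarrow> 'a \<Rightarrow> 'b::{banach,second_countable_topology}"
  assumes meas[measurable]: "\<And>n. f n \<in> borel_measurable M"
    and cauchy: "\<And>e::real. e > 0 \<Longrightarrow> \<exists>N. \<forall>m\<ge>N. \<forall>n\<ge>N. (\<integral>\<^sup>+x. ennreal ((norm (f m x - f n x))\<^sup>2) \<partial>M) \<le> ennreal e"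
  obtains r g where "strict_mono (r::nat\<Rightarrow>nat)" "g \<in> borel_measurable M"
    "AE x in M. (\<lambda>k. f (r k) x) \<longlonglongrightarrow> g x"
    "(\<lambda>n. \<integral>\<^sup>+x. ennreal ((norm (f n x - g x))\<^sup>2) \<partial>M) \<longlonglongrightarrow> 0"
proof -
  have "\<forall>k. \<exists>N. \<forall>m\<ge>N. \<forall>n\<ge>N. (\<integral>\<^sup>+x. ennreal ((norm (f m x - f n x))\<^sup>2) \<partial>M) \<le> ennreal ((1/4)^k)"
    using cauchy by simp
  then obtain N where N: "\<And>k m n. m \<ge> N k \<Longrightarrow> n \<ge> N k \<Longrightarrow> (\<integral>\<^sup>+x. ennreal ((norm (f m x - f n x))\<^sup>2) \<partial>M) \<le> ennreal ((1/4)^k)"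
    by metis
  define r where "r k = (\<Sum>i\<le>k. Suc (N i))" for k
  have r: "strict_mono r" unfolding strict_mono_Suc_iff r_def by simp
  have rN: "r k \<ge> N k" for k unfolding r_def by (cases k) auto
  have rN': "r (Suc k) \<ge> N k" for k using rN[of k] r by (meson lessI less_imp_le order_trans strict_mono_less)
  \<comment> \<open>Squared distances of size 4^(-k) leave room for the weight 2^k: the weighted
    series still has a finite integral, and where it is finite the k-th jump is O(2^(-k/2)), which
    is summable.\<close>
  let ?D = "\<lambda>k x. ennreal (2^k * (norm (f (r (Suc k)) x - f (r k) x))\<^sup>2)"
  have "(\<integral>\<^sup>+x. (\<Sum>k. ?D k x) \<partial>M) = (\<Sum>k. \<integral>\<^sup>+x. ?D k x \<partial>M)"
    by (intro nn_integral_suminf) measurable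
  also have "\<dots> \<le> (\<Sum>k. ennreal ((1/2)^k))"
  proof (intro suminf_le summableI)
    fix k
    have "(\<integral>\<^sup>+x. ?D k x \<partial>M) = ennreal (2^k) * (\<integral>\<^sup>+x. ennreal ((norm (f (r (Suc k)) x - f (r k) x))\<^sup>2) \<partial>M)"
      by (simp add: ennreal_mult nn_integral_cmult)
    also have "\<dots> \<le> ennreal (2^k) * ennreal ((1/4)^k)"
      by (intro mult_left_mono N rN rN') auto
    also have "\<dots> = ennreal ((1/2)^k)"
      by (simp add: ennreal_mult[symmetric] power_mult_distrib[symmetric])
    finally show "(\<integral>\<^sup>+x. ?D k x \<partial>M) \<le> ennreal ((1/2)^k)" .
  qed
  also have "\<dots> = ennreal (\<Sum>k. (1/2)^k)" by (intro suminf_ennreal2) auto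
  also have "\<dots> < \<infinity>" by simp
  finally have "AE x in M. (\<Sum>k. ?D k x) \<noteq> \<infinity>"
    by (intro nn_integral_PInf_AE) auto
  then have AEc: "AE x in M. convergent (\<lambda>k. f (r k) x)"
  proof eventually_elim
    fix x assume "(\<Sum>k. ?D k x) \<noteq> \<infinity>"
    then obtain S where S: "(\<Sum>k. ?D k x) = ennreal S" "S \<ge> 0"
      using ennreal_cases[of "\<Sum>k. ?D k x"] unfolding infinity_ennreal_def by blast
    let ?d = "\<lambda>k. f (r (Suc k)) x - f (r k) x"
    have "norm (?d k) \<le> sqrt S * (sqrt (1/2)) ^ k" for k
    proof -
      have "?D k x \<le> ennreal S" unfolding S(1)[symmetric] by (rule ennreal_le_suminf)
      then have "2^k * (norm (?d k))\<^sup>2 \<le> S" using S(2) by (simp add: ennreal_le_iff)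
      then have "(norm (?d k))\<^sup>2 \<le> S * (1/2)^k" by (simp add: field_simps)
      then have "norm (?d k) \<le> sqrt (S * (1/2)^k)" by (rule real_le_rsqrt)
      then show ?thesis by (simp add: real_sqrt_mult real_sqrt_power)
    qed
    moreover have "summable (\<lambda>k. sqrt S * (sqrt (1/2)) ^ k)"
      by (intro summable_mult summable_geometric) simp
    ultimately have "summable ?d" by (meson summable_comparison_test')
    then have "convergent (\<lambda>n. \<Sum>k<n. ?d k)" by (simp add: summable_iff_convergent)
    then have "convergent (\<lambda>n. (f (r n) x - f (r 0) x) + f (r 0) x)"
      unfolding sum_lessThan_telescope[of "\<lambda>k. f (r k) x"] by (intro convergent_add convergent_const)
    then show "convergent (\<lambda>k. f (r k) x)" by simp
  qed
  define g where "g x = lim (\<lambda>k. f (r k) x)" for x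
  have gm[measurable]: "g \<in> borel_measurable M" unfolding g_def by measurable
  have AEg: "AE x in M. (\<lambda>k. f (r k) x) \<longlonglongrightarrow> g x"
    using AEc by eventually_elim (simp add: g_def convergent_LIMSEQ_iff)
  have "(\<lambda>n. \<integral>\<^sup>+x. ennreal ((norm (f n x - g x))\<^sup>2) \<partial>M) \<longlonglongrightarrow> 0"
  proof (rule tendsto_0_if_ennreal_le)
    fix e :: real assume e: "e > 0"
    then obtain N where N: "\<And>m n. m \<ge> N \<Longrightarrow> n \<ge> N \<Longrightarrow> (\<integral>\<^sup>+x. ennreal ((norm (f m x - f n x))\<^sup>2) \<partial>M) \<le> ennreal e"
      using cauchy by metis
    have "(\<integral>\<^sup>+x. ennreal ((norm (f n x - g x))\<^sup>2) \<partial>M) \<le> ennreal e" if n: "n \<ge> N" for n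
    proof -
      have "(\<integral>\<^sup>+x. ennreal ((norm (f n x - g x))\<^sup>2) \<partial>M)
        = (\<integral>\<^sup>+x. liminf (\<lambda>k. ennreal ((norm (f n x - f (r k) x))\<^sup>2)) \<partial>M)"
      proof (rule nn_integral_cong_AE, use AEg in eventually_elim)
        fix x assume "(\<lambda>k. f (r k) x) \<longlonglongrightarrow> g x"
        then have "(\<lambda>k. ennreal ((norm (f n x - f (r k) x))\<^sup>2)) \<longlonglongrightarrow> ennreal ((norm (f n x - g x))\<^sup>2)"
          by (intro tendsto_intros)
        then show "ennreal ((norm (f n x - g x))\<^sup>2) = liminf (\<lambda>k. ennreal ((norm (f n x - f (r k) x))\<^sup>2))"
          by (intro lim_imp_Liminf[symmetric] trivial_limit_sequentially)
      qed
      also have "\<dots> \<le> liminf (\<lambda>k. \<integral>\<^sup>+x. ennreal ((norm (f n x - f (r k) x))\<^sup>2) \<partial>M)"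
        by (intro nn_integral_liminf) auto
      also have "\<dots> \<le> ennreal e"
      proof (rule Liminf_le)
        have "\<forall>\<^sub>F k in sequentially. r k \<ge> N" 
          using filterlim_subseq[OF r] by (simp add: filterlim_at_top)
        then show "\<forall>\<^sub>F k in sequentially. (\<integral>\<^sup>+x. ennreal ((norm (f n x - f (r k) x))\<^sup>2) \<partial>M) \<le> ennreal e"
          by eventually_elim (use N n in auto)
      qed simp
      finally show ?thesis .
    qed
    then show "\<forall>\<^sub>F n in sequentially. (\<integral>\<^sup>+x. ennreal ((norm (f n x - g x))\<^sup>2) \<partial>M) \<le> ennreal e"
      using eventually_sequentially by blast
  qed
  with r gm AEg show ?thesis by (rule that)
qed

section \<open>Continuity of translations\<close>

lemma ennreal_tendsto_0_le:
  fixes F G :: "'a \<Rightarrow> ennreal"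
  assumes "\<And>n. F n \<le> G n" "(G \<longlongrightarrow> 0) net"
  shows "(F \<longlongrightarrow> 0) net"
  by (rule tendsto_sandwich[OF _ _ tendsto_const assms(2)]) (simp_all add: assms(1))

lemma real_tendsto_0_le:
  fixes F G :: "'a \<Rightarrow> real"
  assumes "\<And>n. 0 \<le> F n" "\<And>n. F n \<le> G n" "(G \<longlongrightarrow> 0) net"
  shows "(F \<longlongrightarrow> 0) net"
  by (rule tendsto_sandwich[OF _ _ tendsto_const assms(3)]) (simp_all add: assms(1,2))

lemma integral_add3:
  fixes f g k :: "'a \<Rightarrow> real"
  assumes "integrable M f" "integrable M g" "integrable M k"
  shows "(\<integral>x. f x + g x + k x \<partial>M) = (\<integral>x. f x \<partial>M) + (\<integral>x. g x \<partial>M) + (\<integral>x. k x \<partial>M)"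
  using assms by simp

text \<open>The indicator of an open set U is lower semicontinuous, so the positive part of 1_U(x) -
  1_U(h + x) tends to zero pointwise; both indicators have the same integral, hence the negative
  part integrates to the same value. Outer regularity passes from open sets to Borel sets.\<close>

lemma L1_translate_tendsto_indicator:
  fixes A :: "'a::euclidean_space set"
  assumes A: "A \<in> sets borel" "emeasure lborel A < \<infinity>" and h: "h \<longlonglongrightarrow> 0"
  shows "(\<lambda>n. \<integral>x. \<bar>indicat_real A (h n + x) - indicat_real A x\<bar> \<partial>lborel) \<longlonglongrightarrow> 0"
proof (rule LIMSEQ_I)
  fix e :: real assume e: "e > 0"
  obtain U where U: "open U" "A \<subseteq> U" "emeasure lborel (U - A) < ennreal (e / 8)"
    using outer_regular_lborel[OF A(1), of "e / 8"] e by auto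
  have Ub[measurable]: "U \<in> sets borel" "A \<in> sets borel" using U A by auto
  have "emeasure lborel U = emeasure lborel A + emeasure lborel (U - A)"
    using U Ub by (subst plus_emeasure) (auto simp: Un_absorb1)
  also have "\<dots> < \<infinity>"
  proof -
    have "emeasure lborel (U - A) < \<infinity>"
      using U(3) by (metis ennreal_less_top infinity_ennreal_def order_less_trans)
    then show ?thesis using A(2) by (simp add: ennreal_add_less_top)
  qed
  finally have Uf: "emeasure lborel U < \<infinity>" .
  have iU: "integrable lborel (indicat_real U)" using Uf Ub by (simp add: integrable_indicator_iff)
  have iA: "integrable lborel (indicat_real A)" using A by (simp add: integrable_indicator_iff)
  have iUt: "integrable lborel (\<lambda>x. indicat_real U (h n + x))" for n by (rule integrable_lborel_translate[OF iU])
  have iAt: "integrable lborel (\<lambda>x. indicat_real A (h n + x))" for n by (rule integrable_lborel_translate[OF iA])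
  have UA: "(\<integral>x. \<bar>indicat_real U x - indicat_real A x\<bar> \<partial>lborel) \<le> e / 8"
  proof -
    have "(\<integral>x. \<bar>indicat_real U x - indicat_real A x\<bar> \<partial>lborel) = (\<integral>x. indicat_real (U - A) x \<partial>lborel)"
      using U(2) by (intro Bochner_Integration.integral_cong) (auto simp: indicator_def)
    also have "\<dots> = measure lborel (U - A)" by simp
    also have "\<dots> \<le> e / 8"
      using U(3) e unfolding measure_def
      by (metis enn2real_leI less_eq_real_def less_imp_le divide_pos_pos zero_less_numeral)
    finally show ?thesis .
  qed
  have pos: "(\<lambda>n. \<integral>x. max 0 (indicat_real U x - indicat_real U (h n + x)) \<partial>lborel) \<longlonglongrightarrow> (\<integral>x. 0 \<partial>(lborel::'a measure))"
  proof (rule integral_dominated_convergence[where w="indicat_real U"])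
    show "AE x in lborel. (\<lambda>n. max 0 (indicat_real U x - indicat_real U (h n + x))) \<longlonglongrightarrow> 0"
    proof (rule AE_I2)
      fix x :: 'a
      show "(\<lambda>n. max 0 (indicat_real U x - indicat_real U (h n + x))) \<longlonglongrightarrow> 0"
      proof (cases "x \<in> U")
        case True
        have "(\<lambda>n. h n + x) \<longlonglongrightarrow> 0 + x" by (intro tendsto_intros h)
        then have "\<forall>\<^sub>F n in sequentially. h n + x \<in> U"
          using U(1) True by (simp add: topological_tendstoD)
        then have "\<forall>\<^sub>F n in sequentially. max 0 (indicat_real U x - indicat_real U (h n + x)) = 0"
          by eventually_elim (use True in auto)
        then show ?thesis by (rule tendsto_eventually)
      next
        case False
        then show ?thesis by (auto simp: indicator_def)
      qed
    qed
  qed (use iU in \<open>auto simp: indicator_def\<close>)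
  then have "\<exists>N. \<forall>n\<ge>N. (\<integral>x. max 0 (indicat_real U x - indicat_real U (h n + x)) \<partial>lborel) < e / 8"
    using LIMSEQ_D[OF pos, of "e/8"] e by auto
  then obtain N where N: "\<And>n. n \<ge> N \<Longrightarrow> (\<integral>x. max 0 (indicat_real U x - indicat_real U (h n + x)) \<partial>lborel) < e / 8"
    by auto
  have "norm ((\<integral>x. \<bar>indicat_real A (h n + x) - indicat_real A x\<bar> \<partial>lborel) - 0) < e" if n: "n \<ge> N" for n
  proof -
    have "(\<integral>x. \<bar>indicat_real U (h n + x) - indicat_real U x\<bar> \<partial>lborel)
        = (\<integral>x. 2 * max 0 (indicat_real U x - indicat_real U (h n + x)) + (indicat_real U (h n + x) - indicat_real U x) \<partial>lborel)"
      by (intro Bochner_Integration.integral_cong) (auto simp: max_def)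
    also have "\<dots> = 2 * (\<integral>x. max 0 (indicat_real U x - indicat_real U (h n + x)) \<partial>lborel)
       + ((\<integral>x. indicat_real U (h n + x) \<partial>lborel) - (\<integral>x. indicat_real U x \<partial>lborel))"
      using iU iUt by (subst Bochner_Integration.integral_add) (auto intro!: integrable_max)
    also have "(\<integral>x. indicat_real U (h n + x) \<partial>lborel) = (\<integral>x. indicat_real U x \<partial>lborel)"
      by (rule integral_lborel_translate) measurable
    finally have 1: "(\<integral>x. \<bar>indicat_real U (h n + x) - indicat_real U x\<bar> \<partial>lborel) < e / 4"
      using N[OF n] by simp
    have 2: "(\<integral>x. \<bar>indicat_real U (h n + x) - indicat_real A (h n + x)\<bar> \<partial>lborel) \<le> e / 8"
      using UA by (subst integral_lborel_translate[of "\<lambda>x. \<bar>indicat_real U x - indicat_real A x\<bar>"]) simp_all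
    have "(\<integral>x. \<bar>indicat_real A (h n + x) - indicat_real A x\<bar> \<partial>lborel) \<le>
       (\<integral>x. \<bar>indicat_real U (h n + x) - indicat_real A (h n + x)\<bar> + \<bar>indicat_real U (h n + x) - indicat_real U x\<bar>
          + \<bar>indicat_real U x - indicat_real A x\<bar> \<partial>lborel)"
      using iU iUt iA iAt by (intro integral_mono) auto
    also have "\<dots> = (\<integral>x. \<bar>indicat_real U (h n + x) - indicat_real A (h n + x)\<bar> \<partial>lborel)
       + (\<integral>x. \<bar>indicat_real U (h n + x) - indicat_real U x\<bar> \<partial>lborel) + (\<integral>x. \<bar>indicat_real U x - indicat_real A x\<bar> \<partial>lborel)"
      by (rule integral_add3[OF integrable_abs[OF Bochner_Integration.integrable_diff[OF iUt iAt]]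
            integrable_abs[OF Bochner_Integration.integrable_diff[OF iUt iU]] integrable_abs[OF Bochner_Integration.integrable_diff[OF iU iA]]])
    also have "\<dots> < e" using 1 2 UA e by simp
    finally show ?thesis by simp
  qed
  then show "\<exists>N. \<forall>n\<ge>N. norm ((\<integral>x. \<bar>indicat_real A (h n + x) - indicat_real A x\<bar> \<partial>lborel) - 0) < e" by blast
qed

text \<open>Induction over integrable functions; in the limit case translation invariance transfers
  the approximation error to the shifted function.\<close>

lemma L1_translate_tendsto:
  fixes g :: "'a::euclidean_space \<Rightarrow> real"
  assumes g: "integrable lborel g" and h: "h \<longlonglongrightarrow> 0"
  shows "(\<lambda>n. \<integral>x. \<bar>g (h n + x) - g x\<bar> \<partial>lborel) \<longlonglongrightarrow> 0"
  using g
proof (induction rule: integrable_induct)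
  case (base A c)
  have "(\<lambda>n. \<bar>c\<bar> * (\<integral>x. \<bar>indicat_real A (h n + x) - indicat_real A x\<bar> \<partial>lborel)) \<longlonglongrightarrow> \<bar>c\<bar> * 0"
    using base by (intro tendsto_intros L1_translate_tendsto_indicator h) auto
  moreover have "(\<integral>x. \<bar>indicator A (h n + x) *\<^sub>R c - indicator A x *\<^sub>R c\<bar> \<partial>lborel) = \<bar>c\<bar> * (\<integral>x. \<bar>indicat_real A (h n + x) - indicat_real A x\<bar> \<partial>lborel)" for n
    by (subst integral_mult_right_zero[symmetric], intro Bochner_Integration.integral_cong)
      (auto simp: abs_mult[symmetric] algebra_simps)
  ultimately show ?case by simp
next
  case (add f g)
  have "(\<lambda>n. (\<integral>x. \<bar>f (h n + x) - f x\<bar> \<partial>lborel) + (\<integral>x. \<bar>g (h n + x) - g x\<bar> \<partial>lborel)) \<longlonglongrightarrow> 0 + 0"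
    by (intro tendsto_add add.IH)
  then have lim0: "(\<lambda>n. (\<integral>x. \<bar>f (h n + x) - f x\<bar> \<partial>lborel) + (\<integral>x. \<bar>g (h n + x) - g x\<bar> \<partial>lborel)) \<longlonglongrightarrow> 0"
    by simp
  have le: "(\<integral>x. \<bar>(f (h n + x) + g (h n + x)) - (f x + g x)\<bar> \<partial>lborel) \<le> (\<integral>x. \<bar>f (h n + x) - f x\<bar> \<partial>lborel) + (\<integral>x. \<bar>g (h n + x) - g x\<bar> \<partial>lborel)" for n
    using add.hyps integrable_lborel_translate[OF add.hyps(1), of "h n"] integrable_lborel_translate[OF add.hyps(2), of "h n"]
    by (subst Bochner_Integration.integral_add[symmetric]) (auto intro!: integral_mono simp del: Bochner_Integration.integral_add)
  show ?case
    by (rule real_tendsto_0_le[OF _ le lim0]) simp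
next
  case (lim f s)
  note fi = lim.hyps(4) and si = lim.hyps(1)
  show ?case
  proof (rule LIMSEQ_I)
    fix e :: real assume e: "e > 0"
    have "(\<lambda>i. \<integral>x. \<bar>s i x - f x\<bar> \<partial>lborel) \<longlonglongrightarrow> (\<integral>x. 0 \<partial>(lborel::'a measure))"
    proof (rule integral_dominated_convergence[where w="\<lambda>x. 3 * \<bar>f x\<bar>"])
      show "AE x in lborel. (\<lambda>i. \<bar>s i x - f x\<bar>) \<longlonglongrightarrow> 0"
        using lim.hyps(2) by (intro AE_I2 tendsto_rabs_zero LIM_zero) auto
      have "\<bar>s i x - f x\<bar> \<le> 3 * \<bar>f x\<bar>" for i x using lim.hyps(3)[of x i] by simp
      then show "AE x in lborel. norm \<bar>s i x - f x\<bar> \<le> 3 * \<bar>f x\<bar>" for i by simp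
    qed (use fi si in auto)
    then have L: "(\<lambda>i. \<integral>x. \<bar>s i x - f x\<bar> \<partial>lborel) \<longlonglongrightarrow> 0" by simp
    obtain i where "norm ((\<integral>x. \<bar>s i x - f x\<bar> \<partial>lborel) - 0) < e / 4"
      using LIMSEQ_D[OF L, of "e / 4"] e by auto
    then have i: "(\<integral>x. \<bar>s i x - f x\<bar> \<partial>lborel) < e / 4" by simp
    obtain N where N: "\<And>n. n \<ge> N \<Longrightarrow> (\<integral>x. \<bar>s i (h n + x) - s i x\<bar> \<partial>lborel) < e / 4"
      using LIMSEQ_D[OF lim.IH[of i], of "e/4"] e by auto
    have "norm ((\<integral>x. \<bar>f (h n + x) - f x\<bar> \<partial>lborel) - 0) < e" if n: "n \<ge> N" for n
    proof -
      note it = integrable_lborel_translate[OF fi, of "h n"] integrable_lborel_translate[OF si[of i], of "h n"]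
      have 2: "(\<integral>x. \<bar>s i (h n + x) - f (h n + x)\<bar> \<partial>lborel) < e / 4"
        using i fi si by (subst integral_lborel_translate[of "\<lambda>x. \<bar>s i x - f x\<bar>"]) auto
      have "(\<integral>x. \<bar>f (h n + x) - f x\<bar> \<partial>lborel) \<le>
       (\<integral>x. \<bar>s i (h n + x) - f (h n + x)\<bar> + \<bar>s i (h n + x) - s i x\<bar> + \<bar>s i x - f x\<bar> \<partial>lborel)"
        using fi si it by (intro integral_mono) auto
      also have "\<dots> = (\<integral>x. \<bar>s i (h n + x) - f (h n + x)\<bar> \<partial>lborel)
        + (\<integral>x. \<bar>s i (h n + x) - s i x\<bar> \<partial>lborel) + (\<integral>x. \<bar>s i x - f x\<bar> \<partial>lborel)"
        by (rule integral_add3[OF integrable_abs[OF Bochner_Integration.integrable_diff[OF it(2,1)]]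
            integrable_abs[OF Bochner_Integration.integrable_diff[OF it(2) si]] integrable_abs[OF Bochner_Integration.integrable_diff[OF si fi]]])
      also have "\<dots> < e" using 2 i N[OF n] e by simp
      finally show ?thesis by simp
    qed
    then show "\<exists>N. \<forall>n\<ge>N. norm ((\<integral>x. \<bar>f (h n + x) - f x\<bar> \<partial>lborel) - 0) < e" by blast
  qed
qed

text \<open>Reduces continuity of translations in \<open>L^2\<close> to that in \<open>L^1\<close>
  for the signed square \<open>u x * \<bar>u x\<bar>\<close>. With equal signs |a - b| is at most |a
  + b|; with opposite signs (a - b)^2 is at most 2 (a^2 + b^2).\<close>

lemma diff_sq_le_signed_sq:
  fixes a b :: real
  shows "(a - b)\<^sup>2 \<le> 2 * \<bar>a * \<bar>a\<bar> - b * \<bar>b\<bar>\<bar>"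
proof -
  have "(a - b)\<^sup>2 \<le> 2 * \<bar>a * a - b * b\<bar>" if "a \<ge> 0" "b \<ge> 0" for a b :: real
  proof -
    have "(a - b)\<^sup>2 = \<bar>a - b\<bar> * \<bar>a - b\<bar>" by (simp add: power2_eq_square)
    also have "\<dots> \<le> \<bar>a - b\<bar> * (a + b)" using that by (intro mult_left_mono) auto
    also have "\<dots> = \<bar>(a - b) * (a + b)\<bar>" using that by (simp add: abs_mult)
    also have "(a - b) * (a + b) = a * a - b * b" by (simp add: algebra_simps)
    finally show ?thesis by (rule order_trans) simp
  qed note same = this
  have opp: "(a - b)\<^sup>2 \<le> 2 * (a * a + b * b)" for a b :: real
    using sum_squares_bound[of a "-b"] zero_le_power2[of "a+b"] by (simp add: power2_eq_square algebra_simps)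
  consider "a \<ge> 0" "b \<ge> 0" | "a < 0" "b < 0" | "a \<ge> 0" "b < 0" | "a < 0" "b \<ge> 0" by linarith
  then show ?thesis
  proof cases
    case 1 then show ?thesis using same by simp
  next
    case 2 then show ?thesis using same[of "-a" "-b"] by (simp add: power2_commute abs_minus_commute)
  next
    case 3 then show ?thesis using opp[of a b] by (simp add: abs_if)
  next
    case 4 then show ?thesis using opp[of a b] by (simp add: abs_if)
  qed
qed

lemma L2_translate_tendsto:
  fixes u :: "'a::euclidean_space \<Rightarrow> real"
  assumes [measurable]: "u \<in> borel_measurable borel" and u: "integrable lborel (\<lambda>x. (u x)\<^sup>2)" and h: "h \<longlonglongrightarrow> 0"
  shows "(\<lambda>n. \<integral>\<^sup>+x. ennreal ((u (h n + x) - u x)\<^sup>2) \<partial>lborel) \<longlonglongrightarrow> 0"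
proof -
  let ?g = "\<lambda>x. u x * \<bar>u x\<bar>"
  have g: "integrable lborel ?g"
    by (rule Bochner_Integration.integrable_bound[OF u]) (auto simp: abs_mult power2_eq_square)
  have le: "(\<integral>\<^sup>+x. ennreal ((u (h n + x) - u x)\<^sup>2) \<partial>lborel) \<le> ennreal (2 * (\<integral>x. \<bar>?g (h n + x) - ?g x\<bar> \<partial>lborel))" for n
  proof -
    have "(\<integral>\<^sup>+x. ennreal ((u (h n + x) - u x)\<^sup>2) \<partial>lborel) \<le> (\<integral>\<^sup>+x. ennreal (2 * \<bar>?g (h n + x) - ?g x\<bar>) \<partial>lborel)"
      by (intro nn_integral_mono ennreal_leI diff_sq_le_signed_sq)
    also have "\<dots> = ennreal (\<integral>x. 2 * \<bar>?g (h n + x) - ?g x\<bar> \<partial>lborel)"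
      using g integrable_lborel_translate[OF g] by (intro nn_integral_eq_integral) auto
    finally show ?thesis by simp
  qed
  have "(\<lambda>n. ennreal (2 * (\<integral>x. \<bar>?g (h n + x) - ?g x\<bar> \<partial>lborel))) \<longlonglongrightarrow> ennreal (2 * 0)"
    by (intro tendsto_intros L1_translate_tendsto g h)
  then show ?thesis
    by (intro ennreal_tendsto_0_le[OF le]) (simp only: mult_zero_right ennreal_0)
qed

text \<open>Translating by \<open>y\<close> and rescaling by \<open>sqrt a\<close> leaves the fixed
  weight \<open>heat 1\<close> and puts the whole dependence on \<open>a\<close> into the shift
  \<open>sqrt a *\<^sub>R z\<close>, which vanishes as \<open>a\<close> tends to 0.\<close>

lemma nn_integral_heat_diff:
  fixes u :: "'a::euclidean_space \<Rightarrow> real"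
  assumes [measurable]: "u \<in> borel_measurable borel" and a: "0 < a"
  shows "(\<integral>\<^sup>+x. \<integral>\<^sup>+y. ennreal ((u x - u y)\<^sup>2 * heat a (x - y)) \<partial>lborel \<partial>lborel)
    = (\<integral>\<^sup>+z. ennreal (heat 1 z) * (\<integral>\<^sup>+y. ennreal ((u (sqrt a *\<^sub>R z + y) - u y)\<^sup>2) \<partial>lborel) \<partial>lborel)"
proof -
  have "(\<integral>\<^sup>+x. \<integral>\<^sup>+y. ennreal ((u x - u y)\<^sup>2 * heat a (x - y)) \<partial>lborel \<partial>lborel)
     = (\<integral>\<^sup>+y. \<integral>\<^sup>+x. ennreal ((u x - u y)\<^sup>2 * heat a (x - y)) \<partial>lborel \<partial>lborel)"
    by (rule lborel_pair.Fubini') measurable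
  also have "\<dots> = (\<integral>\<^sup>+y. \<integral>\<^sup>+z. ennreal ((u (y + z) - u y)\<^sup>2 * heat a z) \<partial>lborel \<partial>lborel)"
  proof (rule nn_integral_cong)
    fix y :: 'a
    show "(\<integral>\<^sup>+x. ennreal ((u x - u y)\<^sup>2 * heat a (x - y)) \<partial>lborel) = (\<integral>\<^sup>+z. ennreal ((u (y + z) - u y)\<^sup>2 * heat a z) \<partial>lborel)"
      using nn_integral_lborel_translate[of "\<lambda>x. ennreal ((u x - u y)\<^sup>2 * heat a (x - y))" y] by simp
  qed
  also have "\<dots> = (\<integral>\<^sup>+z. \<integral>\<^sup>+y. ennreal ((u (y + z) - u y)\<^sup>2 * heat a z) \<partial>lborel \<partial>lborel)"
    by (rule lborel_pair.Fubini') measurable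
  also have "\<dots> = (\<integral>\<^sup>+z. ennreal (heat a z) * (\<integral>\<^sup>+y. ennreal ((u (z + y) - u y)\<^sup>2) \<partial>lborel) \<partial>lborel)"
    using a by (intro nn_integral_cong, subst nn_integral_cmult[symmetric])
      (auto simp: ennreal_mult[symmetric] ac_simps)
  also have "\<dots> = ennreal (sqrt a ^ DIM('a)) * (\<integral>\<^sup>+z. ennreal (heat a (sqrt a *\<^sub>R z)) * (\<integral>\<^sup>+y. ennreal ((u (sqrt a *\<^sub>R z + y) - u y)\<^sup>2) \<partial>lborel) \<partial>lborel)"
    using a by (intro nn_integral_lborel_scaleR) auto
  also have "\<dots> = (\<integral>\<^sup>+z. ennreal (sqrt a ^ DIM('a)) * (ennreal (heat a (sqrt a *\<^sub>R z)) * (\<integral>\<^sup>+y. ennreal ((u (sqrt a *\<^sub>R z + y) - u y)\<^sup>2) \<partial>lborel)) \<partial>lborel)"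
    by (subst nn_integral_cmult) auto
  also have "\<dots> = (\<integral>\<^sup>+z. ennreal (heat 1 z) * (\<integral>\<^sup>+y. ennreal ((u (sqrt a *\<^sub>R z + y) - u y)\<^sup>2) \<partial>lborel) \<partial>lborel)"
    using a by (intro nn_integral_cong) (simp add: mult.assoc[symmetric] ennreal_mult[symmetric] heat_scaleR)
  finally show ?thesis .
qed

lemma nn_integral_L2_translate_le:
  fixes u :: "'a::euclidean_space \<Rightarrow> real"
  assumes [measurable]: "u \<in> borel_measurable borel" and u: "integrable lborel (\<lambda>x. (u x)\<^sup>2)"
  shows "(\<integral>\<^sup>+y. ennreal ((u (h + y) - u y)\<^sup>2) \<partial>lborel) \<le> ennreal (4 * (\<integral>x. (u x)\<^sup>2 \<partial>lborel))"
proof -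
  note it = integrable_lborel_translate[OF u, of h]
  have "(a - b)\<^sup>2 \<le> 2 * a\<^sup>2 + 2 * b\<^sup>2" for a b :: real
    using zero_le_power2[of "a + b"] by (simp add: power2_eq_square algebra_simps)
  then have "(\<integral>\<^sup>+y. ennreal ((u (h + y) - u y)\<^sup>2) \<partial>lborel) \<le> (\<integral>\<^sup>+y. ennreal (2 * (u (h + y))\<^sup>2 + 2 * (u y)\<^sup>2) \<partial>lborel)"
    by (intro nn_integral_mono ennreal_leI)
  also have "\<dots> = ennreal (\<integral>y. 2 * (u (h + y))\<^sup>2 + 2 * (u y)\<^sup>2 \<partial>lborel)"
    using u it by (intro nn_integral_eq_integral) auto
  also have "(\<integral>y. 2 * (u (h + y))\<^sup>2 + 2 * (u y)\<^sup>2 \<partial>lborel) = 2 * (\<integral>y. (u (h + y))\<^sup>2 \<partial>lborel) + 2 * (\<integral>y. (u y)\<^sup>2 \<partial>lborel)"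
    using u it by (subst Bochner_Integration.integral_add) auto
  also have "(\<integral>y. (u (h + y))\<^sup>2 \<partial>lborel) = (\<integral>y. (u y)\<^sup>2 \<partial>lborel)"
    by (rule integral_lborel_translate) measurable
  finally show ?thesis by simp
qed

text \<open>An approximate identity in quadratic form: each shift distance tends to zero by
  continuity of translations and is at most four times the squared norm, which is integrable against
  \<open>heat 1\<close>.\<close>

lemma nn_integral_heat_diff_tendsto_0:
  fixes u :: "'a::euclidean_space \<Rightarrow> real"
  assumes [measurable]: "u \<in> borel_measurable borel" and u: "integrable lborel (\<lambda>x. (u x)\<^sup>2)"
    and a: "\<And>n. 0 < a n" "a \<longlonglongrightarrow> 0"
  shows "(\<lambda>n. \<integral>\<^sup>+x. \<integral>\<^sup>+y. ennreal ((u x - u y)\<^sup>2 * heat (a n) (x - y)) \<partial>lborel \<partial>lborel) \<longlonglongrightarrow> 0"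
proof -
  let ?w = "\<lambda>z::'a. ennreal (heat 1 z) * ennreal (4 * (\<integral>x. (u x)\<^sup>2 \<partial>lborel))"
  have "(\<lambda>n. \<integral>\<^sup>+z. ennreal (heat 1 z) * (\<integral>\<^sup>+y. ennreal ((u (sqrt (a n) *\<^sub>R z + y) - u y)\<^sup>2) \<partial>lborel) \<partial>lborel) \<longlonglongrightarrow> (\<integral>\<^sup>+z. 0 \<partial>(lborel::'a measure))"
  proof (rule nn_integral_dominated_convergence[where w="?w"])
    show "AE z in lborel. ennreal (heat 1 z) * (\<integral>\<^sup>+y. ennreal ((u (sqrt (a n) *\<^sub>R z + y) - u y)\<^sup>2) \<partial>lborel) \<le> ?w z" for n
      by (intro AE_I2 mult_left_mono nn_integral_L2_translate_le u) auto
    show "integral\<^sup>N lborel ?w < \<infinity>"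
      by (subst nn_integral_multc) (auto simp: nn_integral_heat)
    show "AE z in lborel. (\<lambda>n. ennreal (heat 1 z) * (\<integral>\<^sup>+y. ennreal ((u (sqrt (a n) *\<^sub>R z + y) - u y)\<^sup>2) \<partial>lborel)) \<longlonglongrightarrow> 0"
    proof (rule AE_I2)
      fix z :: 'a
      have "(\<lambda>n. sqrt (a n) *\<^sub>R z) \<longlonglongrightarrow> sqrt 0 *\<^sub>R z" by (intro tendsto_intros a)
      then have "(\<lambda>n. \<integral>\<^sup>+y. ennreal ((u (sqrt (a n) *\<^sub>R z + y) - u y)\<^sup>2) \<partial>lborel) \<longlonglongrightarrow> 0"
        by (intro L2_translate_tendsto u) auto
      then have "(\<lambda>n. ennreal (heat 1 z) * (\<integral>\<^sup>+y. ennreal ((u (sqrt (a n) *\<^sub>R z + y) - u y)\<^sup>2) \<partial>lborel)) \<longlonglongrightarrow> ennreal (heat 1 z) * 0"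
        by (intro ennreal_tendsto_cmult) auto
      then show "(\<lambda>n. ennreal (heat 1 z) * (\<integral>\<^sup>+y. ennreal ((u (sqrt (a n) *\<^sub>R z + y) - u y)\<^sup>2) \<partial>lborel)) \<longlonglongrightarrow> 0" by simp
    qed
  qed measurable
  then show ?thesis by (simp add: nn_integral_heat_diff a)
qed

section \<open>Plancherel identity for integrable functions\<close>

lemma integrable_pair_mult:
  fixes f :: "'a::euclidean_space \<Rightarrow> 'c::{real_normed_field,banach,second_countable_topology}"
    and g :: "'b::euclidean_space \<Rightarrow> 'c"
  assumes f: "integrable lborel f" and g: "integrable lborel g"
  shows "integrable lborel (\<lambda>p. f (fst p) * g (snd p))"
    and "(\<integral>p. f (fst p) * g (snd p) \<partial>lborel) = (\<integral>x. f x \<partial>lborel) * (\<integral>y. g y \<partial>lborel)"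
proof -
  have [measurable]: "f \<in> borel_measurable borel" "g \<in> borel_measurable borel" using f g by auto
  have i: "integrable (lborel \<Otimes>\<^sub>M lborel) (\<lambda>p. f (fst p) * g (snd p))"
  proof (rule lborel_pair.Fubini_integrable)
    show "integrable lborel (\<lambda>x. \<integral>y. norm (f (fst (x, y)) * g (snd (x, y))) \<partial>lborel)"
      using f by (simp add: norm_mult)
    show "AE x in lborel. integrable lborel (\<lambda>y. f (fst (x, y)) * g (snd (x, y)))"
      using g by simp
  qed measurable
  then show "integrable lborel (\<lambda>p. f (fst p) * g (snd p))" by (simp add: lborel_prod)
  show "(\<integral>p. f (fst p) * g (snd p) \<partial>lborel) = (\<integral>x. f x \<partial>lborel) * (\<integral>y. g y \<partial>lborel)"
    using lborel_pair.integral_fst'[OF i] by (simp add: lborel_prod)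
qed

lemma nn_integral_lborel_pair:
  fixes f :: "'a::euclidean_space \<times> 'b::euclidean_space \<Rightarrow> ennreal"
  assumes "f \<in> borel_measurable borel"
  shows "(\<integral>\<^sup>+p. f p \<partial>lborel) = (\<integral>\<^sup>+x. \<integral>\<^sup>+y. f (x, y) \<partial>lborel \<partial>lborel)"
    and "(\<integral>\<^sup>+p. f p \<partial>lborel) = (\<integral>\<^sup>+y. \<integral>\<^sup>+x. f (x, y) \<partial>lborel \<partial>lborel)"
proof -
  have m: "f \<in> borel_measurable (lborel \<Otimes>\<^sub>M lborel)" using assms by (simp add: lborel_prod)
  show "(\<integral>\<^sup>+p. f p \<partial>lborel) = (\<integral>\<^sup>+x. \<integral>\<^sup>+y. f (x, y) \<partial>lborel \<partial>lborel)"
    using lborel.nn_integral_fst[OF m] by (simp add: lborel_prod)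
  show "(\<integral>\<^sup>+p. f p \<partial>lborel) = (\<integral>\<^sup>+y. \<integral>\<^sup>+x. f (x, y) \<partial>lborel \<partial>lborel)"
    using lborel_pair.nn_integral_snd[OF m] by (simp add: lborel_prod)
qed

definition ft :: "('a::euclidean_space \<Rightarrow> real) \<Rightarrow> 'a \<Rightarrow> complex" where
  "ft u \<xi> = (\<integral>x. exp (- (2 * pi * \<i>) * complex_of_real (x \<bullet> \<xi>)) * complex_of_real (u x) \<partial>lborel)"

lemma integrable_ft:
  assumes "integrable lborel u"
  shows "integrable lborel (\<lambda>x. exp (- (2 * pi * \<i>) * complex_of_real (x \<bullet> \<xi>)) * complex_of_real (u x))"
proof -
  have [measurable]: "u \<in> borel_measurable borel" using assms by auto
  show ?thesis
    by (rule Bochner_Integration.integrable_bound[OF assms]) (auto simp: norm_mult)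
qed

lemma borel_measurable_ft [measurable]:
  assumes [measurable]: "u \<in> borel_measurable borel"
  shows "ft u \<in> borel_measurable borel"
  unfolding ft_def by measurable

lemma ft_diff:
  assumes "integrable lborel u" "integrable lborel w"
  shows "ft (\<lambda>x. u x - w x) \<xi> = ft u \<xi> - ft w \<xi>"
  unfolding ft_def
  by (subst Bochner_Integration.integral_diff[OF integrable_ft[OF assms(1)] integrable_ft[OF assms(2)], symmetric])
    (simp add: right_diff_distrib)

lemma norm_ft_le: "cmod (ft u \<xi>) \<le> (\<integral>x. \<bar>u x\<bar> \<partial>lborel)"
  unfolding ft_def by (rule order_trans[OF integral_norm_bound]) (simp add: norm_mult)

lemma integrable_gauss_ft:
  fixes u :: "'a::euclidean_space \<Rightarrow> real"
  assumes u: "integrable lborel u" and a: "0 < a"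
  shows "integrable lborel (\<lambda>\<xi>. exp (- a * (norm \<xi>)\<^sup>2) * (cmod (ft u \<xi>))\<^sup>2)"
proof -
  have [measurable]: "u \<in> borel_measurable borel" using u by auto
  let ?K = "(\<integral>x. \<bar>u x\<bar> \<partial>lborel)\<^sup>2"
  have "integrable lborel (\<lambda>\<xi>::'a. exp (- a * (norm \<xi>)\<^sup>2) * ?K)"
    by (intro integrable_mult_left integrable_exp_norm_sq a)
  then show ?thesis
    by (rule Bochner_Integration.integrable_bound)
      (auto simp: abs_mult intro!: mult_left_mono power_mono norm_ft_le)
qed

text \<open>Written as a double integral, the squared modulus of \<open>ft u\<close> carries the
  phase of x - y. The Gaussian factor makes the triple integral absolutely convergent, and
  integrating over the frequency first produces the heat kernel.\<close>

lemma integral_gauss_ft: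
  fixes u :: "'a::euclidean_space \<Rightarrow> real"
  assumes u: "integrable lborel u" and a: "0 < a"
  shows "(\<integral>\<xi>. exp (- a * (norm \<xi>)\<^sup>2) * (cmod (ft u \<xi>))\<^sup>2 \<partial>lborel)
    = (\<integral>p. u (fst p) * u (snd p) * heat a (fst p - snd p) \<partial>lborel)"
proof -
  have [measurable]: "u \<in> borel_measurable borel" using u by auto
  let ?H = "\<lambda>p \<xi>. complex_of_real (u (fst p) * u (snd p)) *
     (complex_of_real (exp (- a * (norm \<xi>)\<^sup>2)) * exp (- (2 * pi * \<i>) * complex_of_real ((fst p - snd p) \<bullet> \<xi>)))"
  have "integrable lborel (\<lambda>q::('a\<times>'a)\<times>'a. (u (fst (fst q)) * u (snd (fst q))) * exp (- a * (norm (snd q))\<^sup>2))"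
    by (intro integrable_pair_mult(1)[of "\<lambda>p. u (fst p) * u (snd p)" "\<lambda>\<xi>. exp (- a * (norm \<xi>)\<^sup>2)"]
        integrable_pair_mult(1) u integrable_exp_norm_sq a)
  then have "integrable lborel (\<lambda>q::('a\<times>'a)\<times>'a. ?H (fst q) (snd q))"
  proof (rule Bochner_Integration.integrable_bound)
    show "(\<lambda>q::('a\<times>'a)\<times>'a. ?H (fst q) (snd q)) \<in> borel_measurable lborel"
      unfolding borel_prod[symmetric] lborel_prod[symmetric] by measurable
  qed (simp add: norm_mult)
  then have iH: "integrable (lborel \<Otimes>\<^sub>M lborel) (\<lambda>(p, \<xi>). ?H p \<xi>)"
    by (simp add: lborel_prod split_beta')
  have 1: "(\<integral>\<xi>. ?H p \<xi> \<partial>lborel) = complex_of_real (u (fst p) * u (snd p) * heat a (fst p - snd p))" for p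
    by (subst integral_mult_right_zero, subst gaussian_fourier(2)[OF a]) (simp only: of_real_mult)
  have 2: "(\<integral>p. ?H p \<xi> \<partial>lborel) = complex_of_real (exp (- a * (norm \<xi>)\<^sup>2) * (cmod (ft u \<xi>))\<^sup>2)" for \<xi>
  proof -
    let ?E = "\<lambda>x. exp (- (2 * pi * \<i>) * complex_of_real (x \<bullet> \<xi>)) * complex_of_real (u x)"
    have e: "?H p \<xi> = complex_of_real (exp (- a * (norm \<xi>)\<^sup>2)) * (?E (fst p) * cnj (?E (snd p)))" for p
      by (simp add: inner_diff_left exp_cnj exp_diff[symmetric] exp_add[symmetric] ring_distribs exp_minus)
        (simp add: field_simps exp_diff)?
    have "(\<integral>p. ?H p \<xi> \<partial>lborel) = complex_of_real (exp (- a * (norm \<xi>)\<^sup>2)) * (\<integral>p. ?E (fst p) * cnj (?E (snd p)) \<partial>lborel)"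
      unfolding e by (rule integral_mult_right_zero)
    also have "(\<integral>p. ?E (fst p) * cnj (?E (snd p)) \<partial>lborel) = (\<integral>x. ?E x \<partial>lborel) * (\<integral>y. cnj (?E y) \<partial>lborel)"
      by (intro integrable_pair_mult(2) integrable_ft u integrable_cnj)
    also have "(\<integral>y. cnj (?E y) \<partial>lborel) = cnj (\<integral>y. ?E y \<partial>lborel)" by (rule Bochner_Integration.integral_cnj)
    also have "(\<integral>x. ?E x \<partial>lborel) = ft u \<xi>" by (simp add: ft_def)
    also have "ft u \<xi> * cnj (ft u \<xi>) = complex_of_real ((cmod (ft u \<xi>))\<^sup>2)"
      by (rule complex_norm_square[symmetric])
    finally show ?thesis by (simp only: of_real_mult)
  qed
  have "complex_of_real (\<integral>\<xi>. exp (- a * (norm \<xi>)\<^sup>2) * (cmod (ft u \<xi>))\<^sup>2 \<partial>lborel) = (\<integral>\<xi>. \<integral>p. ?H p \<xi> \<partial>lborel \<partial>lborel)"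
    unfolding 2 by (rule integral_complex_of_real[symmetric])
  also have "\<dots> = (\<integral>p. \<integral>\<xi>. ?H p \<xi> \<partial>lborel \<partial>lborel)"
    by (rule lborel_pair.Fubini_integral[OF iH])
  also have "\<dots> = complex_of_real (\<integral>p. u (fst p) * u (snd p) * heat a (fst p - snd p) \<partial>lborel)"
    unfolding 1 by (rule integral_complex_of_real)
  finally show ?thesis by (simp only: of_real_eq_iff)
qed

lemma nn_integral_sq_heat:
  fixes u :: "'a::euclidean_space \<Rightarrow> real"
  assumes [measurable]: "u \<in> borel_measurable borel" and a: "0 < a"
  shows "(\<integral>\<^sup>+p. ennreal ((u (fst p))\<^sup>2 * heat a (fst p - snd p)) \<partial>lborel) = (\<integral>\<^sup>+x. ennreal ((u x)\<^sup>2) \<partial>lborel)"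
    and "(\<integral>\<^sup>+p. ennreal ((u (snd p))\<^sup>2 * heat a (fst p - snd p)) \<partial>lborel) = (\<integral>\<^sup>+x. ennreal ((u x)\<^sup>2) \<partial>lborel)"
proof -
  have h1: "(\<integral>\<^sup>+y. ennreal (heat a (x - y)) \<partial>lborel) = 1" for x :: 'a
  proof -
    have "(\<integral>\<^sup>+y. ennreal (heat a (x - y)) \<partial>lborel) = (\<integral>\<^sup>+y. ennreal (heat a (y - x)) \<partial>lborel)"
      using heat_minus[of a "x - _"] by (simp add: minus_diff_eq)
    then show ?thesis
      using nn_integral_lborel_translate[of "\<lambda>y. ennreal (heat a y)" "-x"] nn_integral_heat[OF a, where 'a='a] by simp
  qed
  have h2: "(\<integral>\<^sup>+x. ennreal (heat a (x - y)) \<partial>lborel) = 1" for y :: 'a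
    using nn_integral_lborel_translate[of "\<lambda>y. ennreal (heat a y)" "-y"] nn_integral_heat[OF a, where 'a='a] by simp
  have m[measurable]: "(\<lambda>p::'a\<times>'a. ennreal ((u (fst p))\<^sup>2 * heat a (fst p - snd p))) \<in> borel_measurable borel"
    "(\<lambda>p::'a\<times>'a. ennreal ((u (snd p))\<^sup>2 * heat a (fst p - snd p))) \<in> borel_measurable borel"
    unfolding borel_prod[symmetric] by measurable
  show "(\<integral>\<^sup>+p. ennreal ((u (fst p))\<^sup>2 * heat a (fst p - snd p)) \<partial>lborel) = (\<integral>\<^sup>+x. ennreal ((u x)\<^sup>2) \<partial>lborel)"
    using a by (subst nn_integral_lborel_pair(1)[OF m(1)]) (simp add: ennreal_mult nn_integral_cmult h1)
  show "(\<integral>\<^sup>+p. ennreal ((u (snd p))\<^sup>2 * heat a (fst p - snd p)) \<partial>lborel) = (\<integral>\<^sup>+x. ennreal ((u x)\<^sup>2) \<partial>lborel)"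
    using a by (subst nn_integral_lborel_pair(2)[OF m(2)]) (simp add: ennreal_mult nn_integral_cmult h2)
qed

lemma integrable_sq_heat:
  fixes u :: "'a::euclidean_space \<Rightarrow> real"
  assumes [measurable]: "u \<in> borel_measurable borel" and u: "integrable lborel (\<lambda>x. (u x)\<^sup>2)" and a: "0 < a"
  shows "integrable lborel (\<lambda>p. (u (fst p))\<^sup>2 * heat a (fst p - snd p))"
    "(\<integral>p. (u (fst p))\<^sup>2 * heat a (fst p - snd p) \<partial>lborel) = (\<integral>x. (u x)\<^sup>2 \<partial>lborel)"
    "integrable lborel (\<lambda>p. (u (snd p))\<^sup>2 * heat a (fst p - snd p))"
    "(\<integral>p. (u (snd p))\<^sup>2 * heat a (fst p - snd p) \<partial>lborel) = (\<integral>x. (u x)\<^sup>2 \<partial>lborel)"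
    "integrable lborel (\<lambda>p. u (fst p) * u (snd p) * heat a (fst p - snd p))"
proof -
  have m[measurable]: "(\<lambda>p::'a\<times>'a. (u (fst p))\<^sup>2 * heat a (fst p - snd p)) \<in> borel_measurable borel"
    "(\<lambda>p::'a\<times>'a. (u (snd p))\<^sup>2 * heat a (fst p - snd p)) \<in> borel_measurable borel"
    "(\<lambda>p::'a\<times>'a. u (fst p) * u (snd p) * heat a (fst p - snd p)) \<in> borel_measurable borel"
    unfolding borel_prod[symmetric] by measurable
  have n: "(\<integral>\<^sup>+x. ennreal ((u x)\<^sup>2) \<partial>lborel) = ennreal (\<integral>x. (u x)\<^sup>2 \<partial>lborel)"
    using u by (intro nn_integral_eq_integral) auto
  have pos: "0 \<le> (\<integral>x. (u x)\<^sup>2 \<partial>lborel)" by simp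
  have h: "has_bochner_integral lborel (\<lambda>p. (u (fst p))\<^sup>2 * heat a (fst p - snd p)) (\<integral>x. (u x)\<^sup>2 \<partial>lborel)"
    using a by (intro has_bochner_integral_nn_integral) (auto simp: nn_integral_sq_heat n)
  have h': "has_bochner_integral lborel (\<lambda>p. (u (snd p))\<^sup>2 * heat a (fst p - snd p)) (\<integral>x. (u x)\<^sup>2 \<partial>lborel)"
    using a by (intro has_bochner_integral_nn_integral) (auto simp: nn_integral_sq_heat n)
  show i: "integrable lborel (\<lambda>p. (u (fst p))\<^sup>2 * heat a (fst p - snd p))"
    "(\<integral>p. (u (fst p))\<^sup>2 * heat a (fst p - snd p) \<partial>lborel) = (\<integral>x. (u x)\<^sup>2 \<partial>lborel)"
    "integrable lborel (\<lambda>p. (u (snd p))\<^sup>2 * heat a (fst p - snd p))"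
    "(\<integral>p. (u (snd p))\<^sup>2 * heat a (fst p - snd p) \<partial>lborel) = (\<integral>x. (u x)\<^sup>2 \<partial>lborel)"
    using h h' by (auto simp: has_bochner_integral_iff)
  have b: "\<bar>x * y\<bar> \<le> x\<^sup>2 + y\<^sup>2" for x y :: real
    using sum_squares_bound[of "\<bar>x\<bar>" "\<bar>y\<bar>"] mult_nonneg_nonneg[OF abs_ge_zero[of x] abs_ge_zero[of y]]
    unfolding abs_mult power2_abs by linarith
  have "integrable lborel (\<lambda>p. (u (fst p))\<^sup>2 * heat a (fst p - snd p) + (u (snd p))\<^sup>2 * heat a (fst p - snd p))"
    using i by simp
  then show "integrable lborel (\<lambda>p. u (fst p) * u (snd p) * heat a (fst p - snd p))"
    by (rule Bochner_Integration.integrable_bound)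
      (use a in \<open>auto simp: abs_mult[of _ "heat _ _"] distrib_right[symmetric] intro!: mult_right_mono b\<close>)
qed

text \<open>Expanding the square, both pure terms integrate to the squared norm because the kernel
  has unit mass; the mixed term is the one that \<open>integral_gauss_ft\<close> expresses by
  frequencies.\<close>

lemma nn_integral_heat_diff_eq:
  fixes u :: "'a::euclidean_space \<Rightarrow> real"
  assumes [measurable]: "u \<in> borel_measurable borel" and u: "integrable lborel (\<lambda>x. (u x)\<^sup>2)" and a: "0 < a"
  shows "(\<integral>\<^sup>+x. \<integral>\<^sup>+y. ennreal ((u x - u y)\<^sup>2 * heat a (x - y)) \<partial>lborel \<partial>lborel)
    = ennreal (2 * ((\<integral>x. (u x)\<^sup>2 \<partial>lborel) - (\<integral>p. u (fst p) * u (snd p) * heat a (fst p - snd p) \<partial>lborel)))"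
proof -
  note i = integrable_sq_heat[OF assms]
  have m[measurable]: "(\<lambda>p::'a\<times>'a. ennreal ((u (fst p) - u (snd p))\<^sup>2 * heat a (fst p - snd p))) \<in> borel_measurable borel"
    unfolding borel_prod[symmetric] by measurable
  have eq: "(u (fst p) - u (snd p))\<^sup>2 * heat a (fst p - snd p) = (u (fst p))\<^sup>2 * heat a (fst p - snd p) + (u (snd p))\<^sup>2 * heat a (fst p - snd p)
     - 2 * (u (fst p) * u (snd p) * heat a (fst p - snd p))" for p
    by (simp add: power2_eq_square algebra_simps)
  have "(\<integral>\<^sup>+x. \<integral>\<^sup>+y. ennreal ((u x - u y)\<^sup>2 * heat a (x - y)) \<partial>lborel \<partial>lborel)
     = (\<integral>\<^sup>+p. ennreal ((u (fst p) - u (snd p))\<^sup>2 * heat a (fst p - snd p)) \<partial>lborel)"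
    by (subst nn_integral_lborel_pair(1)[OF m]) simp
  also have "\<dots> = ennreal (\<integral>p. (u (fst p) - u (snd p))\<^sup>2 * heat a (fst p - snd p) \<partial>lborel)"
  proof (rule nn_integral_eq_integral)
    show "integrable lborel (\<lambda>p. (u (fst p) - u (snd p))\<^sup>2 * heat a (fst p - snd p))"
      unfolding eq using i(1,3,5) by simp
    show "AE p in lborel. 0 \<le> (u (fst p) - u (snd p))\<^sup>2 * heat a (fst p - snd p)"
      using a by simp
  qed
  also have "(\<integral>p. (u (fst p) - u (snd p))\<^sup>2 * heat a (fst p - snd p) \<partial>lborel)
     = 2 * ((\<integral>x. (u x)\<^sup>2 \<partial>lborel) - (\<integral>p. u (fst p) * u (snd p) * heat a (fst p - snd p) \<partial>lborel))"
    unfolding eq using i by simp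
  finally show ?thesis .
qed

text \<open>The Gaussian-regularized frequency integrals equal \<open>K n\<close>. On the frequency
  side monotone convergence removes the Gaussian; on the space side the heat differences, which
  equal \<open>2 * (?S - K n)\<close>, tend to zero.\<close>

theorem plancherel_L1_L2:
  fixes u :: "'a::euclidean_space \<Rightarrow> real"
  assumes u1: "integrable lborel u" and u2: "integrable lborel (\<lambda>x. (u x)\<^sup>2)"
  shows "integrable lborel (\<lambda>\<xi>. (cmod (ft u \<xi>))\<^sup>2)"
    and "(\<integral>\<xi>. (cmod (ft u \<xi>))\<^sup>2 \<partial>lborel) = (\<integral>x. (u x)\<^sup>2 \<partial>lborel)"
proof -
  have [measurable]: "u \<in> borel_measurable borel" using u1 by auto
  define a where "a n = 1 / real (Suc n)" for n
  have a: "0 < a n" "a \<longlonglongrightarrow> 0" for n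
    using LIMSEQ_inverse_real_of_nat unfolding a_def by (auto simp: inverse_eq_divide)
  define K where "K n = (\<integral>p. u (fst p) * u (snd p) * heat (a n) (fst p - snd p) \<partial>lborel)" for n
  let ?S = "\<integral>x. (u x)\<^sup>2 \<partial>lborel"
  have D: "(\<lambda>n. ennreal (2 * (?S - K n))) \<longlonglongrightarrow> ennreal 0"
    using nn_integral_heat_diff_tendsto_0[of u a, OF _ u2 a] nn_integral_heat_diff_eq[OF _ u2 a(1)]
    unfolding K_def by simp
  have I: "(\<integral>\<^sup>+\<xi>. ennreal (exp (- a n * (norm \<xi>)\<^sup>2) * (cmod (ft u \<xi>))\<^sup>2) \<partial>lborel) = ennreal (K n)" for n
    unfolding K_def integral_gauss_ft[OF u1 a(1), symmetric]
    by (intro nn_integral_eq_integral integrable_gauss_ft u1 a) auto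
  \<comment> \<open>With this sign \<open>ennreal\<close> does not truncate \<open>?S - K n\<close>
    at zero, so the limit in \<open>ennreal\<close> is a limit of reals.\<close>
  have KS: "K n \<le> ?S" for n
  proof -
    have "2 * (u (fst p) * u (snd p) * heat (a n) (fst p - snd p)) \<le> (u (fst p))\<^sup>2 * heat (a n) (fst p - snd p) + (u (snd p))\<^sup>2 * heat (a n) (fst p - snd p)" for p
    proof -
      have "0 \<le> (u (fst p) - u (snd p))\<^sup>2 * heat (a n) (fst p - snd p)" using a(1) by simp
      then show ?thesis by (simp add: power2_eq_square algebra_simps)
    qed
    then have "(\<integral>p. 2 * (u (fst p) * u (snd p) * heat (a n) (fst p - snd p)) \<partial>lborel) \<le> (\<integral>p. (u (fst p))\<^sup>2 * heat (a n) (fst p - snd p) + (u (snd p))\<^sup>2 * heat (a n) (fst p - snd p) \<partial>lborel)"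
      using integrable_sq_heat[OF _ u2 a(1)] by (intro integral_mono) auto
    then show ?thesis unfolding K_def using integrable_sq_heat[OF _ u2 a(1)] by simp
  qed
  have "(\<lambda>n. 2 * (?S - K n)) \<longlonglongrightarrow> 0"
    using D KS by (subst (asm) tendsto_ennreal_iff) auto
  then have "(\<lambda>n. ?S - (2 * (?S - K n)) / 2) \<longlonglongrightarrow> ?S - 0 / 2" by (intro tendsto_intros) auto
  moreover have "?S - (2 * (?S - K n)) / 2 = K n" for n by (simp add: field_simps)
  ultimately have "K \<longlonglongrightarrow> ?S" by simp
  then have "(\<lambda>n. ennreal (K n)) \<longlonglongrightarrow> ennreal ?S" by simp
  moreover have "(\<lambda>n. \<integral>\<^sup>+\<xi>. ennreal (exp (- a n * (norm \<xi>)\<^sup>2) * (cmod (ft u \<xi>))\<^sup>2) \<partial>lborel) \<longlonglongrightarrow> (\<integral>\<^sup>+\<xi>. ennreal ((cmod (ft u \<xi>))\<^sup>2) \<partial>lborel)"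
  proof (rule nn_integral_LIMSEQ)
    show "incseq (\<lambda>n \<xi>. ennreal (exp (- a n * (norm \<xi>)\<^sup>2) * (cmod (ft u \<xi>))\<^sup>2))"
      by (auto simp: incseq_def le_fun_def a_def intro!: ennreal_leI mult_right_mono divide_left_mono)
    show "(\<lambda>n. ennreal (exp (- a n * (norm \<xi>)\<^sup>2) * (cmod (ft u \<xi>))\<^sup>2)) \<longlonglongrightarrow> ennreal ((cmod (ft u \<xi>))\<^sup>2)" for \<xi>
    proof -
      have "(\<lambda>n. ennreal (exp (- a n * (norm \<xi>)\<^sup>2) * (cmod (ft u \<xi>))\<^sup>2)) \<longlonglongrightarrow> ennreal (exp (- 0 * (norm \<xi>)\<^sup>2) * (cmod (ft u \<xi>))\<^sup>2)"
        by (intro tendsto_intros a)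
      then show ?thesis by simp
    qed
  qed measurable
  ultimately have "(\<integral>\<^sup>+\<xi>. ennreal ((cmod (ft u \<xi>))\<^sup>2) \<partial>lborel) = ennreal ?S"
    unfolding I using LIMSEQ_unique by blast
  then have "has_bochner_integral lborel (\<lambda>\<xi>. (cmod (ft u \<xi>))\<^sup>2) ?S"
    by (intro has_bochner_integral_nn_integral) auto
  then show "integrable lborel (\<lambda>\<xi>. (cmod (ft u \<xi>))\<^sup>2)" "(\<integral>\<xi>. (cmod (ft u \<xi>))\<^sup>2 \<partial>lborel) = ?S"
    by (auto simp: has_bochner_integral_iff)
qed

text \<open>The gap between Plancherel's identity and its Gaussian-regularized form, computed on
  both sides.\<close>

lemma heat_diff_spectral_L1_L2:
  fixes u :: "'a::euclidean_space \<Rightarrow> real"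
  assumes u1: "integrable lborel u" and u2: "integrable lborel (\<lambda>x. (u x)\<^sup>2)" and a: "0 < a"
  shows "(\<integral>\<^sup>+x. \<integral>\<^sup>+y. ennreal ((u x - u y)\<^sup>2 * heat a (x - y)) \<partial>lborel \<partial>lborel)
    = ennreal (2 * (\<integral>\<xi>. (1 - exp (- a * (norm \<xi>)\<^sup>2)) * (cmod (ft u \<xi>))\<^sup>2 \<partial>lborel))"
proof -
  have "(\<integral>\<xi>. (1 - exp (- a * (norm \<xi>)\<^sup>2)) * (cmod (ft u \<xi>))\<^sup>2 \<partial>lborel)
    = (\<integral>\<xi>. (cmod (ft u \<xi>))\<^sup>2 - exp (- a * (norm \<xi>)\<^sup>2) * (cmod (ft u \<xi>))\<^sup>2 \<partial>lborel)"
    by (simp add: algebra_simps)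
  also have "\<dots> = (\<integral>x. (u x)\<^sup>2 \<partial>lborel) - (\<integral>p. u (fst p) * u (snd p) * heat a (fst p - snd p) \<partial>lborel)"
    unfolding Bochner_Integration.integral_diff[OF plancherel_L1_L2(1)[OF u1 u2] integrable_gauss_ft[OF u1 a]]
      plancherel_L1_L2(2)[OF u1 u2] integral_gauss_ft[OF u1 a] ..
  finally show ?thesis
    using nn_integral_heat_diff_eq[OF _ u2 a] u1 by simp
qed

section \<open>The \<open>L\<^sup>2\<close> Fourier transform\<close>

text \<open>Young's inequality with weight \<open>e\<close> for the product |y| |x - y|; it makes
  quadratic integrals continuous under perturbations that are small in \<open>L^2\<close>.\<close>

lemma sq_norm_diff_le:
  fixes x y :: "'a::real_normed_vector"
  assumes e: "e > 0"
  shows "\<bar>(norm x)\<^sup>2 - (norm y)\<^sup>2\<bar> \<le> e * (norm y)\<^sup>2 + (1 + 1 / e) * (norm (x - y))\<^sup>2"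
proof -
  let ?a = "norm x" and ?b = "norm y" and ?d = "norm (x - y)"
  have d: "\<bar>?a - ?b\<bar> \<le> ?d" by (rule norm_triangle_ineq3)
  have "\<bar>?a\<^sup>2 - ?b\<^sup>2\<bar> = \<bar>?a - ?b\<bar> * (?a + ?b)"
    by (simp add: power2_eq_square square_diff_square_factored abs_mult)
  also have "\<dots> \<le> ?d * (2 * ?b + ?d)"
    using d by (intro mult_mono) auto
  also have "\<dots> = 2 * (sqrt e * ?b) * (?d / sqrt e) + ?d\<^sup>2"
    using e by (simp add: power2_eq_square algebra_simps)
  also have "2 * (sqrt e * ?b) * (?d / sqrt e) \<le> (sqrt e * ?b)\<^sup>2 + (?d / sqrt e)\<^sup>2"
    by (rule sum_squares_bound)
  also have "(sqrt e * ?b)\<^sup>2 + (?d / sqrt e)\<^sup>2 = e * ?b\<^sup>2 + ?d\<^sup>2 / e"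
    using e by (simp add: power_mult_distrib power_divide)
  finally show ?thesis by (simp add: algebra_simps)
qed

lemma L2_tendsto_weighted:
  fixes f :: "nat \<Rightarrow> 'a \<Rightarrow> 'b::{banach,second_countable_topology}"
  assumes fm[measurable]: "\<And>n. f n \<in> borel_measurable M" "g \<in> borel_measurable M" "w \<in> borel_measurable M"
    and f2: "\<And>n. integrable M (\<lambda>x. (norm (f n x))\<^sup>2)" and g2: "integrable M (\<lambda>x. (norm (g x))\<^sup>2)"
    and lim: "(\<lambda>n. \<integral>\<^sup>+x. ennreal ((norm (f n x - g x))\<^sup>2) \<partial>M) \<longlonglongrightarrow> 0"
    and w: "\<And>x. 0 \<le> w x" "\<And>x. w x \<le> 1"
  shows "(\<lambda>n. \<integral>x. w x * (norm (f n x))\<^sup>2 \<partial>M) \<longlonglongrightarrow> (\<integral>x. w x * (norm (g x))\<^sup>2 \<partial>M)"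
proof -
  have wi: "integrable M (\<lambda>x. w x * (norm (k x))\<^sup>2)" if "integrable M (\<lambda>x. (norm (k x))\<^sup>2)" "k \<in> borel_measurable M" for k :: "'a \<Rightarrow> 'b"
  proof (rule Bochner_Integration.integrable_bound[OF that(1)])
    show "(\<lambda>x. w x * (norm (k x))\<^sup>2) \<in> borel_measurable M" using that(2) by measurable
    show "AE x in M. norm (w x * (norm (k x))\<^sup>2) \<le> norm ((norm (k x))\<^sup>2)"
      using w by (auto simp: abs_mult intro!: mult_left_le_one_le)
  qed
  have d2: "integrable M (\<lambda>x. (norm (f n x - g x))\<^sup>2)" for n
  proof -
    have "integrable M (\<lambda>x. 2 * (norm (f n x))\<^sup>2 + 2 * (norm (g x))\<^sup>2)" using f2 g2 by simp
    then show ?thesis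
    proof (rule Bochner_Integration.integrable_bound)
      have "(norm (p - q))\<^sup>2 \<le> 2 * (norm p)\<^sup>2 + 2 * (norm q)\<^sup>2" for p q :: 'b
      proof -
        have "(norm (p - q))\<^sup>2 \<le> (norm p + norm q)\<^sup>2" by (intro power_mono norm_triangle_ineq4) auto
        also have "\<dots> \<le> 2 * (norm p)\<^sup>2 + 2 * (norm q)\<^sup>2"
          using sum_squares_bound[of "norm p" "norm q"] by (simp add: power2_sum)
        finally show ?thesis .
      qed
      then show "AE x in M. norm ((norm (f n x - g x))\<^sup>2) \<le> norm (2 * (norm (f n x))\<^sup>2 + 2 * (norm (g x))\<^sup>2)" by simp
    qed measurable
  qed
  have "(\<integral>\<^sup>+x. ennreal ((norm (f n x - g x))\<^sup>2) \<partial>M) = ennreal (\<integral>x. (norm (f n x - g x))\<^sup>2 \<partial>M)" for n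
    by (intro nn_integral_eq_integral d2) auto
  then have L: "(\<lambda>n. \<integral>x. (norm (f n x - g x))\<^sup>2 \<partial>M) \<longlonglongrightarrow> 0"
    using lim by (simp add: ennreal_0[symmetric] tendsto_ennreal_iff del: ennreal_0)
  show ?thesis
  proof (rule LIMSEQ_I)
    fix r :: real assume r: "r > 0"
    let ?G = "\<integral>x. (norm (g x))\<^sup>2 \<partial>M"
    have G0: "0 \<le> ?G" by simp
    define e where "e = r / (2 * (?G + 1))"
    have e: "e > 0" "e * ?G < r / 2" using r G0 by (auto simp: e_def field_simps add_pos_nonneg)
    obtain N where N: "\<And>n. n \<ge> N \<Longrightarrow> norm ((\<integral>x. (norm (f n x - g x))\<^sup>2 \<partial>M) - 0) < r / (2 * (1 + 1 / e))"
      using LIMSEQ_D[OF L, of "r / (2 * (1 + 1 / e))"] r e by (auto simp: add_pos_nonneg)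
    have "norm ((\<integral>x. w x * (norm (f n x))\<^sup>2 \<partial>M) - (\<integral>x. w x * (norm (g x))\<^sup>2 \<partial>M)) < r" if n: "n \<ge> N" for n
    proof -
      let ?D = "\<integral>x. (norm (f n x - g x))\<^sup>2 \<partial>M"
      have "(\<integral>x. w x * (norm (f n x))\<^sup>2 \<partial>M) - (\<integral>x. w x * (norm (g x))\<^sup>2 \<partial>M) = (\<integral>x. w x * (norm (f n x))\<^sup>2 - w x * (norm (g x))\<^sup>2 \<partial>M)"
        by (rule Bochner_Integration.integral_diff[symmetric]) (auto intro!: wi f2 g2)
      also have "norm \<dots> \<le> (\<integral>x. norm (w x * (norm (f n x))\<^sup>2 - w x * (norm (g x))\<^sup>2) \<partial>M)"
        by (rule integral_norm_bound)
      also have "\<dots> \<le> (\<integral>x. e * (norm (g x))\<^sup>2 + (1 + 1 / e) * (norm (f n x - g x))\<^sup>2 \<partial>M)"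
      proof (rule integral_mono)
        show "norm (w x * (norm (f n x))\<^sup>2 - w x * (norm (g x))\<^sup>2) \<le> e * (norm (g x))\<^sup>2 + (1 + 1 / e) * (norm (f n x - g x))\<^sup>2" for x
        proof -
          have "norm (w x * (norm (f n x))\<^sup>2 - w x * (norm (g x))\<^sup>2) = w x * \<bar>(norm (f n x))\<^sup>2 - (norm (g x))\<^sup>2\<bar>"
            using w(1)[of x] by (simp add: right_diff_distrib[symmetric] abs_mult)
          also have "\<dots> \<le> 1 * \<bar>(norm (f n x))\<^sup>2 - (norm (g x))\<^sup>2\<bar>" using w by (intro mult_right_mono) auto
          also have "\<dots> \<le> e * (norm (g x))\<^sup>2 + (1 + 1 / e) * (norm (f n x - g x))\<^sup>2"
            using sq_norm_diff_le[OF e(1)] by simp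
          finally show ?thesis .
        qed
      qed (use wi f2 g2 d2 in auto)
      also have "\<dots> = e * ?G + (1 + 1 / e) * ?D"
        using g2 d2[of n] by simp
      also have "\<dots> < r / 2 + r / 2"
      proof (rule add_strict_mono[OF e(2)])
        have "0 < 1 + 1 / e" using e by (simp add: add_pos_nonneg)
        moreover have "?D < r / (2 * (1 + 1 / e))" using N[OF n] by simp
        ultimately show "(1 + 1 / e) * ?D < r / 2" by (simp add: field_simps)
      qed
      finally show ?thesis by simp
    qed
    then show "\<exists>N. \<forall>n\<ge>N. norm ((\<integral>x. w x * (norm (f n x))\<^sup>2 \<partial>M) - (\<integral>x. w x * (norm (g x))\<^sup>2 \<partial>M)) < r" by blast
  qed
qed

section \<open>Truncation to balls and the Fourier transform of square integrable functions\<close>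

definition trunc_ball :: "('a::euclidean_space \<Rightarrow> real) \<Rightarrow> real \<Rightarrow> 'a \<Rightarrow> real" where
  "trunc_ball u R x = indicat_real (ball 0 R) x * u x"

lemma trunc_ball_measurable [measurable]:
  "u \<in> borel_measurable borel \<Longrightarrow> trunc_ball u R \<in> borel_measurable borel"
  unfolding trunc_ball_def by (intro borel_measurable_times borel_measurable_indicator) auto

lemma trunc_ball_sq_le: "(trunc_ball u R x)\<^sup>2 \<le> (u x)\<^sup>2"
  by (auto simp: trunc_ball_def indicator_def)

lemma trunc_ball_integrable:
  fixes u :: "'a::euclidean_space \<Rightarrow> real"
  assumes [measurable]: "u \<in> borel_measurable borel" and u: "integrable lborel (\<lambda>x. (u x)\<^sup>2)"
  shows "integrable lborel (trunc_ball u R)" "integrable lborel (\<lambda>x. (trunc_ball u R x)\<^sup>2)"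
proof -
  show "integrable lborel (\<lambda>x. (trunc_ball u R x)\<^sup>2)"
    by (rule Bochner_Integration.integrable_bound[OF u]) (auto simp: trunc_ball_sq_le)
  have "integrable lborel (\<lambda>x::'a. indicat_real (ball 0 R) x + (u x)\<^sup>2)"
    using u emeasure_lborel_ball_finite[of "0::'a" R] by (intro Bochner_Integration.integrable_add) auto
  then show "integrable lborel (trunc_ball u R)"
  proof (rule Bochner_Integration.integrable_bound)
    have "\<bar>t\<bar> \<le> 1 + t\<^sup>2" for t :: real
      using sum_squares_bound[of "\<bar>t\<bar>" 1] zero_le_power2[of t] by simp
    then show "AE x in lborel. norm (trunc_ball u R x) \<le> norm (indicat_real (ball 0 R) x + (u x)\<^sup>2)"
      by (auto simp: trunc_ball_def indicator_def)
  qed measurable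
qed

lemma trunc_ball_tendsto_L2:
  fixes u :: "'a::euclidean_space \<Rightarrow> real"
  assumes [measurable]: "u \<in> borel_measurable borel" and u: "integrable lborel (\<lambda>x. (u x)\<^sup>2)"
  shows "((\<lambda>R. \<integral>x. (u x - trunc_ball u R x)\<^sup>2 \<partial>lborel) \<longlongrightarrow> 0) at_top"
proof -
  have "((\<lambda>R. \<integral>x. (u x - trunc_ball u R x)\<^sup>2 \<partial>lborel) \<longlongrightarrow> (\<integral>x. 0 \<partial>(lborel::'a measure))) at_top"
  proof (rule integral_dominated_convergence_at_top[where w="\<lambda>x. (u x)\<^sup>2"])
    show "AE x in lborel. ((\<lambda>R. (u x - trunc_ball u R x)\<^sup>2) \<longlongrightarrow> 0) at_top"
    proof (rule AE_I2)
      fix x :: 'a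
      have "\<forall>\<^sub>F R in at_top. (u x - trunc_ball u R x)\<^sup>2 = 0"
        using eventually_gt_at_top[of "norm x"] by eventually_elim (simp add: trunc_ball_def)
      then show "((\<lambda>R. (u x - trunc_ball u R x)\<^sup>2) \<longlongrightarrow> 0) at_top" by (rule tendsto_eventually)
    qed
    show "\<forall>\<^sub>F R in at_top. AE x in lborel. norm ((u x - trunc_ball u R x)\<^sup>2) \<le> (u x)\<^sup>2"
      by (auto simp: trunc_ball_def indicator_def)
  qed (use u in auto)
  then show ?thesis by simp
qed

lemma ft_trunc_ball_dist:
  fixes u :: "'a::euclidean_space \<Rightarrow> real"
  assumes [measurable]: "u \<in> borel_measurable borel" and u: "integrable lborel (\<lambda>x. (u x)\<^sup>2)" and RS: "R \<le> S"
  shows "(\<integral>\<^sup>+\<xi>. ennreal ((cmod (ft (trunc_ball u R) \<xi> - ft (trunc_ball u S) \<xi>))\<^sup>2) \<partial>lborel)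
    \<le> ennreal (\<integral>x. (u x - trunc_ball u R x)\<^sup>2 \<partial>lborel)"
proof -
  let ?d = "\<lambda>x. trunc_ball u R x - trunc_ball u S x"
  note t = trunc_ball_integrable[OF assms(1,2)]
  have d1: "integrable lborel ?d" using t(1) by simp
  have le: "(?d x)\<^sup>2 \<le> (u x - trunc_ball u R x)\<^sup>2" for x using RS by (auto simp: trunc_ball_def indicator_def)
  have D: "integrable lborel (\<lambda>x. (u x - trunc_ball u R x)\<^sup>2)"
    by (rule Bochner_Integration.integrable_bound[OF u]) (auto simp: trunc_ball_def indicator_def)
  have d2: "integrable lborel (\<lambda>x. (?d x)\<^sup>2)"
    by (rule Bochner_Integration.integrable_bound[OF D]) (auto simp: le)
  have "(\<integral>\<^sup>+\<xi>. ennreal ((cmod (ft (trunc_ball u R) \<xi> - ft (trunc_ball u S) \<xi>))\<^sup>2) \<partial>lborel)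
    = (\<integral>\<^sup>+\<xi>. ennreal ((cmod (ft ?d \<xi>))\<^sup>2) \<partial>lborel)"
    by (simp add: ft_diff t(1))
  also have "\<dots> = ennreal (\<integral>x. (?d x)\<^sup>2 \<partial>lborel)"
    unfolding plancherel_L1_L2(2)[OF d1 d2, symmetric]
    by (intro nn_integral_eq_integral plancherel_L1_L2(1)[OF d1 d2]) auto
  also have "\<dots> \<le> ennreal (\<integral>x. (u x - trunc_ball u R x)\<^sup>2 \<partial>lborel)"
    by (intro ennreal_leI integral_mono d2 D le)
  finally show ?thesis .
qed

lemma nn_integral_norm_diff_sq_le:
  fixes f g h :: "'a \<Rightarrow> 'b::{banach,second_countable_topology}"
  assumes [measurable]: "f \<in> borel_measurable M" "g \<in> borel_measurable M" "h \<in> borel_measurable M"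
  shows "(\<integral>\<^sup>+x. ennreal ((norm (f x - h x))\<^sup>2) \<partial>M) \<le> 2 * (\<integral>\<^sup>+x. ennreal ((norm (f x - g x))\<^sup>2) \<partial>M) + 2 * (\<integral>\<^sup>+x. ennreal ((norm (g x - h x))\<^sup>2) \<partial>M)"
proof -
  have "(norm (p - q))\<^sup>2 \<le> 2 * (norm (p - s))\<^sup>2 + 2 * (norm (s - q))\<^sup>2" for p q s :: 'b
  proof -
    have "norm (p - q) \<le> norm (p - s) + norm (s - q)" by (metis dist_norm dist_triangle)
    then have "(norm (p - q))\<^sup>2 \<le> (norm (p - s) + norm (s - q))\<^sup>2" by (intro power_mono) auto
    also have "\<dots> \<le> 2 * (norm (p - s))\<^sup>2 + 2 * (norm (s - q))\<^sup>2"
      using sum_squares_bound[of "norm (p - s)" "norm (s - q)"] by (simp add: power2_sum)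
    finally show ?thesis .
  qed
  then have "(\<integral>\<^sup>+x. ennreal ((norm (f x - h x))\<^sup>2) \<partial>M) \<le> (\<integral>\<^sup>+x. ennreal (2 * (norm (f x - g x))\<^sup>2 + 2 * (norm (g x - h x))\<^sup>2) \<partial>M)"
    by (intro nn_integral_mono ennreal_leI)
  also have "\<dots> = (\<integral>\<^sup>+x. 2 * ennreal ((norm (f x - g x))\<^sup>2) + 2 * ennreal ((norm (g x - h x))\<^sup>2) \<partial>M)"
    by (simp add: ennreal_mult)
  also have "\<dots> = 2 * (\<integral>\<^sup>+x. ennreal ((norm (f x - g x))\<^sup>2) \<partial>M) + 2 * (\<integral>\<^sup>+x. ennreal ((norm (g x - h x))\<^sup>2) \<partial>M)"
    by (simp add: nn_integral_add nn_integral_cmult)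
  finally show ?thesis .
qed

text \<open>Plancherel bounds the distance of two truncated transforms by the tail of
  \<open>u\<close> outside the smaller ball. Completeness gives a limit along integer radii, and the
  tail bound, after passing to the limit in the larger radius, extends the convergence to all real
  radii as \<open>is_fourier_L2\<close> demands.\<close>

lemma ft_trunc_ball_L2_limit:
  fixes u :: "'a::euclidean_space \<Rightarrow> real"
  assumes [measurable]: "u \<in> borel_measurable borel" and u: "integrable lborel (\<lambda>x. (u x)\<^sup>2)"
  obtains v where "v \<in> borel_measurable borel" "integrable lborel (\<lambda>\<xi>. (cmod (v \<xi>))\<^sup>2)"
    "((\<lambda>R. \<integral>\<^sup>+\<xi>. ennreal ((cmod (ft (trunc_ball u R) \<xi> - v \<xi>))\<^sup>2) \<partial>lborel) \<longlongrightarrow> 0) at_top"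
proof -
  define \<tau> where "\<tau> R = (\<integral>x. (u x - trunc_ball u R x)\<^sup>2 \<partial>lborel)" for R
  note d = ft_trunc_ball_dist[OF assms, folded \<tau>_def]
  have \<tau>: "(\<tau> \<longlongrightarrow> 0) at_top" using trunc_ball_tendsto_L2[OF assms] unfolding \<tau>_def .
  have d': "(\<integral>\<^sup>+\<xi>. ennreal ((cmod (ft (trunc_ball u S) \<xi> - ft (trunc_ball u R) \<xi>))\<^sup>2) \<partial>lborel) \<le> ennreal (\<tau> R)" if "R \<le> S" for R S
    using d[OF that] by (simp add: norm_minus_commute)
  have cauchy: "\<exists>N. \<forall>m\<ge>N. \<forall>n\<ge>N. (\<integral>\<^sup>+\<xi>. ennreal ((norm (ft (trunc_ball u (real m)) \<xi> - ft (trunc_ball u (real n)) \<xi>))\<^sup>2) \<partial>lborel) \<le> ennreal e"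
    if e: "e > 0" for e :: real
  proof -
    have "\<forall>\<^sub>F R in at_top. \<tau> R < e" using order_tendstoD(2)[OF \<tau> e] .
    then obtain R0 where R0: "\<And>R. R \<ge> R0 \<Longrightarrow> \<tau> R < e" by (auto simp: eventually_at_top_linorder)
    obtain N :: nat where N: "R0 \<le> real N" using real_arch_simple by blast
    have "(\<integral>\<^sup>+\<xi>. ennreal ((norm (ft (trunc_ball u (real m)) \<xi> - ft (trunc_ball u (real n)) \<xi>))\<^sup>2) \<partial>lborel) \<le> ennreal e"
      if "m \<ge> N" "n \<ge> N" for m n
    proof (cases "m \<le> n")
      case True
      then have "(\<integral>\<^sup>+\<xi>. ennreal ((norm (ft (trunc_ball u (real m)) \<xi> - ft (trunc_ball u (real n)) \<xi>))\<^sup>2) \<partial>lborel) \<le> ennreal (\<tau> m)"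
        by (intro d) simp
      also have "\<dots> \<le> ennreal e" using R0[of "real m"] N that by (intro ennreal_leI) auto
      finally show ?thesis .
    next
      case False
      then have "(\<integral>\<^sup>+\<xi>. ennreal ((norm (ft (trunc_ball u (real m)) \<xi> - ft (trunc_ball u (real n)) \<xi>))\<^sup>2) \<partial>lborel) \<le> ennreal (\<tau> n)"
        by (intro d') simp
      also have "\<dots> \<le> ennreal e" using R0[of "real n"] N that by (intro ennreal_leI) auto
      finally show ?thesis .
    qed
    then show ?thesis by blast
  qed
  obtain r v where v[measurable]: "v \<in> borel_measurable lborel"
    and lim: "(\<lambda>n. \<integral>\<^sup>+\<xi>. ennreal ((norm (ft (trunc_ball u (real n)) \<xi> - v \<xi>))\<^sup>2) \<partial>lborel) \<longlonglongrightarrow> 0"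
  proof (rule L2_complete[of "\<lambda>n. ft (trunc_ball u (real n))" lborel])
    show "\<exists>N. \<forall>m\<ge>N. \<forall>n\<ge>N. (\<integral>\<^sup>+\<xi>. ennreal ((norm (ft (trunc_ball u (real m)) \<xi> - ft (trunc_ball u (real n)) \<xi>))\<^sup>2) \<partial>lborel) \<le> ennreal e"
      if "e > 0" for e :: real using cauchy[OF that] .
  qed auto
  have bound: "(\<integral>\<^sup>+\<xi>. ennreal ((cmod (ft (trunc_ball u R) \<xi> - v \<xi>))\<^sup>2) \<partial>lborel) \<le> 2 * ennreal (\<tau> R)" for R
  proof (rule tendsto_lowerbound)
    show "(\<lambda>n. 2 * ennreal (\<tau> R) + 2 * (\<integral>\<^sup>+\<xi>. ennreal ((norm (ft (trunc_ball u (real n)) \<xi> - v \<xi>))\<^sup>2) \<partial>lborel)) \<longlonglongrightarrow> 2 * ennreal (\<tau> R)"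
      using tendsto_add[OF tendsto_const ennreal_tendsto_cmult[OF _ lim, of 2]] by simp
    obtain N :: nat where N: "R \<le> real N" using real_arch_simple by blast
    show "\<forall>\<^sub>F n in sequentially. (\<integral>\<^sup>+\<xi>. ennreal ((cmod (ft (trunc_ball u R) \<xi> - v \<xi>))\<^sup>2) \<partial>lborel)
       \<le> 2 * ennreal (\<tau> R) + 2 * (\<integral>\<^sup>+\<xi>. ennreal ((norm (ft (trunc_ball u (real n)) \<xi> - v \<xi>))\<^sup>2) \<partial>lborel)"
      using eventually_ge_at_top[of N]
    proof eventually_elim
      case (elim n)
      have "(\<integral>\<^sup>+\<xi>. ennreal ((cmod (ft (trunc_ball u R) \<xi> - v \<xi>))\<^sup>2) \<partial>lborel)
       \<le> 2 * (\<integral>\<^sup>+\<xi>. ennreal ((cmod (ft (trunc_ball u R) \<xi> - ft (trunc_ball u (real n)) \<xi>))\<^sup>2) \<partial>lborel) + 2 * (\<integral>\<^sup>+\<xi>. ennreal ((norm (ft (trunc_ball u (real n)) \<xi> - v \<xi>))\<^sup>2) \<partial>lborel)"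
        by (rule nn_integral_norm_diff_sq_le) auto
      also have "\<dots> \<le> 2 * ennreal (\<tau> R) + 2 * (\<integral>\<^sup>+\<xi>. ennreal ((norm (ft (trunc_ball u (real n)) \<xi> - v \<xi>))\<^sup>2) \<partial>lborel)"
        using elim N by (intro add_right_mono mult_left_mono d) auto
      finally show ?case .
    qed
  qed simp
  have "((\<lambda>R. 2 * ennreal (\<tau> R)) \<longlongrightarrow> 2 * ennreal 0) at_top"
    by (intro ennreal_tendsto_cmult tendsto_ennrealI \<tau>) simp
  then have lim': "((\<lambda>R. \<integral>\<^sup>+\<xi>. ennreal ((cmod (ft (trunc_ball u R) \<xi> - v \<xi>))\<^sup>2) \<partial>lborel) \<longlongrightarrow> 0) at_top"
    by (intro ennreal_tendsto_0_le[OF bound]) simp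
  have "integrable lborel (\<lambda>\<xi>. (cmod (v \<xi>))\<^sup>2)"
  proof (rule integrableI_bounded)
    have "(\<integral>\<^sup>+\<xi>. ennreal ((cmod (v \<xi> - 0))\<^sup>2) \<partial>lborel) \<le> 2 * (\<integral>\<^sup>+\<xi>. ennreal ((cmod (v \<xi> - ft (trunc_ball u 0) \<xi>))\<^sup>2) \<partial>lborel) + 2 * (\<integral>\<^sup>+\<xi>. ennreal ((cmod (ft (trunc_ball u 0) \<xi> - 0))\<^sup>2) \<partial>lborel)"
      by (rule nn_integral_norm_diff_sq_le) auto
    also have "\<dots> < \<infinity>"
    proof -
      have "(\<integral>\<^sup>+\<xi>. ennreal ((cmod (v \<xi> - ft (trunc_ball u 0) \<xi>))\<^sup>2) \<partial>lborel) < \<infinity>"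
        using bound[of 0] by (simp add: norm_minus_commute) (metis ennreal_less_top ennreal_mult_less_top ennreal_numeral_less_top order_le_less_trans top.not_eq_extremum)
      moreover have "(\<integral>\<^sup>+\<xi>. ennreal ((cmod (ft (trunc_ball u 0) \<xi> - 0))\<^sup>2) \<partial>lborel) < \<infinity>"
        using plancherel_L1_L2(1)[OF trunc_ball_integrable[OF assms]] unfolding integrable_iff_bounded by simp
      ultimately show ?thesis by (simp add: ennreal_mult_less_top ennreal_add_less_top)
    qed
    finally show "(\<integral>\<^sup>+\<xi>. ennreal (norm ((cmod (v \<xi>))\<^sup>2)) \<partial>lborel) < \<infinity>" by simp
  qed auto
  with lim' v show ?thesis by (intro that) auto
qed

text \<open>At fixed time both sides pass to the limit along truncations: by dominated convergence
  for the differences, and by \<open>L^2\<close> convergence against a weight between 0 and 1 for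
  the frequencies. The boundedness of this weight is the reason for integrating over time only
  afterwards.\<close>

lemma heat_diff_spectral:
  fixes u :: "'a::euclidean_space \<Rightarrow> real"
  assumes [measurable]: "u \<in> borel_measurable borel" and u: "integrable lborel (\<lambda>x. (u x)\<^sup>2)"
    and v[measurable]: "v \<in> borel_measurable borel" and v2: "integrable lborel (\<lambda>\<xi>. (cmod (v \<xi>))\<^sup>2)"
    and lim: "((\<lambda>R. \<integral>\<^sup>+\<xi>. ennreal ((cmod (ft (trunc_ball u R) \<xi> - v \<xi>))\<^sup>2) \<partial>lborel) \<longlongrightarrow> 0) at_top"
    and a: "0 < a"
  shows "(\<integral>\<^sup>+x. \<integral>\<^sup>+y. ennreal ((u x - u y)\<^sup>2 * heat a (x - y)) \<partial>lborel \<partial>lborel)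
    = 2 * (\<integral>\<^sup>+\<xi>. ennreal ((1 - exp (- a * (norm \<xi>)\<^sup>2)) * (cmod (v \<xi>))\<^sup>2) \<partial>lborel)"
proof -
  let ?u = "\<lambda>n::nat. trunc_ball u (real n)"
  let ?w = "\<lambda>\<xi>::'a. 1 - exp (- a * (norm \<xi>)\<^sup>2)"
  note t = trunc_ball_integrable[OF assms(1,2)]
  have w: "0 \<le> ?w \<xi>" "?w \<xi> \<le> 1" for \<xi> using a by auto
  have limn: "(\<lambda>n. \<integral>\<^sup>+\<xi>. ennreal ((norm (ft (?u n) \<xi> - v \<xi>))\<^sup>2) \<partial>lborel) \<longlonglongrightarrow> 0"
    using filterlim_compose[OF lim filterlim_real_sequentially] .
  have "(\<lambda>n. \<integral>\<xi>. ?w \<xi> * (norm (ft (?u n) \<xi>))\<^sup>2 \<partial>lborel) \<longlonglongrightarrow> (\<integral>\<xi>. ?w \<xi> * (norm (v \<xi>))\<^sup>2 \<partial>lborel)"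
    by (rule L2_tendsto_weighted[OF _ _ _ _ v2 limn w]) (auto intro!: plancherel_L1_L2 t)
  then have 1: "(\<lambda>n. ennreal (2 * (\<integral>\<xi>. ?w \<xi> * (norm (ft (?u n) \<xi>))\<^sup>2 \<partial>lborel))) \<longlonglongrightarrow> ennreal (2 * (\<integral>\<xi>. ?w \<xi> * (norm (v \<xi>))\<^sup>2 \<partial>lborel))"
    by (intro tendsto_intros)
  have m: "(\<lambda>p::'a\<times>'a. ennreal ((k (fst p) - k (snd p))\<^sup>2 * heat a (fst p - snd p))) \<in> borel_measurable borel"
    if [measurable]: "k \<in> borel_measurable borel" for k
    unfolding borel_prod[symmetric] by measurable
  have 2: "(\<lambda>n. \<integral>\<^sup>+p. ennreal ((?u n (fst p) - ?u n (snd p))\<^sup>2 * heat a (fst p - snd p)) \<partial>lborel)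
     \<longlonglongrightarrow> (\<integral>\<^sup>+p. ennreal ((u (fst p) - u (snd p))\<^sup>2 * heat a (fst p - snd p)) \<partial>lborel)"
  proof (rule nn_integral_dominated_convergence[where w="\<lambda>p. ennreal (2 * ((u (fst p))\<^sup>2 * heat a (fst p - snd p)) + 2 * ((u (snd p))\<^sup>2 * heat a (fst p - snd p)))"])
    show "(\<lambda>p::'a\<times>'a. ennreal ((?u n (fst p) - ?u n (snd p))\<^sup>2 * heat a (fst p - snd p))) \<in> borel_measurable lborel" for n
      using m[of "?u n"] by simp
    show "(\<lambda>p::'a\<times>'a. ennreal ((u (fst p) - u (snd p))\<^sup>2 * heat a (fst p - snd p))) \<in> borel_measurable lborel"
      using m[of u] by simp
    note i = integrable_sq_heat[OF assms(1,2) a]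
    show "(\<integral>\<^sup>+p. ennreal (2 * ((u (fst p))\<^sup>2 * heat a (fst p - snd p)) + 2 * ((u (snd p))\<^sup>2 * heat a (fst p - snd p))) \<partial>lborel) < \<infinity>"
      using i(1,3) a by (subst nn_integral_eq_integral) auto
    show "(\<lambda>p. ennreal (2 * ((u (fst p))\<^sup>2 * heat a (fst p - snd p)) + 2 * ((u (snd p))\<^sup>2 * heat a (fst p - snd p)))) \<in> borel_measurable lborel"
      using i(1,3) by auto
    show "AE p in lborel. ennreal ((?u n (fst p) - ?u n (snd p))\<^sup>2 * heat a (fst p - snd p)) \<le> ennreal (2 * ((u (fst p))\<^sup>2 * heat a (fst p - snd p)) + 2 * ((u (snd p))\<^sup>2 * heat a (fst p - snd p)))" for n
    proof (intro AE_I2 ennreal_leI)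
      fix p :: "'a \<times> 'a"
      have "(?u n (fst p) - ?u n (snd p))\<^sup>2 \<le> 2 * (?u n (fst p))\<^sup>2 + 2 * (?u n (snd p))\<^sup>2"
        using zero_le_power2[of "?u n (fst p) + ?u n (snd p)"] by (simp add: power2_eq_square algebra_simps)
      also have "\<dots> \<le> 2 * (u (fst p))\<^sup>2 + 2 * (u (snd p))\<^sup>2"
        using trunc_ball_sq_le[of u "real n" "fst p"] trunc_ball_sq_le[of u "real n" "snd p"] by linarith
      finally have "(?u n (fst p) - ?u n (snd p))\<^sup>2 * heat a (fst p - snd p) \<le> (2 * (u (fst p))\<^sup>2 + 2 * (u (snd p))\<^sup>2) * heat a (fst p - snd p)"
        using a by (intro mult_right_mono) auto
      then show "(?u n (fst p) - ?u n (snd p))\<^sup>2 * heat a (fst p - snd p) \<le> 2 * ((u (fst p))\<^sup>2 * heat a (fst p - snd p)) + 2 * ((u (snd p))\<^sup>2 * heat a (fst p - snd p))"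
        by (simp add: algebra_simps)
    qed
    show "AE p in lborel. (\<lambda>n. ennreal ((?u n (fst p) - ?u n (snd p))\<^sup>2 * heat a (fst p - snd p))) \<longlonglongrightarrow> ennreal ((u (fst p) - u (snd p))\<^sup>2 * heat a (fst p - snd p))"
    proof (rule AE_I2)
      fix p :: "'a \<times> 'a"
      have e: "\<forall>\<^sub>F n in sequentially. ?u n x = u x" for x
      proof -
        obtain N :: nat where "norm x < real N" using reals_Archimedean2 by blast
        then show ?thesis
          by (intro eventually_sequentiallyI[of N]) (auto simp: trunc_ball_def)
      qed
      have "\<forall>\<^sub>F n in sequentially. ennreal ((?u n (fst p) - ?u n (snd p))\<^sup>2 * heat a (fst p - snd p)) = ennreal ((u (fst p) - u (snd p))\<^sup>2 * heat a (fst p - snd p))"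
        using e[of "fst p"] e[of "snd p"] by eventually_elim simp
      then show "(\<lambda>n. ennreal ((?u n (fst p) - ?u n (snd p))\<^sup>2 * heat a (fst p - snd p))) \<longlonglongrightarrow> ennreal ((u (fst p) - u (snd p))\<^sup>2 * heat a (fst p - snd p))"
        by (rule tendsto_eventually)
    qed
  qed
  have eq: "(\<integral>\<^sup>+p. ennreal ((?u n (fst p) - ?u n (snd p))\<^sup>2 * heat a (fst p - snd p)) \<partial>lborel) = ennreal (2 * (\<integral>\<xi>. ?w \<xi> * (norm (ft (?u n) \<xi>))\<^sup>2 \<partial>lborel))" for n
    using heat_diff_spectral_L1_L2[OF t(1) t(2) a, of "real n"]
    by (subst nn_integral_lborel_pair(1)[OF m]) auto
  have "(\<integral>\<^sup>+p. ennreal ((u (fst p) - u (snd p))\<^sup>2 * heat a (fst p - snd p)) \<partial>lborel) = ennreal (2 * (\<integral>\<xi>. ?w \<xi> * (norm (v \<xi>))\<^sup>2 \<partial>lborel))"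
    using LIMSEQ_unique[OF 2] 1 unfolding eq by blast
  also have "\<dots> = 2 * ennreal (\<integral>\<xi>. ?w \<xi> * (norm (v \<xi>))\<^sup>2 \<partial>lborel)"
    by (subst ennreal_mult') simp_all
  also have "ennreal (\<integral>\<xi>. ?w \<xi> * (norm (v \<xi>))\<^sup>2 \<partial>lborel) = (\<integral>\<^sup>+\<xi>. ennreal (?w \<xi> * (norm (v \<xi>))\<^sup>2) \<partial>lborel)"
  proof (rule nn_integral_eq_integral[symmetric])
    show "integrable lborel (\<lambda>\<xi>. ?w \<xi> * (cmod (v \<xi>))\<^sup>2)"
      by (rule Bochner_Integration.integrable_bound[OF v2]) (use w in \<open>auto simp: abs_mult intro!: mult_left_le_one_le\<close>)
    show "AE \<xi> in lborel. 0 \<le> ?w \<xi> * (cmod (v \<xi>))\<^sup>2" using w by simp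
  qed
  finally show ?thesis
    by (subst (asm) nn_integral_lborel_pair(1)[OF m]) auto
qed

section \<open>The fractional seminorm as a weighted integral of differences\<close>

definition frac_const :: "real \<Rightarrow> real" where
  "frac_const s = enn2real (\<integral>\<^sup>+t. ennreal (indicat_real {0<..} t * ((1 - exp (- t)) * t powr (-1 - s))) \<partial>lborel)"

text \<open>The constant is Gamma(1 - s) / s. It is finite because 1 - exp (- t) is at most t, which
  leaves t powr (- s) near 0, integrable for s < 1, while t powr (-1 - s) is integrable at infinity
  for s > 0.\<close>

lemma frac_const:
  assumes s: "0 < s" "s < 1"
  shows "0 < frac_const s"
    and "(\<integral>\<^sup>+t. ennreal (indicat_real {0<..} t * ((1 - exp (- t)) * t powr (-1 - s))) \<partial>lborel) = ennreal (frac_const s)"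
proof -
  let ?f = "\<lambda>t. ennreal (indicat_real {0<..} t * ((1 - exp (- t)) * t powr (-1 - s)))"
  let ?I = "\<integral>\<^sup>+t. ?f t \<partial>lborel"
  have i1: "(\<integral>\<^sup>+t. ennreal (indicat_real {0..1} t * t powr (- s)) \<partial>lborel) < \<infinity>"
    using nn_integral_has_integral_lebesgue[OF _ has_integral_powr_from_0[of "- s" 1]] s by simp
  have i2: "(\<integral>\<^sup>+t. ennreal (indicat_real {1..} t * t powr (-1 - s)) \<partial>lborel) < \<infinity>"
    using nn_integral_has_integral_lebesgue[OF _ has_integral_powr_to_inf[of "-1 - s" 1]] s by simp
  have "?I \<le> (\<integral>\<^sup>+t. ennreal (indicat_real {0..1} t * t powr (- s)) + ennreal (indicat_real {1..} t * t powr (-1 - s)) \<partial>lborel)"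
  proof (rule nn_integral_mono)
    fix t :: real
    show "?f t \<le> ennreal (indicat_real {0..1} t * t powr (- s)) + ennreal (indicat_real {1..} t * t powr (-1 - s))"
    proof (cases "t > 0")
      case t: True
      have e: "1 - exp (- t) \<le> t" using exp_ge_add_one_self[of "-t"] by simp
      show ?thesis
      proof (cases "t \<le> 1")
        case True
        have "(1 - exp (- t)) * t powr (-1 - s) \<le> t * t powr (-1 - s)" using e by (intro mult_right_mono) auto
        also have "\<dots> = t powr (- s)" using t by (simp add: powr_mult_base)
        finally show ?thesis using t True by (auto intro!: ennreal_leI add_increasing2)
      next
        case False
        have "(1 - exp (- t)) * t powr (-1 - s) \<le> 1 * t powr (-1 - s)" by (intro mult_right_mono) auto
        then show ?thesis using t False by (auto intro!: ennreal_leI add_increasing)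
      qed
    qed simp
  qed
  also have "\<dots> < \<infinity>" using i1 i2 by (subst nn_integral_add) (auto simp: ennreal_add_less_top)
  finally have fin: "?I < \<infinity>" .
  then show eq: "?I = ennreal (frac_const s)" unfolding frac_const_def by simp
  let ?c = "(1 - exp (-1)) * 2 powr (-1 - s)"
  have "ennreal ?c = (\<integral>\<^sup>+t. ennreal ?c * indicator {1..2::real} t \<partial>lborel)" by (simp add: nn_integral_cmult_indicator)
  also have "\<dots> \<le> ?I"
  proof (rule nn_integral_mono)
    fix t :: real
    have "?c \<le> (1 - exp (- t)) * t powr (-1 - s)" if "1 \<le> t" "t \<le> 2"
      using that s by (intro mult_mono powr_mono2') auto
    then show "ennreal ?c * indicator {1..2} t \<le> ?f t" by (auto simp: indicator_def intro!: ennreal_leI)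
  qed
  finally have "ennreal ?c \<le> ennreal (frac_const s)" unfolding eq .
  moreover have "0 < ?c" by simp
  ultimately show "0 < frac_const s"
    by (metis ennreal_0 ennreal_le_iff2 ennreal_less_zero_iff linorder_not_less order_less_le_trans)
qed

lemma nn_integral_powr_spectral:
  assumes s: "0 < s" "s < 1" and r: "0 \<le> r"
  shows "(\<integral>\<^sup>+t. ennreal (indicat_real {0<..} t * ((1 - exp (- t * r\<^sup>2)) * t powr (-1 - s))) \<partial>lborel) = ennreal (frac_const s * r powr (2 * s))"
proof (cases "r = 0")
  case False
  with r have r: "r > 0" by simp
  let ?f = "\<lambda>t. ennreal (indicat_real {0<..} t * ((1 - exp (- t * r\<^sup>2)) * t powr (-1 - s)))"
  have fe: "?f (0 + 1 / r\<^sup>2 * t) = ennreal (r powr (2 * s + 2)) * ennreal (indicat_real {0<..} t * ((1 - exp (- t)) * t powr (-1 - s)))" for t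
  proof (cases "t > 0")
    case True
    have "(t / r\<^sup>2) powr (-1 - s) = t powr (-1 - s) * r powr (2 * s + 2)"
    proof -
      have "r\<^sup>2 powr (-1 - s) = r powr (2 * (-1 - s))" using powr_powr[of r 2 "-1 - s"] r by simp
      then have "(t / r\<^sup>2) powr (-1 - s) = t powr (-1 - s) / r powr (2 * (-1 - s))"
        using r True by (simp only: powr_divide)
      also have "\<dots> = t powr (-1 - s) * r powr (2 * s + 2)"
        by (simp add: powr_minus_divide[symmetric] divide_inverse powr_minus[symmetric] algebra_simps)
      finally show ?thesis .
    qed
    then show ?thesis using r True by (simp add: ennreal_mult[symmetric] mult_ac)
  next
    case False
    then show ?thesis using r by (simp add: zero_less_divide_iff)
  qed
  have "(\<integral>\<^sup>+t. ?f t \<partial>lborel) = ennreal \<bar>1 / r\<^sup>2\<bar> * (\<integral>\<^sup>+t. ?f (0 + 1 / r\<^sup>2 * t) \<partial>lborel)"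
    using r by (intro nn_integral_real_affine) auto
  also have "(\<integral>\<^sup>+t. ?f (0 + 1 / r\<^sup>2 * t) \<partial>lborel) = (\<integral>\<^sup>+t. ennreal (r powr (2 * s + 2)) * ennreal (indicat_real {0<..} t * ((1 - exp (- t)) * t powr (-1 - s))) \<partial>lborel)"
    unfolding fe ..
  also have "(\<integral>\<^sup>+t. ennreal (r powr (2 * s + 2)) * ennreal (indicat_real {0<..} t * ((1 - exp (- t)) * t powr (-1 - s))) \<partial>lborel) = ennreal (r powr (2 * s + 2)) * ennreal (frac_const s)"
    by (subst nn_integral_cmult) (auto simp: frac_const(2)[OF s])
  also have "ennreal \<bar>1 / r\<^sup>2\<bar> * (ennreal (r powr (2 * s + 2)) * ennreal (frac_const s)) = ennreal (1 / r\<^sup>2 * (r powr (2 * s + 2) * frac_const s))"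
    using r frac_const(1)[OF s] by (simp add: ennreal_mult[symmetric])
  also have "1 / r\<^sup>2 * (r powr (2 * s + 2) * frac_const s) = frac_const s * r powr (2 * s)"
    using r by (simp add: powr_add)
  finally show ?thesis .
qed simp

text \<open>Integrated over the time coordinate this is a multiple of the Gagliardo kernel |x -
  y|^(- N - 2 s), with N the dimension. The 2 in the denominator compensates the factor 2 in the
  spectral identity for heat differences.\<close>

definition frac_kernel :: "real \<Rightarrow> real \<times> 'a::euclidean_space \<times> 'a \<Rightarrow> real" where
  "frac_kernel s p = indicat_real {0<..} (fst p) * (fst p powr (-1 - s) * heat (fst p) (fst (snd p) - snd (snd p)) / (2 * frac_const s))"

text \<open>With the root of the kernel built in, this depends linearly on \<open>u\<close>, and
  polarization, Fatou and splitting become statements about squares on the product space.\<close>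

definition frac_diff :: "real \<Rightarrow> ('a::euclidean_space \<Rightarrow> real) \<Rightarrow> real \<times> 'a \<times> 'a \<Rightarrow> real" where
  "frac_diff s u p = sqrt (frac_kernel s p) * (u (fst (snd p)) - u (snd (snd p)))"

lemma frac_kernel_nonneg:
  assumes "0 < s" "s < 1"
  shows "0 \<le> frac_kernel s p"
  using frac_const(1)[OF assms] by (auto simp: frac_kernel_def indicator_def)

lemma borel_measurable_frac_kernel [measurable]:
  "frac_kernel s \<in> borel_measurable (borel :: (real \<times> 'a::euclidean_space \<times> 'a) measure)"
  unfolding frac_kernel_def borel_prod[symmetric] by measurable

lemma borel_measurable_frac_diff [measurable]:
  fixes u :: "'a::euclidean_space \<Rightarrow> real"
  assumes [measurable]: "u \<in> borel_measurable borel"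
  shows "frac_diff s u \<in> borel_measurable borel"
proof -
  have "(\<lambda>p::real \<times> 'a \<times> 'a. u (fst (snd p)) - u (snd (snd p))) \<in> borel_measurable borel"
    unfolding borel_prod[symmetric] by measurable
  then show ?thesis unfolding frac_diff_def[abs_def] by measurable
qed

lemma frac_diff_sq:
  assumes "0 < s" "s < 1"
  shows "(frac_diff s u p)\<^sup>2 = frac_kernel s p * (u (fst (snd p)) - u (snd (snd p)))\<^sup>2"
  by (simp add: frac_diff_def power_mult_distrib frac_kernel_nonneg[OF assms])

lemma frac_diff_add: "frac_diff s (\<lambda>x. u x + w x) p = frac_diff s u p + frac_diff s w p"
  by (simp add: frac_diff_def algebra_simps)

lemma frac_diff_minus: "frac_diff s (\<lambda>x. u x - w x) p = frac_diff s u p - frac_diff s w p"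
  by (simp add: frac_diff_def algebra_simps)

lemma frac_diff_cmult: "frac_diff s (\<lambda>x. c * u x) p = c * frac_diff s u p"
  by (simp add: frac_diff_def algebra_simps)

lemma nn_integral_frac_diff:
  fixes u :: "'a::euclidean_space \<Rightarrow> real"
  assumes s: "0 < s" "s < 1" and [measurable]: "u \<in> borel_measurable borel"
  shows "(\<integral>\<^sup>+p. ennreal ((frac_diff s u p)\<^sup>2) \<partial>lborel)
    = (\<integral>\<^sup>+t. ennreal (indicat_real {0<..} t * t powr (-1 - s) / (2 * frac_const s)) *
         (\<integral>\<^sup>+x. \<integral>\<^sup>+y. ennreal ((u x - u y)\<^sup>2 * heat t (x - y)) \<partial>lborel \<partial>lborel) \<partial>lborel)"
proof -
  have m: "(\<lambda>p. ennreal ((frac_diff s u p)\<^sup>2)) \<in> borel_measurable borel" by measurable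
  have m2: "(\<lambda>q. ennreal ((frac_diff s u (t, q))\<^sup>2)) \<in> borel_measurable borel" for t
  proof -
    have "(\<lambda>q. (t, q)) \<in> borel \<rightarrow>\<^sub>M (borel :: (real \<times> 'a \<times> 'a) measure)"
      unfolding borel_prod[symmetric] by measurable
    from measurable_compose[OF this m] show ?thesis .
  qed
  have m3: "(\<lambda>q::'a\<times>'a. ennreal ((u (fst q) - u (snd q))\<^sup>2 * heat t (fst q - snd q))) \<in> borel_measurable borel" for t
    unfolding borel_prod[symmetric] by measurable
  have "(\<integral>\<^sup>+p. ennreal ((frac_diff s u p)\<^sup>2) \<partial>lborel) = (\<integral>\<^sup>+t. \<integral>\<^sup>+q. ennreal ((frac_diff s u (t, q))\<^sup>2) \<partial>lborel \<partial>lborel)"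
    by (rule nn_integral_lborel_pair(1)[OF m])
  also have "\<dots> = (\<integral>\<^sup>+t. ennreal (indicat_real {0<..} t * t powr (-1 - s) / (2 * frac_const s)) *
         (\<integral>\<^sup>+x. \<integral>\<^sup>+y. ennreal ((u x - u y)\<^sup>2 * heat t (x - y)) \<partial>lborel \<partial>lborel) \<partial>lborel)"
  proof (rule nn_integral_cong)
    fix t :: real
    have "(\<integral>\<^sup>+q. ennreal ((frac_diff s u (t, q))\<^sup>2) \<partial>lborel) = (\<integral>\<^sup>+q. ennreal (indicat_real {0<..} t * t powr (-1 - s) / (2 * frac_const s)) * ennreal ((u (fst q) - u (snd q))\<^sup>2 * heat t (fst q - snd q)) \<partial>lborel)"
    proof (rule nn_integral_cong)
      fix q :: "'a \<times> 'a"
      show "ennreal ((frac_diff s u (t, q))\<^sup>2) = ennreal (indicat_real {0<..} t * t powr (-1 - s) / (2 * frac_const s)) * ennreal ((u (fst q) - u (snd q))\<^sup>2 * heat t (fst q - snd q))"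
        using frac_const(1)[OF s] by (cases "t > 0") (simp_all add: frac_diff_sq[OF s] frac_kernel_def ennreal_mult[symmetric] mult_ac)
    qed
    also have "\<dots> = ennreal (indicat_real {0<..} t * t powr (-1 - s) / (2 * frac_const s)) * (\<integral>\<^sup>+q. ennreal ((u (fst q) - u (snd q))\<^sup>2 * heat t (fst q - snd q)) \<partial>lborel)"
      by (rule nn_integral_cmult) (use m3 in simp)
    also have "(\<integral>\<^sup>+q. ennreal ((u (fst q) - u (snd q))\<^sup>2 * heat t (fst q - snd q)) \<partial>lborel) = (\<integral>\<^sup>+x. \<integral>\<^sup>+y. ennreal ((u x - u y)\<^sup>2 * heat t (x - y)) \<partial>lborel \<partial>lborel)"
      by (subst nn_integral_lborel_pair(1)[OF m3]) simp
    finally show "(\<integral>\<^sup>+q. ennreal ((frac_diff s u (t, q))\<^sup>2) \<partial>lborel) = ennreal (indicat_real {0<..} t * t powr (-1 - s) / (2 * frac_const s)) *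
         (\<integral>\<^sup>+x. \<integral>\<^sup>+y. ennreal ((u x - u y)\<^sup>2 * heat t (x - y)) \<partial>lborel \<partial>lborel)" .
  qed
  finally show ?thesis .
qed

text \<open>The subordination formula \<open>C |\<xi>| powr (2 s) = \<integral>\<^sub>0\<^sup>\<infinity> (1 - exp (- t |\<xi>|\<^sup>2)) t powr (-1 - s) dt\<close>
  turns the Fourier seminorm into a weighted square integral of differences.\<close>

lemma frac_seminorm_eq:
  fixes u :: "'a::euclidean_space \<Rightarrow> real" and v :: "'a \<Rightarrow> complex"
  assumes s: "0 < s" "s < 1" and [measurable]: "u \<in> borel_measurable borel" "v \<in> borel_measurable borel"
    and spec: "\<And>a. 0 < a \<Longrightarrow> (\<integral>\<^sup>+x. \<integral>\<^sup>+y. ennreal ((u x - u y)\<^sup>2 * heat a (x - y)) \<partial>lborel \<partial>lborel)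
      = 2 * (\<integral>\<^sup>+\<xi>. ennreal ((1 - exp (- a * (norm \<xi>)\<^sup>2)) * (cmod (v \<xi>))\<^sup>2) \<partial>lborel)"
  shows "(\<integral>\<^sup>+\<xi>. ennreal (norm \<xi> powr (2 * s) * (cmod (v \<xi>))\<^sup>2) \<partial>lborel) = (\<integral>\<^sup>+p. ennreal ((frac_diff s u p)\<^sup>2) \<partial>lborel)"
proof -
  note C = frac_const(1)[OF s]
  let ?g = "\<lambda>t \<xi>. ennreal (indicat_real {0<..} t * t powr (-1 - s) * (1 - exp (- t * (norm \<xi>)\<^sup>2)) * (cmod (v \<xi>))\<^sup>2 / frac_const s)"
  have "(\<integral>\<^sup>+p. ennreal ((frac_diff s u p)\<^sup>2) \<partial>lborel) = (\<integral>\<^sup>+t. \<integral>\<^sup>+\<xi>. ?g t \<xi> \<partial>lborel \<partial>lborel)"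
    unfolding nn_integral_frac_diff[OF s assms(3)]
  proof (rule nn_integral_cong)
    fix t :: real
    show "ennreal (indicat_real {0<..} t * t powr (-1 - s) / (2 * frac_const s)) *
         (\<integral>\<^sup>+x. \<integral>\<^sup>+y. ennreal ((u x - u y)\<^sup>2 * heat t (x - y)) \<partial>lborel \<partial>lborel) = (\<integral>\<^sup>+\<xi>. ?g t \<xi> \<partial>lborel)"
    proof (cases "t > 0")
      case True
      have "ennreal (t powr (-1 - s) / (2 * frac_const s)) * 2 = ennreal (t powr (-1 - s) / frac_const s)"
        using C ennreal_mult[of "t powr (-1 - s) / (2 * frac_const s)" 2] by simp
      then have "ennreal (indicat_real {0<..} t * t powr (-1 - s) / (2 * frac_const s)) *
         (\<integral>\<^sup>+x. \<integral>\<^sup>+y. ennreal ((u x - u y)\<^sup>2 * heat t (x - y)) \<partial>lborel \<partial>lborel)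
         = ennreal (t powr (-1 - s) / frac_const s) * (\<integral>\<^sup>+\<xi>. ennreal ((1 - exp (- t * (norm \<xi>)\<^sup>2)) * (cmod (v \<xi>))\<^sup>2) \<partial>lborel)"
        unfolding spec[OF True] using True by (simp add: mult.assoc[symmetric])
      also have "\<dots> = (\<integral>\<^sup>+\<xi>. ennreal (t powr (-1 - s) / frac_const s) * ennreal ((1 - exp (- t * (norm \<xi>)\<^sup>2)) * (cmod (v \<xi>))\<^sup>2) \<partial>lborel)"
        by (rule nn_integral_cmult[symmetric]) measurable
      also have "\<dots> = (\<integral>\<^sup>+\<xi>. ?g t \<xi> \<partial>lborel)"
        using True C by (intro nn_integral_cong) (simp add: ennreal_mult[symmetric] mult_ac)
      finally show ?thesis .
    qed simp
  qed
  also have "\<dots> = (\<integral>\<^sup>+\<xi>. \<integral>\<^sup>+t. ?g t \<xi> \<partial>lborel \<partial>lborel)"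
    by (rule lborel_pair.Fubini') measurable
  also have "\<dots> = (\<integral>\<^sup>+\<xi>. ennreal (norm \<xi> powr (2 * s) * (cmod (v \<xi>))\<^sup>2) \<partial>lborel)"
  proof (rule nn_integral_cong)
    fix \<xi> :: 'a
    have "(\<integral>\<^sup>+t. ?g t \<xi> \<partial>lborel) = (\<integral>\<^sup>+t. ennreal ((cmod (v \<xi>))\<^sup>2 / frac_const s) * ennreal (indicat_real {0<..} t * ((1 - exp (- t * (norm \<xi>)\<^sup>2)) * t powr (-1 - s))) \<partial>lborel)"
      using C by (intro nn_integral_cong) (auto simp: indicator_def ennreal_mult[symmetric] mult_ac)
    also have "\<dots> = ennreal ((cmod (v \<xi>))\<^sup>2 / frac_const s) * ennreal (frac_const s * norm \<xi> powr (2 * s))"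
      by (subst nn_integral_cmult) (auto simp: nn_integral_powr_spectral[OF s, of "norm \<xi>", simplified])
    also have "\<dots> = ennreal (norm \<xi> powr (2 * s) * (cmod (v \<xi>))\<^sup>2)"
      using C by (simp add: ennreal_mult[symmetric])
    finally show "(\<integral>\<^sup>+t. ?g t \<xi> \<partial>lborel) = ennreal (norm \<xi> powr (2 * s) * (cmod (v \<xi>))\<^sup>2)" .
  qed
  finally show ?thesis by simp
qed

text \<open>For times between r^2 and 2 r^2 and |x - y| at most r, the Gaussian exponent stays above
  - pi^2, and the powers of t contribute r^(-2 - 2 s) and r^(- N).\<close>

lemma frac_kernel_lower:
  fixes s :: real
  assumes s: "0 < s" "s < 1"
  obtains c where "c > 0" "\<And>r t x y. r > 0 \<Longrightarrow> r\<^sup>2 \<le> t \<Longrightarrow> t \<le> 2 * r\<^sup>2 \<Longrightarrow> dist x y \<le> r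
    \<Longrightarrow> c * r powr (-2 - 2 * s - DIM('a)) \<le> frac_kernel s (t, x, y :: 'a::euclidean_space)"
proof
  note C = frac_const(1)[OF s]
  let ?N = "DIM('a)"
  let ?c = "2 powr (-1 - s) * sqrt (pi / 2) ^ ?N * exp (- (pi\<^sup>2)) / (2 * frac_const s)"
  show "?c > 0" using C by simp
  fix r t :: real and x y :: 'a
  assume r: "r > 0" and t: "r\<^sup>2 \<le> t" "t \<le> 2 * r\<^sup>2" and d: "dist x y \<le> r"
  have t0: "t > 0" using r t by (meson less_le_trans zero_less_power)
  have 1: "(2 * r\<^sup>2) powr (-1 - s) \<le> t powr (-1 - s)" using t t0 s by (intro powr_mono2') auto
  have 2: "sqrt (pi / (2 * r\<^sup>2)) ^ ?N \<le> sqrt (pi / t) ^ ?N"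
    using t t0 r by (intro power_mono real_sqrt_le_mono divide_left_mono) auto
  have "(norm (x - y))\<^sup>2 \<le> t" using d t power_mono[OF d[unfolded dist_norm], of 2] by simp
  then have "pi\<^sup>2 * (norm (x - y))\<^sup>2 / t \<le> pi\<^sup>2"
    using t0 by (simp add: divide_le_eq mult_left_mono)
  then have 3: "exp (- (pi\<^sup>2)) \<le> exp (- (pi\<^sup>2 * (norm (x - y))\<^sup>2 / t))" by simp
  have "((2 * r\<^sup>2) powr (-1 - s) * (sqrt (pi / (2 * r\<^sup>2)) ^ ?N * exp (- (pi\<^sup>2)))) / (2 * frac_const s)
    \<le> (t powr (-1 - s) * (sqrt (pi / t) ^ ?N * exp (- (pi\<^sup>2 * (norm (x - y))\<^sup>2 / t)))) / (2 * frac_const s)"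
    using C t0 r by (intro divide_right_mono mult_mono 1 2 3) auto
  also have "\<dots> = frac_kernel s (t, x, y)" using t0 by (simp add: frac_kernel_def heat_def)
  also have "((2 * r\<^sup>2) powr (-1 - s) * (sqrt (pi / (2 * r\<^sup>2)) ^ ?N * exp (- (pi\<^sup>2)))) / (2 * frac_const s) = ?c * r powr (-2 - 2 * s - ?N)"
  proof -
    have "(2 * r\<^sup>2) powr (-1 - s) = 2 powr (-1 - s) * r powr (-2 - 2 * s)"
    proof -
      have "r\<^sup>2 powr (-1 - s) = r powr (2 * (-1 - s))" using powr_powr[of r 2 "-1 - s"] r by simp
      then have "(2 * r\<^sup>2) powr (-1 - s) = 2 powr (-1 - s) * r powr (2 * (-1 - s))"
        using r by (simp only: powr_mult)
      then show ?thesis by (simp add: algebra_simps)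
    qed
    moreover have "sqrt (pi / (2 * r\<^sup>2)) ^ ?N = sqrt (pi / 2) ^ ?N * r powr (- real ?N)"
    proof -
      have "sqrt (pi / (2 * r\<^sup>2)) = sqrt (pi / 2) / r" using r by (simp add: real_sqrt_divide real_sqrt_mult)
      moreover have "r powr (- real ?N) = inverse (r ^ ?N)" using r by (simp add: powr_minus powr_realpow)
      ultimately show ?thesis by (simp only: power_mult_distrib power_inverse divide_inverse)
    qed
    moreover have "r powr (-2 - 2 * s - ?N) = r powr (-2 - 2 * s) * r powr (- real ?N)"
      by (simp add: powr_add[symmetric])
    ultimately show ?thesis by simp
  qed
  finally show "?c * r powr (-2 - 2 * s - ?N) \<le> frac_kernel s (t, x, y)" .
qed

text \<open>The time slab in \<open>frac_kernel_lower\<close> has length r^2; integrating over it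
  cancels r^(-2) and leaves r^(- N - 2 s), the size of the Gagliardo kernel at distance r.\<close>

lemma local_diff_le_frac_seminorm:
  fixes s :: real
  assumes s: "0 < s" "s < 1"
  obtains C where "C > 0" "\<And>(u :: 'a::euclidean_space \<Rightarrow> real) r. u \<in> borel_measurable borel \<Longrightarrow> r > 0 \<Longrightarrow>
    (\<integral>\<^sup>+x. \<integral>\<^sup>+y. ennreal ((u x - u y)\<^sup>2) * indicator (cball x r) y \<partial>lborel \<partial>lborel)
    \<le> ennreal (C * r powr (DIM('a) + 2 * s)) * (\<integral>\<^sup>+p. ennreal ((frac_diff s u p)\<^sup>2) \<partial>lborel)"
proof -
  let ?N = "DIM('a)"
  obtain c where c: "c > 0" "\<And>r t x y. r > 0 \<Longrightarrow> r\<^sup>2 \<le> t \<Longrightarrow> t \<le> 2 * r\<^sup>2 \<Longrightarrow> dist x y \<le> r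
    \<Longrightarrow> c * r powr (-2 - 2 * s - ?N) \<le> frac_kernel s (t, x, y :: 'a)"
    using frac_kernel_lower[OF s] by blast
  have "(\<integral>\<^sup>+x. \<integral>\<^sup>+y. ennreal ((u x - u y)\<^sup>2) * indicator (cball x r) y \<partial>lborel \<partial>lborel)
    \<le> ennreal (1 / c * r powr (?N + 2 * s)) * (\<integral>\<^sup>+p. ennreal ((frac_diff s u p)\<^sup>2) \<partial>lborel)"
    if [measurable]: "u \<in> borel_measurable borel" and r: "r > 0" for u :: "'a \<Rightarrow> real" and r
  proof -
    let ?K = "c * r powr (-2 - 2 * s - ?N)"
    let ?L = "\<integral>\<^sup>+q. ennreal ((u (fst q) - u (snd q))\<^sup>2) * indicator {q. dist (fst q) (snd q) \<le> r} q \<partial>(lborel :: ('a\<times>'a) measure)"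
    have m1: "(\<lambda>q::'a\<times>'a. ennreal ((u (fst q) - u (snd q))\<^sup>2) * indicator {q. dist (fst q) (snd q) \<le> r} q) \<in> borel_measurable borel"
      unfolding borel_prod[symmetric] by measurable
    have L: "(\<integral>\<^sup>+x. \<integral>\<^sup>+y. ennreal ((u x - u y)\<^sup>2) * indicator (cball x r) y \<partial>lborel \<partial>lborel) = ?L"
      by (subst nn_integral_lborel_pair(1)[OF m1]) (auto intro!: nn_integral_cong simp: indicator_def)
    have "ennreal (r\<^sup>2 * ?K) * ?L = (\<integral>\<^sup>+t. ennreal ?K * ?L * indicator {r\<^sup>2..2*r\<^sup>2} t \<partial>lborel)"
    proof -
      have "(\<integral>\<^sup>+t. ennreal ?K * ?L * indicator {r\<^sup>2..2*r\<^sup>2} t \<partial>lborel) = ennreal ?K * ?L * emeasure lborel {r\<^sup>2..2*r\<^sup>2}"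
        by (rule nn_integral_cmult_indicator) simp
      also have "emeasure lborel {r\<^sup>2..2*r\<^sup>2} = ennreal (r\<^sup>2)" using r by simp
      also have "ennreal ?K * ?L * ennreal (r\<^sup>2) = ennreal (r\<^sup>2) * ennreal ?K * ?L" by (simp only: mult_ac)
      also have "ennreal (r\<^sup>2) * ennreal ?K = ennreal (r\<^sup>2 * ?K)" using c(1) by (intro ennreal_mult[symmetric]) auto
      finally show ?thesis by simp
    qed
    also have "\<dots> \<le> (\<integral>\<^sup>+t. \<integral>\<^sup>+q. ennreal ((frac_diff s u (t, q))\<^sup>2) \<partial>lborel \<partial>lborel)"
    proof (rule nn_integral_mono)
      fix t :: real
      show "ennreal ?K * ?L * indicator {r\<^sup>2..2*r\<^sup>2} t \<le> (\<integral>\<^sup>+q. ennreal ((frac_diff s u (t, q))\<^sup>2) \<partial>lborel)"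
      proof (cases "t \<in> {r\<^sup>2..2*r\<^sup>2}")
        case True
        have "ennreal ?K * ?L = (\<integral>\<^sup>+q. ennreal ?K * (ennreal ((u (fst q) - u (snd q))\<^sup>2) * indicator {q. dist (fst q) (snd q) \<le> r} q) \<partial>(lborel :: ('a\<times>'a) measure))"
          by (rule nn_integral_cmult[symmetric]) (use m1 in simp)
        also have "\<dots> \<le> (\<integral>\<^sup>+q. ennreal ((frac_diff s u (t, q))\<^sup>2) \<partial>lborel)"
        proof (rule nn_integral_mono)
          fix q :: "'a \<times> 'a"
          show "ennreal ?K * (ennreal ((u (fst q) - u (snd q))\<^sup>2) * indicator {q. dist (fst q) (snd q) \<le> r} q) \<le> ennreal ((frac_diff s u (t, q))\<^sup>2)"
          proof (cases "dist (fst q) (snd q) \<le> r")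
            case d: True
            have "?K * (u (fst q) - u (snd q))\<^sup>2 \<le> frac_kernel s (t, q) * (u (fst q) - u (snd q))\<^sup>2"
              using c(2)[OF r, of t "fst q" "snd q"] True d by (intro mult_right_mono) auto
            then show ?thesis using d c(1)
              by (simp add: frac_diff_sq[OF s] ennreal_mult[symmetric] ennreal_leI)
          qed simp
        qed
        finally show ?thesis using True by simp
      qed simp
    qed
    also have "\<dots> = (\<integral>\<^sup>+p. ennreal ((frac_diff s u p)\<^sup>2) \<partial>lborel)"
      by (rule nn_integral_lborel_pair(1)[symmetric]) measurable
    finally have main: "ennreal (r\<^sup>2 * ?K) * ?L \<le> (\<integral>\<^sup>+p. ennreal ((frac_diff s u p)\<^sup>2) \<partial>lborel)" .
    have "1 / c * r powr (?N + 2 * s) * (r\<^sup>2 * ?K) = 1"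
    proof -
      have "r\<^sup>2 = r powr 2" using r by simp
      then have "r powr (?N + 2 * s) * (r\<^sup>2 * r powr (-2 - 2 * s - ?N)) = r powr ((?N + 2 * s) + (2 + (-2 - 2 * s - ?N)))"
        by (simp only: powr_add)
      also have "\<dots> = 1" using r by simp
      finally show ?thesis using c(1) by (simp add: field_simps)
    qed
    then have "?L = ennreal (1 / c * r powr (?N + 2 * s)) * (ennreal (r\<^sup>2 * ?K) * ?L)"
      using c(1) by (simp add: mult.assoc[symmetric] ennreal_mult[symmetric])
    also have "\<dots> \<le> ennreal (1 / c * r powr (?N + 2 * s)) * (\<integral>\<^sup>+p. ennreal ((frac_diff s u p)\<^sup>2) \<partial>lborel)"
      by (intro mult_left_mono main) simp
    finally show ?thesis unfolding L .
  qed
  moreover have "1 / c > 0" using c(1) by simp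
  ultimately show ?thesis using that by blast
qed

section \<open>Averages over balls\<close>

definition frac_space :: "real \<Rightarrow> ('a::euclidean_space \<Rightarrow> real) set" where
  "frac_space s = {u. u \<in> borel_measurable borel \<and> integrable lborel (\<lambda>x. (u x)\<^sup>2) \<and> integrable lborel (\<lambda>p. (frac_diff s u p)\<^sup>2)}"

definition sob_sq :: "real \<Rightarrow> ('a::euclidean_space \<Rightarrow> real) \<Rightarrow> real" where
  "sob_sq s u = (\<integral>x. (u x)\<^sup>2 \<partial>lborel) + (\<integral>p. (frac_diff s u p)\<^sup>2 \<partial>lborel)"

lemma frac_spaceD:
  assumes "u \<in> frac_space s"
  shows "u \<in> borel_measurable borel" "integrable lborel (\<lambda>x. (u x)\<^sup>2)" "integrable lborel (\<lambda>p. (frac_diff s u p)\<^sup>2)"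
  using assms by (auto simp: frac_space_def)

lemma sob_sq_nonneg: "0 \<le> sob_sq s u"
  by (simp add: sob_sq_def)

definition avg :: "('a::euclidean_space \<Rightarrow> real) \<Rightarrow> 'a \<Rightarrow> real \<Rightarrow> real" where
  "avg u c r = (\<integral>y. u y * indicat_real (ball c r) y \<partial>lborel) / measure lborel (ball c r)"

lemma measure_ball_pos:
  fixes c :: "'a::euclidean_space"
  assumes "r > 0"
  shows "0 < measure lborel (ball c r)" "measure lborel (ball c r) = unit_ball_vol (real DIM('a)) * r ^ DIM('a)"
  using assms by (simp_all add: content_ball)

text \<open>Jensen's inequality, from the nonnegativity of the variance of \<open>g\<close> over
  \<open>B\<close>.\<close>

lemma integral_sq_avg_le:
  fixes g :: "'a::euclidean_space \<Rightarrow> real"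
  assumes B: "B \<in> sets borel" "emeasure lborel B < \<infinity>" "0 < measure lborel B"
    and g: "integrable lborel (\<lambda>y. g y * indicat_real B y)" and g2: "integrable lborel (\<lambda>y. (g y)\<^sup>2 * indicat_real B y)"
  shows "((\<integral>y. g y * indicat_real B y \<partial>lborel) / measure lborel B)\<^sup>2 \<le> (\<integral>y. (g y)\<^sup>2 * indicat_real B y \<partial>lborel) / measure lborel B"
proof -
  let ?m = "measure lborel B"
  define \<mu> where "\<mu> = (\<integral>y. g y * indicat_real B y \<partial>lborel) / ?m"
  have iB: "integrable lborel (indicat_real B)" using B by (simp add: integrable_indicator_iff)
  have e: "(g y - \<mu>)\<^sup>2 * indicat_real B y = (g y)\<^sup>2 * indicat_real B y + \<mu>\<^sup>2 * indicat_real B y - 2 * \<mu> * (g y * indicat_real B y)" for y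
    by (simp add: power2_eq_square algebra_simps)
  have "0 \<le> (\<integral>y. (g y - \<mu>)\<^sup>2 * indicat_real B y \<partial>lborel)" by simp
  also have "\<dots> = (\<integral>y. (g y)\<^sup>2 * indicat_real B y \<partial>lborel) + \<mu>\<^sup>2 * ?m - 2 * \<mu> * (\<integral>y. g y * indicat_real B y \<partial>lborel)"
    unfolding e using g g2 iB B(1) by simp
  also have "(\<integral>y. g y * indicat_real B y \<partial>lborel) = \<mu> * ?m" using B(3) by (simp add: \<mu>_def)
  finally have "\<mu>\<^sup>2 * ?m \<le> (\<integral>y. (g y)\<^sup>2 * indicat_real B y \<partial>lborel)" by (simp add: power2_eq_square algebra_simps)
  then show ?thesis unfolding \<mu>_def[symmetric] using B(3) by (simp add: pos_le_divide_eq)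
qed

lemma L2_integrable_on_ball:
  fixes u :: "'a::euclidean_space \<Rightarrow> real"
  assumes [measurable]: "u \<in> borel_measurable borel" and u: "integrable lborel (\<lambda>x. (u x)\<^sup>2)"
  shows "integrable lborel (\<lambda>y. u y * indicat_real (ball c r) y)" "integrable lborel (\<lambda>y. (u y)\<^sup>2 * indicat_real (ball c r) y)"
    "integrable lborel (indicat_real (ball c r))"
proof -
  have [measurable]: "ball c r \<in> sets borel" by simp
  show iB: "integrable lborel (indicat_real (ball c r))" using emeasure_lborel_ball_finite[of c r] by (simp add: integrable_indicator_iff)
  show "integrable lborel (\<lambda>y. (u y)\<^sup>2 * indicat_real (ball c r) y)"
    by (rule Bochner_Integration.integrable_bound[OF u]) (auto simp: indicator_def)
  have "integrable lborel (\<lambda>y. indicat_real (ball c r) y + (u y)\<^sup>2)" using iB u by simp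
  then show "integrable lborel (\<lambda>y. u y * indicat_real (ball c r) y)"
  proof (rule Bochner_Integration.integrable_bound)
    have "\<bar>t\<bar> \<le> 1 + t\<^sup>2" for t :: real
      using sum_squares_bound[of "\<bar>t\<bar>" 1] zero_le_power2[of t] by simp
    then show "AE y in lborel. norm (u y * indicat_real (ball c r) y) \<le> norm (indicat_real (ball c r) y + (u y)\<^sup>2)"
      by (auto simp: indicator_def)
  qed measurable
qed

text \<open>Jensen over the ball around \<open>c\<close>, which lies in the ball of radius
  \<open>2 * r\<close> around \<open>x\<close>. The centre may differ from \<open>x\<close> because
  the compactness argument takes its centres from a countable set.\<close>

lemma sq_minus_avg_le:
  fixes u :: "'a::euclidean_space \<Rightarrow> real"
  assumes m[measurable]: "u \<in> borel_measurable borel" and u: "integrable lborel (\<lambda>x. (u x)\<^sup>2)"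
    and r: "r > 0" and d: "dist x c \<le> r"
  shows "ennreal ((u x - avg u c r)\<^sup>2) \<le> ennreal (1 / measure lborel (ball c r)) * (\<integral>\<^sup>+y. ennreal ((u x - u y)\<^sup>2) * indicator (cball x (2 * r)) y \<partial>lborel)"
proof -
  let ?B = "ball c r" and ?m = "measure lborel (ball c r)"
  have [measurable]: "?B \<in> sets borel" by simp
  have mp: "?m > 0" using r by (rule measure_ball_pos)
  note i = L2_integrable_on_ball[OF m u, of c r]
  have g: "integrable lborel (\<lambda>y. (u x - u y) * indicat_real ?B y)"
    using i by (simp add: left_diff_distrib)
  have g2: "integrable lborel (\<lambda>y. (u x - u y)\<^sup>2 * indicat_real ?B y)"
  proof -
    have "(u x - u y)\<^sup>2 * indicat_real ?B y = (u x)\<^sup>2 * indicat_real ?B y + (u y)\<^sup>2 * indicat_real ?B y - 2 * u x * (u y * indicat_real ?B y)" for y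
      by (simp add: power2_eq_square algebra_simps)
    then show ?thesis using i by simp
  qed
  have "u x - avg u c r = (\<integral>y. (u x - u y) * indicat_real ?B y \<partial>lborel) / ?m"
    unfolding avg_def left_diff_distrib using i mp by (simp add: diff_divide_distrib)
  then have "(u x - avg u c r)\<^sup>2 \<le> (\<integral>y. (u x - u y)\<^sup>2 * indicat_real ?B y \<partial>lborel) / ?m"
    using integral_sq_avg_le[OF _ emeasure_lborel_ball_finite mp g g2] by simp
  then have "ennreal ((u x - avg u c r)\<^sup>2) \<le> ennreal (1 / ?m) * ennreal (\<integral>y. (u x - u y)\<^sup>2 * indicat_real ?B y \<partial>lborel)"
    using mp by (simp add: ennreal_mult'[symmetric] ennreal_leI)
  also have "ennreal (\<integral>y. (u x - u y)\<^sup>2 * indicat_real ?B y \<partial>lborel) = (\<integral>\<^sup>+y. ennreal ((u x - u y)\<^sup>2 * indicat_real ?B y) \<partial>lborel)"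
    using g2 by (intro nn_integral_eq_integral[symmetric]) auto
  also have "ennreal (1 / ?m) * \<dots> \<le> ennreal (1 / ?m) * (\<integral>\<^sup>+y. ennreal ((u x - u y)\<^sup>2) * indicator (cball x (2 * r)) y \<partial>lborel)"
  proof (intro mult_left_mono nn_integral_mono)
    fix y
    have "y \<in> cball x (2 * r)" if "y \<in> ?B"
      using that d dist_triangle[of x y c] by (simp add: dist_commute)
    then show "ennreal ((u x - u y)\<^sup>2 * indicat_real ?B y) \<le> ennreal ((u x - u y)\<^sup>2) * indicator (cball x (2 * r)) y"
      by (auto simp: indicator_def)
  qed simp
  finally show ?thesis .
qed

lemma avg_measurable [measurable]:
  fixes u :: "'a::euclidean_space \<Rightarrow> real"
  assumes [measurable]: "u \<in> borel_measurable borel"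
  shows "(\<lambda>x. avg u x r) \<in> borel_measurable borel"
proof (cases "r > 0")
  case True
  have eq: "(\<lambda>x. avg u x r) = (\<lambda>x. (\<integral>y. u y * (if dist x y < r then 1 else 0) \<partial>lborel) / (unit_ball_vol (real DIM('a)) * r ^ DIM('a)))"
    unfolding avg_def measure_ball_pos(2)[OF True] by (simp add: indicator_def of_bool_def)
  show ?thesis unfolding eq by measurable
next
  case False
  then have "avg u x r = 0" for x by (simp add: avg_def ball_empty)
  then show ?thesis by simp
qed

text \<open>The first bound is of Poincare type: dividing the local difference bound r^(N + 2 s) by
  the volume of a ball leaves r^(2 s). The second divides once more by a volume. The centre map
  \<open>c\<close> of the first is arbitrary, a freedom used both in the proof of the second and for
  countably many centres.\<close>

lemma frac_avg_estimates:
  fixes s :: real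
  assumes s: "0 < s" "s < 1"
  obtains C where "C > 0"
    "\<And>(u :: 'a::euclidean_space \<Rightarrow> real) K r c. u \<in> frac_space s \<Longrightarrow> sob_sq s u \<le> K \<Longrightarrow> r > 0 \<Longrightarrow> (\<And>x. dist x (c x) \<le> r) \<Longrightarrow>
      (\<integral>\<^sup>+x. ennreal ((u x - avg u (c x) r)\<^sup>2) \<partial>lborel) \<le> ennreal (C * r powr (2 * s) * K)"
    "\<And>(u :: 'a::euclidean_space \<Rightarrow> real) K r x. u \<in> frac_space s \<Longrightarrow> sob_sq s u \<le> K \<Longrightarrow> r > 0 \<Longrightarrow>
      (avg u x (r / 2) - avg u x r)\<^sup>2 \<le> C * r powr (2 * s - DIM('a)) * K"
proof -
  let ?N = "DIM('a)" and ?\<omega> = "unit_ball_vol (real DIM('a))"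
  obtain C0 where C0: "C0 > 0" "\<And>(u :: 'a::euclidean_space \<Rightarrow> real) r. u \<in> borel_measurable borel \<Longrightarrow> r > 0 \<Longrightarrow>
    (\<integral>\<^sup>+x. \<integral>\<^sup>+y. ennreal ((u x - u y)\<^sup>2) * indicator (cball x r) y \<partial>lborel \<partial>lborel)
    \<le> ennreal (C0 * r powr (?N + 2 * s)) * (\<integral>\<^sup>+p. ennreal ((frac_diff s u p)\<^sup>2) \<partial>lborel)"
    using local_diff_le_frac_seminorm[OF s] by blast
  have \<omega>: "?\<omega> > 0" by simp
  have main: "(\<integral>\<^sup>+x. \<integral>\<^sup>+y. ennreal ((u x - u y)\<^sup>2) * indicator (cball x (2 * r)) y \<partial>lborel \<partial>lborel) \<le> ennreal (C0 * 2 powr (?N + 2 * s) * r powr (?N + 2 * s) * K)"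
    if u: "u \<in> frac_space s" and K: "sob_sq s u \<le> K" and r: "r > 0" for u :: "'a \<Rightarrow> real" and K r
  proof -
    note uD = frac_spaceD[OF u]
    have "(\<integral>\<^sup>+p. ennreal ((frac_diff s u p)\<^sup>2) \<partial>lborel) = ennreal (\<integral>p. (frac_diff s u p)\<^sup>2 \<partial>lborel)"
      using uD(3) by (intro nn_integral_eq_integral) auto
    also have "\<dots> \<le> ennreal K"
    proof (rule ennreal_leI)
      have "0 \<le> (\<integral>x. (u x)\<^sup>2 \<partial>lborel)" by simp
      then show "(\<integral>p. (frac_diff s u p)\<^sup>2 \<partial>lborel) \<le> K" using K unfolding sob_sq_def by linarith
    qed
    finally have "(\<integral>\<^sup>+x. \<integral>\<^sup>+y. ennreal ((u x - u y)\<^sup>2) * indicator (cball x (2 * r)) y \<partial>lborel \<partial>lborel) \<le> ennreal (C0 * (2 * r) powr (?N + 2 * s)) * ennreal K"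
      using C0(2)[OF uD(1), of "2 * r"] r by (meson mult_left_mono mult_pos_pos order_trans zero_le zero_less_numeral)
    also have "\<dots> = ennreal (C0 * 2 powr (?N + 2 * s) * r powr (?N + 2 * s) * K)"
      using C0(1) r by (subst ennreal_mult'[symmetric]) (simp_all add: powr_mult mult_ac)
    finally show ?thesis .
  qed
  let ?D = "C0 * 2 powr (?N + 2 * s) / ?\<omega>"
  have rN: "r powr (?N + 2 * s) / r ^ ?N = r powr (2 * s)" if "r > 0" for r :: real
    using that by (simp add: powr_add powr_realpow)
  have est1: "(\<integral>\<^sup>+x. ennreal ((u x - avg u (c x) r)\<^sup>2) \<partial>lborel) \<le> ennreal (?D * r powr (2 * s) * K)"
    if u: "u \<in> frac_space s" and K: "sob_sq s u \<le> K" and r: "r > 0" and c: "\<And>x. dist x (c x) \<le> r" for u :: "'a \<Rightarrow> real" and K r c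
  proof -
    note uD = frac_spaceD[OF u]
    have [measurable]: "u \<in> borel_measurable borel" by (rule uD)
    let ?m = "?\<omega> * r ^ ?N"
    have mm: "(\<lambda>x. \<integral>\<^sup>+y. ennreal ((u x - u y)\<^sup>2) * indicator (cball x (2 * r)) y \<partial>lborel) \<in> borel_measurable lborel"
    proof -
      have "(\<lambda>x. \<integral>\<^sup>+y. ennreal ((u x - u y)\<^sup>2) * (if dist x y \<le> 2 * r then 1 else 0) \<partial>lborel) \<in> borel_measurable lborel" by measurable
      then show ?thesis by (simp add: indicator_def)
    qed
    have "(\<integral>\<^sup>+x. ennreal ((u x - avg u (c x) r)\<^sup>2) \<partial>lborel) \<le> (\<integral>\<^sup>+x. ennreal (1 / ?m) * (\<integral>\<^sup>+y. ennreal ((u x - u y)\<^sup>2) * indicator (cball x (2 * r)) y \<partial>lborel) \<partial>lborel)"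
      using sq_minus_avg_le[OF uD(1,2) r c] unfolding measure_ball_pos(2)[OF r] by (intro nn_integral_mono) auto
    also have "\<dots> = ennreal (1 / ?m) * (\<integral>\<^sup>+x. \<integral>\<^sup>+y. ennreal ((u x - u y)\<^sup>2) * indicator (cball x (2 * r)) y \<partial>lborel \<partial>lborel)"
      by (rule nn_integral_cmult[OF mm])
    also have "\<dots> \<le> ennreal (1 / ?m) * ennreal (C0 * 2 powr (?N + 2 * s) * r powr (?N + 2 * s) * K)"
      by (intro mult_left_mono main u K r) simp
    also have "\<dots> = ennreal (C0 * 2 powr (?N + 2 * s) / ?\<omega> * (r powr (?N + 2 * s) / r ^ ?N) * K)"
      using r \<omega> by (simp add: ennreal_mult'[symmetric])
    finally show ?thesis unfolding rN[OF r] .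
  qed
  let ?D2 = "?D / (?\<omega> * (1 / 2) ^ ?N)"
  have est2: "(avg u x (r / 2) - avg u x r)\<^sup>2 \<le> ?D2 * r powr (2 * s - ?N) * K"
    if u: "u \<in> frac_space s" and K: "sob_sq s u \<le> K" and r: "r > 0" for u :: "'a \<Rightarrow> real" and K r x
  proof -
    note uD = frac_spaceD[OF u]
    have [measurable]: "u \<in> borel_measurable borel" by (rule uD)
    let ?B = "ball x (r / 2)" and ?a = "avg u x r"
    let ?m = "measure lborel ?B"
    have r2: "r / 2 > 0" using r by simp
    have [measurable]: "?B \<in> sets borel" by simp
    have mp: "?m > 0" by (rule measure_ball_pos[OF r2])
    note i = L2_integrable_on_ball[OF uD(1,2), of x "r / 2"]
    have g: "integrable lborel (\<lambda>y. (u y - ?a) * indicat_real ?B y)" using i by (simp add: left_diff_distrib)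
    have g2: "integrable lborel (\<lambda>y. (u y - ?a)\<^sup>2 * indicat_real ?B y)"
    proof -
      have "(u y - ?a)\<^sup>2 * indicat_real ?B y = (u y)\<^sup>2 * indicat_real ?B y + ?a\<^sup>2 * indicat_real ?B y - 2 * ?a * (u y * indicat_real ?B y)" for y
        by (simp add: power2_eq_square algebra_simps)
      then show ?thesis using i by simp
    qed
    have "avg u x (r / 2) - ?a = (\<integral>y. (u y - ?a) * indicat_real ?B y \<partial>lborel) / ?m"
    proof -
      have "(\<integral>y. (u y - ?a) * indicat_real ?B y \<partial>lborel) = (\<integral>y. u y * indicat_real ?B y \<partial>lborel) - ?a * ?m"
        unfolding left_diff_distrib using i by simp
      then show ?thesis unfolding avg_def[of u x "r / 2"] using mp by (simp add: diff_divide_distrib)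
    qed
    then have "(avg u x (r / 2) - ?a)\<^sup>2 \<le> (\<integral>y. (u y - ?a)\<^sup>2 * indicat_real ?B y \<partial>lborel) / ?m"
      using integral_sq_avg_le[OF _ emeasure_lborel_ball_finite mp g g2] by simp
    moreover have "(\<integral>y. (u y - ?a)\<^sup>2 * indicat_real ?B y \<partial>lborel) \<le> ?D * r powr (2 * s) * K"
    proof -
      \<comment> \<open>Centre \<open>x\<close> on the small ball and the identity elsewhere: the
        global bound for this centre map dominates the local integral.\<close>
      let ?c = "\<lambda>y. if y \<in> ?B then x else y"
      have "ennreal (\<integral>y. (u y - ?a)\<^sup>2 * indicat_real ?B y \<partial>lborel) = (\<integral>\<^sup>+y. ennreal ((u y - ?a)\<^sup>2 * indicat_real ?B y) \<partial>lborel)"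
        using g2 by (intro nn_integral_eq_integral[symmetric]) auto
      also have "\<dots> \<le> (\<integral>\<^sup>+y. ennreal ((u y - avg u (?c y) r)\<^sup>2) \<partial>lborel)"
        by (intro nn_integral_mono) (auto simp: indicator_def)
      also have "\<dots> \<le> ennreal (?D * r powr (2 * s) * K)"
        using r by (intro est1 u K) (auto simp: dist_commute)
      finally show ?thesis
        using C0(1) \<omega> order_trans[OF sob_sq_nonneg K] by (simp add: ennreal_le_iff)
    qed
    ultimately have "(avg u x (r / 2) - ?a)\<^sup>2 \<le> (?D * r powr (2 * s) * K) / ?m"
      using mp by (meson divide_right_mono less_imp_le order_trans)
    also have "\<dots> = ?D2 * (r powr (2 * s) / r ^ ?N) * K"
      unfolding measure_ball_pos(2)[OF r2] by (simp add: power_divide power_one_over field_simps)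
    also have "r powr (2 * s) / r ^ ?N = r powr (2 * s - ?N)"
      using r by (simp add: powr_diff powr_realpow)
    finally show ?thesis .
  qed
  define C where "C = max ?D ?D2"
  have C: "C > 0" "?D \<le> C" "?D2 \<le> C" unfolding C_def using C0(1) \<omega> by (auto simp: less_max_iff_disj)
  show ?thesis
  proof (rule that[of C])
    show "C > 0" by (rule C)
    fix u :: "'a \<Rightarrow> real" and K r :: real and c :: "'a \<Rightarrow> 'a" and x :: 'a
    assume u: "u \<in> frac_space s" and K: "sob_sq s u \<le> K" and r: "r > 0"
    have K0: "0 \<le> K" using order_trans[OF sob_sq_nonneg K] .
    {
      assume c: "\<And>x. dist x (c x) \<le> r"
      have "(\<integral>\<^sup>+x. ennreal ((u x - avg u (c x) r)\<^sup>2) \<partial>lborel) \<le> ennreal (?D * r powr (2 * s) * K)" by (rule est1[OF u K r c])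
      also have "\<dots> \<le> ennreal (C * r powr (2 * s) * K)" using K0 C by (intro ennreal_leI mult_right_mono) auto
      finally show "(\<integral>\<^sup>+x. ennreal ((u x - avg u (c x) r)\<^sup>2) \<partial>lborel) \<le> ennreal (C * r powr (2 * s) * K)" .
    }
    have "(avg u x (r / 2) - avg u x r)\<^sup>2 \<le> ?D2 * r powr (2 * s - ?N) * K" by (rule est2[OF u K r])
    also have "\<dots> \<le> C * r powr (2 * s - ?N) * K" using K0 C by (intro mult_right_mono) auto
    finally show "(avg u x (r / 2) - avg u x r)\<^sup>2 \<le> C * r powr (2 * s - ?N) * K" .
  qed
qed

lemma avg_sq_le:
  fixes u :: "'a::euclidean_space \<Rightarrow> real"
  assumes m[measurable]: "u \<in> borel_measurable borel" and u: "integrable lborel (\<lambda>x. (u x)\<^sup>2)" and r: "r > 0"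
  shows "(avg u x r)\<^sup>2 \<le> (\<integral>y. (u y)\<^sup>2 * indicat_real (ball x r) y \<partial>lborel) / (unit_ball_vol (real DIM('a)) * r ^ DIM('a))"
  using integral_sq_avg_le[OF _ emeasure_lborel_ball_finite measure_ball_pos(1)[OF r] L2_integrable_on_ball(1,2)[OF m u], of x]
  unfolding avg_def measure_ball_pos(2)[OF r] by simp

text \<open>Plays the role of Minkowski's inequality. With \<open>M\<close> the q-th root of the
  bracket, \<open>a 0\<close> is bounded by \<open>M\<close> and the j-th jump by
  \<open>M * \<rho> ^ j\<close>, so a geometric series bounds the limit; the bracket is a sum of
  q-th powers and can be integrated term by term.\<close>

lemma telescoping_powr_bound:
  fixes a :: "nat \<Rightarrow> real"
  assumes lim: "a \<longlonglongrightarrow> l" and q: "q > 0" and \<rho>: "0 < \<rho>" "\<rho> < 1"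
  shows "ennreal (\<bar>l\<bar> powr q) \<le> ennreal ((1 + 1 / (1 - \<rho>)) powr q) * (ennreal (\<bar>a 0\<bar> powr q) + (\<Sum>j. ennreal ((\<bar>a (Suc j) - a j\<bar> / \<rho> ^ j) powr q)))"
proof (cases "(\<Sum>j. ennreal ((\<bar>a (Suc j) - a j\<bar> / \<rho> ^ j) powr q)) = \<infinity>")
  case True
  have "1 + 1 / (1 - \<rho>) > 0" using \<rho> by (intro add_pos_pos) auto
  then have "(1 + 1 / (1 - \<rho>)) powr q > 0" by simp
  then show ?thesis unfolding True by (simp add: ennreal_mult_top)
next
  case False
  let ?d = "\<lambda>j. \<bar>a (Suc j) - a j\<bar>"
  obtain S where S: "(\<Sum>j. ennreal ((?d j / \<rho> ^ j) powr q)) = ennreal S" "S \<ge> 0"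
    using False ennreal_cases[of "\<Sum>j. ennreal ((?d j / \<rho> ^ j) powr q)"] unfolding infinity_ennreal_def by blast
  define M where "M = (\<bar>a 0\<bar> powr q + S) powr (1 / q)"
  have Mq: "M powr q = \<bar>a 0\<bar> powr q + S" unfolding M_def using q S(2) by (simp add: powr_powr add_nonneg_nonneg)
  have M0: "M \<ge> 0" by (simp add: M_def)
  have root: "x \<le> M" if "x powr q \<le> \<bar>a 0\<bar> powr q + S" "x \<ge> 0" for x
  proof (rule ccontr)
    assume "\<not> x \<le> M"
    then have "M powr q < x powr q" using M0 q by (intro powr_less_mono2) auto
    then show False using that Mq by simp
  qed
  have a0: "\<bar>a 0\<bar> \<le> M" using S(2) by (intro root) auto
  have dj: "?d j \<le> M * \<rho> ^ j" for j
  proof -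
    have "ennreal ((?d j / \<rho> ^ j) powr q) \<le> ennreal S" unfolding S(1)[symmetric] by (rule ennreal_le_suminf)
    then have "(?d j / \<rho> ^ j) powr q \<le> S" using S(2) by (simp add: ennreal_le_iff)
    then have "?d j / \<rho> ^ j \<le> M" using \<rho> by (intro root) (auto intro: add_increasing)
    then show ?thesis using \<rho> by (simp add: pos_divide_le_eq)
  qed
  have part: "\<bar>a n\<bar> \<le> M + M / (1 - \<rho>)" for n
  proof -
    have "a n = a 0 + (\<Sum>j<n. a (Suc j) - a j)" by (simp add: sum_lessThan_telescope)
    then have "\<bar>a n\<bar> \<le> \<bar>a 0\<bar> + \<bar>\<Sum>j<n. a (Suc j) - a j\<bar>" by linarith
    also have "\<bar>\<Sum>j<n. a (Suc j) - a j\<bar> \<le> (\<Sum>j<n. M * \<rho> ^ j)" by (rule order_trans[OF sum_abs sum_mono]) (use dj in auto)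
    also have "\<dots> \<le> (\<Sum>j. M * \<rho> ^ j)" using \<rho> M0 by (intro sum_le_suminf summable_mult summable_geometric) auto
    also have "\<dots> = M / (1 - \<rho>)" using \<rho> by (subst suminf_mult) (auto simp: suminf_geometric summable_geometric)
    finally show ?thesis using a0 by simp
  qed
  have "\<bar>l\<bar> \<le> M + M / (1 - \<rho>)"
    by (rule LIMSEQ_le_const2[OF tendsto_rabs[OF lim]]) (use part in auto)
  also have "\<dots> = (1 + 1 / (1 - \<rho>)) * M" by (simp add: algebra_simps)
  finally have "\<bar>l\<bar> powr q \<le> ((1 + 1 / (1 - \<rho>)) * M) powr q" using q by (intro powr_mono2) auto
  also have "\<dots> = (1 + 1 / (1 - \<rho>)) powr q * (\<bar>a 0\<bar> powr q + S)"
    using M0 \<rho> by (subst powr_mult) (auto simp: Mq)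
  finally have "ennreal (\<bar>l\<bar> powr q) \<le> ennreal ((1 + 1 / (1 - \<rho>)) powr q * (\<bar>a 0\<bar> powr q + S))" by (rule ennreal_leI)
  also have "\<dots> = ennreal ((1 + 1 / (1 - \<rho>)) powr q) * (ennreal (\<bar>a 0\<bar> powr q) + ennreal S)"
    using S(2) by (simp add: ennreal_mult)
  finally show ?thesis unfolding S(1) .
qed

section \<open>Sobolev inequality and vanishing\<close>

text \<open>Interpolation between \<open>L^2\<close> and the supremum norm: |d|^q is d^2 times the
  power (q - 2) / 2 of d^2.\<close>

lemma nn_integral_powr_le_sup:
  fixes d :: "'a \<Rightarrow> real"
  assumes q: "q > 2" and A: "\<And>x. (d x)\<^sup>2 \<le> A" and B: "(\<integral>\<^sup>+x. ennreal ((d x)\<^sup>2) \<partial>M) \<le> ennreal B"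
    and [measurable]: "d \<in> borel_measurable M"
  shows "(\<integral>\<^sup>+x. ennreal (\<bar>d x\<bar> powr q) \<partial>M) \<le> ennreal (A powr ((q - 2) / 2) * B)"
proof -
  have le: "\<bar>d x\<bar> powr q \<le> A powr ((q - 2) / 2) * (d x)\<^sup>2" for x
  proof (cases "d x = 0")
    case False
    have "\<bar>d x\<bar> powr q = \<bar>d x\<bar> powr (q - 2) * \<bar>d x\<bar> powr 2"
      by (simp only: powr_add[symmetric]) simp
    also have "\<bar>d x\<bar> powr 2 = (d x)\<^sup>2" using False by simp
    also have "\<bar>d x\<bar> powr (q - 2) = (\<bar>d x\<bar> powr 2) powr ((q - 2) / 2)" by (subst powr_powr) (simp add: diff_divide_distrib)
    also have "\<bar>d x\<bar> powr 2 = (d x)\<^sup>2" using False by simp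
    also have "((d x)\<^sup>2) powr ((q - 2) / 2) * (d x)\<^sup>2 \<le> A powr ((q - 2) / 2) * (d x)\<^sup>2"
      using q A by (intro mult_right_mono powr_mono2) auto
    finally show ?thesis .
  qed simp
  have "(\<integral>\<^sup>+x. ennreal (\<bar>d x\<bar> powr q) \<partial>M) \<le> (\<integral>\<^sup>+x. ennreal (A powr ((q - 2) / 2)) * ennreal ((d x)\<^sup>2) \<partial>M)"
    by (intro nn_integral_mono) (use le in \<open>auto simp: ennreal_mult[symmetric] intro!: ennreal_leI\<close>)
  also have "\<dots> = ennreal (A powr ((q - 2) / 2)) * (\<integral>\<^sup>+x. ennreal ((d x)\<^sup>2) \<partial>M)" by (rule nn_integral_cmult) measurable
  also have "\<dots> \<le> ennreal (A powr ((q - 2) / 2)) * ennreal B" by (intro mult_left_mono B) simp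
  finally show ?thesis by (simp add: ennreal_mult'[symmetric])
qed

lemma nn_integral_diff_sq_le:
  fixes f g h :: "'a \<Rightarrow> real"
  assumes [measurable]: "f \<in> borel_measurable M" "g \<in> borel_measurable M" "h \<in> borel_measurable M"
    and "(\<integral>\<^sup>+x. ennreal ((f x - g x)\<^sup>2) \<partial>M) \<le> ennreal A" "(\<integral>\<^sup>+x. ennreal ((f x - h x)\<^sup>2) \<partial>M) \<le> ennreal B" "0 \<le> A" "0 \<le> B"
  shows "(\<integral>\<^sup>+x. ennreal ((g x - h x)\<^sup>2) \<partial>M) \<le> ennreal (2 * A + 2 * B)"
proof -
  have "(\<integral>\<^sup>+x. ennreal ((g x - h x)\<^sup>2) \<partial>M) \<le> 2 * (\<integral>\<^sup>+x. ennreal ((g x - f x)\<^sup>2) \<partial>M) + 2 * (\<integral>\<^sup>+x. ennreal ((f x - h x)\<^sup>2) \<partial>M)"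
    using nn_integral_norm_diff_sq_le[of g M f h] by simp
  also have "\<dots> \<le> 2 * ennreal A + 2 * ennreal B"
    using assms by (intro add_mono mult_left_mono) (auto simp: power2_commute)
  also have "\<dots> = ennreal (2 * A + 2 * B)" using assms by (simp add: ennreal_mult)
  finally show ?thesis .
qed

text \<open>A Gagliardo-Nirenberg type inequality: with \<open>\<eta> = K\<close> it is the subcritical Sobolev embedding,
  with \<open>\<eta>\<close> small it is Lions' vanishing lemma. The difference of the averages over the balls of
  radii \<open>2\<^sup>-\<^sup>j\<close> and \<open>2\<^sup>-\<^sup>j\<^sup>-\<^sup>1\<close> is controlled both uniformly and in \<open>L\<^sup>2\<close>.\<close>

proposition frac_vanishing:
  fixes s q :: real
  assumes s: "0 < s" "s < 1" and N: "2 * s < DIM('a::euclidean_space)" and q: "2 < q" "q * (DIM('a) - 2 * s) < 2 * DIM('a)"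
  obtains C \<alpha> \<beta> where "C > 0" "\<alpha> > 0" "\<beta> > 0" "\<alpha> + \<beta> = q / 2"
    "\<And>(u :: 'a \<Rightarrow> real) K \<eta>. u \<in> frac_space s \<Longrightarrow> sob_sq s u \<le> K \<Longrightarrow> 0 < \<eta> \<Longrightarrow> \<eta> \<le> K \<Longrightarrow>
      (\<And>x. (\<integral>y. (u y)\<^sup>2 * indicat_real (ball x 1) y \<partial>lborel) \<le> \<eta>) \<Longrightarrow>
      (\<integral>\<^sup>+x. ennreal (\<bar>u x\<bar> powr q) \<partial>lborel) \<le> ennreal (C * K powr \<alpha> * \<eta> powr \<beta>)"
proof -
  let ?N = "DIM('a)" and ?\<omega> = "unit_ball_vol (real DIM('a))"
  obtain C where C: "C > 0"
    and est1: "\<And>(u :: 'a \<Rightarrow> real) K r c. u \<in> frac_space s \<Longrightarrow> sob_sq s u \<le> K \<Longrightarrow> r > 0 \<Longrightarrow> (\<And>x. dist x (c x) \<le> r) \<Longrightarrow>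
      (\<integral>\<^sup>+x. ennreal ((u x - avg u (c x) r)\<^sup>2) \<partial>lborel) \<le> ennreal (C * r powr (2 * s) * K)"
    and est2: "\<And>(u :: 'a \<Rightarrow> real) K r x. u \<in> frac_space s \<Longrightarrow> sob_sq s u \<le> K \<Longrightarrow> r > 0 \<Longrightarrow>
      (avg u x (r / 2) - avg u x r)\<^sup>2 \<le> C * r powr (2 * s - ?N) * K"
    using frac_avg_estimates[OF s, where 'a='a] by blast
  have \<omega>: "?\<omega> > 0" by simp
  define \<gamma> where "\<gamma> = (q - 2) / 2"
  have \<gamma>: "\<gamma> > 0" using q by (simp add: \<gamma>_def)
  \<comment> \<open>By the energy bounds alone the j-th difference has squared supremum of order
    2^((N - 2 s) j) and squared \<open>L^2\<close> norm of order 2^(- 2 s j), so its q-th power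
    integrates to order 2^(- \<delta> j). Positivity of \<open>\<delta>\<close> is exactly the
    subcriticality of \<open>q\<close>.\<close>
  define \<delta> where "\<delta> = 2 * s - \<gamma> * (?N - 2 * s)"
  have \<delta>: "\<delta> > 0" using q(2) by (simp add: \<delta>_def \<gamma>_def field_simps)
  \<comment> \<open>A fraction \<open>\<theta>\<close> of the supremum bound is traded for the bound
    by \<open>\<eta>\<close>, which grows faster by 2^(2 s j). The resulting loss
    \<open>2 * s * \<theta> * \<gamma>\<close> in the exponent is kept at most
    \<open>\<delta> / 4\<close>.\<close>
  define \<theta> where "\<theta> = min (1/2) (\<delta> / (8 * s * \<gamma>))"
  have \<theta>: "0 < \<theta>" "\<theta> < 1" "2 * s * \<theta> * \<gamma> \<le> \<delta> / 4"
  proof -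
    show "0 < \<theta>" using \<delta> \<gamma> s by (simp add: \<theta>_def)
    have "\<theta> \<le> 1 / 2" by (simp add: \<theta>_def)
    then show "\<theta> < 1" by simp
    have "\<theta> \<le> \<delta> / (8 * s * \<gamma>)" by (simp add: \<theta>_def)
    then have "\<theta> * (8 * s * \<gamma>) \<le> \<delta>" using \<gamma> s by (simp add: pos_le_divide_eq)
    then show "2 * s * \<theta> * \<gamma> \<le> \<delta> / 4" by (simp add: algebra_simps)
  qed
  \<comment> \<open>The weight \<open>\<rho> ^ j\<close> in the telescoping bound costs 2^(\<delta>
    j / 4). Together with the loss from \<open>\<theta>\<close> this leaves the decay 2^(- \<delta>
    j / 2), which is \<open>?E j\<close>.\<close>
  define \<rho> where "\<rho> = 2 powr (- \<delta> / (4 * q))"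
  have "- \<delta> / (4 * q) < 0" using \<delta> q by (simp add: divide_neg_pos)
  then have \<rho>: "0 < \<rho>" "\<rho> < 1" unfolding \<rho>_def using powr_less_mono[of "- \<delta> / (4 * q)" 0 2] by auto
  let ?\<alpha> = "1 + (1 - \<theta>) * \<gamma>" and ?\<beta> = "\<theta> * \<gamma>"
  let ?E = "\<lambda>j::nat. 2 powr (- (\<delta> / 2) * j)"
  define A where "A = C powr ((1 - \<theta>) * \<gamma>) * (4 * 2 ^ ?N / ?\<omega>) powr (\<theta> * \<gamma>) * (4 * C)"
  define B where "B = (1 / ?\<omega>) powr \<gamma> * (2 + 2 * C)"
  define D where "D = (1 + 1 / (1 - \<rho>)) powr q * (B + A * (\<Sum>j. ?E j))"
  have gE: "?E j = (2 powr (- (\<delta> / 2))) ^ j" for j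
    by (simp add: powr_realpow[symmetric] powr_powr)
  have g1: "2 powr (- (\<delta> / 2)) < (1::real)" using \<delta> powr_less_mono[of "- (\<delta>/2)" 0 2] by simp
  have sE: "summable ?E" unfolding gE using g1 by (intro summable_geometric) simp
  have pp: "0 < x powr e" if "0 < x" for x e :: real using that by simp
  have A0: "A > 0" unfolding A_def using C \<omega> by (intro mult_pos_pos pp divide_pos_pos) auto
  have B0: "B > 0" unfolding B_def using C \<omega> by (intro mult_pos_pos pp divide_pos_pos add_pos_pos) auto
  have Esum: "(\<Sum>j. ?E j) > 0" by (rule suminf_pos[OF sE]) simp
  have D0: "D > 0" unfolding D_def
  proof (rule mult_pos_pos)
    have "1 + 1 / (1 - \<rho>) > 0" using \<rho> by (intro add_pos_pos) auto
    then show "(1 + 1 / (1 - \<rho>)) powr q > 0" by simp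
    show "0 < B + A * (\<Sum>j. ?E j)" using A0 B0 Esum by (intro add_pos_pos mult_pos_pos)
  qed
  show ?thesis
  proof (rule that[of D ?\<alpha> ?\<beta>])
    show "D > 0" by (rule D0)
    show "0 < ?\<alpha>" using \<gamma> \<theta> by (intro add_pos_nonneg) auto
    show "0 < ?\<beta>" using \<gamma> \<theta> by simp
    show "?\<alpha> + ?\<beta> = q / 2" by (simp add: \<gamma>_def field_simps)
    fix u :: "'a \<Rightarrow> real" and K \<eta> :: real
    assume u: "u \<in> frac_space s" and K: "sob_sq s u \<le> K" and \<eta>: "0 < \<eta>" "\<eta> \<le> K"
      and van: "\<And>x. (\<integral>y. (u y)\<^sup>2 * indicat_real (ball x 1) y \<partial>lborel) \<le> \<eta>"
    note uD = frac_spaceD[OF u]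
    have um[measurable]: "u \<in> borel_measurable borel" by (rule uD)
    have K0: "K > 0" using \<eta> by simp
    define a where "a j x = avg u x ((1/2) ^ j)" for j :: nat and x
    have am[measurable]: "a j \<in> borel_measurable borel" for j unfolding a_def by measurable
    have r0: "(1/2::real) ^ j > 0" for j by simp
    have rp: "((1/2::real) ^ j) powr e = 2 powr (- e * j)" for j e
    proof -
      have "((1/2::real) ^ j) = 2 powr (- real j)" by (simp add: powr_minus powr_realpow power_one_over inverse_eq_divide)
      then show ?thesis by (simp add: powr_powr mult.commute)
    qed
    have e1: "(\<integral>\<^sup>+x. ennreal ((u x - a j x)\<^sup>2) \<partial>lborel) \<le> ennreal (C * 2 powr (- (2 * s) * j) * K)" for j
      using est1[OF u K r0[of j], of "\<lambda>x. x"] unfolding rp a_def by simp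
    have d2: "(\<integral>\<^sup>+x. ennreal ((a (Suc j) x - a j x)\<^sup>2) \<partial>lborel) \<le> ennreal (4 * C * 2 powr (- (2 * s) * j) * K)" for j
    proof -
      have "(\<integral>\<^sup>+x. ennreal ((a (Suc j) x - a j x)\<^sup>2) \<partial>lborel) \<le> ennreal (2 * (C * 2 powr (- (2 * s) * Suc j) * K) + 2 * (C * 2 powr (- (2 * s) * j) * K))"
        by (rule nn_integral_diff_sq_le[OF _ _ _ e1 e1]) (use C K0 in auto)
      also have "\<dots> \<le> ennreal (4 * C * 2 powr (- (2 * s) * j) * K)"
      proof (rule ennreal_leI)
        have "2 powr (- (2 * s) * Suc j) \<le> 2 powr (- (2 * s) * j)" using s by (intro powr_mono) (auto simp: algebra_simps)
        then have "C * 2 powr (- (2 * s) * Suc j) * K \<le> C * 2 powr (- (2 * s) * j) * K"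
          using C K0 by (intro mult_right_mono mult_left_mono) auto
        then show "2 * (C * 2 powr (- (2 * s) * Suc j) * K) + 2 * (C * 2 powr (- (2 * s) * j) * K) \<le> 4 * C * 2 powr (- (2 * s) * j) * K" by linarith
      qed
      finally show ?thesis .
    qed
    have X: "(a (Suc j) x - a j x)\<^sup>2 \<le> C * 2 powr ((?N - 2 * s) * j) * K" for j x
    proof -
      have "(a (Suc j) x - a j x)\<^sup>2 \<le> C * ((1/2)^j) powr (2 * s - ?N) * K"
        using est2[OF u K r0[of j], of x] unfolding a_def by simp
      also have "((1/2::real)^j) powr (2 * s - ?N) = 2 powr ((?N - 2 * s) * j)" unfolding rp by (simp add: algebra_simps)
      finally show ?thesis .
    qed
    have asq: "(a j x)\<^sup>2 \<le> \<eta> / ?\<omega> * 2 ^ (?N * j)" for j x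
    proof -
      have "(a j x)\<^sup>2 \<le> (\<integral>y. (u y)\<^sup>2 * indicat_real (ball x ((1/2)^j)) y \<partial>lborel) / (?\<omega> * ((1/2)^j) ^ ?N)"
        unfolding a_def by (rule avg_sq_le[OF uD(1,2) r0])
      also have "\<dots> \<le> \<eta> / (?\<omega> * ((1/2)^j) ^ ?N)"
      proof (rule divide_right_mono)
        have "(\<integral>y. (u y)\<^sup>2 * indicat_real (ball x ((1/2)^j)) y \<partial>lborel) \<le> (\<integral>y. (u y)\<^sup>2 * indicat_real (ball x 1) y \<partial>lborel)"
        proof (intro integral_mono L2_integrable_on_ball(2) uD)
          fix y
          have "(1/2::real)^j \<le> 1" by (simp add: power_le_one)
          then have "ball x ((1/2)^j) \<subseteq> ball x 1" by (rule subset_ball)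
          then show "(u y)\<^sup>2 * indicat_real (ball x ((1/2)^j)) y \<le> (u y)\<^sup>2 * indicat_real (ball x 1) y"
            by (auto simp: indicator_def)
        qed
        then show "(\<integral>y. (u y)\<^sup>2 * indicat_real (ball x ((1/2)^j)) y \<partial>lborel) \<le> \<eta>" using van[of x] by simp
      qed (use \<omega> in auto)
      also have "\<dots> = \<eta> / ?\<omega> * 2 ^ (?N * j)"
        by (simp add: power_one_over power_mult[symmetric] mult.commute field_simps)
      finally show ?thesis .
    qed
    have Y: "(a (Suc j) x - a j x)\<^sup>2 \<le> (4 * 2 ^ ?N / ?\<omega>) * \<eta> * 2 powr (?N * j)" for j x
    proof -
      have "(a (Suc j) x - a j x)\<^sup>2 \<le> 2 * (a (Suc j) x)\<^sup>2 + 2 * (a j x)\<^sup>2"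
        using zero_le_power2[of "a (Suc j) x + a j x"] by (simp add: power2_eq_square algebra_simps)
      also have "\<dots> \<le> 2 * (\<eta> / ?\<omega> * 2 ^ (?N * Suc j)) + 2 * (\<eta> / ?\<omega> * 2 ^ (?N * j))" by (intro add_mono mult_left_mono asq) auto
      also have "\<dots> \<le> 4 * (\<eta> / ?\<omega> * 2 ^ (?N * Suc j))"
      proof -
        have "(2::real) ^ (?N * j) \<le> 2 ^ (?N * Suc j)" by (intro power_increasing) auto
        then have "\<eta> / ?\<omega> * 2 ^ (?N * j) \<le> \<eta> / ?\<omega> * 2 ^ (?N * Suc j)" using \<eta> \<omega> by (intro mult_left_mono) auto
        then show ?thesis by linarith
      qed
      also have "\<dots> = (4 * 2 ^ ?N / ?\<omega>) * \<eta> * 2 ^ (?N * j)" by (simp add: power_add algebra_simps)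
      also have "(2::real) ^ (?N * j) = 2 powr (?N * j)" by (simp add: powr_realpow[symmetric])
      finally show ?thesis .
    qed
    define Z where "Z j = (C * 2 powr ((?N - 2 * s) * j) * K) powr (1 - \<theta>) * ((4 * 2 ^ ?N / ?\<omega>) * \<eta> * 2 powr (?N * j)) powr \<theta>" for j :: nat
    have Z: "(a (Suc j) x - a j x)\<^sup>2 \<le> Z j" for j x
    proof -
      let ?t = "(a (Suc j) x - a j x)\<^sup>2"
      have "?t = ?t powr (1 - \<theta>) * ?t powr \<theta>"
      proof (cases "?t = 0")
        case False
        then have "?t > 0" by (metis zero_less_power2 power_zero_numeral)
        then show ?thesis by (simp add: powr_add[symmetric])
      qed simp
      also have "\<dots> \<le> Z j" unfolding Z_def using X[where j=j and x=x] Y[where j=j and x=x] \<theta> by (intro mult_mono powr_mono2) auto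
      finally show ?thesis .
    qed
    have dq: "(\<integral>\<^sup>+x. ennreal ((\<bar>a (Suc j) x - a j x\<bar> / \<rho> ^ j) powr q) \<partial>lborel) \<le> ennreal (A * K powr ?\<alpha> * \<eta> powr ?\<beta>) * ennreal (?E j)" for j
    proof -
      have \<rho>j: "(\<rho> ^ j) powr q = 2 powr (- (\<delta> / 4) * j)"
        unfolding \<rho>_def using q by (simp add: powr_realpow[symmetric] powr_powr)
      have "(\<bar>a (Suc j) x - a j x\<bar> / \<rho> ^ j) powr q = 2 powr (\<delta> / 4 * j) * \<bar>a (Suc j) x - a j x\<bar> powr q" for x
        using \<rho> by (simp add: powr_divide \<rho>j powr_minus field_simps)
      then have "(\<integral>\<^sup>+x. ennreal ((\<bar>a (Suc j) x - a j x\<bar> / \<rho> ^ j) powr q) \<partial>lborel) = ennreal (2 powr (\<delta> / 4 * j)) * (\<integral>\<^sup>+x. ennreal (\<bar>a (Suc j) x - a j x\<bar> powr q) \<partial>lborel)"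
        by (simp add: ennreal_mult nn_integral_cmult)
      also have "\<dots> \<le> ennreal (2 powr (\<delta> / 4 * j)) * ennreal (Z j powr \<gamma> * (4 * C * 2 powr (- (2 * s) * j) * K))"
        unfolding \<gamma>_def by (intro mult_left_mono nn_integral_powr_le_sup q Z d2) auto
      also have "\<dots> = ennreal (2 powr (\<delta> / 4 * j) * (Z j powr \<gamma> * (4 * C * 2 powr (- (2 * s) * j) * K)))"
        by (simp add: ennreal_mult')
      also have "Z j powr \<gamma> = C powr ((1 - \<theta>) * \<gamma>) * K powr ((1 - \<theta>) * \<gamma>) * (4 * 2 ^ ?N / ?\<omega>) powr (\<theta> * \<gamma>) * \<eta> powr (\<theta> * \<gamma>) * 2 powr ((?N - 2 * s) * j * ((1 - \<theta>) * \<gamma>) + ?N * j * (\<theta> * \<gamma>))"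
      proof -
        have "Z j powr \<gamma> = (C * 2 powr ((?N - 2 * s) * j) * K) powr ((1 - \<theta>) * \<gamma>) * ((4 * 2 ^ ?N / ?\<omega>) * \<eta> * 2 powr (?N * j)) powr (\<theta> * \<gamma>)"
          unfolding Z_def using C K0 \<eta> \<omega> by (subst powr_mult) (auto simp: powr_powr)
        also have "(C * 2 powr ((?N - 2 * s) * j) * K) powr ((1 - \<theta>) * \<gamma>) = C powr ((1 - \<theta>) * \<gamma>) * 2 powr ((?N - 2 * s) * j * ((1 - \<theta>) * \<gamma>)) * K powr ((1 - \<theta>) * \<gamma>)"
          using C K0 by (simp add: powr_mult powr_powr)
        also have "((4 * 2 ^ ?N / ?\<omega>) * \<eta> * 2 powr (?N * j)) powr (\<theta> * \<gamma>) = (4 * 2 ^ ?N / ?\<omega>) powr (\<theta> * \<gamma>) * \<eta> powr (\<theta> * \<gamma>) * 2 powr (?N * j * (\<theta> * \<gamma>))"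
          using \<eta> \<omega> by (simp only: powr_mult powr_powr)
        finally show ?thesis by (simp add: powr_add mult_ac)
      qed
      also have "2 powr (\<delta> / 4 * j) * (C powr ((1 - \<theta>) * \<gamma>) * K powr ((1 - \<theta>) * \<gamma>) * (4 * 2 ^ ?N / ?\<omega>) powr (\<theta> * \<gamma>) * \<eta> powr (\<theta> * \<gamma>) * 2 powr ((?N - 2 * s) * j * ((1 - \<theta>) * \<gamma>) + ?N * j * (\<theta> * \<gamma>)) * (4 * C * 2 powr (- (2 * s) * j) * K))
        = A * K powr ?\<alpha> * \<eta> powr ?\<beta> * 2 powr (\<delta> / 4 * j + ((?N - 2 * s) * j * ((1 - \<theta>) * \<gamma>) + ?N * j * (\<theta> * \<gamma>)) + - (2 * s) * j)"
        unfolding A_def powr_add using K0 by simp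
      also have "\<delta> / 4 * j + ((?N - 2 * s) * j * ((1 - \<theta>) * \<gamma>) + ?N * j * (\<theta> * \<gamma>)) + - (2 * s) * j = (\<delta> / 4 - \<delta> + 2 * s * \<theta> * \<gamma>) * j"
        by (simp add: \<delta>_def algebra_simps)
      also have "ennreal (A * K powr ?\<alpha> * \<eta> powr ?\<beta> * 2 powr ((\<delta> / 4 - \<delta> + 2 * s * \<theta> * \<gamma>) * j)) \<le> ennreal (A * K powr ?\<alpha> * \<eta> powr ?\<beta> * ?E j)"
      proof (intro ennreal_leI mult_left_mono powr_mono)
        have "\<delta> / 4 - \<delta> + 2 * s * \<theta> * \<gamma> \<le> - (\<delta> / 2)" using \<theta>(3) by linarith
        then show "(\<delta> / 4 - \<delta> + 2 * s * \<theta> * \<gamma>) * j \<le> - (\<delta> / 2) * j" by (intro mult_right_mono) auto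
      qed (use A0 in auto)
      also have "\<dots> = ennreal (A * K powr ?\<alpha> * \<eta> powr ?\<beta>) * ennreal (?E j)" using A0 by (simp add: ennreal_mult)
      finally show ?thesis .
    qed
    have a0q: "(\<integral>\<^sup>+x. ennreal (\<bar>a 0 x\<bar> powr q) \<partial>lborel) \<le> ennreal (B * K powr ?\<alpha> * \<eta> powr ?\<beta>)"
    proof -
      have "(\<integral>\<^sup>+x. ennreal ((0 - a 0 x)\<^sup>2) \<partial>lborel) \<le> ennreal (2 * K + 2 * (C * K))"
      proof (rule nn_integral_diff_sq_le[of u lborel "\<lambda>_. 0" "a 0"])
        have "(\<integral>\<^sup>+x. ennreal ((u x - 0)\<^sup>2) \<partial>lborel) = ennreal (\<integral>x. (u x)\<^sup>2 \<partial>lborel)"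
          using uD(2) by (simp add: nn_integral_eq_integral)
        also have "\<dots> \<le> ennreal K"
        proof (rule ennreal_leI)
          have "0 \<le> (\<integral>p. (frac_diff s u p)\<^sup>2 \<partial>lborel)" by simp
          then show "(\<integral>x. (u x)\<^sup>2 \<partial>lborel) \<le> K" using K unfolding sob_sq_def by linarith
        qed
        finally show "(\<integral>\<^sup>+x. ennreal ((u x - 0)\<^sup>2) \<partial>lborel) \<le> ennreal K" .
        show "(\<integral>\<^sup>+x. ennreal ((u x - a 0 x)\<^sup>2) \<partial>lborel) \<le> ennreal (C * K)" using e1[of 0] by simp
      qed (use C K0 in auto)
      then have "(\<integral>\<^sup>+x. ennreal (\<bar>a 0 x\<bar> powr q) \<partial>lborel) \<le> ennreal ((\<eta> / ?\<omega>) powr ((q - 2) / 2) * (2 * K + 2 * (C * K)))"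
        using asq[of 0] by (intro nn_integral_powr_le_sup q) auto
      also have "\<dots> \<le> ennreal (B * K powr ?\<alpha> * \<eta> powr ?\<beta>)"
      proof (rule ennreal_leI)
        \<comment> \<open>Since \<open>\<eta> \<le> K\<close>, part of the power of
          \<open>\<eta>\<close> is given up for \<open>K\<close>, so that the coarsest scale has the
          same exponents as the differences.\<close>
        have "\<eta> powr \<gamma> = \<eta> powr ((1 - \<theta>) * \<gamma>) * \<eta> powr (\<theta> * \<gamma>)" by (simp add: powr_add[symmetric] algebra_simps)
        also have "\<dots> \<le> K powr ((1 - \<theta>) * \<gamma>) * \<eta> powr (\<theta> * \<gamma>)" using \<eta> \<theta> \<gamma> by (intro mult_right_mono powr_mono2) auto
        finally have le: "\<eta> powr \<gamma> \<le> K powr ((1 - \<theta>) * \<gamma>) * \<eta> powr (\<theta> * \<gamma>)" .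
        have "(\<eta> / ?\<omega>) powr ((q - 2) / 2) * (2 * K + 2 * (C * K)) = (1 / ?\<omega>) powr \<gamma> * (2 + 2 * C) * (\<eta> powr \<gamma> * K)"
          unfolding \<gamma>_def[symmetric] using \<eta> \<omega> by (simp add: powr_divide algebra_simps)
        also have "\<dots> \<le> (1 / ?\<omega>) powr \<gamma> * (2 + 2 * C) * ((K powr ((1 - \<theta>) * \<gamma>) * \<eta> powr (\<theta> * \<gamma>)) * K)"
          using C K0 le by (intro mult_left_mono mult_right_mono) auto
        also have "\<dots> = B * K powr ?\<alpha> * \<eta> powr ?\<beta>" unfolding B_def powr_add using K0 by simp
        finally show "(\<eta> / ?\<omega>) powr ((q - 2) / 2) * (2 * K + 2 * (C * K)) \<le> B * K powr ?\<alpha> * \<eta> powr ?\<beta>" .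
      qed
      finally show ?thesis .
    qed
    \<comment> \<open>The squared errors in \<open>L^2\<close> decay geometrically along these
      radii, so their sum is integrable and the averages converge almost everywhere.\<close>
    have AEa: "AE x in lborel. (\<lambda>j. a j x) \<longlonglongrightarrow> u x"
    proof -
      let ?R = "\<lambda>j::nat. 2 powr (- (2 * s) * j)"
      have gR: "?R j = (2 powr (- (2 * s))) ^ j" for j by (simp add: powr_realpow[symmetric] powr_powr)
      have "2 powr (- (2 * s)) < (1::real)" using s powr_less_mono[of "- (2 * s)" 0 2] by simp
      then have sR: "summable ?R" unfolding gR by (intro summable_geometric) simp
      have "(\<integral>\<^sup>+x. (\<Sum>j. ennreal ((u x - a j x)\<^sup>2)) \<partial>lborel) = (\<Sum>j. \<integral>\<^sup>+x. ennreal ((u x - a j x)\<^sup>2) \<partial>lborel)"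
        by (intro nn_integral_suminf) measurable
      also have "\<dots> \<le> (\<Sum>j. ennreal (C * ?R j * K))" by (intro suminf_le summableI e1)
      also have "\<dots> = ennreal (\<Sum>j. C * ?R j * K)" using C K0 sR by (intro suminf_ennreal2 summable_mult summable_mult2) auto
      also have "\<dots> < \<infinity>" by simp
      finally have "AE x in lborel. (\<Sum>j. ennreal ((u x - a j x)\<^sup>2)) \<noteq> \<infinity>" by (intro nn_integral_PInf_AE) auto
      then show ?thesis
      proof eventually_elim
        case (elim x)
        then have "summable (\<lambda>j. (u x - a j x)\<^sup>2)" by (intro summable_suminf_not_top) auto
        then have "(\<lambda>j. (u x - a j x)\<^sup>2) \<longlonglongrightarrow> 0" by (rule summable_LIMSEQ_zero)
        then have "(\<lambda>j. sqrt ((u x - a j x)\<^sup>2)) \<longlonglongrightarrow> sqrt 0" by (intro tendsto_real_sqrt)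
        then have "(\<lambda>j. u x - a j x) \<longlonglongrightarrow> 0" by (simp add: tendsto_rabs_zero_iff)
        then have "(\<lambda>j. u x - (u x - a j x)) \<longlonglongrightarrow> u x - 0" by (intro tendsto_intros)
        then show ?case by simp
      qed
    qed
    let ?T = "(1 + 1 / (1 - \<rho>)) powr q"
    have "(\<integral>\<^sup>+x. ennreal (\<bar>u x\<bar> powr q) \<partial>lborel) \<le> (\<integral>\<^sup>+x. ennreal ?T * (ennreal (\<bar>a 0 x\<bar> powr q) + (\<Sum>j. ennreal ((\<bar>a (Suc j) x - a j x\<bar> / \<rho> ^ j) powr q))) \<partial>lborel)"
      by (rule nn_integral_mono_AE, use AEa in eventually_elim) (rule telescoping_powr_bound, use q \<rho> in auto)
    also have "\<dots> = ennreal ?T * ((\<integral>\<^sup>+x. ennreal (\<bar>a 0 x\<bar> powr q) \<partial>lborel) + (\<Sum>j. \<integral>\<^sup>+x. ennreal ((\<bar>a (Suc j) x - a j x\<bar> / \<rho> ^ j) powr q) \<partial>lborel))"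
      by (simp add: nn_integral_cmult nn_integral_add nn_integral_suminf)
    also have "\<dots> \<le> ennreal ?T * (ennreal (B * K powr ?\<alpha> * \<eta> powr ?\<beta>) + (\<Sum>j. ennreal (A * K powr ?\<alpha> * \<eta> powr ?\<beta>) * ennreal (?E j)))"
      by (intro mult_left_mono add_mono a0q suminf_le summableI dq) simp
    also have "(\<Sum>j. ennreal (A * K powr ?\<alpha> * \<eta> powr ?\<beta>) * ennreal (?E j)) = ennreal (A * K powr ?\<alpha> * \<eta> powr ?\<beta>) * ennreal (\<Sum>j. ?E j)"
      unfolding ennreal_suminf_cmult by (subst suminf_ennreal2[OF _ sE]) simp_all
    also have "ennreal ?T * (ennreal (B * K powr ?\<alpha> * \<eta> powr ?\<beta>) + ennreal (A * K powr ?\<alpha> * \<eta> powr ?\<beta>) * ennreal (\<Sum>j. ?E j))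
      = ennreal (?T * (B * K powr ?\<alpha> * \<eta> powr ?\<beta> + A * K powr ?\<alpha> * \<eta> powr ?\<beta> * (\<Sum>j. ?E j)))"
      using A0 B0 Esum by (simp add: ennreal_mult[symmetric] ennreal_plus[symmetric] del: ennreal_plus)
    also have "?T * (B * K powr ?\<alpha> * \<eta> powr ?\<beta> + A * K powr ?\<alpha> * \<eta> powr ?\<beta> * (\<Sum>j. ?E j)) = D * K powr ?\<alpha> * \<eta> powr ?\<beta>"
      unfolding D_def by (simp add: algebra_simps)
    finally show "(\<integral>\<^sup>+x. ennreal (\<bar>u x\<bar> powr q) \<partial>lborel) \<le> ennreal (D * K powr ?\<alpha> * \<eta> powr ?\<beta>)" .
  qed
qed

section \<open>Local compactness\<close>

lemma ennreal_two_mult_add: "0 \<le> a \<Longrightarrow> 0 \<le> b \<Longrightarrow> 2 * ennreal a + 2 * ennreal b = ennreal (2 * a + 2 * b)"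
  by (simp add: ennreal_mult)

lemma AE_lborel_fst:
  assumes "AE x in (lborel :: 'a::euclidean_space measure). Q x"
  shows "AE p in (lborel :: ('a \<times> 'b::euclidean_space) measure). Q (fst p)"
proof -
  obtain N where N: "{x \<in> space lborel. \<not> Q x} \<subseteq> N" "emeasure lborel N = 0" "N \<in> sets lborel"
    using AE_E[OF assms] by blast
  have "emeasure (lborel \<Otimes>\<^sub>M lborel) (N \<times> (UNIV :: 'b set)) = emeasure lborel N * emeasure lborel (UNIV :: 'b set)"
    by (rule lborel.emeasure_pair_measure_Times) (use N in auto)
  then have "N \<times> (UNIV :: 'b set) \<in> null_sets (lborel \<Otimes>\<^sub>M lborel)"
    using N by (intro null_setsI) auto
  then have "N \<times> (UNIV :: 'b set) \<in> null_sets lborel" by (simp add: lborel_prod)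
  then show ?thesis by (rule AE_I') (use N in auto)
qed

lemma AE_lborel_snd:
  assumes "AE x in (lborel :: 'b::euclidean_space measure). Q x"
  shows "AE p in (lborel :: ('a::euclidean_space \<times> 'b) measure). Q (snd p)"
proof -
  obtain N where N: "{x \<in> space lborel. \<not> Q x} \<subseteq> N" "emeasure lborel N = 0" "N \<in> sets lborel"
    using AE_E[OF assms] by blast
  have "emeasure (lborel \<Otimes>\<^sub>M lborel) ((UNIV :: 'a set) \<times> N) = emeasure lborel (UNIV :: 'a set) * emeasure lborel N"
    by (rule lborel.emeasure_pair_measure_Times) (use N in auto)
  then have "(UNIV :: 'a set) \<times> N \<in> null_sets (lborel \<Otimes>\<^sub>M lborel)"
    using N by (intro null_setsI) auto
  then have "(UNIV :: 'a set) \<times> N \<in> null_sets lborel" by (simp add: lborel_prod)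
  then show ?thesis by (rule AE_I') (use N in auto)
qed

lemma AE_frac_diff_tendsto:
  assumes "AE x in lborel. (\<lambda>n. u n x) \<longlonglongrightarrow> w x"
  shows "AE p in lborel. (\<lambda>n. frac_diff s (u n) p) \<longlonglongrightarrow> frac_diff s w p"
proof -
  have "AE p in lborel. (\<lambda>n. u n (fst (snd p))) \<longlonglongrightarrow> w (fst (snd p))"
    by (rule AE_lborel_snd[OF AE_lborel_fst[OF assms]])
  moreover have "AE p in lborel. (\<lambda>n. u n (snd (snd p))) \<longlonglongrightarrow> w (snd (snd p))"
    by (rule AE_lborel_snd[OF AE_lborel_snd[OF assms]])
  ultimately show ?thesis
    by eventually_elim (auto simp: frac_diff_def intro!: tendsto_intros)
qed

lemma integrable_sq_Fatou:
  fixes f :: "nat \<Rightarrow> 'a \<Rightarrow> real"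
  assumes [measurable]: "\<And>n. f n \<in> borel_measurable M" "g \<in> borel_measurable M"
    and lim: "AE x in M. (\<lambda>n. f n x) \<longlonglongrightarrow> g x" and f2: "\<And>n. integrable M (\<lambda>x. (f n x)\<^sup>2)" and K: "\<And>n. (\<integral>x. (f n x)\<^sup>2 \<partial>M) \<le> K"
  shows "integrable M (\<lambda>x. (g x)\<^sup>2)"
proof (rule integrableI_bounded)
  have "(\<integral>\<^sup>+x. ennreal ((g x)\<^sup>2) \<partial>M) = (\<integral>\<^sup>+x. liminf (\<lambda>n. ennreal ((f n x)\<^sup>2)) \<partial>M)"
  proof (rule nn_integral_cong_AE, use lim in eventually_elim)
    fix x assume "(\<lambda>n. f n x) \<longlonglongrightarrow> g x"
    then have "(\<lambda>n. ennreal ((f n x)\<^sup>2)) \<longlonglongrightarrow> ennreal ((g x)\<^sup>2)" by (intro tendsto_intros)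
    then show "ennreal ((g x)\<^sup>2) = liminf (\<lambda>n. ennreal ((f n x)\<^sup>2))"
      by (intro lim_imp_Liminf[symmetric] trivial_limit_sequentially)
  qed
  also have "\<dots> \<le> liminf (\<lambda>n. \<integral>\<^sup>+x. ennreal ((f n x)\<^sup>2) \<partial>M)" by (intro nn_integral_liminf) auto
  also have "\<dots> \<le> ennreal K"
  proof (rule Liminf_le)
    show "\<forall>\<^sub>F n in sequentially. (\<integral>\<^sup>+x. ennreal ((f n x)\<^sup>2) \<partial>M) \<le> ennreal K"
    proof (rule always_eventually, rule allI)
      fix n
      have "(\<integral>\<^sup>+x. ennreal ((f n x)\<^sup>2) \<partial>M) = ennreal (\<integral>x. (f n x)\<^sup>2 \<partial>M)" by (intro nn_integral_eq_integral f2) auto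
      then show "(\<integral>\<^sup>+x. ennreal ((f n x)\<^sup>2) \<partial>M) \<le> ennreal K" using K by (simp add: ennreal_leI)
    qed
  qed simp
  also have "\<dots> < \<infinity>" by simp
  finally show "(\<integral>\<^sup>+x. ennreal (norm ((g x)\<^sup>2)) \<partial>M) < \<infinity>" by simp
qed measurable

text \<open>Averages over balls of a fixed radius centred in a countable dense set converge along a
  diagonal subsequence; they approximate every function of the sequence uniformly in \<open>L\<^sup>2\<close>.
  The weight \<open>exp (- |x|\<^sup>2)\<close> makes the underlying measure finite.\<close>

proposition frac_compact:
  fixes u :: "nat \<Rightarrow> 'a::euclidean_space \<Rightarrow> real" and s :: real
  assumes s: "0 < s" "s < 1" and u: "\<And>n. u n \<in> frac_space s" and K: "\<And>n. sob_sq s (u n) \<le> K"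
  obtains r w where "strict_mono (r :: nat \<Rightarrow> nat)" "w \<in> frac_space s"
    "AE x in lborel. (\<lambda>n. u (r n) x) \<longlonglongrightarrow> w x"
    "(\<lambda>n. \<integral>\<^sup>+x. ennreal ((u (r n) x - w x)\<^sup>2) * indicator (ball 0 1) x \<partial>lborel) \<longlonglongrightarrow> 0"
proof -
  let ?N = "DIM('a)" and ?\<omega> = "unit_ball_vol (real DIM('a))"
  note uD = frac_spaceD[OF u]
  have um[measurable]: "u n \<in> borel_measurable borel" for n by (rule uD)
  have K0: "0 \<le> K" using order_trans[OF sob_sq_nonneg K] .
  have \<omega>: "?\<omega> > 0" by simp
  have u2K: "(\<integral>x. (u n x)\<^sup>2 \<partial>lborel) \<le> K" for n
  proof -
    have "0 \<le> (\<integral>p. (frac_diff s (u n) p)\<^sup>2 \<partial>lborel)" by simp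
    then show ?thesis using K[of n] unfolding sob_sq_def by linarith
  qed
  have f2K: "(\<integral>p. (frac_diff s (u n) p)\<^sup>2 \<partial>lborel) \<le> K" for n
  proof -
    have "0 \<le> (\<integral>x. (u n x)\<^sup>2 \<partial>lborel)" by simp
    then show ?thesis using K[of n] unfolding sob_sq_def by linarith
  qed
  obtain C where C: "C > 0"
    and est: "\<And>(u :: 'a \<Rightarrow> real) K r c. u \<in> frac_space s \<Longrightarrow> sob_sq s u \<le> K \<Longrightarrow> r > 0 \<Longrightarrow> (\<And>x. dist x (c x) \<le> r) \<Longrightarrow>
      (\<integral>\<^sup>+x. ennreal ((u x - avg u (c x) r)\<^sup>2) \<partial>lborel) \<le> ennreal (C * r powr (2 * s) * K)"
    and "\<And>(u :: 'a \<Rightarrow> real) K r x. u \<in> frac_space s \<Longrightarrow> sob_sq s u \<le> K \<Longrightarrow> r > 0 \<Longrightarrow>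
      (avg u x (r / 2) - avg u x r)\<^sup>2 \<le> C * r powr (2 * s - ?N) * K"
    using frac_avg_estimates[OF s, where 'a='a] by blast
  obtain D :: "'a set" where D: "countable D" "\<And>X. open X \<Longrightarrow> X \<noteq> {} \<Longrightarrow> \<exists>d\<in>D. d \<in> X"
    using countable_dense_exists by blast
  define d where "d = from_nat_into D"
  have "D \<noteq> {}" using D(2)[of UNIV] by auto
  then have rd: "range d = D" unfolding d_def using D(1) by (simp add: range_from_nat_into)
  define h where "h m = (1/2::real) ^ m" for m :: nat
  have h0: "h m > 0" for m by (simp add: h_def)
  \<comment> \<open>The first centre within distance \<open>h m\<close>: it exists by density, and
    taking the least index makes the choice measurable with countably many values.\<close>
  define idx where "idx m x = (LEAST i. dist x (d i) < h m)" for m x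
  have idx: "dist x (d (idx m x)) < h m" for m x
    unfolding idx_def
  proof (rule LeastI_ex)
    have "ball x (h m) \<noteq> {}" using h0 by (metis centre_in_ball empty_iff)
    then obtain e where "e \<in> D" "e \<in> ball x (h m)" using D(2)[OF open_ball] by blast
    then show "\<exists>i. dist x (d i) < h m" using rd by (metis mem_ball rangeE)
  qed
  have idxm[measurable]: "idx m \<in> borel \<rightarrow>\<^sub>M count_space UNIV" for m unfolding idx_def by measurable
  define b where "b n m i = avg (u n) (d i) (h m)" for n m i
  have bsq: "(b n m i)\<^sup>2 \<le> K / (?\<omega> * h m ^ ?N)" for n m i
  proof -
    have "(b n m i)\<^sup>2 \<le> (\<integral>y. (u n y)\<^sup>2 * indicat_real (ball (d i) (h m)) y \<partial>lborel) / (?\<omega> * h m ^ ?N)"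
      unfolding b_def by (rule avg_sq_le[OF uD(1,2) h0])
    also have "\<dots> \<le> K / (?\<omega> * h m ^ ?N)"
    proof (rule divide_right_mono)
      have "(\<integral>y. (u n y)\<^sup>2 * indicat_real (ball (d i) (h m)) y \<partial>lborel) \<le> (\<integral>y. (u n y)\<^sup>2 \<partial>lborel)"
        by (intro integral_mono L2_integrable_on_ball(2) uD) (auto simp: indicator_def)
      then show "(\<integral>y. (u n y)\<^sup>2 * indicat_real (ball (d i) (h m)) y \<partial>lborel) \<le> K" using u2K[of n] by simp
    qed (use \<omega> h0[of m] in auto)
    finally show ?thesis .
  qed
  \<comment> \<open>The averages at scale \<open>h m\<close> are bounded by a multiple of h m powr
    (- N / 2). The factor \<open>sqrt (h (fst p) ^ ?N)\<close> makes the bound the same for all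
    scales, as \<open>function_convergent_subsequence\<close> asks.\<close>
  obtain k where k: "strict_mono (k :: nat \<Rightarrow> nat)" and kc: "\<And>p. p \<in> (UNIV :: (nat \<times> nat) set) \<Longrightarrow> \<exists>l. (\<lambda>n. b (k n) (fst p) (snd p) * sqrt (h (fst p) ^ ?N)) \<longlonglongrightarrow> l"
  proof (rule function_convergent_subsequence[of "UNIV :: (nat \<times> nat) set" "\<lambda>n p. b n (fst p) (snd p) * sqrt (h (fst p) ^ ?N)" "sqrt (K / ?\<omega>)"])
    show "norm (b n (fst p) (snd p) * sqrt (h (fst p) ^ ?N)) \<le> sqrt (K / ?\<omega>)" for n and p :: "nat \<times> nat"
    proof -
      have "(b n (fst p) (snd p) * sqrt (h (fst p) ^ ?N))\<^sup>2 = (b n (fst p) (snd p))\<^sup>2 * h (fst p) ^ ?N"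
        using h0[of "fst p"] by (simp add: power_mult_distrib)
      also have "\<dots> \<le> K / (?\<omega> * h (fst p) ^ ?N) * h (fst p) ^ ?N" using bsq h0[of "fst p"] by (intro mult_right_mono) auto
      also have "\<dots> = K / ?\<omega>" using h0[of "fst p"] by simp
      finally show ?thesis unfolding real_norm_def by (metis real_sqrt_abs real_sqrt_le_iff)
    qed
  qed auto
  have "\<exists>l. (\<lambda>n. b (k n) m i) \<longlonglongrightarrow> l" for m i
  proof -
    obtain l where "(\<lambda>n. b (k n) m i * sqrt (h m ^ ?N)) \<longlonglongrightarrow> l" using kc[of "(m, i)"] by auto
    then have "(\<lambda>n. b (k n) m i * sqrt (h m ^ ?N) / sqrt (h m ^ ?N)) \<longlonglongrightarrow> l / sqrt (h m ^ ?N)"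
      using h0[of m] by (intro tendsto_intros) auto
    moreover have "b (k n) m i * sqrt (h m ^ ?N) / sqrt (h m ^ ?N) = b (k n) m i" for n using h0[of m] by simp
    ultimately show ?thesis by auto
  qed
  then obtain L where L: "\<And>m i. (\<lambda>n. b (k n) m i) \<longlonglongrightarrow> L m i" by metis
  define P where "P n m x = b (k n) m (idx m x)" for n m x
  define p where "p m x = L m (idx m x)" for m x
  have Pm[measurable]: "P n m \<in> borel_measurable borel" for n m unfolding P_def by measurable
  have pm[measurable]: "p m \<in> borel_measurable borel" for m unfolding p_def by measurable
  define \<rho> where "\<rho> x = ennreal (exp (- (norm x)\<^sup>2))" for x :: 'a
  have \<rho>m[measurable]: "\<rho> \<in> borel_measurable borel" unfolding \<rho>_def by measurable
  have \<rho>1: "\<rho> x \<le> 1" for x unfolding \<rho>_def by (simp add: ennreal_le_1)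
  have \<rho>fin: "(\<integral>\<^sup>+x. \<rho> x \<partial>lborel) < \<infinity>"
  proof -
    have "integrable lborel (\<lambda>x::'a. exp (- 1 * (norm x)\<^sup>2))" by (rule integrable_exp_norm_sq) simp
    then show ?thesis unfolding \<rho>_def integrable_iff_bounded by simp
  qed
  define M where "M = density lborel \<rho>"
  have sM[measurable_cong, simp]: "sets M = sets borel" by (simp add: M_def)
  have iM: "(\<integral>\<^sup>+x. g x \<partial>M) = (\<integral>\<^sup>+x. \<rho> x * g x \<partial>lborel)" if "g \<in> borel_measurable borel" for g
    unfolding M_def using that by (intro nn_integral_density) auto
  define v where "v n = u (k n)" for n
  have vm[measurable]: "v n \<in> borel_measurable borel" for n unfolding v_def by measurable
  have vP: "(\<integral>\<^sup>+x. ennreal ((norm (v n x - P n m x))\<^sup>2) \<partial>M) \<le> ennreal (C * h m powr (2 * s) * K)" for n m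
  proof -
    have "(\<integral>\<^sup>+x. ennreal ((norm (v n x - P n m x))\<^sup>2) \<partial>M) = (\<integral>\<^sup>+x. \<rho> x * ennreal ((norm (v n x - P n m x))\<^sup>2) \<partial>lborel)"
      by (rule iM) measurable
    also have "\<dots> \<le> (\<integral>\<^sup>+x. ennreal ((v n x - P n m x)\<^sup>2) \<partial>lborel)"
    proof (rule nn_integral_mono)
      fix x
      show "\<rho> x * ennreal ((norm (v n x - P n m x))\<^sup>2) \<le> ennreal ((v n x - P n m x)\<^sup>2)"
        using mult_right_mono[OF \<rho>1[of x], of "ennreal ((v n x - P n m x)\<^sup>2)"] by simp
    qed
    also have "\<dots> \<le> ennreal (C * h m powr (2 * s) * K)"
      unfolding v_def P_def b_def using idx by (intro est u K h0) (auto intro: less_imp_le)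
    finally show ?thesis .
  qed
  have Pp: "(\<lambda>n. \<integral>\<^sup>+x. ennreal ((norm (P n m x - p m x))\<^sup>2) \<partial>M) \<longlonglongrightarrow> 0" for m
  proof -
    let ?B = "K / (?\<omega> * h m ^ ?N)"
    have B0: "?B \<ge> 0" using K0 \<omega> h0[of m] by simp
    have Lsq: "(L m i)\<^sup>2 \<le> ?B" for i
      by (rule LIMSEQ_le_const2[OF tendsto_power[OF L]]) (use bsq in auto)
    have "(\<lambda>n. \<integral>\<^sup>+x. \<rho> x * ennreal ((norm (P n m x - p m x))\<^sup>2) \<partial>lborel) \<longlonglongrightarrow> (\<integral>\<^sup>+x. 0 \<partial>(lborel :: 'a measure))"
    proof (rule nn_integral_dominated_convergence[where w="\<lambda>x. \<rho> x * ennreal (4 * ?B)"])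
      show "AE x in lborel. \<rho> x * ennreal ((norm (P n m x - p m x))\<^sup>2) \<le> \<rho> x * ennreal (4 * ?B)" for n
      proof (intro AE_I2 mult_left_mono ennreal_leI)
        fix x
        have "(P n m x - p m x)\<^sup>2 \<le> 2 * (P n m x)\<^sup>2 + 2 * (p m x)\<^sup>2"
          using zero_le_power2[of "P n m x + p m x"] by (simp add: power2_eq_square algebra_simps)
        also have "\<dots> \<le> 2 * ?B + 2 * ?B" unfolding P_def p_def by (intro add_mono mult_left_mono bsq Lsq) auto
        finally show "(norm (P n m x - p m x))\<^sup>2 \<le> 4 * ?B" by simp
      qed simp
      show "(\<integral>\<^sup>+x. \<rho> x * ennreal (4 * ?B) \<partial>lborel) < \<infinity>"
        using \<rho>fin by (subst nn_integral_multc) (auto simp: ennreal_mult_less_top)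
      show "AE x in lborel. (\<lambda>n. \<rho> x * ennreal ((norm (P n m x - p m x))\<^sup>2)) \<longlonglongrightarrow> 0"
      proof (rule AE_I2)
        fix x :: 'a
        have "(\<lambda>n. P n m x - p m x) \<longlonglongrightarrow> 0" unfolding P_def p_def using L LIM_zero by blast
        then have "(\<lambda>n. ennreal ((norm (P n m x - p m x))\<^sup>2)) \<longlonglongrightarrow> ennreal ((norm (0::real))\<^sup>2)" by (intro tendsto_intros)
        then have "(\<lambda>n. \<rho> x * ennreal ((norm (P n m x - p m x))\<^sup>2)) \<longlonglongrightarrow> \<rho> x * ennreal ((norm (0::real))\<^sup>2)"
          by (intro ennreal_tendsto_cmult) (auto simp: \<rho>_def)
        then show "(\<lambda>n. \<rho> x * ennreal ((norm (P n m x - p m x))\<^sup>2)) \<longlonglongrightarrow> 0" by simp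
      qed
    qed measurable
    moreover have "(\<integral>\<^sup>+x. ennreal ((norm (P n m x - p m x))\<^sup>2) \<partial>M) = (\<integral>\<^sup>+x. \<rho> x * ennreal ((norm (P n m x - p m x))\<^sup>2) \<partial>lborel)" for n
      by (rule iM) measurable
    ultimately show ?thesis by simp
  qed
  have cauchy: "\<exists>N. \<forall>m\<ge>N. \<forall>n\<ge>N. (\<integral>\<^sup>+x. ennreal ((norm (v m x - v n x))\<^sup>2) \<partial>M) \<le> ennreal e" if e: "e > 0" for e :: real
  proof -
    have "(\<lambda>m. C * h m powr (2 * s) * K) \<longlonglongrightarrow> C * 0 * K"
    proof (intro tendsto_intros)
      have "h \<longlonglongrightarrow> 0" unfolding h_def by (intro LIMSEQ_realpow_zero) auto
      then have "(\<lambda>m. h m powr (2 * s)) \<longlonglongrightarrow> 0 powr (2 * s)"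
        using s by (intro tendsto_powr') (auto intro!: always_eventually less_imp_le[OF h0])
      then show "(\<lambda>m. h m powr (2 * s)) \<longlonglongrightarrow> 0" by simp
    qed
    \<comment> \<open>Each use of the squared triangle inequality doubles both terms; two uses take
      e / 16 to e / 4 and then to e.\<close>
    then have "\<forall>\<^sub>F m in sequentially. C * h m powr (2 * s) * K < e / 16" using e by (intro order_tendstoD(2)) auto
    then obtain m where m: "C * h m powr (2 * s) * K < e / 16" by (auto simp: eventually_sequentially)
    have "\<forall>\<^sub>F n in sequentially. (\<integral>\<^sup>+x. ennreal ((norm (P n m x - p m x))\<^sup>2) \<partial>M) < ennreal (e / 16)"
      using order_tendstoD(2)[OF Pp, of "ennreal (e / 16)"] e by simp
    then obtain N where N: "\<And>n. n \<ge> N \<Longrightarrow> (\<integral>\<^sup>+x. ennreal ((norm (P n m x - p m x))\<^sup>2) \<partial>M) < ennreal (e / 16)"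
      by (auto simp: eventually_sequentially)
    have A: "(\<integral>\<^sup>+x. ennreal ((norm (v n x - p m x))\<^sup>2) \<partial>M) \<le> ennreal (e / 4)" if "n \<ge> N" for n
    proof -
      have "(\<integral>\<^sup>+x. ennreal ((norm (v n x - p m x))\<^sup>2) \<partial>M) \<le> 2 * (\<integral>\<^sup>+x. ennreal ((norm (v n x - P n m x))\<^sup>2) \<partial>M) + 2 * (\<integral>\<^sup>+x. ennreal ((norm (P n m x - p m x))\<^sup>2) \<partial>M)"
        by (rule nn_integral_norm_diff_sq_le) auto
      also have "\<dots> \<le> 2 * ennreal (e / 16) + 2 * ennreal (e / 16)"
      proof (intro add_mono mult_left_mono)
        show "(\<integral>\<^sup>+x. ennreal ((norm (v n x - P n m x))\<^sup>2) \<partial>M) \<le> ennreal (e / 16)"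
          by (rule order_trans[OF vP]) (use m in \<open>auto intro!: ennreal_leI\<close>)
        show "(\<integral>\<^sup>+x. ennreal ((norm (P n m x - p m x))\<^sup>2) \<partial>M) \<le> ennreal (e / 16)" using N[OF that] by simp
      qed auto
      also have "2 * ennreal (e / 16) + 2 * ennreal (e / 16) = ennreal (2 * (e / 16) + 2 * (e / 16))" using e by (intro ennreal_two_mult_add) auto
      also have "2 * (e / 16) + 2 * (e / 16) = e / 4" by simp
      finally show ?thesis .
    qed
    have "(\<integral>\<^sup>+x. ennreal ((norm (v n x - v l x))\<^sup>2) \<partial>M) \<le> ennreal e" if "n \<ge> N" "l \<ge> N" for n l
    proof -
      have "(\<integral>\<^sup>+x. ennreal ((norm (v n x - v l x))\<^sup>2) \<partial>M) \<le> 2 * (\<integral>\<^sup>+x. ennreal ((norm (v n x - p m x))\<^sup>2) \<partial>M) + 2 * (\<integral>\<^sup>+x. ennreal ((norm (p m x - v l x))\<^sup>2) \<partial>M)"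
        by (rule nn_integral_norm_diff_sq_le) auto
      also have "\<dots> \<le> 2 * ennreal (e / 4) + 2 * ennreal (e / 4)"
        using A[OF that(1)] A[OF that(2)] by (intro add_mono mult_left_mono) (auto simp: power2_commute)
      also have "2 * ennreal (e / 4) + 2 * ennreal (e / 4) = ennreal (2 * (e / 4) + 2 * (e / 4))" using e by (intro ennreal_two_mult_add) auto
      also have "2 * (e / 4) + 2 * (e / 4) = e" by simp
      finally show ?thesis .
    qed
    then show ?thesis by blast
  qed
  obtain r w where r: "strict_mono (r :: nat \<Rightarrow> nat)" and wm: "w \<in> borel_measurable M"
    and AEM: "AE x in M. (\<lambda>n. v (r n) x) \<longlonglongrightarrow> w x"
    and limM: "(\<lambda>n. \<integral>\<^sup>+x. ennreal ((norm (v n x - w x))\<^sup>2) \<partial>M) \<longlonglongrightarrow> 0"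
  proof (rule L2_complete[of v M])
    show "\<exists>N. \<forall>m\<ge>N. \<forall>n\<ge>N. (\<integral>\<^sup>+x. ennreal ((norm (v m x - v n x))\<^sup>2) \<partial>M) \<le> ennreal e" if "e > 0" for e :: real
      using cauchy[OF that] .
  qed auto
  have wm'[measurable]: "w \<in> borel_measurable borel" using wm by simp
  have AEw: "AE x in lborel. (\<lambda>n. u ((k \<circ> r) n) x) \<longlonglongrightarrow> w x"
  proof -
    have "AE x in lborel. 0 < \<rho> x \<longrightarrow> (\<lambda>n. v (r n) x) \<longlonglongrightarrow> w x"
      using AEM unfolding M_def by (subst (asm) AE_density) auto
    then show ?thesis by eventually_elim (auto simp: \<rho>_def v_def)
  qed
  have w2: "integrable lborel (\<lambda>x. (w x)\<^sup>2)"
    by (rule integrable_sq_Fatou[OF _ _ AEw uD(2) u2K]) auto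
  have "integrable lborel (\<lambda>p. (frac_diff s w p)\<^sup>2)"
    by (rule integrable_sq_Fatou[OF _ _ AE_frac_diff_tendsto[OF AEw] uD(3) f2K]) auto
  then have wE: "w \<in> frac_space s" using w2 by (simp add: frac_space_def)
  \<comment> \<open>\<open>exp 1\<close> undoes the weight on the unit ball, where exp (- |x|^2) is
    at least exp (- 1).\<close>
  have bound: "(\<integral>\<^sup>+x. ennreal ((u ((k \<circ> r) n) x - w x)\<^sup>2) * indicator (ball 0 1) x \<partial>lborel) \<le> ennreal (exp 1) * (\<integral>\<^sup>+x. ennreal ((norm (v (r n) x - w x))\<^sup>2) \<partial>M)" for n
  proof -
    have "(\<integral>\<^sup>+x. ennreal ((u ((k \<circ> r) n) x - w x)\<^sup>2) * indicator (ball 0 1) x \<partial>lborel) \<le> (\<integral>\<^sup>+x. ennreal (exp 1) * (\<rho> x * ennreal ((norm (v (r n) x - w x))\<^sup>2)) \<partial>lborel)"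
    proof (rule nn_integral_mono)
      fix x :: 'a
      show "ennreal ((u ((k \<circ> r) n) x - w x)\<^sup>2) * indicator (ball 0 1) x \<le> ennreal (exp 1) * (\<rho> x * ennreal ((norm (v (r n) x - w x))\<^sup>2))"
      proof (cases "norm x < 1")
        case True
        then have "(norm x)\<^sup>2 \<le> 1" by (simp add: power_le_one)
        then have "1 \<le> exp 1 * exp (- (norm x)\<^sup>2)" by (simp add: exp_add[symmetric])
        then have "1 * (v (r n) x - w x)\<^sup>2 \<le> exp 1 * exp (- (norm x)\<^sup>2) * (v (r n) x - w x)\<^sup>2" by (rule mult_right_mono) simp
        then show ?thesis using True
          by (simp add: \<rho>_def v_def ennreal_mult[symmetric] ennreal_leI mult.assoc)
      qed simp
    qed
    also have "\<dots> = ennreal (exp 1) * (\<integral>\<^sup>+x. \<rho> x * ennreal ((norm (v (r n) x - w x))\<^sup>2) \<partial>lborel)"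
      by (rule nn_integral_cmult) measurable
    also have "(\<integral>\<^sup>+x. \<rho> x * ennreal ((norm (v (r n) x - w x))\<^sup>2) \<partial>lborel) = (\<integral>\<^sup>+x. ennreal ((norm (v (r n) x - w x))\<^sup>2) \<partial>M)"
      by (rule iM[symmetric]) measurable
    finally show ?thesis .
  qed
  have "(\<lambda>n. \<integral>\<^sup>+x. ennreal ((norm (v (r n) x - w x))\<^sup>2) \<partial>M) \<longlonglongrightarrow> 0"
    using LIMSEQ_subseq_LIMSEQ[OF limM r] by (simp add: o_def)
  then have "(\<lambda>n. ennreal (exp 1) * (\<integral>\<^sup>+x. ennreal ((norm (v (r n) x - w x))\<^sup>2) \<partial>M)) \<longlonglongrightarrow> ennreal (exp 1) * 0"
    by (intro ennreal_tendsto_cmult) auto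
  then have "(\<lambda>n. \<integral>\<^sup>+x. ennreal ((u ((k \<circ> r) n) x - w x)\<^sup>2) * indicator (ball 0 1) x \<partial>lborel) \<longlonglongrightarrow> 0"
    by (intro ennreal_tendsto_0_le[OF bound]) simp
  then show ?thesis using that[of "k \<circ> r" w] strict_mono_o[OF k r] wE AEw by blast
qed

section \<open>The nonlinearity\<close>

lemma MVT_abs_bound:
  fixes j :: "real \<Rightarrow> real"
  assumes d: "\<And>t. (j has_real_derivative j' t) (at t)" and B: "\<And>t. \<bar>t\<bar> \<le> max \<bar>a\<bar> \<bar>b\<bar> \<Longrightarrow> \<bar>j' t\<bar> \<le> B"
  shows "\<bar>j b - j a\<bar> \<le> B * \<bar>b - a\<bar>"
proof -
  have main: "\<bar>j b - j a\<bar> \<le> B * (b - a)" if ab: "a < b" and B: "\<And>t. \<bar>t\<bar> \<le> max \<bar>a\<bar> \<bar>b\<bar> \<Longrightarrow> \<bar>j' t\<bar> \<le> B" for a b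
  proof -
    obtain z where z: "a < z" "z < b" "j b - j a = (b - a) * j' z" using MVT2[OF ab, of j j'] d by blast
    have "\<bar>z\<bar> \<le> max \<bar>a\<bar> \<bar>b\<bar>" using z by (auto simp: abs_if max_def)
    then have "\<bar>j' z\<bar> \<le> B" by (rule B)
    then show ?thesis using ab unfolding z(3) by (simp add: abs_mult mult.commute mult_right_mono)
  qed
  consider "a < b" | "a = b" | "b < a" by linarith
  then show ?thesis
  proof cases
    case 1 then show ?thesis using main[of a b] B by simp
  next
    case 2 then show ?thesis by simp
  next
    case 3 then show ?thesis using main[of b a] B by (simp add: abs_minus_commute max.commute)
  qed
qed

text \<open>One gauge for both ends of the growth condition: for measurable \<open>u\<close>,
  integrability of \<open>young p (u x)\<close> means that \<open>u\<close> lies in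
  \<open>L^2\<close> and in \<open>L^(p+1)\<close>.\<close>

definition young :: "real \<Rightarrow> real \<Rightarrow> real" where
  "young p t = t\<^sup>2 + \<bar>t\<bar> powr (p + 1)"

lemma young_nonneg [simp]: "0 \<le> young p t"
  by (simp add: young_def)

lemma young_measurable [measurable]: "young p \<in> borel_measurable borel"
  unfolding young_def by measurable

text \<open>The estimate behind both the continuity of the Nemytskii functionals and the Brezis-Lieb splitting.\<close>

definition young_cont :: "real \<Rightarrow> (real \<Rightarrow> real) \<Rightarrow> bool" where
  "young_cont p j \<longleftrightarrow> continuous_on UNIV j \<and> j 0 = 0 \<and>
     (\<forall>e>0. \<exists>C\<ge>0. \<forall>a b. \<bar>j (a + b) - j a\<bar> \<le> e * young p a + C * young p b)"

text \<open>The mean value theorem bounds the difference by |b| times the growth of the derivative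
  at |a| + |b|. Where |b| is at most \<delta> |a| this is a small multiple of
  \<open>young p a\<close>; elsewhere |a| is at most |b| / \<delta> and it is a multiple of
  \<open>young p b\<close>.\<close>

lemma young_cont_if_deriv:
  fixes j :: "real \<Rightarrow> real"
  assumes p: "p > 1" and d: "\<And>t. (j has_real_derivative j' t) (at t)" and j0: "j 0 = 0" and c: "c \<ge> 0"
    and j': "\<And>t. \<bar>j' t\<bar> \<le> c * (\<bar>t\<bar> + \<bar>t\<bar> powr p)"
  shows "young_cont p j"
  unfolding young_cont_def
proof (intro conjI allI impI j0)
  show "continuous_on UNIV j"
    using d by (meson DERIV_continuous continuous_at_imp_continuous_on)
  have bound: "\<bar>j (a + b) - j a\<bar> \<le> c * \<bar>b\<bar> * ((\<bar>a\<bar> + \<bar>b\<bar>) + (\<bar>a\<bar> + \<bar>b\<bar>) powr p)" for a b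
  proof -
    have "\<bar>j (a + b) - j a\<bar> \<le> c * ((\<bar>a\<bar> + \<bar>b\<bar>) + (\<bar>a\<bar> + \<bar>b\<bar>) powr p) * \<bar>(a + b) - a\<bar>"
    proof (rule MVT_abs_bound[OF d])
      fix t :: real assume "\<bar>t\<bar> \<le> max \<bar>a\<bar> \<bar>a + b\<bar>"
      then have t: "\<bar>t\<bar> \<le> \<bar>a\<bar> + \<bar>b\<bar>" by linarith
      have "\<bar>j' t\<bar> \<le> c * (\<bar>t\<bar> + \<bar>t\<bar> powr p)" by (rule j')
      also have "\<dots> \<le> c * ((\<bar>a\<bar> + \<bar>b\<bar>) + (\<bar>a\<bar> + \<bar>b\<bar>) powr p)"
        using c t p by (intro mult_left_mono add_mono powr_mono2) auto
      finally show "\<bar>j' t\<bar> \<le> c * ((\<bar>a\<bar> + \<bar>b\<bar>) + (\<bar>a\<bar> + \<bar>b\<bar>) powr p)" .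
    qed
    then show ?thesis by (simp add: mult_ac)
  qed
  have pw: "x * x powr p = x powr (p + 1)" if "x \<ge> 0" for x :: real
    using that by (cases "x = 0") (auto simp: powr_add)
  have key: "\<bar>b\<bar> * ((\<bar>a\<bar> + \<bar>b\<bar>) + (\<bar>a\<bar> + \<bar>b\<bar>) powr p) \<le> k * (1 + l) powr p * young p x"
    if "\<bar>b\<bar> \<le> k * \<bar>x\<bar>" "\<bar>a\<bar> + \<bar>b\<bar> \<le> (1 + l) * \<bar>x\<bar>" "k \<ge> 0" "l \<ge> 0" for a b x k l :: real
  proof -
    have l1: "1 + l \<le> (1 + l) powr p" using that(4) p powr_mono[of 1 p "1 + l"] by simp
    have "(\<bar>a\<bar> + \<bar>b\<bar>) + (\<bar>a\<bar> + \<bar>b\<bar>) powr p \<le> (1 + l) * \<bar>x\<bar> + ((1 + l) * \<bar>x\<bar>) powr p"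
      using that p by (intro add_mono powr_mono2) auto
    also have "((1 + l) * \<bar>x\<bar>) powr p = (1 + l) powr p * \<bar>x\<bar> powr p" using that by (simp add: powr_mult)
    also have "(1 + l) * \<bar>x\<bar> + (1 + l) powr p * \<bar>x\<bar> powr p \<le> (1 + l) powr p * (\<bar>x\<bar> + \<bar>x\<bar> powr p)"
      using l1 by (simp add: distrib_left mult_right_mono)
    finally have "\<bar>b\<bar> * ((\<bar>a\<bar> + \<bar>b\<bar>) + (\<bar>a\<bar> + \<bar>b\<bar>) powr p) \<le> (k * \<bar>x\<bar>) * ((1 + l) powr p * (\<bar>x\<bar> + \<bar>x\<bar> powr p))"
      using that by (intro mult_mono) auto
    also have "\<dots> = k * (1 + l) powr p * (\<bar>x\<bar> * \<bar>x\<bar> + \<bar>x\<bar> * \<bar>x\<bar> powr p)" by (simp add: algebra_simps)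
    also have "\<dots> = k * (1 + l) powr p * young p x" by (simp add: young_def pw power2_eq_square)
    finally show ?thesis .
  qed
  fix e :: real assume e: "e > 0"
  define \<delta> where "\<delta> = min 1 (e / ((c + 1) * 2 powr p))"
  have \<delta>: "\<delta> > 0" "\<delta> \<le> 1" "c * (\<delta> * 2 powr p) \<le> e"
  proof -
    show "\<delta> > 0" "\<delta> \<le> 1" using e c by (auto simp: \<delta>_def)
    have "\<delta> \<le> e / ((c + 1) * 2 powr p)" by (simp add: \<delta>_def)
    then have "\<delta> * ((c + 1) * 2 powr p) \<le> e" using c by (simp add: pos_le_divide_eq add_nonneg_pos)
    moreover have "c * (\<delta> * 2 powr p) \<le> \<delta> * ((c + 1) * 2 powr p)" using \<open>\<delta> > 0\<close> by (simp add: algebra_simps)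
    ultimately show "c * (\<delta> * 2 powr p) \<le> e" by linarith
  qed
  let ?C = "c * (1 + 1 / \<delta>) powr p"
  show "\<exists>C\<ge>0. \<forall>a b. \<bar>j (a + b) - j a\<bar> \<le> e * young p a + C * young p b"
  proof (intro exI[of _ ?C] conjI allI)
    show "0 \<le> ?C" using c by simp
    fix a b :: real
    show "\<bar>j (a + b) - j a\<bar> \<le> e * young p a + ?C * young p b"
    proof (cases "\<bar>b\<bar> \<le> \<delta> * \<bar>a\<bar>")
      case True
      have "\<bar>b\<bar> \<le> \<bar>a\<bar>" using True \<delta> mult_right_mono[OF \<delta>(2), of "\<bar>a\<bar>"] by simp
      then have "\<bar>b\<bar> * ((\<bar>a\<bar> + \<bar>b\<bar>) + (\<bar>a\<bar> + \<bar>b\<bar>) powr p) \<le> \<delta> * (1 + 1) powr p * young p a"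
        using True \<delta> by (intro key) auto
      then have "c * (\<bar>b\<bar> * ((\<bar>a\<bar> + \<bar>b\<bar>) + (\<bar>a\<bar> + \<bar>b\<bar>) powr p)) \<le> c * (\<delta> * (1 + 1) powr p * young p a)"
        using c by (intro mult_left_mono)
      also have "\<dots> = c * (\<delta> * 2 powr p) * young p a" by simp
      also have "\<dots> \<le> e * young p a" using \<delta>(3) by (intro mult_right_mono) auto
      also have "\<dots> \<le> e * young p a + ?C * young p b" using c by simp
      finally show ?thesis using bound[of a b] by (simp add: mult.assoc)
    next
      case False
      then have "\<bar>a\<bar> \<le> 1 / \<delta> * \<bar>b\<bar>" using \<delta> by (simp add: field_simps)
      then have "\<bar>b\<bar> * ((\<bar>a\<bar> + \<bar>b\<bar>) + (\<bar>a\<bar> + \<bar>b\<bar>) powr p) \<le> 1 * (1 + 1 / \<delta>) powr p * young p b"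
        using \<delta> by (intro key) (auto simp: algebra_simps)
      then have "c * (\<bar>b\<bar> * ((\<bar>a\<bar> + \<bar>b\<bar>) + (\<bar>a\<bar> + \<bar>b\<bar>) powr p)) \<le> c * (1 * (1 + 1 / \<delta>) powr p * young p b)"
        using c by (intro mult_left_mono)
      also have "\<dots> \<le> e * young p a + ?C * young p b" using e by simp
      finally show ?thesis using bound[of a b] by (simp add: mult.assoc)
    qed
  qed
qed

text \<open>\<open>F\<close> is an abstract antiderivative normalized at 0, so that the interval
  integral \<open>prim f\<close> is met only when the locale is interpreted. \<open>AR\<close> is
  the Ambrosetti-Rabinowitz condition.\<close>

locale superlinear =
  fixes f F f' :: "real \<Rightarrow> real" and p \<mu> a1 a2 :: real
  assumes f_deriv: "(f has_real_derivative f' t) (at t)"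
    and f'_cont: "continuous_on UNIV f'"
    and F_deriv: "(F has_real_derivative f t) (at t)" and F0: "F 0 = 0"
    and f0: "f 0 = 0" and f'0: "f' 0 = 0"
    and p1: "1 < p" and a1: "a1 > 0" and a2: "a2 > 0"
    and f'_growth: "\<bar>f' t\<bar> \<le> a1 + a2 * \<bar>t\<bar> powr (p - 1)"
    and mu: "\<mu> > 2"
    and AR: "t \<noteq> 0 \<Longrightarrow> 0 < \<mu> * F t \<and> \<mu> * F t \<le> t * f t"
    and mono: "mono_on {0<..} (\<lambda>t. \<sigma> * f (t * \<sigma>) / t)"
begin

lemma f_growth: "\<bar>f t\<bar> \<le> a1 * \<bar>t\<bar> + a2 * \<bar>t\<bar> powr p"
proof -
  have "\<bar>f t - f 0\<bar> \<le> (a1 + a2 * \<bar>t\<bar> powr (p - 1)) * \<bar>t - 0\<bar>"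
  proof (rule MVT_abs_bound[OF f_deriv])
    fix x :: real assume "\<bar>x\<bar> \<le> max \<bar>0\<bar> \<bar>t\<bar>"
    then have "a1 + a2 * \<bar>x\<bar> powr (p - 1) \<le> a1 + a2 * \<bar>t\<bar> powr (p - 1)"
      using a2 p1 by (intro add_mono mult_left_mono powr_mono2) auto
    then show "\<bar>f' x\<bar> \<le> a1 + a2 * \<bar>t\<bar> powr (p - 1)" using f'_growth[of x] by linarith
  qed
  moreover have "\<bar>t\<bar> powr (p - 1) * \<bar>t\<bar> = \<bar>t\<bar> powr p"
    using powr_mult_base[of "\<bar>t\<bar>" "p - 1"] by (simp add: mult.commute)
  ultimately show ?thesis by (simp add: f0 distrib_right mult.assoc)
qed

lemma f_continuous: "continuous_on UNIV f"
  using f_deriv by (meson DERIV_continuous continuous_at_imp_continuous_on)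

lemma F_continuous: "continuous_on UNIV F"
  using F_deriv by (meson DERIV_continuous continuous_at_imp_continuous_on)

lemma f_measurable [measurable]: "f \<in> borel_measurable borel"
  using f_continuous by (rule borel_measurable_continuous_onI)

lemma F_measurable [measurable]: "F \<in> borel_measurable borel"
  using F_continuous by (rule borel_measurable_continuous_onI)

lemma F_pos: "t \<noteq> 0 \<Longrightarrow> 0 < F t"
  using AR[of t] mu by (simp add: zero_less_mult_iff)

lemma F_nonneg: "0 \<le> F t"
  using F_pos[of t] F0 by (cases "t = 0") auto

lemma F_le: "\<mu> * F t \<le> t * f t"
  using AR[of t] by (cases "t = 0") (auto simp: F0)

lemma young_cont_F: "young_cont p F"
proof (rule young_cont_if_deriv[OF p1 F_deriv F0])
  show "0 \<le> a1 + a2" using a1 a2 by simp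
  show "\<bar>f t\<bar> \<le> (a1 + a2) * (\<bar>t\<bar> + \<bar>t\<bar> powr p)" for t
  proof -
    have "a1 * \<bar>t\<bar> + a2 * \<bar>t\<bar> powr p \<le> (a1 + a2) * \<bar>t\<bar> + (a1 + a2) * \<bar>t\<bar> powr p"
      using a1 a2 by (intro add_mono mult_right_mono) auto
    then show ?thesis using f_growth[of t] by (simp add: distrib_left)
  qed
qed

lemma young_cont_tf: "young_cont p (\<lambda>t. t * f t)"
proof (rule young_cont_if_deriv[OF p1])
  show "((\<lambda>t. t * f t) has_real_derivative f t + f' t * t) (at t)" for t
    by (rule DERIV_cong[OF DERIV_mult[OF DERIV_ident f_deriv]]) simp
  show "0 \<le> 2 * (a1 + a2)" using a1 a2 by simp
  show "\<bar>f t + f' t * t\<bar> \<le> 2 * (a1 + a2) * (\<bar>t\<bar> + \<bar>t\<bar> powr p)" for t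
  proof -
    have pw: "\<bar>t\<bar> powr (p - 1) * \<bar>t\<bar> = \<bar>t\<bar> powr p"
      using powr_mult_base[of "\<bar>t\<bar>" "p - 1"] by (simp add: mult.commute)
    have "\<bar>f' t * t\<bar> \<le> (a1 + a2 * \<bar>t\<bar> powr (p - 1)) * \<bar>t\<bar>"
      unfolding abs_mult by (intro mult_right_mono f'_growth) auto
    also have "\<dots> = a1 * \<bar>t\<bar> + a2 * \<bar>t\<bar> powr p" using pw by (simp add: distrib_right mult.assoc)
    finally have "\<bar>f t + f' t * t\<bar> \<le> 2 * (a1 * \<bar>t\<bar> + a2 * \<bar>t\<bar> powr p)"
      using f_growth[of t] abs_triangle_ineq[of "f t" "f' t * t"] by simp
    also have "a1 * \<bar>t\<bar> + a2 * \<bar>t\<bar> powr p \<le> (a1 + a2) * \<bar>t\<bar> + (a1 + a2) * \<bar>t\<bar> powr p"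
      using a1 a2 by (intro add_mono mult_right_mono) auto
    finally show ?thesis by (simp add: algebra_simps)
  qed
qed (simp add: f0)

text \<open>Near 0 the mean value theorem with f'(0) = 0 gives a linear term with small factor; for
  |t| at least \<delta> the linear growth is absorbed because |t| is then at most \<delta> powr (1 -
  p) times |t| powr p.\<close>

lemma f_small:
  assumes e: "e > 0"
  obtains C where "C \<ge> 0" "\<And>t. \<bar>f t\<bar> \<le> e * \<bar>t\<bar> + C * \<bar>t\<bar> powr p"
proof -
  have "isCont f' 0" using f'_cont by (simp add: continuous_on_eq_continuous_at)
  then obtain \<delta> where \<delta>: "\<delta> > 0" "\<And>x. \<bar>x\<bar> < \<delta> \<Longrightarrow> \<bar>f' x\<bar> < e"
    using e f'0 unfolding continuous_at_eps_delta dist_real_def by (metis diff_zero)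
  define C where "C = a1 * \<delta> powr (1 - p) + a2"
  have "\<bar>f t\<bar> \<le> e * \<bar>t\<bar> + C * \<bar>t\<bar> powr p" for t
  proof (cases "\<bar>t\<bar> < \<delta>")
    case True
    have "\<bar>f t - f 0\<bar> \<le> e * \<bar>t - 0\<bar>"
      by (rule MVT_abs_bound[OF f_deriv]) (use \<delta>(2) True in \<open>auto intro: less_imp_le\<close>)
    moreover have "0 \<le> C * \<bar>t\<bar> powr p" unfolding C_def using a1 a2 by simp
    ultimately show ?thesis by (simp add: f0)
  next
    case False
    then have t: "\<bar>t\<bar> \<ge> \<delta>" "\<bar>t\<bar> > 0" using \<delta>(1) by auto
    have "\<bar>t\<bar> = \<bar>t\<bar> powr (1 - p) * \<bar>t\<bar> powr p" using t by (simp add: powr_add[symmetric])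
    also have "\<dots> \<le> \<delta> powr (1 - p) * \<bar>t\<bar> powr p" using t \<delta> p1 by (intro mult_right_mono powr_mono2') auto
    finally have "a1 * \<bar>t\<bar> \<le> a1 * (\<delta> powr (1 - p) * \<bar>t\<bar> powr p)" using a1 by (intro mult_left_mono) auto
    then have "\<bar>f t\<bar> \<le> C * \<bar>t\<bar> powr p" using f_growth[of t] unfolding C_def by (simp add: distrib_right mult.assoc)
    moreover have "0 \<le> e * \<bar>t\<bar>" using e by simp
    ultimately show ?thesis by linarith
  qed
  moreover have "C \<ge> 0" unfolding C_def using a1 a2 by simp
  ultimately show ?thesis using that by blast
qed

lemma F_ray_deriv: "((\<lambda>t. F (t * \<sigma>)) has_real_derivative \<sigma> * f (t * \<sigma>)) (at t)"
  by (rule DERIV_cong[OF DERIV_chain2[OF F_deriv, of "\<lambda>t. t * \<sigma>"]])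
    (auto intro!: derivative_eq_intros)

lemma mono_ray: "0 < t \<Longrightarrow> t \<le> t' \<Longrightarrow> \<sigma> * f (t * \<sigma>) / t \<le> \<sigma> * f (t' * \<sigma>) / t'"
  using mono[of \<sigma>] by (auto simp: mono_on_def)

text \<open>In the variable \<open>\<tau> = t\<^sup>2\<close> the monotonicity hypothesis says that \<open>\<tau> \<mapsto> F (sqrt \<tau> * \<sigma>)\<close> is convex;
  this is the tangent line at \<open>\<tau> = 1\<close>.\<close>

lemma F_tangent:
  assumes t: "t \<ge> 0"
  shows "F \<sigma> + (t\<^sup>2 - 1) / 2 * (\<sigma> * f \<sigma>) \<le> F (t * \<sigma>)"
proof (cases "t = 0")
  case True
  \<comment> \<open>Monotonicity does not reach t = 0. There the claim reads
    \<open>2 * F \<sigma> \<le> \<sigma> * f \<sigma>\<close>, which follows from \<open>AR\<close>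
    and \<mu> > 2.\<close>
  have "2 * F \<sigma> \<le> \<mu> * F \<sigma>" using mu F_nonneg by (intro mult_right_mono) auto
  then show ?thesis using True F_le[of \<sigma>] by (simp add: F0)
next
  case False
  with t have t: "t > 0" by simp
  define H where "H x = F (x * \<sigma>) - x\<^sup>2 / 2 * (\<sigma> * f \<sigma>)" for x
  have Hd: "(H has_real_derivative \<sigma> * f (x * \<sigma>) - x * (\<sigma> * f \<sigma>)) (at x)" for x
    unfolding H_def by (auto intro!: derivative_eq_intros F_ray_deriv)
  have "H 1 \<le> H t"
  proof (cases "t \<ge> 1")
    case True
    show ?thesis
    proof (rule DERIV_nonneg_imp_nondecreasing[OF True])
      fix x :: real assume "1 \<le> x" "x \<le> t"
      then have "\<sigma> * f \<sigma> * x \<le> \<sigma> * f (x * \<sigma>)" using mono_ray[of 1 x \<sigma>] by (simp add: pos_le_divide_eq)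
      then show "\<exists>y. (H has_real_derivative y) (at x) \<and> 0 \<le> y" using Hd[of x] by (intro exI conjI) (auto simp: algebra_simps)
    qed
  next
    case False
    then have "t \<le> 1" by simp
    then show ?thesis
    proof (rule DERIV_nonpos_imp_nonincreasing)
      fix x :: real assume "t \<le> x" "x \<le> 1"
      then have "\<sigma> * f (x * \<sigma>) \<le> \<sigma> * f \<sigma> * x" using mono_ray[of x 1 \<sigma>] t by (simp add: pos_divide_le_eq)
      then show "\<exists>y. (H has_real_derivative y) (at x) \<and> y \<le> 0" using Hd[of x] by (intro exI conjI) (auto simp: algebra_simps)
    qed
  qed
  then show ?thesis by (simp add: H_def algebra_simps diff_divide_distrib)
qed

text \<open>By the tangent inequality \<open>H\<close> is minimal at 1; equality makes
  \<open>t\<close> another minimum point, so the derivative of \<open>H\<close> vanishes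
  there.\<close>

lemma F_tangent_eq:
  assumes t: "t > 0" and eq: "F (t * \<sigma>) = F \<sigma> + (t\<^sup>2 - 1) / 2 * (\<sigma> * f \<sigma>)"
  shows "f (t * \<sigma>) = t * f \<sigma>"
proof (cases "\<sigma> = 0")
  case False
  define H where "H x = F (x * \<sigma>) - x\<^sup>2 / 2 * (\<sigma> * f \<sigma>)" for x
  have Hd: "(H has_real_derivative \<sigma> * f (t * \<sigma>) - t * (\<sigma> * f \<sigma>)) (at t)"
    unfolding H_def by (auto intro!: derivative_eq_intros F_ray_deriv)
  have "\<sigma> * f (t * \<sigma>) - t * (\<sigma> * f \<sigma>) = 0"
  proof (rule DERIV_local_min[OF Hd t])
    show "\<forall>y. \<bar>t - y\<bar> < t \<longrightarrow> H t \<le> H y"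
    proof (intro allI impI)
      fix y assume "\<bar>t - y\<bar> < t"
      then have "F \<sigma> + (y\<^sup>2 - 1) / 2 * (\<sigma> * f \<sigma>) \<le> F (y * \<sigma>)" by (intro F_tangent) auto
      then show "H t \<le> H y" unfolding H_def eq by (simp add: algebra_simps diff_divide_distrib)
    qed
  qed
  then have "\<sigma> * (f (t * \<sigma>) - t * f \<sigma>) = 0" by (simp add: algebra_simps)
  then show ?thesis using False by simp
qed (simp add: f0)

text \<open>\<open>AR\<close> says that \<open>F (x * \<sigma>) * x powr (- \<mu>)\<close> has a
  nonnegative derivative in \<open>x\<close>.\<close>

lemma F_superquadratic:
  assumes t: "t \<ge> 1"
  shows "t powr \<mu> * F \<sigma> \<le> F (t * \<sigma>)"
proof -
  define H where "H x = F (x * \<sigma>) * x powr (- \<mu>)" for x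
  have "H 1 \<le> H t"
  proof (rule DERIV_nonneg_imp_nondecreasing[OF t])
    fix x :: real assume x: "1 \<le> x" "x \<le> t"
    have "(H has_real_derivative \<sigma> * f (x * \<sigma>) * x powr (- \<mu>) + (- \<mu> * x powr (- \<mu> - 1)) * F (x * \<sigma>)) (at x)"
      unfolding H_def using x by (intro DERIV_mult F_ray_deriv has_real_derivative_powr) auto
    moreover have "\<sigma> * f (x * \<sigma>) * x powr (- \<mu>) + (- \<mu> * x powr (- \<mu> - 1)) * F (x * \<sigma>) = x powr (- \<mu> - 1) * ((x * \<sigma>) * f (x * \<sigma>) - \<mu> * F (x * \<sigma>))"
    proof -
      have "x powr (- \<mu>) = x powr (- \<mu> - 1) * x" using powr_mult_base[of x "- \<mu> - 1"] x by (simp add: mult.commute)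
      then show ?thesis by (simp add: algebra_simps)
    qed
    moreover have "0 \<le> x powr (- \<mu> - 1) * ((x * \<sigma>) * f (x * \<sigma>) - \<mu> * F (x * \<sigma>))" using F_le[of "x * \<sigma>"] by simp
    ultimately show "\<exists>y. (H has_real_derivative y) (at x) \<and> 0 \<le> y" by auto
  qed
  then have "F \<sigma> \<le> F (t * \<sigma>) / t powr \<mu>" by (simp add: H_def powr_minus divide_inverse)
  then show ?thesis using t by (simp add: pos_le_divide_eq mult.commute)
qed

lemma F_quadratic_le:
  assumes "0 \<le> t" "t \<le> 1"
  shows "F (t * \<sigma>) \<le> t\<^sup>2 * F \<sigma>"
proof (cases "t = 0")
  case False
  with assms have t: "0 < t" by simp
  have "1 / t \<ge> 1" using t assms by simp
  then have "(1 / t) powr 2 * F (t * \<sigma>) \<le> (1 / t) powr \<mu> * F (t * \<sigma>)"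
    using mu F_nonneg by (intro mult_right_mono powr_mono) auto
  also have "\<dots> \<le> F (1 / t * (t * \<sigma>))" using \<open>1 / t \<ge> 1\<close> by (rule F_superquadratic)
  also have "1 / t * (t * \<sigma>) = \<sigma>" using t by simp
  finally show ?thesis using t by (simp add: field_simps)
qed (simp add: F0)

end

section \<open>Function space and Nemytskii functionals\<close>

text \<open>The Brezis-Lieb mechanism. The positive part of |R n| - e g n is dominated by the fixed
  function C h and still tends to zero, while the subtracted part integrates to at most e B. The
  functions \<open>g n\<close> are only bounded in \<open>L^1\<close>.\<close>

lemma L1_tendsto_0_split:
  fixes R :: "nat \<Rightarrow> 'a \<Rightarrow> real"
  assumes Rm[measurable]: "\<And>n. R n \<in> borel_measurable M" and lim: "AE x in M. (\<lambda>n. R n x) \<longlonglongrightarrow> 0"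
    and gi: "\<And>n. integrable M (g n)" and g0: "\<And>n x. 0 \<le> g n x" and gB: "\<And>n. (\<integral>x. g n x \<partial>M) \<le> B"
    and hi: "integrable M h" and h0: "\<And>x. 0 \<le> h x"
    and dom: "\<And>e. e > 0 \<Longrightarrow> \<exists>C\<ge>0. \<forall>n x. \<bar>R n x\<bar> \<le> e * g n x + C * h x"
  shows "\<And>n. integrable M (R n)" "(\<lambda>n. \<integral>x. \<bar>R n x\<bar> \<partial>M) \<longlonglongrightarrow> 0"
proof -
  have gm[measurable]: "g n \<in> borel_measurable M" "h \<in> borel_measurable M" for n using gi hi by auto
  have B0: "0 \<le> B"
  proof -
    have "0 \<le> (\<integral>x. g 0 x \<partial>M)" by (rule integral_nonneg_AE) (simp add: g0)
    then show ?thesis using gB[of 0] by linarith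
  qed
  show Ri: "integrable M (R n)" for n
  proof -
    obtain C where "C \<ge> 0" and C: "\<And>n x. \<bar>R n x\<bar> \<le> 1 * g n x + C * h x" using dom[of 1] by auto
    have "integrable M (\<lambda>x. 1 * g n x + C * h x)" using gi hi by simp
    then show ?thesis
      by (rule Bochner_Integration.integrable_bound) (use C in \<open>auto intro!: AE_I2 intro: order_trans[OF _ abs_ge_self]\<close>)
  qed
  show "(\<lambda>n. \<integral>x. \<bar>R n x\<bar> \<partial>M) \<longlonglongrightarrow> 0"
  proof (rule LIMSEQ_I)
    fix r :: real assume r: "r > 0"
    define e where "e = r / (2 * (B + 1))"
    have e: "e > 0" "e * B \<le> r / 2" using r B0 by (auto simp: e_def field_simps add_pos_nonneg)
    obtain C where C0: "C \<ge> 0" and C: "\<And>n x. \<bar>R n x\<bar> \<le> e * g n x + C * h x" using dom[OF e(1)] by auto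
    let ?W = "\<lambda>n x. max 0 (\<bar>R n x\<bar> - e * g n x)"
    have "(\<lambda>n. \<integral>x. ?W n x \<partial>M) \<longlonglongrightarrow> (\<integral>x. 0 \<partial>M)"
    proof (rule integral_dominated_convergence[where w="\<lambda>x. C * h x"])
      show "AE x in M. (\<lambda>n. ?W n x) \<longlonglongrightarrow> 0"
        using lim
      proof eventually_elim
        case (elim x)
        show ?case
        proof (rule real_tendsto_0_le[OF _ _ tendsto_rabs_zero[OF elim]])
          show "?W n x \<le> \<bar>R n x\<bar>" for n using g0[of n x] e by simp
        qed simp
      qed
      show "AE x in M. norm (?W n x) \<le> C * h x" for n
      proof (rule AE_I2)
        fix x
        show "norm (?W n x) \<le> C * h x" using C[of n x] mult_nonneg_nonneg[OF C0 h0[of x]] by simp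
      qed
    qed (use hi in auto)
    then have L: "(\<lambda>n. \<integral>x. ?W n x \<partial>M) \<longlonglongrightarrow> 0" by simp
    obtain N where N: "\<And>n. n \<ge> N \<Longrightarrow> norm ((\<integral>x. ?W n x \<partial>M) - 0) < r / 2"
      using LIMSEQ_D[OF L, of "r / 2"] r by auto
    have "norm ((\<integral>x. \<bar>R n x\<bar> \<partial>M) - 0) < r" if "n \<ge> N" for n
    proof -
      have Wi: "integrable M (?W n)" using Ri gi by (intro integrable_max) auto
      have "(\<integral>x. \<bar>R n x\<bar> \<partial>M) \<le> (\<integral>x. ?W n x + e * g n x \<partial>M)"
        using Ri gi Wi by (intro integral_mono) auto
      also have "\<dots> = (\<integral>x. ?W n x \<partial>M) + e * (\<integral>x. g n x \<partial>M)" using Wi gi by simp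
      also have "\<dots> < r"
      proof -
        have "e * (\<integral>x. g n x \<partial>M) \<le> e * B" using e gB by (intro mult_left_mono) auto
        moreover have "(\<integral>x. ?W n x \<partial>M) < r / 2" using N[OF that] by (simp add: abs_less_iff)
        ultimately show ?thesis using e(2) by linarith
      qed
      finally show ?thesis by simp
    qed
    then show "\<exists>N. \<forall>n\<ge>N. norm ((\<integral>x. \<bar>R n x\<bar> \<partial>M) - 0) < r" by blast
  qed
qed

lemma tendsto_integral_if_abs:
  fixes R :: "nat \<Rightarrow> 'a \<Rightarrow> real"
  assumes "(\<lambda>n. \<integral>x. \<bar>R n x\<bar> \<partial>M) \<longlonglongrightarrow> 0"
  shows "(\<lambda>n. \<integral>x. R n x \<partial>M) \<longlonglongrightarrow> 0"
proof (rule tendsto_rabs_zero_cancel)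
  show "(\<lambda>n. \<bar>\<integral>x. R n x \<partial>M\<bar>) \<longlonglongrightarrow> 0"
    by (rule real_tendsto_0_le[OF _ _ assms]) (auto intro: integral_abs_bound)
qed

section \<open>Linear structure, translations and quadratic forms\<close>

lemma L2_algebra:
  fixes g h :: "'a \<Rightarrow> real"
  assumes [measurable]: "g \<in> borel_measurable M" "h \<in> borel_measurable M"
    and g: "integrable M (\<lambda>x. (g x)\<^sup>2)" and h: "integrable M (\<lambda>x. (h x)\<^sup>2)"
  shows "integrable M (\<lambda>x. g x * h x)" "integrable M (\<lambda>x. (g x + h x)\<^sup>2)" "integrable M (\<lambda>x. (g x - h x)\<^sup>2)"
    "integrable M (\<lambda>x. (c * g x)\<^sup>2)"
proof -
  have i: "integrable M (\<lambda>x. (g x)\<^sup>2 + (h x)\<^sup>2)" using g h by simp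
  show p: "integrable M (\<lambda>x. g x * h x)"
  proof (rule Bochner_Integration.integrable_bound[OF i])
    have "\<bar>x * y\<bar> \<le> x\<^sup>2 + y\<^sup>2" for x y :: real
      using sum_squares_bound[of "\<bar>x\<bar>" "\<bar>y\<bar>"] mult_nonneg_nonneg[OF abs_ge_zero[of x] abs_ge_zero[of y]]
      unfolding abs_mult power2_abs by linarith
    then show "AE x in M. norm (g x * h x) \<le> norm ((g x)\<^sup>2 + (h x)\<^sup>2)" by simp
  qed measurable
  show "integrable M (\<lambda>x. (g x + h x)\<^sup>2)" using g h p by (simp add: power2_sum mult.assoc)
  show "integrable M (\<lambda>x. (g x - h x)\<^sup>2)" using g h p by (simp add: power2_diff mult.assoc)
  show "integrable M (\<lambda>x. (c * g x)\<^sup>2)" using g by (simp add: power_mult_distrib)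
qed

lemma frac_space_add:
  assumes "u \<in> frac_space s" "v \<in> frac_space s"
  shows "(\<lambda>x. u x + v x) \<in> frac_space s"
proof -
  note u = frac_spaceD[OF assms(1)] and v = frac_spaceD[OF assms(2)]
  have [measurable]: "u \<in> borel_measurable borel" "v \<in> borel_measurable borel" using u v by auto
  show ?thesis
    using L2_algebra(2)[OF _ _ u(2) v(2)] L2_algebra(2)[OF _ _ u(3) v(3)] by (simp add: frac_space_def frac_diff_add)
qed

lemma frac_space_cmult:
  assumes "u \<in> frac_space s"
  shows "(\<lambda>x. c * u x) \<in> frac_space s"
  using frac_spaceD[OF assms] by (simp add: frac_space_def frac_diff_cmult power_mult_distrib)

lemma frac_space_diff:
  assumes "u \<in> frac_space s" "v \<in> frac_space s"
  shows "(\<lambda>x. u x - v x) \<in> frac_space s"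
  using frac_space_add[OF assms(1) frac_space_cmult[OF assms(2), of "-1"]] by simp

lemma sob_sq_cmult: "sob_sq s (\<lambda>x. c * u x) = c\<^sup>2 * sob_sq s u"
  unfolding sob_sq_def frac_diff_cmult by (simp add: power_mult_distrib distrib_left)

text \<open>The kernel sees x and y only through x - y, so shifting \<open>u\<close> shifts the
  argument by \<open>(0, h, h)\<close>, and invariance of the seminorm is that of Lebesgue measure
  on the product.\<close>

lemma frac_diff_translate: "frac_diff s (\<lambda>x. u (h + x)) q = frac_diff s u ((0, h, h) + q)"
  by (simp add: frac_diff_def frac_kernel_def)

lemma frac_space_translate:
  assumes "u \<in> frac_space s"
  shows "(\<lambda>x. u (h + x)) \<in> frac_space s"
proof -
  note u = frac_spaceD[OF assms]
  have "(\<lambda>x. u (h + x)) \<in> borel_measurable borel" using u(1) by measurable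
  moreover have "integrable lborel (\<lambda>x. (u (h + x))\<^sup>2)" by (rule integrable_lborel_translate[OF u(2)])
  moreover have "integrable lborel (\<lambda>q. (frac_diff s u ((0, h, h) + q))\<^sup>2)" by (rule integrable_lborel_translate[OF u(3)])
  ultimately show ?thesis by (simp add: frac_space_def frac_diff_translate)
qed

text \<open>For \<open>W = V\<close> this is the squared norm of the space. The potential is a
  parameter because translating functions replaces \<open>V\<close> by its translates and their
  limits.\<close>

definition quad :: "real \<Rightarrow> ('a::euclidean_space \<Rightarrow> real) \<Rightarrow> ('a \<Rightarrow> real) \<Rightarrow> real" where
  "quad s W u = (\<integral>q. (frac_diff s u q)\<^sup>2 \<partial>lborel) + (\<integral>x. W x * (u x)\<^sup>2 \<partial>lborel)"

definition bil :: "real \<Rightarrow> ('a::euclidean_space \<Rightarrow> real) \<Rightarrow> ('a \<Rightarrow> real) \<Rightarrow> ('a \<Rightarrow> real) \<Rightarrow> real" where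
  "bil s W u v = (\<integral>q. frac_diff s u q * frac_diff s v q \<partial>lborel) + (\<integral>x. W x * (u x * v x) \<partial>lborel)"

lemma quad_translate:
  fixes u W :: "'a::euclidean_space \<Rightarrow> real"
  assumes [measurable]: "u \<in> borel_measurable borel" "W \<in> borel_measurable borel"
  shows "quad s (\<lambda>x. W (h + x)) (\<lambda>x. u (h + x)) = quad s W u"
  unfolding quad_def frac_diff_translate
  using integral_lborel_translate[of "\<lambda>q. (frac_diff s u q)\<^sup>2" "(0, h, h)"] integral_lborel_translate[of "\<lambda>x. W x * (u x)\<^sup>2" h]
  by simp

lemma sob_sq_translate:
  fixes u :: "'a::euclidean_space \<Rightarrow> real"
  assumes [measurable]: "u \<in> borel_measurable borel"
  shows "sob_sq s (\<lambda>x. u (h + x)) = sob_sq s u"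
  using quad_translate[of u "\<lambda>_. 1" s h] unfolding quad_def sob_sq_def by simp

lemma young_add_le:
  assumes "p > 1"
  shows "young p (\<bar>a\<bar> + \<bar>b\<bar>) \<le> 2 powr (p + 1) * (young p a + young p b)"
proof -
  let ?m = "max \<bar>a\<bar> \<bar>b\<bar>"
  have m: "\<bar>a\<bar> + \<bar>b\<bar> \<le> 2 * ?m" by simp
  have n: "\<bar>\<bar>a\<bar> + \<bar>b\<bar>\<bar> = \<bar>a\<bar> + \<bar>b\<bar>" by simp
  have "young p (\<bar>a\<bar> + \<bar>b\<bar>) \<le> (2 * ?m)\<^sup>2 + (2 * ?m) powr (p + 1)"
    unfolding young_def n using assms by (intro add_mono powr_mono2 power_mono m) auto
  also have "\<dots> = 2\<^sup>2 * ?m\<^sup>2 + 2 powr (p + 1) * ?m powr (p + 1)" by (simp only: powr_mult power_mult_distrib)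
  also have "\<dots> \<le> 2 powr (p + 1) * ?m\<^sup>2 + 2 powr (p + 1) * ?m powr (p + 1)"
  proof (intro add_right_mono mult_right_mono)
    show "(2::real)\<^sup>2 \<le> 2 powr (p + 1)" using assms powr_mono[of 2 "p + 1" "2::real"] by simp
  qed simp
  also have "\<dots> = 2 powr (p + 1) * young p ?m" by (simp add: young_def distrib_left)
  also have "\<dots> \<le> 2 powr (p + 1) * (young p a + young p b)"
  proof (rule mult_left_mono)
    have "young p \<bar>a\<bar> = young p a" "young p \<bar>b\<bar> = young p b" by (simp_all add: young_def)
    then show "young p ?m \<le> young p a + young p b"
      using young_nonneg[of p a] young_nonneg[of p b] by (cases "\<bar>a\<bar> \<le> \<bar>b\<bar>") (auto simp: max_def)
  qed simp
  finally show ?thesis .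
qed

section \<open>The variational setting for a bounded potential\<close>

locale frac_problem = superlinear f F f' p \<mu> a1 a2
  for f F f' :: "real \<Rightarrow> real" and p \<mu> a1 a2 :: real +
  fixes V :: "'a::euclidean_space \<Rightarrow> real" and s V0 V1 :: real
  assumes s0: "0 < s" and s1: "s < 1" and Ns: "2 * s < DIM('a)"
    and pN: "p < (DIM('a) + 2 * s) / (DIM('a) - 2 * s)"
    and V0: "0 < V0" and V_meas: "V \<in> borel_measurable borel" and V_bounds: "\<And>x. V0 \<le> V x" "\<And>x. V x \<le> V1"
begin

text \<open>A class stable under translations and pointwise limits of sequences, on which the
  constants below are uniform: bounds between \<open>V0 > 0\<close> and \<open>V1\<close> make every
  \<open>quad s W\<close> equivalent to \<open>sob_sq s\<close> on one and the same space.\<close>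

definition pot :: "('a \<Rightarrow> real) \<Rightarrow> bool" where
  "pot W \<longleftrightarrow> W \<in> borel_measurable borel \<and> (\<forall>x. V0 \<le> W x \<and> W x \<le> V1)"

lemma potD: "pot W \<Longrightarrow> W \<in> borel_measurable borel" "pot W \<Longrightarrow> V0 \<le> W x" "pot W \<Longrightarrow> W x \<le> V1" "pot W \<Longrightarrow> 0 \<le> W x"
  using V0 unfolding pot_def by (auto intro: order_trans[of 0 V0])

lemma pot_abs_le: "pot W \<Longrightarrow> \<bar>W x\<bar> \<le> V1"
  using potD(3,4)[of W x] by simp

lemma pot_V: "pot V"
  using V_meas V_bounds by (simp add: pot_def)

lemma pot_translate: "pot W \<Longrightarrow> pot (\<lambda>x. W (h + x))"
  unfolding pot_def by auto

abbreviation E :: "('a \<Rightarrow> real) set" where "E \<equiv> frac_space s"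

lemma pot_integrable:
  assumes W: "pot W" and g: "integrable lborel (g :: 'a \<Rightarrow> real)"
  shows "integrable lborel (\<lambda>x. W x * g x)"
proof -
  have [measurable]: "W \<in> borel_measurable borel" "g \<in> borel_measurable borel" using potD[OF W] g by auto
  have "integrable lborel (\<lambda>x. V1 * g x)" using g by simp
  then show ?thesis
  proof (rule Bochner_Integration.integrable_bound)
    show "AE x in lborel. norm (W x * g x) \<le> norm (V1 * g x)"
      using pot_abs_le[OF W] by (auto simp: abs_mult intro!: AE_I2 mult_right_mono intro: order_trans[OF _ abs_ge_self])
  qed measurable
qed

lemma quad_integrable:
  assumes "pot W" "u \<in> E" "v \<in> E"
  shows "integrable lborel (\<lambda>q. frac_diff s u q * frac_diff s v q)" "integrable lborel (\<lambda>x. W x * (u x * v x))"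
    "integrable lborel (\<lambda>x. W x * (u x)\<^sup>2)"
proof -
  note u = frac_spaceD[OF assms(2)] and v = frac_spaceD[OF assms(3)]
  have [measurable]: "u \<in> borel_measurable borel" "v \<in> borel_measurable borel" using u v by auto
  show "integrable lborel (\<lambda>q. frac_diff s u q * frac_diff s v q)" by (rule L2_algebra(1)[OF _ _ u(3) v(3)]) auto
  show "integrable lborel (\<lambda>x. W x * (u x * v x))" by (intro pot_integrable assms L2_algebra(1)[OF _ _ u(2) v(2)]) auto
  show "integrable lborel (\<lambda>x. W x * (u x)\<^sup>2)" by (intro pot_integrable assms u)
qed

lemma quad_add:
  assumes W: "pot W" and u: "u \<in> E" and v: "v \<in> E"
  shows "quad s W (\<lambda>x. u x + t * v x) = quad s W u + 2 * t * bil s W u v + t\<^sup>2 * quad s W v"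
proof -
  note i = quad_integrable[OF W u v] and iu = quad_integrable[OF W u u] and iv = quad_integrable[OF W v v]
  note uD = frac_spaceD[OF u] and vD = frac_spaceD[OF v]
  have 1: "(frac_diff s (\<lambda>x. u x + t * v x) q)\<^sup>2 = (frac_diff s u q)\<^sup>2 + 2 * t * (frac_diff s u q * frac_diff s v q) + t\<^sup>2 * (frac_diff s v q)\<^sup>2" for q
    by (simp add: frac_diff_add frac_diff_cmult power2_eq_square algebra_simps)
  have 2: "W x * (u x + t * v x)\<^sup>2 = W x * (u x)\<^sup>2 + 2 * t * (W x * (u x * v x)) + t\<^sup>2 * (W x * (v x)\<^sup>2)" for x
    by (simp add: power2_eq_square algebra_simps)
  have 3: "(\<integral>q. (frac_diff s (\<lambda>x. u x + t * v x) q)\<^sup>2 \<partial>lborel) = (\<integral>q. (frac_diff s u q)\<^sup>2 \<partial>lborel) + 2 * t * (\<integral>q. frac_diff s u q * frac_diff s v q \<partial>lborel) + t\<^sup>2 * (\<integral>q. (frac_diff s v q)\<^sup>2 \<partial>lborel)"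
    unfolding 1 using i iu iv uD(3) vD(3) by simp
  have 4: "(\<integral>x. W x * (u x + t * v x)\<^sup>2 \<partial>lborel) = (\<integral>x. W x * (u x)\<^sup>2 \<partial>lborel) + 2 * t * (\<integral>x. W x * (u x * v x) \<partial>lborel) + t\<^sup>2 * (\<integral>x. W x * (v x)\<^sup>2 \<partial>lborel)"
    unfolding 2 using i iu iv by simp
  show ?thesis unfolding quad_def bil_def 3 4 by (simp add: algebra_simps)
qed

lemma quad_cmult: "quad s W (\<lambda>x. c * u x) = c\<^sup>2 * quad s W u"
proof -
  have eq: "W x * (c * u x)\<^sup>2 = c\<^sup>2 * (W x * (u x)\<^sup>2)" for x by (simp add: power_mult_distrib)
  have eq2: "(frac_diff s (\<lambda>x. c * u x) q)\<^sup>2 = c\<^sup>2 * (frac_diff s u q)\<^sup>2" for q by (simp add: frac_diff_cmult power_mult_distrib)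
  show ?thesis unfolding quad_def eq eq2 by (simp add: distrib_left)
qed

lemma bil_add:
  assumes W: "pot W" and u: "u \<in> E" and v: "v \<in> E"
  shows "bil s W (\<lambda>x. a * u x + b * v x) v = a * bil s W u v + b * quad s W v"
proof -
  note i = quad_integrable[OF W u v] and iv = quad_integrable[OF W v v]
  note vD = frac_spaceD[OF v]
  have 1: "frac_diff s (\<lambda>x. a * u x + b * v x) q * frac_diff s v q = a * (frac_diff s u q * frac_diff s v q) + b * (frac_diff s v q)\<^sup>2" for q
    by (simp add: frac_diff_add frac_diff_cmult power2_eq_square algebra_simps)
  have 2: "W x * ((a * u x + b * v x) * v x) = a * (W x * (u x * v x)) + b * (W x * (v x)\<^sup>2)" for x
    by (simp add: power2_eq_square algebra_simps)
  show ?thesis unfolding quad_def bil_def 1 2 using i iv vD(3) by (simp add: algebra_simps)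
qed

definition c0 :: real where "c0 = min 1 V0"
definition c1 :: real where "c1 = max 1 V1"

lemma c0_pos: "0 < c0" and c1_pos: "0 < c1"
  using V0 by (auto simp: c0_def c1_def)

lemma quad_bounds:
  assumes W: "pot W" and u: "u \<in> E"
  shows "c0 * sob_sq s u \<le> quad s W u" "quad s W u \<le> c1 * sob_sq s u" "V0 * (\<integral>x. (u x)\<^sup>2 \<partial>lborel) \<le> quad s W u"
proof -
  note uD = frac_spaceD[OF u]
  let ?A = "\<integral>q. (frac_diff s u q)\<^sup>2 \<partial>lborel" and ?B = "\<integral>x. (u x)\<^sup>2 \<partial>lborel" and ?C = "\<integral>x. W x * (u x)\<^sup>2 \<partial>lborel"
  have A: "0 \<le> ?A" and B: "0 \<le> ?B" by auto
  have "(\<integral>x. V0 * (u x)\<^sup>2 \<partial>lborel) \<le> ?C"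
    using potD[OF W] uD quad_integrable(3)[OF W u u] by (intro integral_mono) (auto intro: mult_right_mono)
  then have 1: "V0 * ?B \<le> ?C" by simp
  have "?C \<le> (\<integral>x. V1 * (u x)\<^sup>2 \<partial>lborel)"
    using potD[OF W] uD quad_integrable(3)[OF W u u] by (intro integral_mono) (auto intro: mult_right_mono)
  then have 2: "?C \<le> V1 * ?B" by simp
  have "c0 * ?A \<le> 1 * ?A" by (rule mult_right_mono[OF _ A]) (simp add: c0_def)
  moreover have "c0 * ?B \<le> V0 * ?B" by (rule mult_right_mono[OF _ B]) (simp add: c0_def)
  ultimately show "c0 * sob_sq s u \<le> quad s W u" using 1 unfolding quad_def sob_sq_def distrib_left by linarith
  have "1 * ?A \<le> c1 * ?A" by (rule mult_right_mono[OF _ A]) (simp add: c1_def)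
  moreover have "V1 * ?B \<le> c1 * ?B" by (rule mult_right_mono[OF _ B]) (simp add: c1_def)
  ultimately show "quad s W u \<le> c1 * sob_sq s u" using 2 unfolding quad_def sob_sq_def distrib_left by linarith
  show "V0 * ?B \<le> quad s W u" using 1 A unfolding quad_def by linarith
qed

lemma quad_nonneg: "pot W \<Longrightarrow> u \<in> E \<Longrightarrow> 0 \<le> quad s W u"
  using quad_bounds(1)[of W u] c0_pos sob_sq_nonneg[of s u] by (meson less_imp_le mult_nonneg_nonneg order_trans)

lemma quad_pos_iff: "pot W \<Longrightarrow> u \<in> E \<Longrightarrow> 0 < quad s W u \<longleftrightarrow> 0 < sob_sq s u"
  using quad_bounds(1,2)[of W u] c0_pos c1_pos sob_sq_nonneg[of s u] quad_nonneg[of W u]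
  by (metis less_eq_real_def mult_pos_pos mult_zero_right not_le order_less_le_trans)

lemma sob_sq_le_quad: "pot W \<Longrightarrow> u \<in> E \<Longrightarrow> sob_sq s u \<le> quad s W u / c0"
  using quad_bounds(1)[of W u] c0_pos by (simp add: pos_le_divide_eq mult.commute)

lemma subcritical: "2 < p + 1" "(p + 1) * (DIM('a) - 2 * s) < 2 * DIM('a)"
proof -
  show "2 < p + 1" using p1 by simp
  have "p * (DIM('a) - 2 * s) < DIM('a) + 2 * s" using pN Ns by (simp add: pos_less_divide_eq)
  then show "(p + 1) * (DIM('a) - 2 * s) < 2 * DIM('a)" by (simp add: algebra_simps)
qed

lemma ball_L2_le_sob_sq:
  assumes u: "u \<in> E"
  shows "(\<integral>y. (u y)\<^sup>2 * indicat_real (ball x 1) y \<partial>lborel) \<le> sob_sq s u"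
proof -
  note uD = frac_spaceD[OF u]
  have "(\<integral>y. (u y)\<^sup>2 * indicat_real (ball x 1) y \<partial>lborel) \<le> (\<integral>y. (u y)\<^sup>2 \<partial>lborel)"
    by (intro integral_mono L2_integrable_on_ball(2) uD) (auto simp: indicator_def)
  moreover have "0 \<le> (\<integral>q. (frac_diff s u q)\<^sup>2 \<partial>lborel)" by simp
  ultimately show ?thesis unfolding sob_sq_def by linarith
qed

lemma vanishing_ex:
  "\<exists>C \<alpha> \<beta>. C > 0 \<and> \<alpha> > 0 \<and> \<beta> > 0 \<and> \<alpha> + \<beta> = (p + 1) / 2 \<and>
    (\<forall>(u :: 'a \<Rightarrow> real) K \<eta>. u \<in> E \<longrightarrow> sob_sq s u \<le> K \<longrightarrow> 0 < \<eta> \<longrightarrow> \<eta> \<le> K \<longrightarrow>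
      (\<forall>x. (\<integral>y. (u y)\<^sup>2 * indicat_real (ball x 1) y \<partial>lborel) \<le> \<eta>) \<longrightarrow>
      integrable lborel (\<lambda>x. \<bar>u x\<bar> powr (p + 1)) \<and> (\<integral>x. \<bar>u x\<bar> powr (p + 1) \<partial>lborel) \<le> C * K powr \<alpha> * \<eta> powr \<beta>)"
proof -
  obtain C \<alpha> \<beta> where C: "C > 0" "\<alpha> > 0" "\<beta> > 0" "\<alpha> + \<beta> = (p + 1) / 2"
    and *: "\<And>(u :: 'a \<Rightarrow> real) K \<eta>. u \<in> frac_space s \<Longrightarrow> sob_sq s u \<le> K \<Longrightarrow> 0 < \<eta> \<Longrightarrow> \<eta> \<le> K \<Longrightarrow>
      (\<And>x. (\<integral>y. (u y)\<^sup>2 * indicat_real (ball x 1) y \<partial>lborel) \<le> \<eta>) \<Longrightarrow>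
      (\<integral>\<^sup>+x. ennreal (\<bar>u x\<bar> powr (p + 1)) \<partial>lborel) \<le> ennreal (C * K powr \<alpha> * \<eta> powr \<beta>)"
    using frac_vanishing[OF s0 s1 Ns subcritical] by blast
  have "integrable lborel (\<lambda>x. \<bar>u x\<bar> powr (p + 1)) \<and> (\<integral>x. \<bar>u x\<bar> powr (p + 1) \<partial>lborel) \<le> C * K powr \<alpha> * \<eta> powr \<beta>"
    if u: "u \<in> E" "sob_sq s u \<le> K" "0 < \<eta>" "\<eta> \<le> K" and v: "\<forall>x. (\<integral>y. (u y)\<^sup>2 * indicat_real (ball x 1) y \<partial>lborel) \<le> \<eta>" for u :: "'a \<Rightarrow> real" and K \<eta>
  proof -
    have [measurable]: "u \<in> borel_measurable borel" using frac_spaceD[OF u(1)] by simp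
    have le: "(\<integral>\<^sup>+x. ennreal (\<bar>u x\<bar> powr (p + 1)) \<partial>lborel) \<le> ennreal (C * K powr \<alpha> * \<eta> powr \<beta>)" using *[OF u] v by blast
    have i: "integrable lborel (\<lambda>x. \<bar>u x\<bar> powr (p + 1))"
    proof (rule integrableI_bounded)
      show "(\<integral>\<^sup>+x. ennreal (norm (\<bar>u x\<bar> powr (p + 1))) \<partial>lborel) < \<infinity>" using le by (simp add: le_less_trans)
    qed measurable
    have "ennreal (\<integral>x. \<bar>u x\<bar> powr (p + 1) \<partial>lborel) \<le> ennreal (C * K powr \<alpha> * \<eta> powr \<beta>)"
      using le i by (subst nn_integral_eq_integral[symmetric]) auto
    then show ?thesis using i C(1) by (simp add: ennreal_le_iff)
  qed
  then show ?thesis using C by blast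
qed

lemma sobolev_ex:
  "\<exists>C>0. \<forall>(u :: 'a \<Rightarrow> real) K. u \<in> E \<longrightarrow> sob_sq s u \<le> K \<longrightarrow> 0 < K \<longrightarrow>
      integrable lborel (\<lambda>x. \<bar>u x\<bar> powr (p + 1)) \<and> (\<integral>x. \<bar>u x\<bar> powr (p + 1) \<partial>lborel) \<le> C * K powr ((p + 1) / 2)"
proof -
  obtain C \<alpha> \<beta> where C: "C > 0" "\<alpha> + \<beta> = (p + 1) / 2"
    and *: "\<And>(u :: 'a \<Rightarrow> real) K \<eta>. u \<in> E \<Longrightarrow> sob_sq s u \<le> K \<Longrightarrow> 0 < \<eta> \<Longrightarrow> \<eta> \<le> K \<Longrightarrow>
      (\<forall>x. (\<integral>y. (u y)\<^sup>2 * indicat_real (ball x 1) y \<partial>lborel) \<le> \<eta>) \<Longrightarrow>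
      integrable lborel (\<lambda>x. \<bar>u x\<bar> powr (p + 1)) \<and> (\<integral>x. \<bar>u x\<bar> powr (p + 1) \<partial>lborel) \<le> C * K powr \<alpha> * \<eta> powr \<beta>"
    using vanishing_ex by blast
  have "integrable lborel (\<lambda>x. \<bar>u x\<bar> powr (p + 1)) \<and> (\<integral>x. \<bar>u x\<bar> powr (p + 1) \<partial>lborel) \<le> C * K powr ((p + 1) / 2)"
    if "u \<in> E" "sob_sq s u \<le> K" "0 < K" for u :: "'a \<Rightarrow> real" and K
    using *[OF that(1,2,3) order_refl] order_trans[OF ball_L2_le_sob_sq[OF that(1)] that(2)]
    unfolding C(2)[symmetric] powr_add by (simp add: mult.assoc)
  then show ?thesis using C by blast
qed

definition CS :: real where
  "CS = (SOME C. C > 0 \<and> (\<forall>(u :: 'a \<Rightarrow> real) K. u \<in> E \<longrightarrow> sob_sq s u \<le> K \<longrightarrow> 0 < K \<longrightarrow>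
      integrable lborel (\<lambda>x. \<bar>u x\<bar> powr (p + 1)) \<and> (\<integral>x. \<bar>u x\<bar> powr (p + 1) \<partial>lborel) \<le> C * K powr ((p + 1) / 2)))"

lemma CS_pos: "CS > 0" and
  sobolev: "u \<in> E \<Longrightarrow> sob_sq s u \<le> K \<Longrightarrow> 0 < K \<Longrightarrow> (\<integral>x. \<bar>u x\<bar> powr (p + 1) \<partial>lborel) \<le> CS * K powr ((p + 1) / 2)" and
  powr_integrable: "u \<in> E \<Longrightarrow> integrable lborel (\<lambda>x. \<bar>u x\<bar> powr (p + 1))"
proof -
  have *: "CS > 0 \<and> (\<forall>(u :: 'a \<Rightarrow> real) K. u \<in> E \<longrightarrow> sob_sq s u \<le> K \<longrightarrow> 0 < K \<longrightarrow>
      integrable lborel (\<lambda>x. \<bar>u x\<bar> powr (p + 1)) \<and> (\<integral>x. \<bar>u x\<bar> powr (p + 1) \<partial>lborel) \<le> CS * K powr ((p + 1) / 2))"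
    unfolding CS_def by (rule someI_ex) (use sobolev_ex in blast)
  show "CS > 0" using * by blast
  show "u \<in> E \<Longrightarrow> sob_sq s u \<le> K \<Longrightarrow> 0 < K \<Longrightarrow> (\<integral>x. \<bar>u x\<bar> powr (p + 1) \<partial>lborel) \<le> CS * K powr ((p + 1) / 2)"
    using * by blast
  show "u \<in> E \<Longrightarrow> integrable lborel (\<lambda>x. \<bar>u x\<bar> powr (p + 1))"
    using *[THEN conjunct2, rule_format, of u "sob_sq s u + 1"] sob_sq_nonneg[of s u] by simp
qed

lemma vanishing:
  assumes K: "K > 0" and e: "e > 0"
  obtains \<eta> where "\<eta> > 0"
    "\<And>u. u \<in> E \<Longrightarrow> sob_sq s u \<le> K \<Longrightarrow> (\<And>x. (\<integral>y. (u y)\<^sup>2 * indicat_real (ball x 1) y \<partial>lborel) \<le> \<eta>) \<Longrightarrow>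
      (\<integral>x. \<bar>u x\<bar> powr (p + 1) \<partial>lborel) \<le> e"
proof -
  obtain C \<alpha> \<beta> where C: "C > 0" "\<alpha> > 0" "\<beta> > 0"
    and *: "\<And>(u :: 'a \<Rightarrow> real) K \<eta>. u \<in> E \<Longrightarrow> sob_sq s u \<le> K \<Longrightarrow> 0 < \<eta> \<Longrightarrow> \<eta> \<le> K \<Longrightarrow>
      (\<forall>x. (\<integral>y. (u y)\<^sup>2 * indicat_real (ball x 1) y \<partial>lborel) \<le> \<eta>) \<Longrightarrow>
      integrable lborel (\<lambda>x. \<bar>u x\<bar> powr (p + 1)) \<and> (\<integral>x. \<bar>u x\<bar> powr (p + 1) \<partial>lborel) \<le> C * K powr \<alpha> * \<eta> powr \<beta>"
    using vanishing_ex by blast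
  define \<eta> where "\<eta> = min K ((e / (C * K powr \<alpha>)) powr (1 / \<beta>))"
  have \<eta>: "0 < \<eta>" "\<eta> \<le> K" using K e C by (auto simp: \<eta>_def)
  have "\<eta> powr \<beta> \<le> ((e / (C * K powr \<alpha>)) powr (1 / \<beta>)) powr \<beta>"
    using \<eta> C by (intro powr_mono2) (auto simp: \<eta>_def)
  also have "\<dots> = e / (C * K powr \<alpha>)" using C e K by (simp add: powr_powr)
  finally have "C * K powr \<alpha> * \<eta> powr \<beta> \<le> e" using C K by (simp add: pos_le_divide_eq mult.commute)
  then have "\<And>u. u \<in> E \<Longrightarrow> sob_sq s u \<le> K \<Longrightarrow> (\<And>x. (\<integral>y. (u y)\<^sup>2 * indicat_real (ball x 1) y \<partial>lborel) \<le> \<eta>) \<Longrightarrow>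
      (\<integral>x. \<bar>u x\<bar> powr (p + 1) \<partial>lborel) \<le> e"
    using *[OF _ _ \<eta>] by (meson order_trans)
  then show ?thesis using that \<eta>(1) by blast
qed

lemma young_integrable: "u \<in> E \<Longrightarrow> integrable lborel (\<lambda>x. young p (u x))"
  unfolding young_def using powr_integrable[of u] frac_spaceD(2)[of u s] by simp

lemma young_integral_le:
  assumes "u \<in> E" "sob_sq s u \<le> K" "0 < K"
  shows "(\<integral>x. young p (u x) \<partial>lborel) \<le> K + CS * K powr ((p + 1) / 2)"
proof -
  have "(\<integral>x. young p (u x) \<partial>lborel) = (\<integral>x. (u x)\<^sup>2 \<partial>lborel) + (\<integral>x. \<bar>u x\<bar> powr (p + 1) \<partial>lborel)"
    unfolding young_def using powr_integrable[OF assms(1)] frac_spaceD(2)[OF assms(1)] by simp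
  moreover have "(\<integral>x. (u x)\<^sup>2 \<partial>lborel) \<le> K"
  proof -
    have "0 \<le> (\<integral>q. (frac_diff s u q)\<^sup>2 \<partial>lborel)" by simp
    then show ?thesis using assms(2) unfolding sob_sq_def by linarith
  qed
  ultimately show ?thesis using sobolev[OF assms] by linarith
qed

lemma young_cont_measurable: "young_cont p j \<Longrightarrow> j \<in> borel_measurable borel"
  unfolding young_cont_def by (blast intro: borel_measurable_continuous_onI)

lemma nemytskii_integrable:
  assumes j: "young_cont p j" and u: "u \<in> E"
  shows "integrable lborel (\<lambda>x. j (u x))"
proof -
  have [measurable]: "j \<in> borel_measurable borel" "u \<in> borel_measurable borel"
    using young_cont_measurable[OF j] frac_spaceD[OF u] by auto
  obtain C where C: "C \<ge> 0" "\<And>a b. \<bar>j (a + b) - j a\<bar> \<le> 1 * young p a + C * young p b"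
    using j unfolding young_cont_def by (meson zero_less_one)
  have b: "\<bar>j t\<bar> \<le> C * young p t" for t
    using C(2)[of 0 t] j p1 by (simp add: young_cont_def young_def)
  have "integrable lborel (\<lambda>x. C * young p (u x))" using young_integrable[OF u] by simp
  then show ?thesis
    by (rule Bochner_Integration.integrable_bound) (use b C(1) in auto)
qed

text \<open>\<open>young_cont\<close> is used with base point \<open>u\<close> and increment
  \<open>v - u\<close>: the first term is small by the choice of \<open>\<epsilon>\<close> against
  the fixed integral of \<open>young p (u x)\<close>, the second by the Sobolev bound on the
  increment.\<close>

lemma nemytskii_continuous:
  assumes j: "young_cont p j" and u: "u \<in> E" and e: "e > 0"
  obtains d where "d > 0" "\<And>v. v \<in> E \<Longrightarrow> sob_sq s (\<lambda>x. v x - u x) < d \<Longrightarrow> \<bar>(\<integral>x. j (v x) \<partial>lborel) - (\<integral>x. j (u x) \<partial>lborel)\<bar> < e"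
proof -
  let ?Y = "\<integral>x. young p (u x) \<partial>lborel"
  have Y0: "0 \<le> ?Y" by simp
  define \<epsilon> where "\<epsilon> = e / (2 * (?Y + 1))"
  have \<epsilon>: "\<epsilon> > 0" "\<epsilon> * ?Y < e / 2" using e Y0 by (auto simp: \<epsilon>_def field_simps add_pos_nonneg)
  obtain C where C: "C \<ge> 0" "\<And>a b. \<bar>j (a + b) - j a\<bar> \<le> \<epsilon> * young p a + C * young p b"
    using j \<epsilon>(1) unfolding young_cont_def by meson
  have "((\<lambda>K. C * (K + CS * K powr ((p + 1) / 2))) \<longlongrightarrow> C * (0 + CS * 0 powr ((p + 1) / 2))) (at_right 0)"
    using p1 by (intro tendsto_intros tendsto_powr') (auto simp: eventually_at_right_less intro: eventually_at_right_less[THEN eventually_mono])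
  then have "\<forall>\<^sub>F K in at_right 0. C * (K + CS * K powr ((p + 1) / 2)) < e / 2" using e by (intro order_tendstoD(2)) auto
  then obtain d where d: "d > 0" "\<And>K. 0 < K \<Longrightarrow> K < d \<Longrightarrow> C * (K + CS * K powr ((p + 1) / 2)) < e / 2"
    unfolding eventually_at_right_field by auto
  define K where "K = d / 2"
  have K: "0 < K" "K < d" "C * (K + CS * K powr ((p + 1) / 2)) < e / 2" using d by (auto simp: K_def)
  show ?thesis
  proof (rule that[OF K(1)])
    fix v assume v: "v \<in> E" and vK: "sob_sq s (\<lambda>x. v x - u x) < K"
    let ?d = "\<lambda>x. v x - u x"
    have dE: "?d \<in> E" by (rule frac_space_diff[OF v u])
    have "(\<integral>x. j (v x) \<partial>lborel) - (\<integral>x. j (u x) \<partial>lborel) = (\<integral>x. j (v x) - j (u x) \<partial>lborel)"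
      by (rule Bochner_Integration.integral_diff[symmetric]) (intro nemytskii_integrable j u v)+
    also have "\<bar>\<dots>\<bar> \<le> (\<integral>x. \<bar>j (v x) - j (u x)\<bar> \<partial>lborel)" by (rule integral_abs_bound)
    also have "\<dots> \<le> (\<integral>x. \<epsilon> * young p (u x) + C * young p (?d x) \<partial>lborel)"
    proof (rule integral_mono)
      show "integrable lborel (\<lambda>x. \<bar>j (v x) - j (u x)\<bar>)" by (intro integrable_abs Bochner_Integration.integrable_diff nemytskii_integrable j u v)
      show "integrable lborel (\<lambda>x. \<epsilon> * young p (u x) + C * young p (?d x))" using young_integrable[OF u] young_integrable[OF dE] by simp
      show "\<bar>j (v x) - j (u x)\<bar> \<le> \<epsilon> * young p (u x) + C * young p (?d x)" for x using C(2)[of "u x" "?d x"] by simp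
    qed
    also have "\<dots> = \<epsilon> * ?Y + C * (\<integral>x. young p (?d x) \<partial>lborel)"
      using young_integrable[OF u] young_integrable[OF dE] by simp
    also have "\<dots> < e"
    proof -
      have "C * (\<integral>x. young p (?d x) \<partial>lborel) \<le> C * (K + CS * K powr ((p + 1) / 2))"
        using C(1) vK K(1) by (intro mult_left_mono young_integral_le dE) auto
      then show ?thesis using \<epsilon>(2) K(3) by linarith
    qed
    finally show "\<bar>(\<integral>x. j (v x) \<partial>lborel) - (\<integral>x. j (u x) \<partial>lborel)\<bar> < e" .
  qed
qed

lemma quad_continuous:
  assumes W: "pot W" and u: "u \<in> E" and e: "e > 0"
  obtains d where "d > 0" "\<And>v. v \<in> E \<Longrightarrow> sob_sq s (\<lambda>x. v x - u x) < d \<Longrightarrow> \<bar>quad s W v - quad s W u\<bar> < e"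
proof -
  let ?Q = "quad s W u"
  have Q0: "0 \<le> ?Q" by (rule quad_nonneg[OF W u])
  define \<epsilon> where "\<epsilon> = e / (2 * (?Q + 1))"
  have \<epsilon>: "\<epsilon> > 0" "\<epsilon> * ?Q < e / 2" using e Q0 by (auto simp: \<epsilon>_def field_simps add_pos_nonneg)
  have main: "\<bar>quad s W v - ?Q\<bar> \<le> \<epsilon> * ?Q + (1 + 1 / \<epsilon>) * quad s W (\<lambda>x. v x - u x)" if v: "v \<in> E" for v
  proof -
    let ?d = "\<lambda>x. v x - u x"
    have dE: "?d \<in> E" by (rule frac_space_diff[OF v u])
    note uD = frac_spaceD[OF u] and vD = frac_spaceD[OF v] and dD = frac_spaceD[OF dE]
    note iu = quad_integrable(3)[OF W u u] and iv = quad_integrable(3)[OF W v v] and id = quad_integrable(3)[OF W dE dE]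
    have sq: "\<bar>x\<^sup>2 - y\<^sup>2\<bar> \<le> \<epsilon> * y\<^sup>2 + (1 + 1 / \<epsilon>) * (x - y)\<^sup>2" for x y :: real
      using sq_norm_diff_le[OF \<epsilon>(1), of x y] by simp
    have 1: "\<bar>(\<integral>q. (frac_diff s v q)\<^sup>2 \<partial>lborel) - (\<integral>q. (frac_diff s u q)\<^sup>2 \<partial>lborel)\<bar> \<le> \<epsilon> * (\<integral>q. (frac_diff s u q)\<^sup>2 \<partial>lborel) + (1 + 1 / \<epsilon>) * (\<integral>q. (frac_diff s ?d q)\<^sup>2 \<partial>lborel)"
    proof -
      have "\<bar>(\<integral>q. (frac_diff s v q)\<^sup>2 \<partial>lborel) - (\<integral>q. (frac_diff s u q)\<^sup>2 \<partial>lborel)\<bar> = \<bar>\<integral>q. (frac_diff s v q)\<^sup>2 - (frac_diff s u q)\<^sup>2 \<partial>lborel\<bar>"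
        using uD(3) vD(3) by simp
      also have "\<dots> \<le> (\<integral>q. \<bar>(frac_diff s v q)\<^sup>2 - (frac_diff s u q)\<^sup>2\<bar> \<partial>lborel)" by (rule integral_abs_bound)
      also have "\<dots> \<le> (\<integral>q. \<epsilon> * (frac_diff s u q)\<^sup>2 + (1 + 1 / \<epsilon>) * (frac_diff s ?d q)\<^sup>2 \<partial>lborel)"
        using uD(3) vD(3) dD(3) sq by (intro integral_mono) (auto simp: frac_diff_minus)
      also have "\<dots> = \<epsilon> * (\<integral>q. (frac_diff s u q)\<^sup>2 \<partial>lborel) + (1 + 1 / \<epsilon>) * (\<integral>q. (frac_diff s ?d q)\<^sup>2 \<partial>lborel)"
        using uD(3) dD(3) by simp
      finally show ?thesis .
    qed
    have 2: "\<bar>(\<integral>x. W x * (v x)\<^sup>2 \<partial>lborel) - (\<integral>x. W x * (u x)\<^sup>2 \<partial>lborel)\<bar> \<le> \<epsilon> * (\<integral>x. W x * (u x)\<^sup>2 \<partial>lborel) + (1 + 1 / \<epsilon>) * (\<integral>x. W x * (?d x)\<^sup>2 \<partial>lborel)"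
    proof -
      have "\<bar>(\<integral>x. W x * (v x)\<^sup>2 \<partial>lborel) - (\<integral>x. W x * (u x)\<^sup>2 \<partial>lborel)\<bar> = \<bar>\<integral>x. W x * (v x)\<^sup>2 - W x * (u x)\<^sup>2 \<partial>lborel\<bar>"
        using iu iv by simp
      also have "\<dots> \<le> (\<integral>x. \<bar>W x * (v x)\<^sup>2 - W x * (u x)\<^sup>2\<bar> \<partial>lborel)" by (rule integral_abs_bound)
      also have "\<dots> \<le> (\<integral>x. \<epsilon> * (W x * (u x)\<^sup>2) + (1 + 1 / \<epsilon>) * (W x * (?d x)\<^sup>2) \<partial>lborel)"
      proof (rule integral_mono)
        fix x
        have "\<bar>W x * (v x)\<^sup>2 - W x * (u x)\<^sup>2\<bar> = W x * \<bar>(v x)\<^sup>2 - (u x)\<^sup>2\<bar>"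
          using potD(4)[OF W, of x] by (simp add: right_diff_distrib[symmetric] abs_mult)
        also have "\<dots> \<le> W x * (\<epsilon> * (u x)\<^sup>2 + (1 + 1 / \<epsilon>) * (v x - u x)\<^sup>2)" using potD(4)[OF W] sq by (intro mult_left_mono) auto
        finally show "\<bar>W x * (v x)\<^sup>2 - W x * (u x)\<^sup>2\<bar> \<le> \<epsilon> * (W x * (u x)\<^sup>2) + (1 + 1 / \<epsilon>) * (W x * (?d x)\<^sup>2)" by (simp add: algebra_simps)
      qed (use iu iv id in auto)
      also have "\<dots> = \<epsilon> * (\<integral>x. W x * (u x)\<^sup>2 \<partial>lborel) + (1 + 1 / \<epsilon>) * (\<integral>x. W x * (?d x)\<^sup>2 \<partial>lborel)"
        using iu id by simp
      finally show ?thesis .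
    qed
    show ?thesis using 1 2 unfolding quad_def distrib_left by linarith
  qed
  have k: "0 < 1 + 1 / \<epsilon>" using \<epsilon> by (simp add: add_pos_nonneg)
  define d where "d = e / (2 * (1 + 1 / \<epsilon>) * c1)"
  show ?thesis
  proof (rule that[of d])
    show "d > 0" using e k c1_pos by (simp add: d_def)
    fix v assume v: "v \<in> E" and vd: "sob_sq s (\<lambda>x. v x - u x) < d"
    have "quad s W (\<lambda>x. v x - u x) \<le> c1 * sob_sq s (\<lambda>x. v x - u x)" by (rule quad_bounds(2)[OF W frac_space_diff[OF v u]])
    also have "\<dots> < c1 * d" using vd c1_pos by simp
    finally have "(1 + 1 / \<epsilon>) * quad s W (\<lambda>x. v x - u x) < (1 + 1 / \<epsilon>) * (c1 * d)" using k by simp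
    also have "\<dots> = e / 2"
    proof -
      have "k * (c1 * (e / (2 * k * c1))) = e / 2" if "k > 0" for k using that c1_pos by simp
      then show ?thesis unfolding d_def using k by blast
    qed
    finally show "\<bar>quad s W v - ?Q\<bar> < e" using main[OF v] \<epsilon>(2) by linarith
  qed
qed

end

section \<open>The energy functional\<close>

context frac_problem
begin

definition Jf :: "('a \<Rightarrow> real) \<Rightarrow> ('a \<Rightarrow> real) \<Rightarrow> real" where
  "Jf W u = quad s W u / 2 - (\<integral>x. F (u x) \<partial>lborel)"

text \<open>The derivative of \<open>J\<close> at \<open>u\<close> in the direction \<open>u\<close>
  itself; its zeros of positive norm form the Nehari set.\<close>

definition Gf :: "('a \<Rightarrow> real) \<Rightarrow> ('a \<Rightarrow> real) \<Rightarrow> real" where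
  "Gf W u = quad s W u - (\<integral>x. u x * f (u x) \<partial>lborel)"

definition dJ :: "('a \<Rightarrow> real) \<Rightarrow> ('a \<Rightarrow> real) \<Rightarrow> ('a \<Rightarrow> real) \<Rightarrow> real" where
  "dJ W u v = bil s W u v - (\<integral>x. f (u x) * v x \<partial>lborel)"

lemmas F_integrable = nemytskii_integrable[OF young_cont_F]
lemmas tf_integrable = nemytskii_integrable[OF young_cont_tf]

text \<open>The pointwise tangent inequality, integrated. If \<open>Gf W u = 0\<close>, it says that
  \<open>u\<close> maximizes \<open>J\<close> on its ray; the converse is
  \<open>G_zero_if_ray_max\<close>.\<close>

lemma J_tangent:
  assumes W: "pot W" and u: "u \<in> E" and t: "t \<ge> 0"
  shows "Jf W (\<lambda>x. t * u x) \<le> Jf W u + (t\<^sup>2 - 1) / 2 * Gf W u"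
proof -
  have "(\<integral>x. F (u x) + (t\<^sup>2 - 1) / 2 * (u x * f (u x)) \<partial>lborel) \<le> (\<integral>x. F (t * u x) \<partial>lborel)"
    using F_integrable[OF u] tf_integrable[OF u] F_integrable[OF frac_space_cmult[OF u, of t]]
    by (intro integral_mono F_tangent t) auto
  then have "(\<integral>x. F (u x) \<partial>lborel) + (t\<^sup>2 - 1) / 2 * (\<integral>x. u x * f (u x) \<partial>lborel) \<le> (\<integral>x. F (t * u x) \<partial>lborel)"
    using F_integrable[OF u] tf_integrable[OF u] by simp
  then show ?thesis unfolding Jf_def Gf_def quad_cmult by (simp add: algebra_simps diff_divide_distrib)
qed

text \<open>For t at most 1 the quadratic part scales exactly by t^2, while \<open>F\<close> shrinks
  at least by that factor.\<close>

lemma J_scale: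
  assumes W: "pot W" and u: "u \<in> E" and t: "0 \<le> t" "t \<le> 1"
  shows "t\<^sup>2 * Jf W u \<le> Jf W (\<lambda>x. t * u x)"
proof -
  have "(\<integral>x. F (t * u x) \<partial>lborel) \<le> (\<integral>x. t\<^sup>2 * F (u x) \<partial>lborel)"
    using F_integrable[OF u] F_integrable[OF frac_space_cmult[OF u, of t]]
    by (intro integral_mono F_quadratic_le t) auto
  then show ?thesis unfolding Jf_def quad_cmult by (simp add: algebra_simps)
qed

text \<open>\<open>J_scale\<close> with the factor \<open>T / t\<close>: a nonnegative value at
  \<open>t\<close> would force one at \<open>T\<close>. This confines the parameters of positive
  energy on a ray to a bounded interval.\<close>

lemma J_neg_beyond:
  assumes W: "pot W" and u: "u \<in> E" and T: "0 < T" "T \<le> t" and neg: "Jf W (\<lambda>x. T * u x) < 0"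
  shows "Jf W (\<lambda>x. t * u x) < 0"
proof -
  have "(T / t)\<^sup>2 * Jf W (\<lambda>x. t * u x) \<le> Jf W (\<lambda>x. T / t * (t * u x))"
    using T by (intro J_scale W frac_space_cmult u) auto
  also have "(\<lambda>x. T / t * (t * u x)) = (\<lambda>x. T * u x)" using T by auto
  finally have "(T / t)\<^sup>2 * Jf W (\<lambda>x. t * u x) < 0" using neg by simp
  then show ?thesis using T by (simp add: mult_less_0_iff)
qed

text \<open>Puts the endpoint of a mountain pass path, where \<open>J\<close> is negative, on the
  side of negative \<open>Gf\<close>.\<close>

lemma G_le_J:
  assumes W: "pot W" and u: "u \<in> E"
  shows "Gf W u \<le> 2 * Jf W u"
proof -
  have "(\<integral>x. 2 * F (u x) \<partial>lborel) \<le> (\<integral>x. u x * f (u x) \<partial>lborel)"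
  proof (intro integral_mono)
    fix x
    have "2 * F (u x) \<le> \<mu> * F (u x)" using mu F_nonneg by (intro mult_right_mono) auto
    then show "2 * F (u x) \<le> u x * f (u x)" using F_le[of "u x"] by linarith
  qed (use F_integrable[OF u] tf_integrable[OF u] in auto)
  then show ?thesis unfolding Jf_def Gf_def by simp
qed

text \<open>\<open>AR\<close> in integrated form: on the Nehari set the energy controls the norm,
  which bounds minimizing sequences and keeps the level positive.\<close>

lemma J_nehari_lower:
  assumes W: "pot W" and u: "u \<in> E" and G: "Gf W u = 0"
  shows "(1 / 2 - 1 / \<mu>) * quad s W u \<le> Jf W u"
proof -
  have "(\<integral>x. \<mu> * F (u x) \<partial>lborel) \<le> (\<integral>x. u x * f (u x) \<partial>lborel)"
    using F_integrable[OF u] tf_integrable[OF u] by (intro integral_mono F_le) auto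
  then have "\<mu> * (\<integral>x. F (u x) \<partial>lborel) \<le> quad s W u" using G by (simp add: Gf_def)
  then have "(\<integral>x. F (u x) \<partial>lborel) \<le> quad s W u / \<mu>" using mu by (simp add: pos_le_divide_eq mult.commute)
  then show ?thesis unfolding Jf_def by (simp add: algebra_simps)
qed

lemma J_le_quad: "Jf W u \<le> quad s W u / 2"
  unfolding Jf_def using F_nonneg by (simp add: integral_nonneg_AE)

lemma AE_frac_diff_cong:
  assumes "AE x in lborel. u x = v x"
  shows "AE q in lborel. frac_diff s u q = frac_diff s v q"
proof -
  have "AE q in lborel. u (fst (snd q)) = v (fst (snd q))" by (rule AE_lborel_snd[OF AE_lborel_fst[OF assms]])
  moreover have "AE q in lborel. u (snd (snd q)) = v (snd (snd q))" by (rule AE_lborel_snd[OF AE_lborel_snd[OF assms]])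
  ultimately show ?thesis by eventually_elim (simp add: frac_diff_def)
qed

lemma sob_sq_AE_zero:
  assumes u: "u \<in> E" and z: "AE x in lborel. u x = 0"
  shows "sob_sq s u = 0"
proof -
  have [measurable]: "u \<in> borel_measurable borel" using frac_spaceD[OF u] by simp
  have "AE q in lborel. frac_diff s u q = frac_diff s (\<lambda>_. 0) q" by (rule AE_frac_diff_cong[OF z])
  then have "AE q in lborel. (frac_diff s u q)\<^sup>2 = 0" by eventually_elim (simp add: frac_diff_def)
  then have "(\<integral>q. (frac_diff s u q)\<^sup>2 \<partial>lborel) = 0" by (simp add: integral_eq_zero_AE)
  moreover have "(\<integral>x. (u x)\<^sup>2 \<partial>lborel) = 0" using z by (intro integral_eq_zero_AE) auto
  ultimately show ?thesis by (simp add: sob_sq_def)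
qed

lemma sob_sq_zero_AE:
  assumes u: "u \<in> E" and z: "sob_sq s u = 0"
  shows "AE x in lborel. u x = 0"
proof -
  have "(\<integral>x. (u x)\<^sup>2 \<partial>lborel) \<ge> 0" "(\<integral>q. (frac_diff s u q)\<^sup>2 \<partial>lborel) \<ge> 0" by auto
  then have "(\<integral>x. (u x)\<^sup>2 \<partial>lborel) = 0" using z unfolding sob_sq_def by linarith
  then have "AE x in lborel. (u x)\<^sup>2 = 0" using frac_spaceD[OF u] by (subst (asm) integral_nonneg_eq_0_iff_AE) auto
  then show ?thesis by eventually_elim simp
qed

lemma integral_F_pos:
  assumes u: "u \<in> E" and pos: "sob_sq s u > 0"
  shows "0 < (\<integral>x. F (u x) \<partial>lborel)"
proof (rule ccontr)
  assume "\<not> ?thesis"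
  moreover have "0 \<le> (\<integral>x. F (u x) \<partial>lborel)" using F_nonneg by (simp add: integral_nonneg_AE)
  ultimately have "(\<integral>x. F (u x) \<partial>lborel) = 0" by linarith
  then have "AE x in lborel. F (u x) = 0"
    using F_integrable[OF u] F_nonneg by (subst (asm) integral_nonneg_eq_0_iff_AE) auto
  then have "AE x in lborel. u x = 0" by eventually_elim (use F_pos in \<open>metis less_irrefl\<close>)
  then show False using sob_sq_AE_zero[OF u] pos by simp
qed

lemma J_neg_ex:
  assumes W: "pot W" and u: "u \<in> E" and pos: "sob_sq s u > 0"
  obtains T where "T > 0" "Jf W (\<lambda>x. T * u x) < 0"
proof -
  let ?A = "\<integral>x. F (u x) \<partial>lborel" and ?Q = "quad s W u"
  have A: "?A > 0" by (rule integral_F_pos[OF u pos])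
  have Q: "?Q \<ge> 0" by (rule quad_nonneg[OF W u])
  \<comment> \<open>Chosen so that \<open>t powr (\<mu> - 2) = ?Q / ?A + 1\<close>: then t powr
    \<mu> times A equals t^2 (Q + A), which exceeds the quadratic part t^2 Q / 2.\<close>
  define t where "t = (?Q / ?A + 1) powr (1 / (\<mu> - 2))"
  have t: "t \<ge> 1" unfolding t_def using A Q mu by (intro ge_one_powr_ge_zero) auto
  have tm: "t powr (\<mu> - 2) = ?Q / ?A + 1" unfolding t_def using mu A Q by (simp add: powr_powr add_nonneg_pos)
  have "(\<integral>x. t powr \<mu> * F (u x) \<partial>lborel) \<le> (\<integral>x. F (t * u x) \<partial>lborel)"
    using F_integrable[OF u] F_integrable[OF frac_space_cmult[OF u, of t]] by (intro integral_mono F_superquadratic t) auto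
  then have 1: "t powr \<mu> * ?A \<le> (\<integral>x. F (t * u x) \<partial>lborel)" by simp
  have "t powr \<mu> = t powr (\<mu> - 2) * t\<^sup>2"
  proof -
    have "t powr \<mu> = t powr (\<mu> - 2) * t powr 2" by (simp only: powr_add[symmetric]) simp
    then show ?thesis using t by simp
  qed
  then have "t powr \<mu> * ?A = t\<^sup>2 * (?Q + ?A)" unfolding tm using A by (simp add: field_simps)
  then have "Jf W (\<lambda>x. t * u x) \<le> t\<^sup>2 * ?Q / 2 - t\<^sup>2 * (?Q + ?A)"
    unfolding Jf_def quad_cmult using 1 by simp
  also have "\<dots> < 0"
  proof -
    have "0 \<le> t\<^sup>2 * ?Q" using Q by simp
    moreover have "0 < t\<^sup>2 * ?A" using t A by simp
    ultimately show ?thesis unfolding distrib_left by linarith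
  qed
  finally have "Jf W (\<lambda>x. t * u x) < 0" .
  moreover have "t > 0" using t by simp
  ultimately show ?thesis using that by blast
qed

text \<open>Half of the quadratic form absorbs the linear part of \<open>f\<close>; the other half
  is then at most a multiple of the integral of |u| powr (p + 1), which by Sobolev is of higher
  order in the norm, so the norm cannot be small. The sign condition on \<open>Gf\<close> covers
  both the Nehari set and the end of a path, where \<open>Gf\<close> is negative.\<close>

lemma nehari_lower_ex:
  "\<exists>\<rho>>0. \<exists>\<delta>>0. \<forall>W u. pot W \<longrightarrow> u \<in> E \<longrightarrow> 0 < quad s W u \<longrightarrow> Gf W u \<le> 0 \<longrightarrow> \<rho> \<le> quad s W u \<and> \<delta> \<le> (\<integral>x. \<bar>u x\<bar> powr (p + 1) \<partial>lborel)"
proof -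
  obtain C where C: "C \<ge> 0" "\<And>t. \<bar>f t\<bar> \<le> V0 / 2 * \<bar>t\<bar> + C * \<bar>t\<bar> powr p"
    using f_small[of "V0 / 2"] V0 by auto
  have main: "quad s W u / 2 \<le> C * (\<integral>x. \<bar>u x\<bar> powr (p + 1) \<partial>lborel)" if W: "pot W" and u: "u \<in> E" and G: "Gf W u \<le> 0" for W u
  proof -
    have b: "t * f t \<le> V0 / 2 * t\<^sup>2 + C * \<bar>t\<bar> powr (p + 1)" for t
    proof -
      have "t * f t \<le> \<bar>t\<bar> * \<bar>f t\<bar>" by (metis abs_ge_self abs_mult)
      also have "\<dots> \<le> \<bar>t\<bar> * (V0 / 2 * \<bar>t\<bar> + C * \<bar>t\<bar> powr p)" by (intro mult_left_mono C) auto
      also have "\<dots> = V0 / 2 * (\<bar>t\<bar> * \<bar>t\<bar>) + C * (\<bar>t\<bar> * \<bar>t\<bar> powr p)" by (simp add: algebra_simps)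
      also have "\<bar>t\<bar> * \<bar>t\<bar> powr p = \<bar>t\<bar> powr (p + 1)" by (simp add: powr_mult_base add.commute)
      finally show ?thesis by (simp add: power2_eq_square)
    qed
    have "(\<integral>x. u x * f (u x) \<partial>lborel) \<le> (\<integral>x. V0 / 2 * (u x)\<^sup>2 + C * \<bar>u x\<bar> powr (p + 1) \<partial>lborel)"
      using tf_integrable[OF u] frac_spaceD(2)[OF u] powr_integrable[OF u] by (intro integral_mono b) auto
    also have "\<dots> = V0 * (\<integral>x. (u x)\<^sup>2 \<partial>lborel) / 2 + C * (\<integral>x. \<bar>u x\<bar> powr (p + 1) \<partial>lborel)"
      using frac_spaceD(2)[OF u] powr_integrable[OF u] by simp
    finally show ?thesis using G quad_bounds(3)[OF W u] unfolding Gf_def by linarith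
  qed
  define D where "D = C * CS + 1"
  have D: "D > 0" using C(1) CS_pos by (simp add: D_def add_nonneg_pos)
  \<comment> \<open>c0 times the positive solution K of c0 K / 2 = D K powr ((p + 1) / 2), since the
    quadratic form is written as c0 K below.\<close>
  define \<rho> where "\<rho> = c0 * (c0 / (2 * D)) powr (2 / (p - 1))"
  have \<rho>: "\<rho> > 0" unfolding \<rho>_def using c0_pos D by simp
  define \<delta> where "\<delta> = \<rho> / (2 * (C + 1))"
  have \<delta>: "\<delta> > 0" unfolding \<delta>_def using \<rho> C(1) by simp
  have "\<rho> \<le> quad s W u \<and> \<delta> \<le> (\<integral>x. \<bar>u x\<bar> powr (p + 1) \<partial>lborel)" if W: "pot W" and u: "u \<in> E" and Q: "0 < quad s W u" and G: "Gf W u \<le> 0" for W u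
  proof -
    let ?Q = "quad s W u" and ?P = "\<integral>x. \<bar>u x\<bar> powr (p + 1) \<partial>lborel"
    define K where "K = ?Q / c0"
    have K: "K > 0" "?Q = c0 * K" using Q c0_pos by (auto simp: K_def)
    have P0: "?P \<ge> 0" by simp
    have "?P \<le> CS * K powr ((p + 1) / 2)" using sob_sq_le_quad[OF W u] by (intro sobolev u K) (simp add: K_def)
    then have "C * ?P \<le> C * (CS * K powr ((p + 1) / 2))" using C(1) by (intro mult_left_mono)
    also have "\<dots> \<le> D * K powr ((p + 1) / 2)" by (simp add: D_def distrib_right)
    finally have "c0 * K / 2 \<le> D * K powr ((p + 1) / 2)" using main[OF W u G] K(2) by linarith
    also have "K powr ((p + 1) / 2) = K * K powr ((p - 1) / 2)" using K(1) by (simp add: powr_mult_base field_simps)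
    finally have "c0 / (2 * D) \<le> K powr ((p - 1) / 2)" using K(1) D by (simp add: field_simps)
    then have "(c0 / (2 * D)) powr (2 / (p - 1)) \<le> (K powr ((p - 1) / 2)) powr (2 / (p - 1))"
      using c0_pos D p1 by (intro powr_mono2) auto
    also have "\<dots> = K"
    proof -
      have e: "(p - 1) / 2 * (2 / (p - 1)) = 1" using p1 by simp
      show ?thesis unfolding powr_powr e using K(1) by simp
    qed
    finally have \<rho>Q: "\<rho> \<le> ?Q" unfolding \<rho>_def K(2) using c0_pos by simp
    have "?Q / 2 \<le> (C + 1) * ?P" using main[OF W u G] P0 unfolding distrib_right by linarith
    then have "\<delta> \<le> ?P" unfolding \<delta>_def using \<rho>Q C(1) by (simp add: field_simps add_nonneg_pos)
    then show ?thesis using \<rho>Q by simp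
  qed
  then show ?thesis using \<rho> \<delta> by blast
qed

section \<open>Continuity and differentiability of the functional\<close>

lemma functional_tendsto:
  assumes W: "pot W" and u: "u \<in> E" and g: "\<forall>\<^sub>F t in net. g t \<in> E"
    and lim: "((\<lambda>t. sob_sq s (\<lambda>x. g t x - u x)) \<longlongrightarrow> 0) net"
  shows "((\<lambda>t. quad s W (g t)) \<longlongrightarrow> quad s W u) net" "((\<lambda>t. Jf W (g t)) \<longlongrightarrow> Jf W u) net" "((\<lambda>t. Gf W (g t)) \<longlongrightarrow> Gf W u) net"
proof -
  have close: "\<forall>\<^sub>F t in net. g t \<in> E \<and> sob_sq s (\<lambda>x. g t x - u x) < d" if "d > 0" for d
    using g order_tendstoD(2)[OF lim that] by eventually_elim simp
  show Q: "((\<lambda>t. quad s W (g t)) \<longlongrightarrow> quad s W u) net"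
  proof (rule tendstoI)
    fix e :: real assume "e > 0"
    then obtain d where d: "d > 0" "\<And>v. v \<in> E \<Longrightarrow> sob_sq s (\<lambda>x. v x - u x) < d \<Longrightarrow> \<bar>quad s W v - quad s W u\<bar> < e"
      using quad_continuous[OF W u] by blast
    show "\<forall>\<^sub>F t in net. dist (quad s W (g t)) (quad s W u) < e"
      using close[OF d(1)] by eventually_elim (simp add: dist_real_def d(2))
  qed
  have N: "((\<lambda>t. \<integral>x. j (g t x) \<partial>lborel) \<longlongrightarrow> (\<integral>x. j (u x) \<partial>lborel)) net" if j: "young_cont p j" for j
  proof (rule tendstoI)
    fix e :: real assume "e > 0"
    then obtain d where d: "d > 0" "\<And>v. v \<in> E \<Longrightarrow> sob_sq s (\<lambda>x. v x - u x) < d \<Longrightarrow> \<bar>(\<integral>x. j (v x) \<partial>lborel) - (\<integral>x. j (u x) \<partial>lborel)\<bar> < e"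
      using nemytskii_continuous[OF j u] by blast
    show "\<forall>\<^sub>F t in net. dist (\<integral>x. j (g t x) \<partial>lborel) (\<integral>x. j (u x) \<partial>lborel) < e"
      using close[OF d(1)] by eventually_elim (simp add: dist_real_def d(2))
  qed
  show "((\<lambda>t. Jf W (g t)) \<longlongrightarrow> Jf W u) net" unfolding Jf_def by (intro tendsto_intros Q N young_cont_F) auto
  show "((\<lambda>t. Gf W (g t)) \<longlongrightarrow> Gf W u) net" unfolding Gf_def by (intro tendsto_intros Q N[OF young_cont_tf])
qed

lemma sob_sq_lincomb_le:
  assumes u: "u \<in> E" and v: "v \<in> E"
  shows "sob_sq s (\<lambda>x. a * u x + b * v x) \<le> 2 * a\<^sup>2 * sob_sq s u + 2 * b\<^sup>2 * sob_sq s v"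
proof -
  have uv: "(\<lambda>x. a * u x + b * v x) \<in> E" by (intro frac_space_add frac_space_cmult u v)
  note D = frac_spaceD[OF uv] and uD = frac_spaceD[OF u] and vD = frac_spaceD[OF v]
  have b: "(x + y)\<^sup>2 \<le> 2 * x\<^sup>2 + 2 * y\<^sup>2" for x y :: real
    using zero_le_power2[of "x - y"] by (simp add: power2_eq_square algebra_simps)
  have "(\<integral>x. (a * u x + b * v x)\<^sup>2 \<partial>lborel) \<le> (\<integral>x. 2 * a\<^sup>2 * (u x)\<^sup>2 + 2 * b\<^sup>2 * (v x)\<^sup>2 \<partial>lborel)"
  proof (rule integral_mono)
    show "(a * u x + b * v x)\<^sup>2 \<le> 2 * a\<^sup>2 * (u x)\<^sup>2 + 2 * b\<^sup>2 * (v x)\<^sup>2" for x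
      using b[of "a * u x" "b * v x"] by (simp add: power_mult_distrib)
  qed (use D uD vD in auto)
  then have 1: "(\<integral>x. (a * u x + b * v x)\<^sup>2 \<partial>lborel) \<le> 2 * a\<^sup>2 * (\<integral>x. (u x)\<^sup>2 \<partial>lborel) + 2 * b\<^sup>2 * (\<integral>x. (v x)\<^sup>2 \<partial>lborel)"
    using uD(2) vD(2) by simp
  have "(\<integral>q. (frac_diff s (\<lambda>x. a * u x + b * v x) q)\<^sup>2 \<partial>lborel) \<le> (\<integral>q. 2 * a\<^sup>2 * (frac_diff s u q)\<^sup>2 + 2 * b\<^sup>2 * (frac_diff s v q)\<^sup>2 \<partial>lborel)"
  proof (rule integral_mono)
    show "(frac_diff s (\<lambda>x. a * u x + b * v x) q)\<^sup>2 \<le> 2 * a\<^sup>2 * (frac_diff s u q)\<^sup>2 + 2 * b\<^sup>2 * (frac_diff s v q)\<^sup>2" for q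
      using b[of "a * frac_diff s u q" "b * frac_diff s v q"] by (simp add: power_mult_distrib frac_diff_add frac_diff_cmult)
  qed (use D uD vD in auto)
  then have 2: "(\<integral>q. (frac_diff s (\<lambda>x. a * u x + b * v x) q)\<^sup>2 \<partial>lborel) \<le> 2 * a\<^sup>2 * (\<integral>q. (frac_diff s u q)\<^sup>2 \<partial>lborel) + 2 * b\<^sup>2 * (\<integral>q. (frac_diff s v q)\<^sup>2 \<partial>lborel)"
    using uD(3) vD(3) by simp
  show ?thesis using 1 2 unfolding sob_sq_def distrib_left by linarith
qed

lemma J_lincomb_tendsto:
  assumes W: "pot W" and u: "u \<in> E" and v: "v \<in> E" and a: "(a \<longlongrightarrow> a') net" and b: "(b \<longlongrightarrow> b') net"
  shows "((\<lambda>n. Jf W (\<lambda>x. a n * u x + b n * v x)) \<longlongrightarrow> Jf W (\<lambda>x. a' * u x + b' * v x)) net"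
proof (rule functional_tendsto(2)[OF W])
  show "(\<lambda>x. a' * u x + b' * v x) \<in> E" by (intro frac_space_add frac_space_cmult u v)
  show "\<forall>\<^sub>F n in net. (\<lambda>x. a n * u x + b n * v x) \<in> E" by (intro always_eventually allI frac_space_add frac_space_cmult u v)
  show "((\<lambda>n. sob_sq s (\<lambda>x. a n * u x + b n * v x - (a' * u x + b' * v x))) \<longlongrightarrow> 0) net"
  proof (rule real_tendsto_0_le[OF sob_sq_nonneg])
    show "sob_sq s (\<lambda>x. a n * u x + b n * v x - (a' * u x + b' * v x)) \<le> 2 * (a n - a')\<^sup>2 * sob_sq s u + 2 * (b n - b')\<^sup>2 * sob_sq s v" for n
      using sob_sq_lincomb_le[OF u v, of "a n - a'" "b n - b'"] by (simp add: algebra_simps)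
    have "((\<lambda>n. 2 * (a n - a')\<^sup>2 * sob_sq s u + 2 * (b n - b')\<^sup>2 * sob_sq s v) \<longlongrightarrow> 2 * (a' - a')\<^sup>2 * sob_sq s u + 2 * (b' - b')\<^sup>2 * sob_sq s v) net"
      by (intro tendsto_intros a b)
    then show "((\<lambda>n. 2 * (a n - a')\<^sup>2 * sob_sq s u + 2 * (b n - b')\<^sup>2 * sob_sq s v) \<longlongrightarrow> 0) net" by simp
  qed
qed

lemma f_mult_bound:
  assumes "\<bar>y\<bar> \<le> z" "\<bar>w\<bar> \<le> z"
  shows "\<bar>f y * w\<bar> \<le> (a1 + a2) * young p z"
proof -
  have z0: "z \<ge> 0" using assms by simp
  have "\<bar>f y\<bar> \<le> a1 * \<bar>y\<bar> + a2 * \<bar>y\<bar> powr p" by (rule f_growth)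
  also have "\<dots> \<le> a1 * z + a2 * z powr p" using assms a1 a2 p1 by (intro add_mono mult_left_mono powr_mono2) auto
  finally have "\<bar>f y * w\<bar> \<le> (a1 * z + a2 * z powr p) * z" unfolding abs_mult using assms by (intro mult_mono) auto
  also have "\<dots> = a1 * z\<^sup>2 + a2 * (z * z powr p)" by (simp add: algebra_simps power2_eq_square)
  also have "z * z powr p = \<bar>z\<bar> powr (p + 1)" using z0 by (simp add: powr_mult_base add.commute)
  also have "a1 * z\<^sup>2 + a2 * \<bar>z\<bar> powr (p + 1) \<le> (a1 + a2) * z\<^sup>2 + (a1 + a2) * \<bar>z\<bar> powr (p + 1)"
    using a1 a2 by (intro add_mono mult_right_mono) auto
  finally show ?thesis by (simp add: young_def distrib_left)
qed

lemma young_lincomb_integrable: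
  assumes u: "u \<in> E" and v: "v \<in> E"
  shows "integrable lborel (\<lambda>x. young p (A * \<bar>u x\<bar> + B * \<bar>v x\<bar>))"
proof -
  have [measurable]: "u \<in> borel_measurable borel" "v \<in> borel_measurable borel" using frac_spaceD[OF u] frac_spaceD[OF v] by auto
  have "integrable lborel (\<lambda>x. 2 powr (p + 1) * (young p (A * u x) + young p (B * v x)))"
    using young_integrable[OF frac_space_cmult[OF u, of A]] young_integrable[OF frac_space_cmult[OF v, of B]] by simp
  then show ?thesis
  proof (rule Bochner_Integration.integrable_bound)
    have "young p (A * \<bar>u x\<bar> + B * \<bar>v x\<bar>) \<le> 2 powr (p + 1) * (young p (A * u x) + young p (B * v x))" for x
    proof -
      have mono: "young p y \<le> young p z" if "\<bar>y\<bar> \<le> \<bar>z\<bar>" for y z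
        unfolding young_def using that p1 by (intro add_mono powr_mono2) (auto simp: abs_le_square_iff)
      have "young p (A * \<bar>u x\<bar> + B * \<bar>v x\<bar>) \<le> young p (\<bar>A * u x\<bar> + \<bar>B * v x\<bar>)"
        by (rule mono) (use abs_triangle_ineq[of "A * \<bar>u x\<bar>" "B * \<bar>v x\<bar>"] in \<open>simp add: abs_mult\<close>)
      also have "\<dots> \<le> 2 powr (p + 1) * (young p (A * u x) + young p (B * v x))" by (rule young_add_le[OF p1])
      finally show ?thesis .
    qed
    then show "AE x in lborel. norm (young p (A * \<bar>u x\<bar> + B * \<bar>v x\<bar>)) \<le> norm (2 powr (p + 1) * (young p (A * u x) + young p (B * v x)))" by simp
  qed measurable
qed

text \<open>Continuity of the derivative within the span of \<open>u\<close> and \<open>v\<close>,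
  where bounded coefficients allow a single dominating function.\<close>

lemma dJ_lincomb_tendsto:
  assumes W: "pot W" and u: "u \<in> E" and v: "v \<in> E" and a: "a \<longlonglongrightarrow> a'" and b: "b \<longlonglongrightarrow> b'"
  shows "(\<lambda>n. dJ W (\<lambda>x. a n * u x + b n * v x) v) \<longlonglongrightarrow> dJ W (\<lambda>x. a' * u x + b' * v x) v"
proof -
  have [measurable]: "u \<in> borel_measurable borel" "v \<in> borel_measurable borel" using frac_spaceD[OF u] frac_spaceD[OF v] by auto
  obtain A where A: "\<And>n. \<bar>a n\<bar> \<le> A" using convergent_imp_Bseq[OF convergentI[OF a]] by (auto simp: Bseq_def)
  obtain B where B: "\<And>n. \<bar>b n\<bar> \<le> B" using convergent_imp_Bseq[OF convergentI[OF b]] by (auto simp: Bseq_def)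
  let ?z = "\<lambda>x. A * \<bar>u x\<bar> + max 1 B * \<bar>v x\<bar>"
  have "(\<lambda>n. \<integral>x. f (a n * u x + b n * v x) * v x \<partial>lborel) \<longlonglongrightarrow> (\<integral>x. f (a' * u x + b' * v x) * v x \<partial>lborel)"
  proof (rule integral_dominated_convergence[where w="\<lambda>x. (a1 + a2) * young p (?z x)"])
    show "integrable lborel (\<lambda>x. (a1 + a2) * young p (?z x))" by (intro integrable_mult_right young_lincomb_integrable u v)
    show "AE x in lborel. (\<lambda>n. f (a n * u x + b n * v x) * v x) \<longlonglongrightarrow> f (a' * u x + b' * v x) * v x"
    proof (rule AE_I2)
      fix x
      have "isCont f y" for y using f_continuous by (simp add: continuous_on_eq_continuous_at)
      then show "(\<lambda>n. f (a n * u x + b n * v x) * v x) \<longlonglongrightarrow> f (a' * u x + b' * v x) * v x"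
        by (intro tendsto_intros isCont_tendsto_compose[where g=f] a b)
    qed
    show "AE x in lborel. norm (f (a n * u x + b n * v x) * v x) \<le> (a1 + a2) * young p (?z x)" for n
    proof (rule AE_I2)
      fix x
      have A0: "0 \<le> A" using A[of 0] by simp
      have "\<bar>a n * u x + b n * v x\<bar> \<le> \<bar>a n\<bar> * \<bar>u x\<bar> + \<bar>b n\<bar> * \<bar>v x\<bar>" by (metis abs_mult abs_triangle_ineq)
      also have "\<dots> \<le> ?z x" using A[of n] B[of n] by (intro add_mono mult_right_mono) auto
      finally have 1: "\<bar>a n * u x + b n * v x\<bar> \<le> ?z x" .
      have "1 * \<bar>v x\<bar> \<le> max 1 B * \<bar>v x\<bar>" by (intro mult_right_mono) auto
      then have 2: "\<bar>v x\<bar> \<le> ?z x" using mult_nonneg_nonneg[OF A0 abs_ge_zero[of "u x"]] by linarith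
      show "norm (f (a n * u x + b n * v x) * v x) \<le> (a1 + a2) * young p (?z x)"
        using f_mult_bound[OF 1 2] by simp
    qed
  qed measurable
  moreover have "(\<lambda>n. a n * bil s W u v + b n * quad s W v) \<longlonglongrightarrow> a' * bil s W u v + b' * quad s W v" by (intro tendsto_intros a b)
  ultimately show ?thesis unfolding dJ_def bil_add[OF W u v] by (intro tendsto_diff)
qed

lemma nonlinear_deriv:
  assumes u: "u \<in> E" and v: "v \<in> E"
  shows "((\<lambda>t. \<integral>x. F (u x + t * v x) \<partial>lborel) has_real_derivative (\<integral>x. f (u x) * v x \<partial>lborel)) (at 0)"
  unfolding DERIV_def tendsto_at_iff_sequentially o_def
proof (intro allI impI)
  fix X :: "nat \<Rightarrow> real"
  assume X0: "\<forall>i. X i \<in> UNIV - {0}" and X: "X \<longlonglongrightarrow> 0"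
  have [measurable]: "u \<in> borel_measurable borel" "v \<in> borel_measurable borel" using frac_spaceD[OF u] frac_spaceD[OF v] by auto
  obtain B where B: "\<And>n. \<bar>X n\<bar> \<le> B" using convergent_imp_Bseq[OF convergentI[OF X]] by (auto simp: Bseq_def)
  \<comment> \<open>The factor \<open>max 1 B\<close> makes \<open>?z\<close> dominate both |v|
    itself and every argument u + \<theta> v between \<open>u\<close> and
    \<open>u + X n * v\<close>, as \<open>f_mult_bound\<close> asks.\<close>
  let ?z = "\<lambda>x. 1 * \<bar>u x\<bar> + max 1 B * \<bar>v x\<bar>"
  have Ei: "integrable lborel (\<lambda>x. F (u x + t * v x))" for t by (intro F_integrable frac_space_add frac_space_cmult u v)
  have "(\<lambda>n. \<integral>x. (F (u x + X n * v x) - F (u x)) / X n \<partial>lborel) \<longlonglongrightarrow> (\<integral>x. f (u x) * v x \<partial>lborel)"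
  proof (rule integral_dominated_convergence[where w="\<lambda>x. (a1 + a2) * young p (?z x)"])
    show "integrable lborel (\<lambda>x. (a1 + a2) * young p (?z x))" by (intro integrable_mult_right young_lincomb_integrable u v)
    show "AE x in lborel. (\<lambda>n. (F (u x + X n * v x) - F (u x)) / X n) \<longlonglongrightarrow> f (u x) * v x"
    proof (rule AE_I2)
      fix x
      have "((\<lambda>t. F (u x + t * v x)) has_real_derivative f (u x) * v x) (at 0)"
        by (rule DERIV_cong[OF DERIV_chain2[where f=F and g="\<lambda>t. u x + t * v x" and x=0, OF F_deriv]])
          (auto intro!: derivative_eq_intros)
      then have "((\<lambda>h. (F (u x + (0 + h) * v x) - F (u x + 0 * v x)) / h) \<longlongrightarrow> f (u x) * v x) (at 0)" unfolding DERIV_def .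
      then have "((\<lambda>h. (F (u x + h * v x) - F (u x)) / h) \<longlongrightarrow> f (u x) * v x) (at 0)" by simp
      then show "(\<lambda>n. (F (u x + X n * v x) - F (u x)) / X n) \<longlonglongrightarrow> f (u x) * v x"
        unfolding tendsto_at_iff_sequentially o_def using X0 X by blast
    qed
    show "AE x in lborel. norm ((F (u x + X n * v x) - F (u x)) / X n) \<le> (a1 + a2) * young p (?z x)" for n
    proof (rule AE_I2)
      fix x
      have X0n: "X n \<noteq> 0" using X0 by simp
      obtain \<theta> where \<theta>: "\<bar>\<theta>\<bar> \<le> \<bar>X n\<bar>" "(F (u x + X n * v x) - F (u x)) / X n = f (u x + \<theta> * v x) * v x"
      proof -
        have d: "((\<lambda>t. F (u x + t * v x)) has_real_derivative f (u x + t * v x) * v x) (at t)" for t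
          by (rule DERIV_cong[OF DERIV_chain2[where f=F and g="\<lambda>t. u x + t * v x" and x=t, OF F_deriv]])
            (auto intro!: derivative_eq_intros)
        show ?thesis
        proof (cases "X n > 0")
          case True
          obtain z where z: "0 < z" "z < X n" "F (u x + X n * v x) - F (u x + 0 * v x) = (X n - 0) * (f (u x + z * v x) * v x)"
            using MVT2[OF True, of "\<lambda>t. F (u x + t * v x)" "\<lambda>t. f (u x + t * v x) * v x"] d by blast
          show ?thesis by (rule that[of z]) (use z in \<open>auto simp: field_simps\<close>)
        next
          case False
          then have neg: "X n < 0" using X0n by simp
          obtain z where z: "X n < z" "z < 0" "F (u x + 0 * v x) - F (u x + X n * v x) = (0 - X n) * (f (u x + z * v x) * v x)"
            using MVT2[OF neg, of "\<lambda>t. F (u x + t * v x)" "\<lambda>t. f (u x + t * v x) * v x"] d by blast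
          show ?thesis by (rule that[of z]) (use z neg in \<open>auto simp: field_simps\<close>)
        qed
      qed
      have "\<bar>u x + \<theta> * v x\<bar> \<le> \<bar>u x\<bar> + \<bar>\<theta>\<bar> * \<bar>v x\<bar>" by (metis abs_mult abs_triangle_ineq)
      also have "\<dots> \<le> ?z x" using \<theta>(1) B[of n] by (intro add_mono mult_right_mono) auto
      finally have 1: "\<bar>u x + \<theta> * v x\<bar> \<le> ?z x" .
      have "1 * \<bar>v x\<bar> \<le> max 1 B * \<bar>v x\<bar>" by (intro mult_right_mono) auto
      then have 2: "\<bar>v x\<bar> \<le> ?z x" using abs_ge_zero[of "u x"] by linarith
      show "norm ((F (u x + X n * v x) - F (u x)) / X n) \<le> (a1 + a2) * young p (?z x)"
        unfolding \<theta>(2) using f_mult_bound[OF 1 2] by simp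
    qed
  qed measurable
  note lim = this
  have eq: "(\<integral>x. (F (u x + X n * v x) - F (u x)) / X n \<partial>lborel) = ((\<integral>x. F (u x + (0 + X n) * v x) \<partial>lborel) - (\<integral>x. F (u x + 0 * v x) \<partial>lborel)) / X n" for n
    using Ei[of "X n"] Ei[of 0] by simp
  show "(\<lambda>n. ((\<integral>x. F (u x + (0 + X n) * v x) \<partial>lborel) - (\<integral>x. F (u x + 0 * v x) \<partial>lborel)) / X n) \<longlonglongrightarrow> (\<integral>x. f (u x) * v x \<partial>lborel)"
    using lim unfolding eq .
qed

lemma J_deriv_0:
  assumes W: "pot W" and u: "u \<in> E" and v: "v \<in> E"
  shows "((\<lambda>t. Jf W (\<lambda>x. u x + t * v x)) has_real_derivative dJ W u v) (at 0)"
  unfolding Jf_def dJ_def quad_add[OF W u v]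
  by (auto intro!: derivative_eq_intros nonlinear_deriv u v)

lemma J_deriv:
  assumes W: "pot W" and u: "u \<in> E" and v: "v \<in> E"
  shows "((\<lambda>t. Jf W (\<lambda>x. u x + t * v x)) has_real_derivative dJ W (\<lambda>x. u x + t * v x) v) (at t)"
proof -
  have "((\<lambda>h. Jf W (\<lambda>x. (u x + t * v x) + h * v x)) has_real_derivative dJ W (\<lambda>x. u x + t * v x) v) (at 0)"
    by (intro J_deriv_0 W v frac_space_add frac_space_cmult u)
  then have "((\<lambda>h. (\<lambda>t. Jf W (\<lambda>x. u x + t * v x)) (h + t)) has_real_derivative dJ W (\<lambda>x. u x + t * v x) v) (at 0)"
    by (simp add: algebra_simps)
  then show ?thesis
    using DERIV_shift[of "\<lambda>t. Jf W (\<lambda>x. u x + t * v x)" "dJ W (\<lambda>x. u x + t * v x) v" 0 t] by simp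
qed

lemma dJ_self: "dJ W u u = Gf W u"
  unfolding dJ_def Gf_def bil_def quad_def by (simp add: power2_eq_square mult.commute)

end

section \<open>Critical points on rays and energy splitting\<close>

context frac_problem
begin

lemma F_AE_zero:
  assumes "AE x in lborel. u x = 0" "u \<in> borel_measurable borel"
  shows "(\<integral>x. F (u x) \<partial>lborel) = 0"
proof (rule integral_eq_zero_AE)
  show "AE x in lborel. F (u x) = 0" using assms(1) by eventually_elim (simp add: F0)
qed

lemma J_neg_imp_nonzero:
  assumes W: "pot W" and u: "u \<in> E" and neg: "Jf W u < 0"
  shows "sob_sq s u > 0"
proof (rule ccontr)
  assume "\<not> ?thesis"
  then have "sob_sq s u = 0" using sob_sq_nonneg[of s u] by linarith
  then have "(\<integral>x. F (u x) \<partial>lborel) = 0" by (intro F_AE_zero sob_sq_zero_AE u frac_spaceD(1)[OF u])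
  then show False using neg quad_nonneg[OF W u] by (simp add: Jf_def)
qed

lemma J_zero: "pot W \<Longrightarrow> Jf W (\<lambda>x. 0 * u x) = 0"
  unfolding Jf_def quad_cmult by (simp add: F0)

lemma J_pos_imp_nonzero:
  assumes W: "pot W" and u: "u \<in> E" and pos: "Jf W u > 0"
  shows "sob_sq s u > 0"
  using J_le_quad[of W u] pos quad_pos_iff[OF W u] by linarith

lemma J_translate:
  assumes u: "u \<in> borel_measurable borel" and W: "pot W"
  shows "Jf (\<lambda>x. W (h + x)) (\<lambda>x. u (h + x)) = Jf W u"
proof -
  have [measurable]: "u \<in> borel_measurable borel" "W \<in> borel_measurable borel" using u potD[OF W] by auto
  have "(\<integral>x. F (u (h + x)) \<partial>lborel) = (\<integral>x. F (u x) \<partial>lborel)" by (rule integral_lborel_translate) measurable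
  then show ?thesis unfolding Jf_def by (simp add: quad_translate)
qed

lemma G_zero_if_ray_max:
  assumes W: "pot W" and u: "u \<in> E" and max: "\<And>t. t \<ge> 0 \<Longrightarrow> Jf W (\<lambda>x. t * u x) \<le> Jf W u"
  shows "Gf W u = 0"
proof -
  have "dJ W u u = 0"
  proof (rule DERIV_local_max[OF J_deriv_0[OF W u u] zero_less_one])
    show "\<forall>y. \<bar>0 - y\<bar> < 1 \<longrightarrow> Jf W (\<lambda>x. u x + y * u x) \<le> Jf W (\<lambda>x. u x + 0 * u x)"
    proof (intro allI impI)
      fix y :: real assume "\<bar>0 - y\<bar> < 1"
      then have "Jf W (\<lambda>x. (1 + y) * u x) \<le> Jf W u" by (intro max) auto
      then show "Jf W (\<lambda>x. u x + y * u x) \<le> Jf W (\<lambda>x. u x + 0 * u x)" by (simp add: distrib_right)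
    qed
  qed
  then show ?thesis by (simp add: dJ_self)
qed

lemma dJ_minus:
  shows "dJ W u (\<lambda>x. - v x) = - dJ W u v"
proof -
  have "frac_diff s (\<lambda>x. - v x) q = - frac_diff s v q" for q by (simp add: frac_diff_def algebra_simps)
  then show ?thesis unfolding dJ_def bil_def by simp
qed

text \<open>If the maximum along the ray through \<open>u\<close> is attained at \<open>u\<close> and at \<open>t u\<close>, equality holds
  almost everywhere in the tangent inequality, so the derivatives of \<open>J\<close> at the two points are proportional.\<close>

lemma dJ_proportional:
  assumes W: "pot W" and u: "u \<in> E" and v: "v \<in> E" and G: "Gf W u = 0" and t: "t > 0" and eq: "Jf W (\<lambda>x. t * u x) = Jf W u"
  shows "dJ W (\<lambda>x. t * u x) v = t * dJ W u v"
proof -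
  have [measurable]: "u \<in> borel_measurable borel" "v \<in> borel_measurable borel" using frac_spaceD[OF u] frac_spaceD[OF v] by auto
  let ?R = "\<lambda>x. F (t * u x) - F (u x) - (t\<^sup>2 - 1) / 2 * (u x * f (u x))"
  note i = F_integrable[OF u] tf_integrable[OF u] F_integrable[OF frac_space_cmult[OF u, of t]]
  have Ri: "integrable lborel ?R" using i by simp
  have "(\<integral>x. ?R x \<partial>lborel) = (\<integral>x. F (t * u x) \<partial>lborel) - (\<integral>x. F (u x) \<partial>lborel) - (t\<^sup>2 - 1) / 2 * (\<integral>x. u x * f (u x) \<partial>lborel)"
    using i by simp
  also have "(\<integral>x. u x * f (u x) \<partial>lborel) = quad s W u" using G by (simp add: Gf_def)
  also have "(\<integral>x. F (t * u x) \<partial>lborel) - (\<integral>x. F (u x) \<partial>lborel) - (t\<^sup>2 - 1) / 2 * quad s W u = 0"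
    using eq unfolding Jf_def quad_cmult by (simp add: field_simps)
  finally have "(\<integral>x. ?R x \<partial>lborel) = 0" .
  moreover have "0 \<le> ?R x" for x using F_tangent[of t "u x"] t by simp
  ultimately have "AE x in lborel. ?R x = 0" using Ri by (subst (asm) integral_nonneg_eq_0_iff_AE) auto
  then have AE: "AE x in lborel. f (t * u x) * v x = t * (f (u x) * v x)"
    by eventually_elim (use F_tangent_eq[OF t] in simp)
  have "(\<integral>x. f (t * u x) * v x \<partial>lborel) = (\<integral>x. t * (f (u x) * v x) \<partial>lborel)"
    by (rule integral_cong_AE) (use AE in auto)
  then have 1: "(\<integral>x. f (t * u x) * v x \<partial>lborel) = t * (\<integral>x. f (u x) * v x \<partial>lborel)" by simp
  have 2: "bil s W (\<lambda>x. t * u x) v = t * bil s W u v" using bil_add[OF W u v, of t 0] by simp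
  show ?thesis unfolding dJ_def 1 2 by (simp add: algebra_simps)
qed

text \<open>If \<open>dJ V u v < 0\<close>, the ray through u + \<epsilon> v still reaches the value
  c by \<open>level\<close>. The parameters accumulate at some t' where the ray of \<open>u\<close>
  has value c as well; t' may differ from 1, and proportionality of \<open>dJ\<close> carries the
  negative sign there. The mean value theorem then puts the perturbed value strictly below a value
  on the ray of \<open>u\<close>, hence below c.\<close>

lemma ray_max_critical:
  assumes c: "c > 0" and u: "u \<in> E" and Ju: "Jf V u = c" and max: "\<And>t. t \<ge> 0 \<Longrightarrow> Jf V (\<lambda>x. t * u x) \<le> c"
    and level: "\<And>v. v \<in> E \<Longrightarrow> sob_sq s v > 0 \<Longrightarrow> \<exists>t\<ge>0. c \<le> Jf V (\<lambda>x. t * v x)"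
    and v: "v \<in> E"
  shows "dJ V u v = 0"
proof -
  note W = pot_V
  have G: "Gf V u = 0" by (rule G_zero_if_ray_max[OF W u]) (use max Ju in simp)
  have nonneg: "0 \<le> dJ V u v" if v: "v \<in> E" for v
  proof (rule ccontr)
    assume "\<not> 0 \<le> dJ V u v"
    then have neg: "dJ V u v < 0" by simp
    define \<epsilon> where "\<epsilon> n = 1 / real (Suc n)" for n
    have \<epsilon>: "\<epsilon> \<longlonglongrightarrow> 0" "\<epsilon> n > 0" for n
      using LIMSEQ_inverse_real_of_nat unfolding \<epsilon>_def by (auto simp: inverse_eq_divide)
    have upos: "sob_sq s u > 0" using J_pos_imp_nonzero[OF W u] Ju c by simp
    \<comment> \<open>A parameter of negative energy. The sign survives small perturbations and so
      bounds the ray parameters of all u + \<epsilon> v with small \<epsilon> at once.\<close>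
    obtain T where T: "T > 0" "Jf V (\<lambda>x. T * u x) < 0" using J_neg_ex[OF W u upos] .
    define w where "w n x = u x + \<epsilon> n * v x" for n x
    have wE: "w n \<in> E" for n unfolding w_def[abs_def] by (intro frac_space_add frac_space_cmult u v)
    have "(\<lambda>n. Jf V (\<lambda>x. T * u x + (T * \<epsilon> n) * v x)) \<longlonglongrightarrow> Jf V (\<lambda>x. T * u x + (T * 0) * v x)"
      by (intro J_lincomb_tendsto W u v tendsto_intros \<epsilon>)
    then have "\<forall>\<^sub>F n in sequentially. Jf V (\<lambda>x. T * u x + (T * \<epsilon> n) * v x) < 0"
      using T(2) by (intro order_tendstoD(2)) auto
    then obtain N where N: "\<And>n. n \<ge> N \<Longrightarrow> Jf V (\<lambda>x. T * u x + (T * \<epsilon> n) * v x) < 0" by (auto simp: eventually_sequentially)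
    have JT: "Jf V (\<lambda>x. T * w n x) < 0" if "n \<ge> N" for n
      using N[OF that] unfolding w_def by (simp add: algebra_simps)
    have "\<exists>t. 0 \<le> t \<and> t \<le> T \<and> c \<le> Jf V (\<lambda>x. t * w (n + N) x)" for n
    proof -
      have "sob_sq s (\<lambda>x. T * w (n + N) x) > 0" by (rule J_neg_imp_nonzero[OF W frac_space_cmult[OF wE] JT]) simp
      then have "sob_sq s (w (n + N)) > 0" unfolding sob_sq_cmult using sob_sq_nonneg[of s "w (n + N)"] by (simp add: zero_less_mult_iff)
      then obtain t where t: "t \<ge> 0" "c \<le> Jf V (\<lambda>x. t * w (n + N) x)" using level[OF wE] by blast
      have "t \<le> T"
      proof (rule ccontr)
        assume "\<not> t \<le> T"
        then have "Jf V (\<lambda>x. t * w (n + N) x) < 0" by (intro J_neg_beyond[OF W wE T(1) _ JT]) auto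
        then show False using t(2) c by simp
      qed
      then show ?thesis using t by blast
    qed
    then obtain t where t: "\<And>n. 0 \<le> t n" "\<And>n. t n \<le> T" "\<And>n. c \<le> Jf V (\<lambda>x. t n * w (n + N) x)" by metis
    have "\<forall>n. t n \<in> {0..T}" using t by auto
    then obtain t' k where k: "strict_mono (k :: nat \<Rightarrow> nat)" "(t \<circ> k) \<longlonglongrightarrow> t'"
      using compact_Icc[of 0 T] unfolding compact_def by blast
    define \<tau> where "\<tau> n = t (k n)" for n
    define e where "e n = \<epsilon> (k n + N)" for n
    have \<tau>: "\<tau> \<longlonglongrightarrow> t'" "0 \<le> \<tau> n" for n using k(2) t by (auto simp: \<tau>_def[abs_def] o_def)
    have e: "e \<longlonglongrightarrow> 0" "e n > 0" for n
    proof -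
      have "strict_mono (\<lambda>n. k n + N)" using k(1) by (simp add: strict_mono_def)
      then show "e \<longlonglongrightarrow> 0" using LIMSEQ_subseq_LIMSEQ[OF \<epsilon>(1)] unfolding e_def by (simp add: o_def)
      show "e n > 0" unfolding e_def by (rule \<epsilon>)
    qed
    have Jc: "c \<le> Jf V (\<lambda>x. \<tau> n * u x + (\<tau> n * e n) * v x)" for n
      using t(3)[of "k n"] unfolding w_def \<tau>_def e_def by (simp add: algebra_simps)
    have "(\<lambda>n. Jf V (\<lambda>x. \<tau> n * u x + (\<tau> n * e n) * v x)) \<longlonglongrightarrow> Jf V (\<lambda>x. t' * u x + (t' * 0) * v x)"
      by (intro J_lincomb_tendsto W u v tendsto_intros \<tau> e)
    then have "c \<le> Jf V (\<lambda>x. t' * u x + (t' * 0) * v x)" by (rule LIMSEQ_le_const) (use Jc in auto)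
    then have ct': "c \<le> Jf V (\<lambda>x. t' * u x)" by simp
    have t'0: "t' \<ge> 0" by (rule LIMSEQ_le_const[OF \<tau>(1)]) (use \<tau>(2) in auto)
    have "t' \<noteq> 0" using ct' c J_zero[OF W, of u] by auto
    then have t': "t' > 0" using t'0 by simp
    have "Jf V (\<lambda>x. t' * u x) = Jf V u" using ct' max[OF t'0] Ju by simp
    then have dneg: "dJ V (\<lambda>x. t' * u x) v < 0"
      using dJ_proportional[OF W u v G t'] neg t' by (simp add: mult_pos_neg)
    have \<tau>pos: "\<tau> n > 0" for n
    proof -
      have "\<tau> n \<noteq> 0" using Jc[of n] c J_zero[OF W, of u] by auto
      then show ?thesis using \<tau>(2)[of n] by simp
    qed
    have "\<exists>\<theta>. 0 < \<theta> \<and> \<theta> < \<tau> n * e n \<and> Jf V (\<lambda>x. \<tau> n * u x + (\<tau> n * e n) * v x) - Jf V (\<lambda>x. \<tau> n * u x + 0 * v x) = (\<tau> n * e n - 0) * dJ V (\<lambda>x. \<tau> n * u x + \<theta> * v x) v" for n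
    proof -
      have lt: "0 < \<tau> n * e n" using \<tau>pos e(2) by simp
      have uE: "(\<lambda>x. \<tau> n * u x) \<in> E" by (rule frac_space_cmult[OF u])
      show ?thesis
        using MVT2[OF lt, of "\<lambda>\<theta>. Jf V (\<lambda>x. \<tau> n * u x + \<theta> * v x)" "\<lambda>\<theta>. dJ V (\<lambda>x. \<tau> n * u x + \<theta> * v x) v"] J_deriv[OF W uE v] by blast
    qed
    then obtain \<theta> where \<theta>: "\<And>n. 0 < \<theta> n" "\<And>n. \<theta> n < \<tau> n * e n"
      "\<And>n. Jf V (\<lambda>x. \<tau> n * u x + (\<tau> n * e n) * v x) - Jf V (\<lambda>x. \<tau> n * u x + 0 * v x) = (\<tau> n * e n - 0) * dJ V (\<lambda>x. \<tau> n * u x + \<theta> n * v x) v" by metis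
    have "(\<lambda>n. \<tau> n * e n) \<longlonglongrightarrow> t' * 0" by (intro tendsto_intros \<tau> e)
    then have "(\<lambda>n. \<tau> n * e n) \<longlonglongrightarrow> 0" by simp
    then have \<theta>0: "\<theta> \<longlonglongrightarrow> 0" by (rule real_tendsto_0_le[rotated 2]) (use \<theta> in \<open>auto intro: less_imp_le\<close>)
    have "(\<lambda>n. dJ V (\<lambda>x. \<tau> n * u x + \<theta> n * v x) v) \<longlonglongrightarrow> dJ V (\<lambda>x. t' * u x + 0 * v x) v"
      by (rule dJ_lincomb_tendsto[OF W u v \<tau>(1) \<theta>0])
    then have "\<forall>\<^sub>F n in sequentially. dJ V (\<lambda>x. \<tau> n * u x + \<theta> n * v x) v < 0" using dneg by (intro order_tendstoD(2)) auto
    then obtain n where n: "dJ V (\<lambda>x. \<tau> n * u x + \<theta> n * v x) v < 0" by (auto simp: eventually_sequentially)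
    have "(\<tau> n * e n - 0) * dJ V (\<lambda>x. \<tau> n * u x + \<theta> n * v x) v < 0" using n \<tau>pos[of n] e(2)[of n] by (simp add: mult_pos_neg)
    then have "Jf V (\<lambda>x. \<tau> n * u x + (\<tau> n * e n) * v x) < Jf V (\<lambda>x. \<tau> n * u x + 0 * v x)" using \<theta>(3)[of n] by linarith
    also have "\<dots> \<le> c" using max[OF \<tau>(2)[of n]] by simp
    finally show False using Jc[of n] by simp
  qed
  have "(\<lambda>x. - v x) \<in> E" using frac_space_cmult[OF v, of "-1"] by simp
  from nonneg[OF this] nonneg[OF v] show ?thesis unfolding dJ_minus by simp
qed

section \<open>Brezis-Lieb splitting of norm and energy\<close>

lemma young_mult_le:
  assumes "0 \<le> t" "t \<le> T" "1 \<le> T"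
  shows "young p (t * x) \<le> T powr (p + 1) * young p x"
proof -
  have "t\<^sup>2 \<le> T\<^sup>2" using assms by (intro power_mono) auto
  also have "T\<^sup>2 \<le> T powr (p + 1)"
  proof -
    have "T powr 2 \<le> T powr (p + 1)" using assms p1 by (intro powr_mono) auto
    then show ?thesis using assms by simp
  qed
  finally have 1: "t\<^sup>2 * x\<^sup>2 \<le> T powr (p + 1) * x\<^sup>2" by (intro mult_right_mono) auto
  have 2: "t powr (p + 1) * \<bar>x\<bar> powr (p + 1) \<le> T powr (p + 1) * \<bar>x\<bar> powr (p + 1)"
    using assms p1 by (intro mult_right_mono powr_mono2) auto
  show ?thesis unfolding young_def using 1 2 assms
    by (simp add: power_mult_distrib abs_mult powr_mult distrib_left)
qed

text \<open>The defect consists of the mixed terms, which vanish in the limit because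
  \<open>v n\<close> is bounded and tends to zero almost everywhere, and of the drift
  \<open>Wn n x - W x\<close> tested on the fixed function \<open>w\<close>.\<close>

lemma quad_split:
  assumes Wn: "\<And>n. pot (Wn n)" and W: "pot W" and WW: "\<And>x. (\<lambda>n. Wn n x) \<longlonglongrightarrow> W x"
    and vE: "\<And>n. v n \<in> E" and w: "w \<in> E" and vK: "\<And>n. sob_sq s (v n) \<le> K"
    and AE: "AE x in lborel. (\<lambda>n. v n x) \<longlonglongrightarrow> 0"
  shows "(\<lambda>n. quad s (Wn n) (\<lambda>x. v n x + w x) - quad s (Wn n) (v n) - quad s W w) \<longlonglongrightarrow> 0"
proof -
  note vD = frac_spaceD[OF vE] and wD = frac_spaceD[OF w]
  have [measurable]: "v n \<in> borel_measurable borel" "w \<in> borel_measurable borel" "Wn n \<in> borel_measurable borel" "W \<in> borel_measurable borel" for n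
    using vD wD potD(1)[OF Wn] potD(1)[OF W] by auto
  have ab: "\<bar>2 * (x * y)\<bar> \<le> e * x\<^sup>2 + 1 / e * y\<^sup>2" if e: "e > 0" for x y e :: real
  proof -
    have "2 * (sqrt e * \<bar>x\<bar>) * (\<bar>y\<bar> / sqrt e) \<le> (sqrt e * \<bar>x\<bar>)\<^sup>2 + (\<bar>y\<bar> / sqrt e)\<^sup>2" by (rule sum_squares_bound)
    then show ?thesis using e by (simp add: abs_mult power_mult_distrib power_divide)
  qed
  have V1: "0 \<le> V1" using potD(4)[OF W, of 0] potD(3)[OF W, of 0] by linarith
  have A: "(\<lambda>n. \<integral>q. (2 * (frac_diff s (v n) q * frac_diff s w q)) \<partial>lborel) \<longlonglongrightarrow> 0"
  proof (rule tendsto_integral_if_abs, rule L1_tendsto_0_split(2))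
    show "AE q in lborel. (\<lambda>n. 2 * (frac_diff s (v n) q * frac_diff s w q)) \<longlonglongrightarrow> 0"
    proof -
      have "AE x in lborel. (\<lambda>n. v n x) \<longlonglongrightarrow> (\<lambda>_. 0) x" using AE by simp
      from AE_frac_diff_tendsto[OF this] have "AE q in lborel. (\<lambda>n. frac_diff s (v n) q) \<longlonglongrightarrow> frac_diff s (\<lambda>_. 0) q" .
      then show ?thesis
      proof eventually_elim
        case (elim q)
        then have "(\<lambda>n. 2 * (frac_diff s (v n) q * frac_diff s w q)) \<longlonglongrightarrow> 2 * (frac_diff s (\<lambda>_. 0) q * frac_diff s w q)" by (intro tendsto_intros)
        then show ?case by (simp add: frac_diff_def)
      qed
    qed
    show "integrable lborel (\<lambda>q. (frac_diff s (v n) q)\<^sup>2)" "integrable lborel (\<lambda>q. (frac_diff s w q)\<^sup>2)" for n using vD wD by auto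
    show "(\<integral>q. (frac_diff s (v n) q)\<^sup>2 \<partial>lborel) \<le> K" for n
    proof -
      have "0 \<le> (\<integral>x. (v n x)\<^sup>2 \<partial>lborel)" by simp
      then show ?thesis using vK[of n] unfolding sob_sq_def by linarith
    qed
    show "\<exists>C\<ge>0. \<forall>n q. \<bar>2 * (frac_diff s (v n) q * frac_diff s w q)\<bar> \<le> e * (frac_diff s (v n) q)\<^sup>2 + C * (frac_diff s w q)\<^sup>2" if "e > 0" for e
      using ab[OF that] that by (intro exI[of _ "1 / e"]) auto
  qed auto
  let ?R = "\<lambda>n x. Wn n x * (2 * (v n x * w x)) + (Wn n x - W x) * (w x)\<^sup>2"
  have B: "(\<lambda>n. \<integral>x. ?R n x \<partial>lborel) \<longlonglongrightarrow> 0"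
  proof (rule tendsto_integral_if_abs, rule L1_tendsto_0_split(2))
    show "AE x in lborel. (\<lambda>n. ?R n x) \<longlonglongrightarrow> 0"
      using AE
    proof eventually_elim
      case (elim x)
      then have "(\<lambda>n. ?R n x) \<longlonglongrightarrow> W x * (2 * (0 * w x)) + (W x - W x) * (w x)\<^sup>2" by (intro tendsto_intros WW)
      then show ?case by simp
    qed
    show "integrable lborel (\<lambda>x. (v n x)\<^sup>2)" "integrable lborel (\<lambda>x. (w x)\<^sup>2)" for n using vD wD by auto
    show "(\<integral>x. (v n x)\<^sup>2 \<partial>lborel) \<le> K" for n
    proof -
      have "0 \<le> (\<integral>q. (frac_diff s (v n) q)\<^sup>2 \<partial>lborel)" by simp
      then show ?thesis using vK[of n] unfolding sob_sq_def by linarith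
    qed
    show "\<exists>C\<ge>0. \<forall>n x. \<bar>?R n x\<bar> \<le> e * (v n x)\<^sup>2 + C * (w x)\<^sup>2" if e: "e > 0" for e
    proof -
      define d where "d = e / (V1 + 1)"
      have d: "d > 0" "V1 * d \<le> e" using e V1 by (auto simp: d_def field_simps)
      have "\<bar>?R n x\<bar> \<le> e * (v n x)\<^sup>2 + (V1 / d + V1) * (w x)\<^sup>2" for n x
      proof -
        have "\<bar>Wn n x - W x\<bar> \<le> V1" using potD(2,3)[OF Wn[of n], of x] potD(2,3)[OF W, of x] V0 by (simp add: abs_le_iff)
        then have 1: "\<bar>(Wn n x - W x) * (w x)\<^sup>2\<bar> \<le> V1 * (w x)\<^sup>2" by (simp add: abs_mult mult_right_mono)
        have "\<bar>Wn n x * (2 * (v n x * w x))\<bar> \<le> V1 * (d * (v n x)\<^sup>2 + 1 / d * (w x)\<^sup>2)"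
          unfolding abs_mult[of "Wn n x"] using V1 by (intro mult_mono pot_abs_le Wn ab d) auto
        also have "\<dots> = V1 * d * (v n x)\<^sup>2 + V1 / d * (w x)\<^sup>2" by (simp add: distrib_left)
        also have "V1 * d * (v n x)\<^sup>2 \<le> e * (v n x)\<^sup>2" using d(2) by (intro mult_right_mono) auto
        finally have 2: "\<bar>Wn n x * (2 * (v n x * w x))\<bar> \<le> e * (v n x)\<^sup>2 + V1 / d * (w x)\<^sup>2" by simp
        have "\<bar>?R n x\<bar> \<le> \<bar>Wn n x * (2 * (v n x * w x))\<bar> + \<bar>(Wn n x - W x) * (w x)\<^sup>2\<bar>" by (rule abs_triangle_ineq)
        then show ?thesis using 1 2 unfolding distrib_right by linarith
      qed
      moreover have "V1 / d + V1 \<ge> 0" using d V1 by simp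
      ultimately show ?thesis by blast
    qed
  qed auto
  have eq: "quad s (Wn n) (\<lambda>x. v n x + w x) - quad s (Wn n) (v n) - quad s W w = (\<integral>q. (2 * (frac_diff s (v n) q * frac_diff s w q)) \<partial>lborel) + (\<integral>x. ?R n x \<partial>lborel)" for n
  proof -
    note i = quad_integrable[OF Wn[of n] vE[of n] w] and iw = quad_integrable(3)[OF W w w] and iw' = quad_integrable(3)[OF Wn[of n] w w]
    have "(\<integral>x. ?R n x \<partial>lborel) = (\<integral>x. 2 * (Wn n x * (v n x * w x)) + (Wn n x * (w x)\<^sup>2 - W x * (w x)\<^sup>2) \<partial>lborel)"
      by (intro Bochner_Integration.integral_cong) (auto simp: algebra_simps)
    also have "\<dots> = 2 * (\<integral>x. Wn n x * (v n x * w x) \<partial>lborel) + ((\<integral>x. Wn n x * (w x)\<^sup>2 \<partial>lborel) - (\<integral>x. W x * (w x)\<^sup>2 \<partial>lborel))"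
      using i iw iw' by simp
    finally have R: "(\<integral>x. ?R n x \<partial>lborel) = 2 * (\<integral>x. Wn n x * (v n x * w x) \<partial>lborel) + ((\<integral>x. Wn n x * (w x)\<^sup>2 \<partial>lborel) - (\<integral>x. W x * (w x)\<^sup>2 \<partial>lborel))" .
    have "quad s (Wn n) (\<lambda>x. v n x + 1 * w x) = quad s (Wn n) (v n) + 2 * 1 * bil s (Wn n) (v n) w + 1\<^sup>2 * quad s (Wn n) w"
      by (rule quad_add[OF Wn vE w])
    then show ?thesis unfolding R by (simp add: bil_def quad_def)
  qed
  show ?thesis unfolding eq using tendsto_add[OF A B] by simp
qed

text \<open>The increment bound for \<open>F\<close> is used in both orders: with
  \<open>t n * v n x\<close> as base point it dominates the defect, with \<open>t n * w x\<close> as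
  base point it gives pointwise convergence. Both bounds are uniform for factors in [0, T], so
  \<open>t n\<close> may oscillate.\<close>

lemma F_split:
  assumes t: "\<And>n. 0 \<le> t n" "\<And>n. t n \<le> T" and T: "1 \<le> T"
    and vE: "\<And>n. v n \<in> E" and w: "w \<in> E" and vK: "\<And>n. sob_sq s (v n) \<le> K" and K: "K > 0"
    and AE: "AE x in lborel. (\<lambda>n. v n x) \<longlonglongrightarrow> 0"
  shows "(\<lambda>n. \<integral>x. F (t n * v n x + t n * w x) - F (t n * v n x) - F (t n * w x) \<partial>lborel) \<longlonglongrightarrow> 0"
proof (rule tendsto_integral_if_abs, rule L1_tendsto_0_split(2))
  note vD = frac_spaceD[OF vE] and wD = frac_spaceD[OF w]
  have [measurable]: "v n \<in> borel_measurable borel" "w \<in> borel_measurable borel" for n using vD wD by auto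
  let ?R = "\<lambda>n x. F (t n * v n x + t n * w x) - F (t n * v n x) - F (t n * w x)"
  let ?M = "T powr (p + 1)"
  have YC: "\<And>e. e > 0 \<Longrightarrow> \<exists>C\<ge>0. \<forall>a b. \<bar>F (a + b) - F a\<bar> \<le> e * young p a + C * young p b"
    using young_cont_F unfolding young_cont_def by blast
  obtain C1 where C1: "C1 \<ge> 0" "\<And>a b. \<bar>F (a + b) - F a\<bar> \<le> 1 * young p a + C1 * young p b" using YC[of 1] by auto
  have FC: "\<bar>F b\<bar> \<le> C1 * young p b" for b using C1(2)[of 0 b] p1 by (simp add: F0 young_def)
  have yt: "young p (t n * x) \<le> ?M * young p x" for n x by (rule young_mult_le[OF t T])
  have M0: "?M > 0" using T by simp
  show "(\<lambda>x. ?R n x) \<in> borel_measurable lborel" for n by measurable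
  show "integrable lborel (\<lambda>x. young p (v n x))" for n by (rule young_integrable[OF vE])
  show "integrable lborel (\<lambda>x. young p (w x))" by (rule young_integrable[OF w])
  show "(\<integral>x. young p (v n x) \<partial>lborel) \<le> K + CS * K powr ((p + 1) / 2)" for n by (rule young_integral_le[OF vE vK K])
  show "\<exists>C\<ge>0. \<forall>n x. \<bar>?R n x\<bar> \<le> e * young p (v n x) + C * young p (w x)" if e: "e > 0" for e
  proof -
    obtain C where C: "C \<ge> 0" "\<And>a b. \<bar>F (a + b) - F a\<bar> \<le> e / ?M * young p a + C * young p b" using YC[of "e / ?M"] e M0 by auto
    have "\<bar>?R n x\<bar> \<le> e * young p (v n x) + (C + C1) * ?M * young p (w x)" for n x
    proof -
      have "\<bar>?R n x\<bar> \<le> \<bar>F (t n * v n x + t n * w x) - F (t n * v n x)\<bar> + \<bar>F (t n * w x)\<bar>" by linarith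
      also have "\<dots> \<le> (e / ?M * young p (t n * v n x) + C * young p (t n * w x)) + C1 * young p (t n * w x)"
        by (intro add_mono C FC)
      also have "\<dots> \<le> (e / ?M * (?M * young p (v n x)) + C * (?M * young p (w x))) + C1 * (?M * young p (w x))"
        using e M0 C(1) C1(1) by (intro add_mono mult_left_mono yt) auto
      also have "\<dots> = e * young p (v n x) + (C + C1) * ?M * young p (w x)" using M0 by (simp add: algebra_simps)
      finally show ?thesis .
    qed
    moreover have "0 \<le> (C + C1) * ?M" using C(1) C1(1) M0 by simp
    ultimately show ?thesis by blast
  qed
  show "AE x in lborel. (\<lambda>n. ?R n x) \<longlonglongrightarrow> 0"
    using AE
  proof eventually_elim
    case (elim x)
    have "(\<lambda>n. young p (v n x)) \<longlonglongrightarrow> 0\<^sup>2 + \<bar>0\<bar> powr (p + 1)"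
      unfolding young_def using p1 elim by (intro tendsto_intros tendsto_powr') auto
    then have y0: "(\<lambda>n. young p (v n x)) \<longlonglongrightarrow> 0" using p1 by simp
    show ?case
    proof (rule LIMSEQ_I)
      fix e :: real assume e: "e > 0"
      let ?y = "young p (w x)"
      define d where "d = e / (2 * (?M * ?y + 1))"
      have y1: "?M * ?y \<ge> 0" using M0 by simp
      have d: "d > 0" "d * (?M * ?y) < e / 2" using e y1 by (auto simp: d_def field_simps add_pos_nonneg)
      obtain C where C: "C \<ge> 0" "\<And>a b. \<bar>F (a + b) - F a\<bar> \<le> d * young p a + C * young p b" using YC[OF d(1)] by auto
      have "(\<lambda>n. (C + C1) * (?M * young p (v n x))) \<longlonglongrightarrow> (C + C1) * (?M * 0)" by (intro tendsto_intros y0)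
      then have "(\<lambda>n. (C + C1) * (?M * young p (v n x))) \<longlonglongrightarrow> 0" by simp
      then obtain N where N: "\<And>n. n \<ge> N \<Longrightarrow> norm ((C + C1) * (?M * young p (v n x)) - 0) < e / 2" using LIMSEQ_D e by (metis half_gt_zero)
      have "norm (?R n x - 0) < e" if "n \<ge> N" for n
      proof -
        have "\<bar>?R n x\<bar> \<le> \<bar>F (t n * w x + t n * v n x) - F (t n * w x)\<bar> + \<bar>F (t n * v n x)\<bar>"
          unfolding add.commute[of "t n * v n x"] by linarith
        also have "\<dots> \<le> (d * young p (t n * w x) + C * young p (t n * v n x)) + C1 * young p (t n * v n x)" by (intro add_mono C FC)
        also have "\<dots> \<le> (d * (?M * ?y) + C * (?M * young p (v n x))) + C1 * (?M * young p (v n x))"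
          using d(1) C(1) C1(1) by (intro add_mono mult_left_mono yt) auto
        also have "\<dots> = d * (?M * ?y) + (C + C1) * (?M * young p (v n x))" by (simp add: algebra_simps)
        also have "\<dots> < e" using d(2) N[OF that] by (simp add: abs_less_iff)
        finally show ?thesis by simp
      qed
      then show "\<exists>N. \<forall>n\<ge>N. norm (?R n x - 0) < e" by blast
    qed
  qed
qed auto

lemma J_split:
  assumes t: "\<And>n. 0 \<le> t n" "\<And>n. t n \<le> T"
    and Wn: "\<And>n. pot (Wn n)" and W: "pot W" and WW: "\<And>x. (\<lambda>n. Wn n x) \<longlonglongrightarrow> W x"
    and vE: "\<And>n. v n \<in> E" and w: "w \<in> E" and vK: "\<And>n. sob_sq s (v n) \<le> K"
    and AE: "AE x in lborel. (\<lambda>n. v n x) \<longlonglongrightarrow> 0"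
  shows "(\<lambda>n. Jf (Wn n) (\<lambda>x. t n * (v n x + w x)) - Jf (Wn n) (\<lambda>x. t n * v n x) - Jf W (\<lambda>x. t n * w x)) \<longlonglongrightarrow> 0"
proof -
  let ?S = "\<lambda>n. quad s (Wn n) (\<lambda>x. v n x + w x) - quad s (Wn n) (v n) - quad s W w"
  let ?R = "\<lambda>n. \<integral>x. F (t n * v n x + t n * w x) - F (t n * v n x) - F (t n * w x) \<partial>lborel"
  have S: "?S \<longlonglongrightarrow> 0" by (rule quad_split[OF Wn W WW vE w vK AE])
  have "sob_sq s (v n) \<le> max 1 K" for n using vK[of n] by simp
  then have R: "?R \<longlonglongrightarrow> 0" using t by (intro F_split[where T="max 1 T" and K="max 1 K"] vE w AE) (auto intro: max.coboundedI2)
  have eq: "Jf (Wn n) (\<lambda>x. t n * (v n x + w x)) - Jf (Wn n) (\<lambda>x. t n * v n x) - Jf W (\<lambda>x. t n * w x) = (t n)\<^sup>2 / 2 * ?S n - ?R n" for n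
  proof -
    have "(\<lambda>x. t n * v n x + t n * w x) \<in> E" by (intro frac_space_add frac_space_cmult vE w)
    then have "integrable lborel (\<lambda>x. F (t n * v n x + t n * w x))" by (rule F_integrable)
    then have R: "?R n = (\<integral>x. F (t n * (v n x + w x)) \<partial>lborel) - (\<integral>x. F (t n * v n x) \<partial>lborel) - (\<integral>x. F (t n * w x) \<partial>lborel)"
      using F_integrable[OF frac_space_cmult[OF vE[of n], of "t n"]] F_integrable[OF frac_space_cmult[OF w, of "t n"]] by (simp add: distrib_left)
    show ?thesis unfolding R Jf_def quad_cmult by (simp add: algebra_simps diff_divide_distrib)
  qed
  have "(\<lambda>n. (t n)\<^sup>2 / 2 * ?S n) \<longlonglongrightarrow> 0"
  proof (rule tendsto_rabs_zero_cancel, rule real_tendsto_0_le)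
    show "\<bar>(t n)\<^sup>2 / 2 * ?S n\<bar> \<le> T\<^sup>2 / 2 * \<bar>?S n\<bar>" for n
      unfolding abs_mult using t by (intro mult_right_mono) (auto intro!: power_mono)
    have "(\<lambda>n. T\<^sup>2 / 2 * \<bar>?S n\<bar>) \<longlonglongrightarrow> T\<^sup>2 / 2 * 0" by (intro tendsto_intros tendsto_rabs_zero S)
    then show "(\<lambda>n. T\<^sup>2 / 2 * \<bar>?S n\<bar>) \<longlonglongrightarrow> 0" by simp
  qed simp
  from tendsto_diff[OF this R] show ?thesis unfolding eq by simp
qed

end

section \<open>Existence of a critical point at the minimal ray level\<close>

context frac_problem
begin

text \<open>Radial compactification of the space to the unit ball: a subsequence of the translations
  either converges or escapes to infinity.\<close>

lemma shifted_potential_limit: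
  fixes y :: "nat \<Rightarrow> 'a"
  assumes cont: "continuous_on UNIV V" and lim: "(V \<longlongrightarrow> V1) at_infinity"
  obtains r W y0 where "strict_mono (r :: nat \<Rightarrow> nat)" "pot W" "\<And>x. (\<lambda>n. V (y (r n) + x)) \<longlonglongrightarrow> W x" "\<And>x. V (y0 + x) \<le> W x"
proof -
  define z where "z n = (1 / (1 + norm (y n))) *\<^sub>R y n" for n
  have pos: "1 + norm (y n) > 0" for n by (simp add: add_pos_nonneg)
  have nz: "1 - norm (z n) = 1 / (1 + norm (y n))" for n
    using pos[of n] by (simp add: z_def field_simps)
  have "0 < 1 - norm (z n)" for n unfolding nz using pos[of n] by simp
  then have "norm (z n) \<le> 1" for n by (meson diff_gt_0_iff_gt less_imp_le)
  then have "\<forall>n. z n \<in> cball 0 1" by simp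
  then obtain l r where r: "strict_mono (r :: nat \<Rightarrow> nat)" and l: "(z \<circ> r) \<longlonglongrightarrow> l" "l \<in> cball 0 1"
    using compact_cball[of "0::'a" 1] unfolding compact_def by blast
  have l': "(\<lambda>n. z (r n)) \<longlonglongrightarrow> l" using l(1) by (simp add: o_def)
  have yz: "y n = (1 / (1 - norm (z n))) *\<^sub>R z n" for n
    unfolding nz using pos[of n] by (simp add: z_def)
  show ?thesis
  proof (cases "norm l < 1")
    case True
    define y0 where "y0 = (1 / (1 - norm l)) *\<^sub>R l"
    have "(\<lambda>n. (1 / (1 - norm (z (r n)))) *\<^sub>R z (r n)) \<longlonglongrightarrow> y0"
      unfolding y0_def using True by (intro tendsto_intros l') auto
    then have ylim: "(\<lambda>n. y (r n)) \<longlonglongrightarrow> y0" unfolding yz[symmetric] .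
    have isC: "isCont V p" for p using cont by (simp add: continuous_on_eq_continuous_at)
    have "(\<lambda>n. V (y (r n) + x)) \<longlonglongrightarrow> V (y0 + x)" for x
      by (rule isCont_tendsto_compose[OF isC]) (intro tendsto_intros ylim)
    then show ?thesis using that[of r "\<lambda>x. V (y0 + x)" y0] r pot_translate[OF pot_V] by blast
  next
    case False
    then have nl: "norm l = 1" using l(2) by simp
    have "(\<lambda>n. 1 - norm (z (r n))) \<longlonglongrightarrow> 1 - norm l" by (intro tendsto_intros l')
    then have "(\<lambda>n. 1 - norm (z (r n))) \<longlonglongrightarrow> 0" by (simp add: nl)
    then have "filterlim (\<lambda>n. inverse (1 - norm (z (r n)))) at_top sequentially"
    proof (rule filterlim_inverse_at_top)
      show "\<forall>\<^sub>F n in sequentially. 0 < 1 - norm (z (r n))" unfolding nz using pos by simp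
    qed
    then have top: "filterlim (\<lambda>n. 1 + norm (y (r n))) at_top sequentially" unfolding nz by simp
    have "(\<lambda>n. V (y (r n) + x)) \<longlonglongrightarrow> V1" for x
    proof (rule filterlim_compose[OF lim], unfold filterlim_at_infinity_conv_norm_at_top)
      have "filterlim (\<lambda>n. - (1 + norm x) + (1 + norm (y (r n)))) at_top sequentially"
        by (rule filterlim_tendsto_add_at_top[OF tendsto_const top])
      then show "filterlim (\<lambda>n. norm (y (r n) + x)) at_top sequentially"
      proof (rule filterlim_at_top_mono)
        have "- (1 + norm x) + (1 + norm (y (r n))) \<le> norm (y (r n) + x)" for n
          using norm_triangle_ineq2[of "y (r n)" "- x"] by simp
        then show "\<forall>\<^sub>F n in sequentially. - (1 + norm x) + (1 + norm (y (r n))) \<le> norm (y (r n) + x)" by simp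
      qed
    qed
    moreover have "pot (\<lambda>_. V1)" using V_bounds[of undefined] by (simp add: pot_def)
    \<comment> \<open>Escape to infinity: the limit potential is the constant \<open>V1\<close>,
      which lies above every translate of \<open>V\<close>; the shift 0 is one choice.\<close>
    ultimately show ?thesis using that[of r "\<lambda>_. V1" 0] r V_bounds(2) by simp
  qed
qed

text \<open>\<open>level\<close> says that no ray stays below c, and the \<open>u n\<close> are
  Nehari points whose energies approach c. By \<open>G\<close> each \<open>u n\<close> is a ray
  maximum, so \<open>J\<close> is at most c + 1 / (n + 1) on its whole ray; this is what is known
  about the sequence and is enough to run the splitting.\<close>

theorem critical_level:
  assumes cont: "continuous_on UNIV V" and lim: "(V \<longlongrightarrow> V1) at_infinity"
    and c: "c > 0"
    and level: "\<And>v. v \<in> E \<Longrightarrow> sob_sq s v > 0 \<Longrightarrow> \<exists>t\<ge>0. c \<le> Jf V (\<lambda>x. t * v x)"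
    and u: "\<And>n. u n \<in> E" and G: "\<And>n. Gf V (u n) = 0" and Q: "\<And>n. quad s V (u n) > 0"
    and J: "\<And>n. Jf V (u n) \<le> c + 1 / real (Suc n)"
  shows "\<exists>u\<in>E. Jf V u = c \<and> (\<forall>v\<in>E. dJ V u v = 0)"
proof -
  have um[measurable]: "u n \<in> borel_measurable borel" for n using frac_spaceD[OF u] by simp
  note Vm[measurable] = V_meas
  have \<mu>0: "1 / 2 - 1 / \<mu> > 0" using mu by (simp add: field_simps)
  \<comment> \<open>From \<open>J_nehari_lower\<close> at energy at most c + 1, then from the
    quadratic form to \<open>sob_sq\<close> through \<open>c0\<close>.\<close>
  define K where "K = (c + 1) / (1 / 2 - 1 / \<mu>) / c0"
  have K0: "K > 0" unfolding K_def using c \<mu>0 c0_pos by simp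
  have uK: "sob_sq s (u n) \<le> K" for n
  proof -
    have "1 / real (Suc n) \<le> 1" by simp
    then have "(1 / 2 - 1 / \<mu>) * quad s V (u n) \<le> c + 1" using J_nehari_lower[OF pot_V u G, of n] J[of n] by linarith
    then have "quad s V (u n) \<le> (c + 1) / (1 / 2 - 1 / \<mu>)" using \<mu>0 by (simp add: pos_le_divide_eq mult.commute)
    then show ?thesis unfolding K_def using sob_sq_le_quad[OF pot_V u, of n] c0_pos by (meson divide_right_mono less_imp_le order_trans)
  qed
  obtain \<delta> where \<delta>: "\<delta> > 0" "\<And>n. \<delta> \<le> (\<integral>x. \<bar>u n x\<bar> powr (p + 1) \<partial>lborel)"
    using nehari_lower_ex pot_V u Q G by (metis order_refl)
  obtain \<eta> where \<eta>: "\<eta> > 0"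
    "\<And>v. v \<in> E \<Longrightarrow> sob_sq s v \<le> K \<Longrightarrow> (\<And>x. (\<integral>y. (v y)\<^sup>2 * indicat_real (ball x 1) y \<partial>lborel) \<le> \<eta>) \<Longrightarrow> (\<integral>x. \<bar>v x\<bar> powr (p + 1) \<partial>lborel) \<le> \<delta> / 2"
    using vanishing[OF K0, of "\<delta> / 2"] \<delta>(1) by auto
  \<comment> \<open>If every unit ball carried mass at most \<open>\<eta>\<close>, the integral of
    |u n| powr (p + 1) would fall below its positive lower bound \<open>\<delta>\<close> on the
    Nehari set. The centres found here are the translations.\<close>
  have "\<exists>x. \<eta> < (\<integral>y. (u n y)\<^sup>2 * indicat_real (ball x 1) y \<partial>lborel)" for n
  proof (rule ccontr)
    assume "\<not> ?thesis"
    then have "(\<integral>x. \<bar>u n x\<bar> powr (p + 1) \<partial>lborel) \<le> \<delta> / 2" by (intro \<eta>(2) u uK) (simp add: not_less)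
    then show False using \<delta>(2)[of n] \<delta>(1) by linarith
  qed
  then obtain y where y: "\<And>n. \<eta> < (\<integral>x. (u n x)\<^sup>2 * indicat_real (ball (y n) 1) x \<partial>lborel)" by metis
  obtain r1 W y0 where r1: "strict_mono (r1 :: nat \<Rightarrow> nat)" and W: "pot W" and Wlim: "\<And>x. (\<lambda>n. V (y (r1 n) + x)) \<longlonglongrightarrow> W x" and Wge: "\<And>x. V (y0 + x) \<le> W x"
    using shifted_potential_limit[OF cont lim, of y] by metis
  define w0 where "w0 n x = u (r1 n) (y (r1 n) + x)" for n x
  have w0E: "w0 n \<in> E" for n unfolding w0_def[abs_def] by (rule frac_space_translate[OF u])
  have w0K: "sob_sq s (w0 n) \<le> K" for n unfolding w0_def[abs_def] sob_sq_translate[OF um] by (rule uK)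
  obtain r2 w where r2: "strict_mono (r2 :: nat \<Rightarrow> nat)" and w: "w \<in> E" and AEw: "AE x in lborel. (\<lambda>n. w0 (r2 n) x) \<longlonglongrightarrow> w x"
    and locw: "(\<lambda>n. \<integral>\<^sup>+x. ennreal ((w0 (r2 n) x - w x)\<^sup>2) * indicator (ball 0 1) x \<partial>lborel) \<longlonglongrightarrow> 0"
    using frac_compact[OF s0 s1 w0E w0K] .
  define k where "k n = r1 (r2 n)" for n
  define wn where "wn n = w0 (r2 n)" for n
  define Wn where "Wn n x = V (y (k n) + x)" for n x
  define vn where "vn n x = wn n x - w x" for n x
  have kn: "n \<le> k n" for n unfolding k_def using seq_suble[OF r1, of "r2 n"] seq_suble[OF r2, of n] by linarith
  have wnE: "wn n \<in> E" for n unfolding wn_def by (rule w0E)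
  have wn_eq: "wn n = (\<lambda>x. u (k n) (y (k n) + x))" for n by (simp add: wn_def w0_def[abs_def] k_def)
  have vnE: "vn n \<in> E" for n unfolding vn_def[abs_def] by (intro frac_space_diff wnE w)
  have potWn: "pot (Wn n)" for n unfolding Wn_def[abs_def] by (rule pot_translate[OF pot_V])
  have WnW: "(\<lambda>n. Wn n x) \<longlonglongrightarrow> W x" for x
    using LIMSEQ_subseq_LIMSEQ[OF Wlim[of x] r2] by (simp add: Wn_def k_def o_def)
  have AEv: "AE x in lborel. (\<lambda>n. vn n x) \<longlonglongrightarrow> 0"
    using AEw by eventually_elim (simp add: vn_def wn_def LIM_zero)
  define K2 where "K2 = 2 * K + 2 * sob_sq s w"
  have vnK: "sob_sq s (vn n) \<le> K2" for n
  proof -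
    have "sob_sq s (\<lambda>x. 1 * wn n x + (-1) * w x) \<le> 2 * 1\<^sup>2 * sob_sq s (wn n) + 2 * (-1)\<^sup>2 * sob_sq s w" by (rule sob_sq_lincomb_le[OF wnE w])
    then show ?thesis unfolding K2_def vn_def[abs_def] using w0K[of "r2 n"] by (simp add: wn_def)
  qed
  have K2: "K2 > 0" unfolding K2_def using K0 sob_sq_nonneg[of s w] by simp
  have Jwn: "Jf (Wn n) (\<lambda>x. t * wn n x) \<le> c + 1 / real (Suc n)" if "t \<ge> 0" for n t
  proof -
    have "Jf (Wn n) (\<lambda>x. t * wn n x) = Jf V (\<lambda>x. t * u (k n) x)"
      unfolding wn_eq Wn_def[abs_def] by (rule J_translate[OF _ pot_V]) measurable
    also have "\<dots> \<le> Jf V (u (k n))" using J_tangent[OF pot_V u that, of "k n"] by (simp add: G)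
    also have "\<dots> \<le> c + 1 / real (Suc (k n))" by (rule J)
    also have "\<dots> \<le> c + 1 / real (Suc n)" using kn[of n] by (intro add_left_mono divide_left_mono) auto
    finally show ?thesis .
  qed
  \<comment> \<open>Each translated function carries mass at least \<open>\<eta>\<close> on the unit
    ball at 0, and convergence in \<open>L^2\<close> is strong there.\<close>
  have wpos: "sob_sq s w > 0"
  proof (rule ccontr)
    assume "\<not> ?thesis"
    then have "sob_sq s w = 0" using sob_sq_nonneg[of s w] by linarith
    then have w0: "AE x in lborel. w x = 0" by (rule sob_sq_zero_AE[OF w])
    have "ennreal \<eta> \<le> (\<integral>\<^sup>+x. ennreal ((w0 (r2 n) x - w x)\<^sup>2) * indicator (ball 0 1) x \<partial>lborel)" for n
    proof -
      note uD = frac_spaceD[OF u[of "k n"]]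
      have "\<eta> \<le> (\<integral>x. (u (k n) x)\<^sup>2 * indicat_real (ball (y (k n)) 1) x \<partial>lborel)" using y[of "k n"] by simp
      also have "\<dots> = (\<integral>x. (u (k n) (y (k n) + x))\<^sup>2 * indicat_real (ball (y (k n)) 1) (y (k n) + x) \<partial>lborel)"
        by (rule integral_lborel_translate[symmetric]) (intro borel_measurable_times borel_measurable_power um borel_measurable_indicator, simp)
      also have "\<dots> = (\<integral>x. (wn n x)\<^sup>2 * indicat_real (ball 0 1) x \<partial>lborel)"
        unfolding wn_eq by (intro Bochner_Integration.integral_cong) (auto simp: indicator_def dist_norm)
      finally have "ennreal \<eta> \<le> ennreal (\<integral>x. (wn n x)\<^sup>2 * indicat_real (ball 0 1) x \<partial>lborel)" by (rule ennreal_leI)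
      also have "\<dots> = (\<integral>\<^sup>+x. ennreal ((wn n x)\<^sup>2 * indicat_real (ball 0 1) x) \<partial>lborel)"
        using L2_integrable_on_ball(2)[OF frac_spaceD(1,2)[OF wnE[of n]], of 0 1] by (intro nn_integral_eq_integral[symmetric]) auto
      also have "\<dots> = (\<integral>\<^sup>+x. ennreal ((w0 (r2 n) x - w x)\<^sup>2) * indicator (ball 0 1) x \<partial>lborel)"
        by (rule nn_integral_cong_AE, use w0 in eventually_elim) (auto simp: wn_def indicator_def)
      finally show ?thesis .
    qed
    then have "ennreal \<eta> \<le> 0" by (intro LIMSEQ_le_const[OF locw]) auto
    then show False using \<eta>(1) by simp
  qed
  have lev': "\<exists>t\<ge>0. c \<le> Jf (Wn n) (\<lambda>x. t * v x)" if v: "v \<in> E" "sob_sq s v > 0" for n v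
  proof -
    let ?v = "\<lambda>x. v (- y (k n) + x)"
    have vE: "?v \<in> E" by (rule frac_space_translate[OF v(1)])
    have vm: "v \<in> borel_measurable borel" using frac_spaceD[OF v(1)] by simp
    have "sob_sq s ?v > 0" using v(2) unfolding sob_sq_translate[OF vm] .
    then obtain t where t: "t \<ge> 0" "c \<le> Jf V (\<lambda>x. t * ?v x)" using level[OF vE] by blast
    have "Jf (\<lambda>x. V (y (k n) + x)) (\<lambda>x. t * ?v (y (k n) + x)) = Jf V (\<lambda>x. t * ?v x)"
      by (rule J_translate[OF _ pot_V]) (use vm in measurable)
    then show ?thesis using t unfolding Wn_def[abs_def] by auto
  qed
  have wn_split: "wn n x = vn n x + w x" for n x by (simp add: vn_def)
  note split = J_split[OF _ _ potWn W WnW vnE w vnK AEv, folded wn_split]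
  have claim: "Jf W (\<lambda>x. t * w x) \<le> c" if t0: "t \<ge> 0" for t
  proof (rule ccontr)
    assume "\<not> ?thesis"
    then have gt: "c < Jf W (\<lambda>x. t * w x)" by simp
    have "t \<noteq> 0" using gt c J_zero[OF W, of w] by auto
    then have t: "t > 0" using t0 by simp
    define \<beta> where "\<beta> = Jf W (\<lambda>x. t * w x) - c"
    have \<beta>: "\<beta> > 0" using gt by (simp add: \<beta>_def)
    have inv: "(\<lambda>n. 1 / real (Suc n)) \<longlonglongrightarrow> 0" using LIMSEQ_inverse_real_of_nat by (simp add: inverse_eq_divide)
    let ?D = "\<lambda>n. Jf (Wn n) (\<lambda>x. t * wn n x) - Jf (Wn n) (\<lambda>x. t * vn n x) - Jf W (\<lambda>x. t * w x)"
    have D: "?D \<longlonglongrightarrow> 0" by (rule split[where t="\<lambda>_. t" and T=t]) (use t0 in auto)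
    have "(\<lambda>n. 1 / real (Suc n) - ?D n) \<longlonglongrightarrow> 0 - 0" by (intro tendsto_diff inv D)
    then have "\<forall>\<^sub>F n in sequentially. 1 / real (Suc n) - ?D n < \<beta>" using \<beta> by (intro order_tendstoD(2)) auto
    then obtain N where N: "\<And>n. n \<ge> N \<Longrightarrow> 1 / real (Suc n) - ?D n < \<beta>" by (auto simp: eventually_sequentially)
    have neg: "Jf (Wn n) (\<lambda>x. t * vn n x) < 0" if "n \<ge> N" for n
      using N[OF that] Jwn[OF t0, of n] unfolding \<beta>_def by linarith
    \<comment> \<open>Before \<open>N\<close> the parameter is set to 0, which keeps the whole
      sequence in [0, t] as \<open>J_split\<close> demands.\<close>
    have "\<exists>\<tau>. 0 \<le> \<tau> \<and> \<tau> \<le> t \<and> (n \<ge> N \<longrightarrow> c \<le> Jf (Wn n) (\<lambda>x. \<tau> * vn n x))" for n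
    proof (cases "n \<ge> N")
      case True
      have "sob_sq s (\<lambda>x. t * vn n x) > 0" by (rule J_neg_imp_nonzero[OF potWn frac_space_cmult[OF vnE] neg[OF True]])
      then have "sob_sq s (vn n) > 0" unfolding sob_sq_cmult using sob_sq_nonneg[of s "vn n"] by (simp add: zero_less_mult_iff)
      then obtain \<tau> where \<tau>: "\<tau> \<ge> 0" "c \<le> Jf (Wn n) (\<lambda>x. \<tau> * vn n x)" using lev'[OF vnE] by blast
      have "\<tau> \<le> t"
      proof (rule ccontr)
        assume "\<not> \<tau> \<le> t"
        then have "Jf (Wn n) (\<lambda>x. \<tau> * vn n x) < 0" by (intro J_neg_beyond[OF potWn vnE t _ neg[OF True]]) auto
        then show False using \<tau>(2) c by simp
      qed
      then show ?thesis using \<tau> by blast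
    next
      case False
      then show ?thesis using t0 by (intro exI[of _ 0]) auto
    qed
    then obtain \<tau> where \<tau>: "\<And>n. 0 \<le> \<tau> n" "\<And>n. \<tau> n \<le> t" "\<And>n. n \<ge> N \<Longrightarrow> c \<le> Jf (Wn n) (\<lambda>x. \<tau> n * vn n x)" by metis
    let ?D' = "\<lambda>n. Jf (Wn n) (\<lambda>x. \<tau> n * wn n x) - Jf (Wn n) (\<lambda>x. \<tau> n * vn n x) - Jf W (\<lambda>x. \<tau> n * w x)"
    have D': "?D' \<longlonglongrightarrow> 0" by (rule split[OF \<tau>(1,2)])
    \<comment> \<open>Energy c at \<open>\<tau> n\<close> forces (\<tau> n)^2 to be at least 2 c /
      (c1 K2), because \<open>J\<close> is at most half the quadratic form; \<open>J_scale\<close>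
      from t down to \<open>\<tau> n\<close> then leaves \<open>w\<close> at least (\<tau> n / t)^2
      c. This fixed gain on top of c contradicts the ray bound c + 1 / (n + 1) for
      \<open>wn n\<close>.\<close>
    define \<kappa> where "\<kappa> = 2 * c / (c1 * K2) / t\<^sup>2 * c"
    have \<kappa>: "\<kappa> > 0" unfolding \<kappa>_def using c c1_pos K2 t by simp
    have lower: "\<kappa> \<le> Jf W (\<lambda>x. \<tau> n * w x)" if n: "n \<ge> N" for n
    proof -
      have "c \<le> (\<tau> n)\<^sup>2 * quad s (Wn n) (vn n) / 2" using \<tau>(3)[OF n] J_le_quad[of "Wn n" "\<lambda>x. \<tau> n * vn n x"] by (simp add: quad_cmult)
      also have "\<dots> \<le> (\<tau> n)\<^sup>2 * (c1 * K2) / 2"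
      proof -
        have "quad s (Wn n) (vn n) \<le> c1 * sob_sq s (vn n)" by (rule quad_bounds(2)[OF potWn vnE])
        also have "\<dots> \<le> c1 * K2" using vnK c1_pos by simp
        finally show ?thesis by (intro divide_right_mono mult_left_mono) auto
      qed
      finally have 1: "2 * c / (c1 * K2) \<le> (\<tau> n)\<^sup>2" using c1_pos K2 by (simp add: field_simps)
      have "\<kappa> \<le> (\<tau> n)\<^sup>2 / t\<^sup>2 * c" unfolding \<kappa>_def using c t 1 by (intro mult_right_mono divide_right_mono) auto
      also have "\<dots> \<le> (\<tau> n / t)\<^sup>2 * Jf W (\<lambda>x. t * w x)" unfolding power_divide using gt by (intro mult_left_mono) auto
      also have "\<dots> \<le> Jf W (\<lambda>x. \<tau> n / t * (t * w x))"
        using \<tau>(1,2)[of n] t by (intro J_scale[OF W frac_space_cmult[OF w]]) auto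
      also have "(\<lambda>x. \<tau> n / t * (t * w x)) = (\<lambda>x. \<tau> n * w x)" using t by auto
      finally show ?thesis .
    qed
    have upper: "Jf W (\<lambda>x. \<tau> n * w x) \<le> 1 / real (Suc n) - ?D' n" if "n \<ge> N" for n
      using Jwn[OF \<tau>(1)[of n], of n] \<tau>(3)[OF that] by linarith
    have "(\<lambda>n. 1 / real (Suc n) - ?D' n) \<longlonglongrightarrow> 0 - 0" by (intro tendsto_diff inv D')
    then have "\<forall>\<^sub>F n in sequentially. 1 / real (Suc n) - ?D' n < \<kappa>" using \<kappa> by (intro order_tendstoD(2)) auto
    then obtain N' where N': "\<And>n. n \<ge> N' \<Longrightarrow> 1 / real (Suc n) - ?D' n < \<kappa>" by (auto simp: eventually_sequentially)
    show False using lower[of "max N N'"] upper[of "max N N'"] N'[of "max N N'"] by linarith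
  qed
  \<comment> \<open>\<open>W\<close> lies above \<open>V\<close> shifted by \<open>y0\<close>, so
    undoing that shift yields a ray on which the original functional never exceeds c.\<close>
  define w1 where "w1 x = w (- y0 + x)" for x
  have w1E: "w1 \<in> E" unfolding w1_def[abs_def] by (rule frac_space_translate[OF w])
  have wm: "w \<in> borel_measurable borel" using frac_spaceD[OF w] by simp
  have w1pos: "sob_sq s w1 > 0" unfolding w1_def[abs_def] sob_sq_translate[OF wm] by (rule wpos)
  have w1le: "Jf V (\<lambda>x. t * w1 x) \<le> c" if "t \<ge> 0" for t
  proof -
    have tw: "(\<lambda>x. t * w x) \<in> E" by (rule frac_space_cmult[OF w])
    have "Jf V (\<lambda>x. t * w1 x) = Jf (\<lambda>x. V (y0 + x)) (\<lambda>x. t * w1 (y0 + x))"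
      by (rule J_translate[OF _ pot_V, symmetric]) (use frac_spaceD(1)[OF w1E] in measurable)
    also have "\<dots> = Jf (\<lambda>x. V (y0 + x)) (\<lambda>x. t * w x)" by (simp add: w1_def)
    also have "\<dots> \<le> Jf W (\<lambda>x. t * w x)"
    proof -
      have "(\<integral>x. V (y0 + x) * (t * w x)\<^sup>2 \<partial>lborel) \<le> (\<integral>x. W x * (t * w x)\<^sup>2 \<partial>lborel)"
        using quad_integrable(3)[OF W tw tw] quad_integrable(3)[OF pot_translate[OF pot_V, of y0] tw tw]
        by (intro integral_mono mult_right_mono Wge) auto
      then show ?thesis unfolding Jf_def quad_def by simp
    qed
    also have "\<dots> \<le> c" by (rule claim[OF that])
    finally show ?thesis .
  qed
  obtain t where t: "t \<ge> 0" "c \<le> Jf V (\<lambda>x. t * w1 x)" using level[OF w1E w1pos] by blast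
  let ?u = "\<lambda>x. t * w1 x"
  have uE: "?u \<in> E" by (rule frac_space_cmult[OF w1E])
  have Ju: "Jf V ?u = c" using t w1le[OF t(1)] by simp
  have "Jf V (\<lambda>x. t' * ?u x) \<le> c" if "t' \<ge> 0" for t'
    using w1le[of "t' * t"] that t(1) by (simp add: mult.assoc)
  then have "\<forall>v\<in>E. dJ V ?u v = 0"
    using ray_max_critical[OF c uE Ju _ level] by blast
  then show ?thesis using uE Ju by blast
qed

end

section \<open>Mountain pass paths\<close>

context frac_problem
begin

lemma path_continuous:
  assumes gE: "\<And>t. t \<in> {0..1} \<Longrightarrow> g t \<in> E"
    and cont: "\<And>t0. t0 \<in> {0..1} \<Longrightarrow> ((\<lambda>t. sob_sq s (\<lambda>x. g t x - g t0 x)) \<longlongrightarrow> 0) (at t0 within {0..1::real})"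
  shows "continuous_on {0..1} (\<lambda>t. quad s V (g t))" "continuous_on {0..1} (\<lambda>t. Jf V (g t))" "continuous_on {0..1} (\<lambda>t. Gf V (g t))"
proof -
  have ev: "\<forall>\<^sub>F t in at t0 within {0..1}. g t \<in> E" for t0
    using gE by (simp add: eventually_at_filter)
  note T = functional_tendsto[OF pot_V gE ev cont]
  show "continuous_on {0..1} (\<lambda>t. quad s V (g t))" unfolding continuous_on_def using T(1) by blast
  show "continuous_on {0..1} (\<lambda>t. Jf V (g t))" unfolding continuous_on_def using T(2) by blast
  show "continuous_on {0..1} (\<lambda>t. Gf V (g t))" unfolding continuous_on_def using T(3) by blast
qed

text \<open>\<open>Gf\<close> also vanishes at the start of the path, so the intermediate value
  theorem applied to it alone might return a point of norm zero. The added term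
  \<open>max 0 (\<rho> / 2 - quad s V (g t))\<close> is positive at small norm, where
  \<open>Gf\<close> is nonnegative, and vanishes at the far end.\<close>

lemma path_crosses_nehari:
  assumes gE: "\<And>t. t \<in> {0..1} \<Longrightarrow> g t \<in> E"
    and cont: "\<And>t0. t0 \<in> {0..1} \<Longrightarrow> ((\<lambda>t. sob_sq s (\<lambda>x. g t x - g t0 x)) \<longlongrightarrow> 0) (at t0 within {0..1::real})"
    and g0: "quad s V (g 0) = 0" and g1: "Jf V (g 1) < 0"
  obtains t where "t \<in> {0..1}" "Gf V (g t) = 0" "quad s V (g t) > 0"
proof -
  obtain \<rho> where \<rho>: "\<rho> > 0" "\<And>u. u \<in> E \<Longrightarrow> 0 < quad s V u \<Longrightarrow> Gf V u \<le> 0 \<Longrightarrow> \<rho> \<le> quad s V u"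
    using nehari_lower_ex pot_V by metis
  have small: "0 \<le> Gf V u" if u: "u \<in> E" and "quad s V u < \<rho>" for u
  proof (cases "quad s V u > 0")
    case True
    then show ?thesis using \<rho>(2)[OF u True] that(2) by linarith
  next
    case False
    then have "quad s V u = 0" "sob_sq s u = 0" using quad_nonneg[OF pot_V u] quad_pos_iff[OF pot_V u] sob_sq_nonneg[of s u] by auto
    moreover have "(\<integral>x. u x * f (u x) \<partial>lborel) = 0"
    proof (rule integral_eq_zero_AE)
      show "AE x in lborel. u x * f (u x) = 0" using sob_sq_zero_AE[OF u \<open>sob_sq s u = 0\<close>] by eventually_elim simp
    qed
    ultimately show ?thesis by (simp add: Gf_def)
  qed
  let ?k = "\<lambda>t. Gf V (g t) + max 0 (\<rho> / 2 - quad s V (g t))"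
  have g1E: "g 1 \<in> E" and g0E: "g 0 \<in> E" using gE by auto
  have k1: "?k 1 \<le> 0"
  proof -
    have G: "Gf V (g 1) < 0" using G_le_J[OF pot_V g1E] g1 by linarith
    have "quad s V (g 1) > 0" using J_neg_imp_nonzero[OF pot_V g1E g1] quad_pos_iff[OF pot_V g1E] by simp
    then have "\<rho> \<le> quad s V (g 1)" using \<rho>(2)[OF g1E] G by simp
    then show ?thesis using G \<rho>(1) by simp
  qed
  have k0: "0 \<le> ?k 0" using small[OF g0E] g0 \<rho>(1) by simp
  have "continuous_on {0..1} ?k"
    by (intro continuous_intros path_continuous[OF gE cont]) auto
  then obtain t where t: "0 \<le> t" "t \<le> 1" "?k t = 0" using IVT2'[of ?k 1 0 0] k0 k1 by auto
  have tE: "g t \<in> E" using gE t by simp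
  have "\<rho> / 2 \<le> quad s V (g t)"
  proof (rule ccontr)
    assume "\<not> ?thesis"
    then have "0 \<le> Gf V (g t)" "0 < max 0 (\<rho> / 2 - quad s V (g t))" using small[OF tE] \<rho>(1) by auto
    then show False using t(3) by linarith
  qed
  then have "Gf V (g t) = 0" "quad s V (g t) > 0" using t(3) \<rho>(1) by auto
  then show ?thesis using that t by auto
qed

end

text \<open>Supplies a nonzero element of the space, hence a mountain pass path. On the frequency
  side |xi|^(2 s) is at most 1 + |xi|^2, hence at most exp (|xi|^2), and the squared transform
  decays like exp (- 2 pi^2 |xi|^2).\<close>

lemma gaussian_in_frac_space:
  fixes s :: real
  assumes s: "0 < s" "s < 1"
  shows "(\<lambda>x::'a::euclidean_space. exp (- (norm x)\<^sup>2)) \<in> frac_space s"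
    and "0 < sob_sq s (\<lambda>x::'a. exp (- (norm x)\<^sup>2))"
proof -
  let ?u = "\<lambda>x::'a. exp (- (norm x)\<^sup>2)"
  have u1: "integrable lborel ?u" using integrable_exp_norm_sq(1)[of 1, where 'a='a] by simp
  have usq: "(?u x)\<^sup>2 = exp (- 2 * (norm x)\<^sup>2)" for x by (simp add: power2_eq_square exp_add[symmetric])
  have u2: "integrable lborel (\<lambda>x. (?u x)\<^sup>2)" unfolding usq by (rule integrable_exp_norm_sq(1)) simp
  have um[measurable]: "?u \<in> borel_measurable borel" by measurable
  have ftu: "ft ?u \<xi> = complex_of_real (heat 1 \<xi>)" for \<xi>
    using gaussian_fourier(2)[of 1 \<xi>] by (simp add: ft_def inner_commute mult.commute)
  have "(\<integral>\<^sup>+x. \<integral>\<^sup>+y. ennreal ((?u x - ?u y)\<^sup>2 * heat a (x - y)) \<partial>lborel \<partial>lborel)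
      = 2 * (\<integral>\<^sup>+\<xi>. ennreal ((1 - exp (- a * (norm \<xi>)\<^sup>2)) * (cmod (ft ?u \<xi>))\<^sup>2) \<partial>lborel)" if a: "0 < a" for a
  proof -
    have i: "integrable lborel (\<lambda>\<xi>. (1 - exp (- a * (norm \<xi>)\<^sup>2)) * (cmod (ft ?u \<xi>))\<^sup>2)"
      unfolding left_diff_distrib using plancherel_L1_L2(1)[OF u1 u2] integrable_gauss_ft[OF u1 a] by simp
    have "(\<integral>\<^sup>+\<xi>. ennreal ((1 - exp (- a * (norm \<xi>)\<^sup>2)) * (cmod (ft ?u \<xi>))\<^sup>2) \<partial>lborel) = ennreal (\<integral>\<xi>. (1 - exp (- a * (norm \<xi>)\<^sup>2)) * (cmod (ft ?u \<xi>))\<^sup>2 \<partial>lborel)"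
      using a by (intro nn_integral_eq_integral i) auto
    then show ?thesis using heat_diff_spectral_L1_L2[OF u1 u2 a] by (simp add: ennreal_mult')
  qed
  from frac_seminorm_eq[OF s um _ this]
  have "(\<integral>\<^sup>+q. ennreal ((frac_diff s ?u q)\<^sup>2) \<partial>lborel) = (\<integral>\<^sup>+\<xi>. ennreal (norm \<xi> powr (2 * s) * (cmod (ft ?u \<xi>))\<^sup>2) \<partial>lborel)" by simp
  also have "\<dots> \<le> (\<integral>\<^sup>+\<xi>. ennreal ((sqrt pi ^ DIM('a))\<^sup>2 * exp (- (2 * pi\<^sup>2 - 1) * (norm \<xi>)\<^sup>2)) \<partial>(lborel :: 'a measure))"
  proof (intro nn_integral_mono ennreal_leI)
    fix \<xi> :: 'a
    have "norm \<xi> powr (2 * s) \<le> 1 + (norm \<xi>)\<^sup>2"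
    proof (cases "norm \<xi> \<le> 1")
      case True
      then have "norm \<xi> powr (2 * s) \<le> 1" using s by (intro powr_le1) auto
      then show ?thesis by (simp add: add_increasing2)
    next
      case False
      then have "norm \<xi> powr (2 * s) \<le> norm \<xi> powr 2" using s by (intro powr_mono) auto
      then show ?thesis using False by simp
    qed
    also have "\<dots> \<le> exp ((norm \<xi>)\<^sup>2)" by (rule exp_ge_add_one_self)
    finally have le: "norm \<xi> powr (2 * s) * (cmod (ft ?u \<xi>))\<^sup>2 \<le> exp ((norm \<xi>)\<^sup>2) * (cmod (ft ?u \<xi>))\<^sup>2" by (intro mult_right_mono) auto
    have cm: "(cmod (ft ?u \<xi>))\<^sup>2 = (sqrt pi ^ DIM('a))\<^sup>2 * exp (- (2 * pi\<^sup>2) * (norm \<xi>)\<^sup>2)"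
    proof -
      have "(cmod (ft ?u \<xi>))\<^sup>2 = (heat 1 \<xi>)\<^sup>2" unfolding ftu by (simp only: norm_of_real power2_abs)
      also have "\<dots> = (sqrt pi ^ DIM('a))\<^sup>2 * (exp (- (pi\<^sup>2 * (norm \<xi>)\<^sup>2)))\<^sup>2" by (simp add: heat_def power_mult_distrib)
      also have "(exp (- (pi\<^sup>2 * (norm \<xi>)\<^sup>2)))\<^sup>2 = exp (- (2 * pi\<^sup>2) * (norm \<xi>)\<^sup>2)" by (simp add: exp_double[symmetric])
      finally show ?thesis .
    qed
    have "(norm \<xi>)\<^sup>2 + (- (2 * pi\<^sup>2) * (norm \<xi>)\<^sup>2) = - (2 * pi\<^sup>2 - 1) * (norm \<xi>)\<^sup>2" by (simp add: algebra_simps)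
    then have "exp ((norm \<xi>)\<^sup>2) * exp (- (2 * pi\<^sup>2) * (norm \<xi>)\<^sup>2) = exp (- (2 * pi\<^sup>2 - 1) * (norm \<xi>)\<^sup>2)" by (simp only: exp_add[symmetric])
    then have "exp ((norm \<xi>)\<^sup>2) * (cmod (ft ?u \<xi>))\<^sup>2 = (sqrt pi ^ DIM('a))\<^sup>2 * exp (- (2 * pi\<^sup>2 - 1) * (norm \<xi>)\<^sup>2)"
      unfolding cm by (metis mult.left_commute)
    with le show "norm \<xi> powr (2 * s) * (cmod (ft ?u \<xi>))\<^sup>2 \<le> (sqrt pi ^ DIM('a))\<^sup>2 * exp (- (2 * pi\<^sup>2 - 1) * (norm \<xi>)\<^sup>2)" by simp
  qed
  also have "\<dots> < \<infinity>"
  proof -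
    have "1 \<le> pi\<^sup>2" using pi_gt3 by (simp add: one_le_power)
    then have "0 < 2 * pi\<^sup>2 - 1" by simp
    then have "integrable lborel (\<lambda>\<xi>::'a. (sqrt pi ^ DIM('a))\<^sup>2 * exp (- (2 * pi\<^sup>2 - 1) * (norm \<xi>)\<^sup>2))"
      by (intro integrable_mult_right integrable_exp_norm_sq(1))
    then show ?thesis unfolding integrable_iff_bounded by simp
  qed
  finally have "integrable lborel (\<lambda>q. (frac_diff s ?u q)\<^sup>2)" by (intro integrableI_bounded) auto
  then show "?u \<in> frac_space s" using u2 um by (simp add: frac_space_def)
  have "0 < (\<integral>x. (?u x)\<^sup>2 \<partial>(lborel :: 'a measure))" unfolding usq using integrable_exp_norm_sq(2)[of 2, where 'a='a] by simp
  moreover have "0 \<le> (\<integral>q. (frac_diff s ?u q)\<^sup>2 \<partial>lborel)" by simp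
  ultimately show "0 < sob_sq s ?u" unfolding sob_sq_def by linarith
qed

section \<open>Identification of the given space and norm with the difference form\<close>

lemma fourier_trunc_eq_ft: "fourier_trunc u R = ft (trunc_ball u R)"
  unfolding fourier_trunc_def ft_def trunc_ball_def set_lebesgue_integral_def
  by (intro ext Bochner_Integration.integral_cong) (auto simp: scaleR_conv_of_real indicator_def)

text \<open>The transform is selected by \<open>SOME\<close>, so it is known only through
  \<open>is_fourier_L2\<close>; exhibiting one candidate gives the selected function this
  property.\<close>

lemma is_fourier_L2_fourier:
  assumes "u \<in> L2"
  shows "is_fourier_L2 u (fourier u)"
proof -
  have u: "u \<in> borel_measurable borel" "integrable lborel (\<lambda>x. (u x)\<^sup>2)" using assms by (auto simp: L2_def)
  obtain v where "v \<in> borel_measurable borel" "integrable lborel (\<lambda>\<xi>. (cmod (v \<xi>))\<^sup>2)"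
    "((\<lambda>R. \<integral>\<^sup>+\<xi>. ennreal ((cmod (ft (trunc_ball u R) \<xi> - v \<xi>))\<^sup>2) \<partial>lborel) \<longlongrightarrow> 0) at_top"
    using ft_trunc_ball_L2_limit[OF u] .
  then have "is_fourier_L2 u v" by (simp add: is_fourier_L2_def fourier_trunc_eq_ft)
  then show ?thesis unfolding fourier_def by (rule someI[of "is_fourier_L2 u"])
qed

text \<open>Stated in \<open>ennreal\<close> for every \<open>u\<close> in \<open>L2\<close>, so
  that it decides membership in the space as well as the value of the norm.\<close>

lemma Es_norm2_eq:
  assumes s: "0 < s" "s < 1" and u: "u \<in> L2"
  shows "Es_norm2 V s u = (\<integral>\<^sup>+q. ennreal ((frac_diff s u q)\<^sup>2) \<partial>lborel) + (\<integral>\<^sup>+x. ennreal (V x * (u x)\<^sup>2) \<partial>lborel)"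
proof -
  have uD: "u \<in> borel_measurable borel" "integrable lborel (\<lambda>x. (u x)\<^sup>2)" using u by (auto simp: L2_def)
  have v: "fourier u \<in> borel_measurable borel" "integrable lborel (\<lambda>\<xi>. (cmod (fourier u \<xi>))\<^sup>2)"
    "((\<lambda>R. \<integral>\<^sup>+\<xi>. ennreal ((cmod (ft (trunc_ball u R) \<xi> - fourier u \<xi>))\<^sup>2) \<partial>lborel) \<longlongrightarrow> 0) at_top"
    using is_fourier_L2_fourier[OF u] by (auto simp: is_fourier_L2_def fourier_trunc_eq_ft)
  show ?thesis unfolding Es_norm2_def
    using frac_seminorm_eq[OF s uD(1) v(1) heat_diff_spectral[OF uD v]] by simp
qed

text \<open>A bounded potential makes the potential term finite on all of \<open>L2\<close>, so
  membership is decided by the difference integral.\<close>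

lemma Es_eq_frac_space:
  fixes V :: "real^'n \<Rightarrow> real"
  assumes s: "0 < s" "s < 1" and V: "V \<in> borel_measurable borel" "\<And>x. 0 \<le> V x" "\<And>x. V x \<le> V1"
  shows "Es V s = frac_space s"
    and "u \<in> frac_space s \<Longrightarrow> (Es_norm V s u)\<^sup>2 = quad s V u"
proof -
  note V(1)[measurable]
  have main: "Es_norm2 V s u = ennreal (quad s V u)" "u \<in> L2" if u: "u \<in> frac_space s" for u
  proof -
    note uD = frac_spaceD[OF u]
    show L: "u \<in> L2" using uD by (simp add: L2_def)
    have [measurable]: "u \<in> borel_measurable borel" by (rule uD)
    have "integrable lborel (\<lambda>x. V1 * (u x)\<^sup>2)" using uD by simp
    then have i: "integrable lborel (\<lambda>x. V x * (u x)\<^sup>2)"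
    proof (rule Bochner_Integration.integrable_bound)
      show "AE x in lborel. norm (V x * (u x)\<^sup>2) \<le> norm (V1 * (u x)\<^sup>2)"
        using V(2,3) by (auto simp: abs_mult intro!: AE_I2 mult_right_mono intro: order_trans[OF _ abs_ge_self])
    qed measurable
    show "Es_norm2 V s u = ennreal (quad s V u)"
      unfolding Es_norm2_eq[OF s L] quad_def using uD(3) i V(2)
      by (simp add: nn_integral_eq_integral ennreal_plus)
  qed
  show "u \<in> frac_space s \<Longrightarrow> (Es_norm V s u)\<^sup>2 = quad s V u"
  proof -
    assume u: "u \<in> frac_space s"
    have "0 \<le> quad s V u" unfolding quad_def using V(2) by (intro add_nonneg_nonneg integral_nonneg_AE) auto
    then show ?thesis unfolding Es_norm_def main(1)[OF u] by simp
  qed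
  show "Es V s = frac_space s"
  proof (intro set_eqI iffI)
    fix u assume "u \<in> Es V s"
    then have L: "u \<in> L2" and fin: "Es_norm2 V s u < \<infinity>" by (auto simp: Es_def)
    have [measurable]: "u \<in> borel_measurable borel" using L by (simp add: L2_def)
    have "(\<integral>\<^sup>+q. ennreal ((frac_diff s u q)\<^sup>2) \<partial>lborel) < \<infinity>"
      using fin unfolding Es_norm2_eq[OF s L] by (simp add: less_top)
    then have "integrable lborel (\<lambda>q. (frac_diff s u q)\<^sup>2)" by (intro integrableI_bounded) auto
    then show "u \<in> frac_space s" using L by (simp add: frac_space_def L2_def)
  next
    fix u :: "real^'n \<Rightarrow> real" assume u: "u \<in> frac_space s"
    then show "u \<in> Es V s" using main[OF u] by (simp add: Es_def)
  qed
qed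

lemma prim_has_real_derivative:
  assumes "continuous_on UNIV f"
  shows "(prim f has_real_derivative f t) (at t)"
proof -
  \<comment> \<open>An interval that contains 0 and has \<open>t\<close> in its interior, so that
    the derivative within the interval is a full derivative.\<close>
  let ?a = "min 0 t - 1" and ?b = "max 0 t + 1"
  have "((\<lambda>u. LBINT y=0..u. f y) has_vector_derivative f t) (at t within {?a..?b})"
    by (rule interval_integral_FTC2[where c=0, unfolded zero_ereal_def[symmetric]])
      (auto intro: continuous_on_subset[OF assms])
  moreover have "at t within {?a..?b} = at t" by (rule at_within_Icc_at) auto
  ultimately show ?thesis
    unfolding has_real_derivative_iff_has_vector_derivative prim_def[abs_def] by simp
qed

theorem theorem5p3:
  fixes V :: "real^'n \<Rightarrow> real" and f :: "real \<Rightarrow> real" and s p \<mu> a1 a2 Vinf :: real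
  assumes s_pos: "0 < s" and s_lt1: "s < 1"
    and N_gt: "2 * s < real CARD('n)"
    \<comment> \<open>(V1)\<close>
    and V_C1: "\<exists>V'. (\<forall>x. (V has_derivative blinfun_apply (V' x)) (at x)) \<and> continuous_on UNIV V'"
    and V_bdd: "bdd_below (range V)" and V_inf_pos: "(INF x. V x) > 0"
    \<comment> \<open>(f1), (f2)\<close>
    and f_C1: "\<exists>f'. (\<forall>t. (f has_real_derivative f' t) (at t)) \<and> continuous_on UNIV f'"
    and f0: "f 0 = 0" and f'0: "deriv f 0 = 0"
    \<comment> \<open>(f3)\<close>
    and a1: "a1 > 0" and a2: "a2 > 0" and p_gt: "1 < p"
    and p_lt: "p < (real CARD('n) + 2 * s) / (real CARD('n) - 2 * s)"
    and f3: "\<forall>t. \<bar>deriv f t\<bar> \<le> a1 + a2 * \<bar>t\<bar> powr (p - 1)"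
    \<comment> \<open>(f4)\<close>
    and mu: "\<mu> > 2"
    and f4: "\<forall>t. t \<noteq> 0 \<longrightarrow> 0 < \<mu> * prim f t \<and> \<mu> * prim f t \<le> t * f t"
    \<comment> \<open>(f5)\<close>
    and f5: "\<forall>\<sigma>. mono_on {0<..} (\<lambda>t. \<sigma> * f (t * \<sigma>) / t)"
    \<comment> \<open>(V3), (V4)\<close>
    and Vinf_pos: "Vinf > 0"
    and V3: "Liminf at_infinity (\<lambda>x. ereal (V x)) = ereal Vinf"
    and V4: "\<forall>x. V x \<le> Vinf" and V4': "\<exists>x. V x \<noteq> Vinf"
  shows "critical_value V f s (mp_level V f s)"
proof -
  obtain f' where f': "\<And>t. (f has_real_derivative f' t) (at t)" "continuous_on UNIV f'" using f_C1 by blast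
  have df: "deriv f = f'" using f'(1) by (auto intro: DERIV_imp_deriv)
  have fcont: "continuous_on UNIV f" using f'(1) by (meson DERIV_continuous continuous_at_imp_continuous_on)
  have Vcont: "continuous_on UNIV V"
    using V_C1 by (meson continuous_at_imp_continuous_on has_derivative_continuous)
  have Vm: "V \<in> borel_measurable borel" by (rule borel_measurable_continuous_onI[OF Vcont])
  define V0 where "V0 = (INF x. V x)"
  have V0le: "V0 \<le> V x" for x unfolding V0_def by (rule cINF_lower[OF V_bdd]) simp
  \<comment> \<open>The lower limit is \<open>Vinf\<close> and \<open>V\<close> never exceeds it, so
    the limit itself exists.\<close>
  have Vlim: "(V \<longlongrightarrow> Vinf) at_infinity"
  proof (rule order_tendstoI)
    fix a assume "a < Vinf"
    then have "ereal a < Liminf at_infinity (\<lambda>x. ereal (V x))" unfolding V3 by simp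
    then have "\<forall>\<^sub>F x in at_infinity. ereal a < ereal (V x)" by (rule less_LiminfD)
    then show "\<forall>\<^sub>F x in at_infinity. a < V x" by simp
  next
    fix a assume "Vinf < a"
    then show "\<forall>\<^sub>F x in at_infinity. V x < a" using V4 by (intro always_eventually allI) (auto intro: le_less_trans)
  qed
  \<comment> \<open>\<open>Vinf\<close> serves as the upper bound \<open>V1\<close>, so the bound
    and the limit at infinity in \<open>critical_level\<close> are the same number.\<close>
  interpret frac_problem f "prim f" f' p \<mu> a1 a2 V s V0 Vinf
  proof
    show "(prim f has_real_derivative f t) (at t)" for t by (rule prim_has_real_derivative[OF fcont])
    show "prim f 0 = 0" by (simp add: prim_def zero_ereal_def)
    show "f' 0 = 0" using f'0 df by simp
    show "\<bar>f' t\<bar> \<le> a1 + a2 * \<bar>t\<bar> powr (p - 1)" for t using f3 df by simp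
    show "0 < \<mu> * prim f t \<and> \<mu> * prim f t \<le> t * f t" if "t \<noteq> 0" for t using f4 that by simp
    show "mono_on {0<..} (\<lambda>t. \<sigma> * f (t * \<sigma>) / t)" for \<sigma> using f5 by simp
    show "0 < V0" using V_inf_pos by (simp add: V0_def)
    show "2 * s < real DIM(real^'n)" "p < (real DIM(real^'n) + 2 * s) / (real DIM(real^'n) - 2 * s)" using N_gt p_lt by simp_all
  qed (use f' f0 a1 a2 p_gt mu s_pos s_lt1 Vm V0le V4 in auto)
  have Vnn: "0 \<le> V x" for x by (rule potD(4)[OF pot_V])
  note EsE = Es_eq_frac_space(1)[OF s0 s1 Vm Vnn V_bounds(2)] and EsN = Es_eq_frac_space(2)[OF s0 s1 Vm Vnn V_bounds(2)]
  have Jfun: "Jfun V f s u = Jf V u" if "u \<in> E" for u unfolding Jfun_def Jf_def EsN[OF that] by simp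
  have Norm: "Es_norm V s u = sqrt (quad s V u)" if "u \<in> E" for u
    using EsN[OF that] by (metis Es_norm_def enn2real_nonneg real_sqrt_ge_zero real_sqrt_unique)
  let ?\<Gamma> = "Gamma_paths V f s" and ?c = "mp_level V f s"
  let ?S = "\<lambda>g. SUP t\<in>{0..1}. Jfun V f s (g t)"
  \<comment> \<open>\<open>Gamma_paths\<close> asks for norm zero at the start, that is, for a
    function vanishing almost everywhere. Continuity in the given norm is passed on to
    \<open>sob_sq\<close>, in which the path lemmas are phrased.\<close>
  have path: "(\<forall>t\<in>{0..1}. g t \<in> E) \<and> (\<forall>t0\<in>{0..1}. ((\<lambda>t. sob_sq s (\<lambda>x. g t x - g t0 x)) \<longlongrightarrow> 0) (at t0 within {0..1}))
      \<and> quad s V (g 0) = 0 \<and> Jf V (g 1) < 0" if g: "g \<in> ?\<Gamma>" for g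
  proof (intro conjI ballI)
    show gE: "g t \<in> E" if "t \<in> {0..1}" for t using g that EsE by (auto simp: Gamma_paths_def)
    have "Es_norm V s (g 0) = 0" using g by (simp add: Gamma_paths_def)
    then show "quad s V (g 0) = 0" using EsN[OF gE[of 0]] by simp
    show "Jf V (g 1) < 0" using g Jfun[OF gE[of 1]] by (simp add: Gamma_paths_def)
    fix t0 :: real assume t0: "t0 \<in> {0..1}"
    have L: "((\<lambda>t. Es_norm V s (\<lambda>x. g t x - g t0 x)) \<longlongrightarrow> 0) (at t0 within {0..1})" using g t0 by (auto simp: Gamma_paths_def)
    have "((\<lambda>t. (Es_norm V s (\<lambda>x. g t x - g t0 x))\<^sup>2 / c0) \<longlongrightarrow> 0\<^sup>2 / c0) (at t0 within {0..1})" using c0_pos by (intro tendsto_intros L) auto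
    then have L2: "((\<lambda>t. (Es_norm V s (\<lambda>x. g t x - g t0 x))\<^sup>2 / c0) \<longlongrightarrow> 0) (at t0 within {0..1})" by simp
    show "((\<lambda>t. sob_sq s (\<lambda>x. g t x - g t0 x)) \<longlongrightarrow> 0) (at t0 within {0..1})"
    proof (rule tendsto_sandwich[OF _ _ tendsto_const L2])
      show "\<forall>\<^sub>F t in at t0 within {0..1}. sob_sq s (\<lambda>x. g t x - g t0 x) \<le> (Es_norm V s (\<lambda>x. g t x - g t0 x))\<^sup>2 / c0"
        unfolding eventually_at_filter
      proof (rule always_eventually, intro allI impI)
        fix t :: real assume "t \<noteq> t0" "t \<in> {0..1}"
        then have dE: "(\<lambda>x. g t x - g t0 x) \<in> E" using t0 by (intro frac_space_diff gE)
        show "sob_sq s (\<lambda>x. g t x - g t0 x) \<le> (Es_norm V s (\<lambda>x. g t x - g t0 x))\<^sup>2 / c0"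
          unfolding EsN[OF dE] by (rule sob_sq_le_quad[OF pot_V dE])
      qed
    qed (simp add: sob_sq_nonneg)
  qed
  \<comment> \<open>A supremum of reals bounds its members only if the set is bounded above; this
    comes from continuity of \<open>J\<close> along the path on a compact interval.\<close>
  have sup: "Jf V (g t) \<le> ?S g" if g: "g \<in> ?\<Gamma>" and t: "t \<in> {0..1}" for g t
  proof -
    have "continuous_on {0..1} (\<lambda>t. Jf V (g t))" using path[OF g] by (intro path_continuous) auto
    then have "compact ((\<lambda>t. Jf V (g t)) ` {0..1})" by (rule compact_continuous_image) simp
    then have "bdd_above ((\<lambda>t. Jf V (g t)) ` {0..1})" by (intro bounded_imp_bdd_above compact_imp_bounded)
    moreover have "(\<lambda>t. Jf V (g t)) ` {0..1} = (\<lambda>t. Jfun V f s (g t)) ` {0..1}" using path[OF g] Jfun by (intro image_cong) auto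
    ultimately have "Jfun V f s (g t) \<le> ?S g" using t by (intro cSUP_upper) auto
    then show ?thesis using Jfun path[OF g] t by simp
  qed
  have cross: "\<exists>t\<in>{0..1}. Gf V (g t) = 0 \<and> quad s V (g t) > 0" if g: "g \<in> ?\<Gamma>" for g
    using path_crosses_nehari[of g] path[OF g] by (metis (no_types, lifting))
  obtain \<rho> where \<rho>: "\<rho> > 0" "\<And>u. u \<in> E \<Longrightarrow> 0 < quad s V u \<Longrightarrow> Gf V u \<le> 0 \<Longrightarrow> \<rho> \<le> quad s V u"
    using nehari_lower_ex pot_V by metis
  have \<mu>0: "1 / 2 - 1 / \<mu> > 0" using mu by (simp add: field_simps)
  \<comment> \<open>Every path meets the Nehari set away from zero. The resulting bound gives both
    the boundedness below that the infimum of reals requires and the positivity of the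
    level.\<close>
  have lower: "(1 / 2 - 1 / \<mu>) * \<rho> \<le> ?S g" if g: "g \<in> ?\<Gamma>" for g
  proof -
    obtain t where t: "t \<in> {0..1}" "Gf V (g t) = 0" "quad s V (g t) > 0" using cross[OF g] by blast
    have gE: "g t \<in> E" using path[OF g] t by blast
    have "(1 / 2 - 1 / \<mu>) * \<rho> \<le> (1 / 2 - 1 / \<mu>) * quad s V (g t)" using \<rho>(2)[OF gE t(3)] t(2) \<mu>0 by (intro mult_left_mono) auto
    also have "\<dots> \<le> Jf V (g t)" by (rule J_nehari_lower[OF pot_V gE t(2)])
    also have "\<dots> \<le> ?S g" by (rule sup[OF g t(1)])
    finally show ?thesis .
  qed
  have bdd: "bdd_below (?S ` ?\<Gamma>)" using lower by (auto intro!: bdd_belowI2)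
  have ray: "\<exists>T>0. (\<lambda>t x. t * (T * v x)) \<in> ?\<Gamma>" if v: "v \<in> E" "sob_sq s v > 0" for v
  proof -
    obtain T where T: "T > 0" "Jf V (\<lambda>x. T * v x) < 0" using J_neg_ex[OF pot_V v] .
    have gE: "(\<lambda>x. t * (T * v x)) \<in> E" for t by (intro frac_space_cmult v)
    have "((\<lambda>t. Es_norm V s (\<lambda>x. t * (T * v x) - t0 * (T * v x))) \<longlongrightarrow> 0) (at t0 within {0..1})" for t0
    proof -
      have "Es_norm V s (\<lambda>x. t * (T * v x) - t0 * (T * v x)) = \<bar>t - t0\<bar> * sqrt (quad s V (\<lambda>x. T * v x))" for t
      proof -
        have "(\<lambda>x. t * (T * v x) - t0 * (T * v x)) = (\<lambda>x. (t - t0) * (T * v x))" by (auto simp: algebra_simps)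
        then show ?thesis using Norm[OF gE[of "t - t0"]] by (simp only: quad_cmult[of V "t - t0"] real_sqrt_mult real_sqrt_abs)
      qed
      moreover have "((\<lambda>t. \<bar>t - t0\<bar> * sqrt (quad s V (\<lambda>x. T * v x))) \<longlongrightarrow> \<bar>t0 - t0\<bar> * sqrt (quad s V (\<lambda>x. T * v x))) (at t0 within {0..1})"
        by (intro tendsto_intros)
      ultimately show ?thesis by simp
    qed
    moreover have "Es_norm V s (\<lambda>x. 0 * (T * v x)) = 0" using Norm[OF gE[of 0]] quad_cmult[of V 0 "\<lambda>x. T * v x"] by simp
    moreover have "Jfun V f s (\<lambda>x. 1 * (T * v x)) < 0" using Jfun[OF gE[of 1]] T(2) by simp
    ultimately have "(\<lambda>t x. t * (T * v x)) \<in> ?\<Gamma>" using gE unfolding Gamma_paths_def EsE by auto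
    then show ?thesis using T(1) by blast
  qed
  have ne: "?\<Gamma> \<noteq> {}" using ray[OF gaussian_in_frac_space[OF s0 s1]] by blast
  have c: "?c > 0"
  proof -
    have "0 < (1 / 2 - 1 / \<mu>) * \<rho>" using \<mu>0 \<rho>(1) by simp
    also have "\<dots> \<le> ?c" unfolding mp_level_def by (rule cINF_greatest[OF ne lower])
    finally show ?thesis .
  qed
  \<comment> \<open>The straight path to a point of negative energy is admissible, and its maximum,
    attained by compactness, is a value on the ray.\<close>
  have level: "\<exists>t\<ge>0. ?c \<le> Jf V (\<lambda>x. t * v x)" if v: "v \<in> E" "sob_sq s v > 0" for v
  proof -
    obtain T where T0: "T > 0" and T: "(\<lambda>t x. t * (T * v x)) \<in> ?\<Gamma>" using ray[OF v] by blast
    let ?g = "\<lambda>t x. t * (T * v x)"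
    have "continuous_on {0..1} (\<lambda>t. Jf V (?g t))" using path[OF T] by (intro path_continuous) auto
    then obtain t where t: "t \<in> {0..1}" "\<And>t'. t' \<in> {0..1} \<Longrightarrow> Jf V (?g t') \<le> Jf V (?g t)"
      using continuous_attains_sup[of "{0..1::real}" "\<lambda>t. Jf V (?g t)"] by auto
    have "?c \<le> ?S ?g" unfolding mp_level_def by (rule cINF_lower[OF bdd T])
    also have "\<dots> \<le> Jf V (?g t)"
    proof (rule cSUP_least)
      fix t' :: real assume t': "t' \<in> {0..1}"
      have "Jfun V f s (?g t') = Jf V (?g t')" by (intro Jfun frac_space_cmult v)
      then show "Jfun V f s (?g t') \<le> Jf V (?g t)" using t(2)[OF t'] by simp
    qed simp
    finally have "?c \<le> Jf V (\<lambda>x. (t * T) * v x)" by (simp add: mult.assoc)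
    then show ?thesis using t(1) T0 by (intro exI[of _ "t * T"]) auto
  qed
  \<comment> \<open>A nearly optimal path crosses the Nehari set at a point whose energy is at most
    the supremum along the path.\<close>
  have "\<exists>u. u \<in> E \<and> Gf V u = 0 \<and> quad s V u > 0 \<and> Jf V u \<le> ?c + 1 / real (Suc n)" for n
  proof -
    have "(INF g\<in>?\<Gamma>. ?S g) < ?c + 1 / real (Suc n)" by (simp add: mp_level_def)
    then obtain g where g: "g \<in> ?\<Gamma>" "?S g < ?c + 1 / real (Suc n)" using cINF_less_iff[OF ne bdd] by blast
    obtain t where t: "t \<in> {0..1}" "Gf V (g t) = 0" "quad s V (g t) > 0" using cross[OF g(1)] by blast
    then show ?thesis using path[OF g(1)] sup[OF g(1) t(1)] g(2) by (intro exI[of _ "g t"]) auto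
  qed
  then obtain w where "\<And>n. w n \<in> E" "\<And>n. Gf V (w n) = 0" "\<And>n. quad s V (w n) > 0" "\<And>n. Jf V (w n) \<le> ?c + 1 / real (Suc n)" by metis
  then obtain u where u: "u \<in> E" "Jf V u = ?c" "\<And>v. v \<in> E \<Longrightarrow> dJ V u v = 0"
    using critical_level[OF Vcont Vlim c level] by blast
  have "((\<lambda>t. Jfun V f s (\<lambda>x. u x + t * v x)) has_real_derivative 0) (at 0)" if v: "v \<in> E" for v
  proof -
    have "Jfun V f s (\<lambda>x. u x + t * v x) = Jf V (\<lambda>x. u x + t * v x)" for t by (intro Jfun frac_space_add frac_space_cmult u v)
    then show ?thesis using J_deriv_0[OF pot_V u(1) v] u(3)[OF v] by simp
  qed
  then have "critical_point V f s u" unfolding critical_point_def EsE using u(1) by blast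
  then show ?thesis unfolding critical_value_def using u(2) Jfun[OF u(1)] by (intro exI[of _ u]) simp
qed

end
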